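(* Let $s>1/2$ and $\beta>0$. For each $n$ let $(e^{ix_j})_{j=1}^n$ be distributed according to the $n$-dimensional circular $\beta$-ensemble, and let $$P_n(\theta)=\prod_{j=1}^n\left(1-e^{i(x_j-\theta)}\right),\qquad X_n(\theta)=\mathrm{Re}\log P_n(\theta),\qquad Y_n(\theta)=\mathrm{Im}\log P_n(\theta),$$ where the branch of the logarithm is such that $\mathrm{Im}\log(1-e^{i(x_j-\theta)})\in(-\pi/2,\pi/2]$ for all $j$ (so $\log P_n(\theta)=\sum_{j}\log(1-e^{i(x_j-\theta)})$). Let $(Z_j)_{j=1}^\infty$ be i.i.d. standard complex Gaussians and let $$X(\theta)=\frac12\sum_{j=1}^\infty\frac{1}{\sqrt{j}}\left(Z_je^{-ij\theta}+Z_j^*e^{ij\theta}\right),\qquad Y(\theta)=\frac12\sum_{j=1}^\infty\frac{i}{\sqrt{j}}\left(-Z_je^{-ij\theta}+Z_j^*e^{ij\theta}\right).$$ Then, as $n\to\infty$, $(X_n,Y_n)$ converges in law in $\mathcal{H}_{-s}\times\mathcal{H}_{-s}$ to $\left(\sqrt{2/\beta}\,X,\sqrt{2/\beta}\,Y\right)$.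
   Context: Circular $\beta$-ensemble: for $\beta>0$, let $\Delta_n=\{(x_1,\dots,x_n)\in[0,2\pi]^n: x_1\le x_2\le\dots\le x_n\}$. The $n$-dimensional circular $\beta$-ensemble is the probability measure on $\Delta_n$ given by $$\frac{n!}{Z_{n,\beta}}\prod_{j<k}|e^{ix_j}-e^{ix_k}|^\beta\prod_{j=1}^n\frac{dx_j}{2\pi},\qquad Z_{n,\beta}=\frac{\Gamma(1+n\beta/2)}{\Gamma(1+\beta/2)^n}.$$ Sobolev spaces: for $s\in\mathbb{R}$, $$\mathcal{H}_s=\left\{(f_k)_{k\in\mathbb{Z}}\subset\mathbb{C}:\ \sum_{k\in\mathbb{Z}}|f_k|^2(1+k^2)^s<\infty\right\},\qquad \langle f,g\rangle_s=\sum_{k\in\mathbb{Z}}(1+k^2)^sf_kg_k^*,$$ where $^*$ denotes complex conjugation; this is a separable Hilbert space. A function (or distribution, or formal Fourier series) $f$ on the unit circle is identified with its sequence of Fourier coefficients $(f_k)_{k\in\mathbb{Z}}$, $f(\theta)=\sum_kf_ke^{ik\theta}$. For every $\epsilon>0$ the series defining $X$ and $Y$ converge almost surely in $\mathcal{H}_{-\epsilon}$, so $X$ and $Y$ are random elements of $\mathcal{H}_{-\epsilon}$; they are built from the same sequence $(Z_j)$. A standard complex Gaussian has independent centered real Gaussian real and imaginary parts, each of variance $1/2$. *)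

theory Defs
  imports "HOL-Probability.Probability"
begin

section \<open>Sobolev spaces of Fourier coefficient sequences\<close>

definition sobolev_weight :: "real \<Rightarrow> int \<Rightarrow> real" where
  "sobolev_weight s k = (1 + (real_of_int k)\<^sup>2) powr s"

definition sobolev :: "real \<Rightarrow> (int \<Rightarrow> complex) set" where
  "sobolev s = {f. (\<lambda>k. (cmod (f k))\<^sup>2 * sobolev_weight s k) summable_on UNIV}"

definition sobolev_inner :: "real \<Rightarrow> (int \<Rightarrow> complex) \<Rightarrow> (int \<Rightarrow> complex) \<Rightarrow> complex" where
  "sobolev_inner s f g = (\<Sum>\<^sub>\<infinity>k. complex_of_real (sobolev_weight s k) * f k * cnj (g k))"

definition sobolev_norm :: "real \<Rightarrow> (int \<Rightarrow> complex) \<Rightarrow> real" where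
  "sobolev_norm s f = sqrt (Re (sobolev_inner s f f))"

definition sobolev_dist :: "real \<Rightarrow> (int \<Rightarrow> complex) \<Rightarrow> (int \<Rightarrow> complex) \<Rightarrow> real" where
  "sobolev_dist s f g = sobolev_norm s (\<lambda>k. f k - g k)"

definition sobolev_topology :: "real \<Rightarrow> (int \<Rightarrow> complex) topology" where
  "sobolev_topology s = Metric_space.mtopology (sobolev s) (sobolev_dist s)"

lemma sobolev_weight_pos: "0 < sobolev_weight s k"
proof -
  have "0 < 1 + (real_of_int k)\<^sup>2"
    by (simp add: add_pos_nonneg)
  then show ?thesis
    by (simp add: sobolev_weight_def)
qed

lemma sobolev_inner_self:
  "sobolev_inner s f f = complex_of_real (\<Sum>\<^sub>\<infinity>k. (cmod (f k))\<^sup>2 * sobolev_weight s k)"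
proof -
  have "complex_of_real (sobolev_weight s k) * f k * cnj (f k) =
        complex_of_real ((cmod (f k))\<^sup>2 * sobolev_weight s k)" for k
    using complex_norm_square[of "f k"] by (simp add: mult.assoc mult.commute)
  moreover have "(\<Sum>\<^sub>\<infinity>k. complex_of_real (g k)) = complex_of_real (\<Sum>\<^sub>\<infinity>k. g k)" for g :: "int \<Rightarrow> real"
  proof (rule infsum_bounded_linear_strong[OF _ bounded_linear_of_real])
    show "(\<lambda>k. complex_of_real (g k)) summable_on UNIV \<longleftrightarrow> g summable_on UNIV"
      using summable_on_of_real[of g UNIV] summable_on_Re[of "\<lambda>k. complex_of_real (g k)" UNIV] by auto
  qed
  ultimately show ?thesis
    by (simp only: sobolev_inner_def)
qed

lemma sobolev_norm_alt:
  "sobolev_norm s f = sqrt (\<Sum>\<^sub>\<infinity>k. (cmod (f k))\<^sup>2 * sobolev_weight s k)"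
  by (simp add: sobolev_norm_def sobolev_inner_self)

lemma sobolev_norm_nonneg: "0 \<le> sobolev_norm s f"
  by (simp add: sobolev_norm_alt infsum_nonneg less_imp_le[OF sobolev_weight_pos])

lemma sobolev_finite_le:
  assumes "f \<in> sobolev s" "finite F"
  shows "L2_set (\<lambda>k. cmod (f k) * sqrt (sobolev_weight s k)) F \<le> sobolev_norm s f"
proof -
  have "(\<Sum>k\<in>F. (cmod (f k))\<^sup>2 * sobolev_weight s k) \<le> (\<Sum>\<^sub>\<infinity>k. (cmod (f k))\<^sup>2 * sobolev_weight s k)"
    using assms by (intro finite_sum_le_infsum) (auto simp: sobolev_def less_imp_le[OF sobolev_weight_pos])
  then show ?thesis
    by (simp add: sobolev_norm_alt L2_set_def power_mult_distrib less_imp_le[OF sobolev_weight_pos])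
qed

lemma sobolev_add:
  assumes "f \<in> sobolev s" "g \<in> sobolev s"
  shows "(\<lambda>k. f k + g k) \<in> sobolev s"
    and "sobolev_norm s (\<lambda>k. f k + g k) \<le> sobolev_norm s f + sobolev_norm s g"
proof -
  let ?w = "sobolev_weight s"
  let ?h = "\<lambda>k. (cmod (f k + g k))\<^sup>2 * ?w k"
  let ?B = "(sobolev_norm s f + sobolev_norm s g)\<^sup>2"
  have le: "sum ?h F \<le> ?B" if F: "finite F" for F
  proof -
    have "L2_set (\<lambda>k. cmod (f k + g k) * sqrt (?w k)) F
        \<le> L2_set (\<lambda>k. cmod (f k) * sqrt (?w k) + cmod (g k) * sqrt (?w k)) F"
    proof (rule L2_set_mono)
      fix k
      have "cmod (f k + g k) * sqrt (?w k) \<le> (cmod (f k) + cmod (g k)) * sqrt (?w k)"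
        by (intro mult_right_mono norm_triangle_ineq) (simp add: less_imp_le[OF sobolev_weight_pos])
      then show "cmod (f k + g k) * sqrt (?w k) \<le> cmod (f k) * sqrt (?w k) + cmod (g k) * sqrt (?w k)"
        by (simp add: distrib_right)
    qed (simp add: less_imp_le[OF sobolev_weight_pos])
    also have "\<dots> \<le> L2_set (\<lambda>k. cmod (f k) * sqrt (?w k)) F + L2_set (\<lambda>k. cmod (g k) * sqrt (?w k)) F"
      by (rule L2_set_triangle_ineq)
    also have "\<dots> \<le> sobolev_norm s f + sobolev_norm s g"
      by (intro add_mono sobolev_finite_le assms F)
    finally have "sqrt (sum ?h F) \<le> sobolev_norm s f + sobolev_norm s g"
      by (simp add: L2_set_def power_mult_distrib less_imp_le[OF sobolev_weight_pos])
    then show ?thesis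
      by (rule sqrt_le_D)
  qed
  show mem: "(\<lambda>k. f k + g k) \<in> sobolev s"
    unfolding sobolev_def mem_Collect_eq
    by (rule nonneg_bdd_above_summable_on)
      (auto simp: less_imp_le[OF sobolev_weight_pos] bdd_above_def intro: le)
  have "infsum ?h UNIV \<le> ?B"
    using mem le by (intro infsum_le_finite_sums) (auto simp: sobolev_def)
  then show "sobolev_norm s (\<lambda>k. f k + g k) \<le> sobolev_norm s f + sobolev_norm s g"
    unfolding sobolev_norm_alt[of s "\<lambda>k. f k + g k"]
    by (intro real_le_lsqrt) (auto intro: add_nonneg_nonneg sobolev_norm_nonneg)
qed

lemma sobolev_minus: "f \<in> sobolev s \<Longrightarrow> (\<lambda>k. - f k) \<in> sobolev s"
  by (simp add: sobolev_def)

lemma sobolev_diff: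
  assumes "f \<in> sobolev s" "g \<in> sobolev s"
  shows "(\<lambda>k. f k - g k) \<in> sobolev s"
  using sobolev_add(1)[OF assms(1) sobolev_minus[OF assms(2)]] by simp

lemma Metric_space_sobolev: "Metric_space (sobolev s) (sobolev_dist s)"
proof
  show "0 \<le> sobolev_dist s f g" for f g
    by (simp add: sobolev_dist_def sobolev_norm_nonneg)
  show "sobolev_dist s f g = sobolev_dist s g f" for f g
    by (simp add: sobolev_dist_def sobolev_norm_alt norm_minus_commute)
  show "sobolev_dist s f g = 0 \<longleftrightarrow> f = g" if "f \<in> sobolev s" "g \<in> sobolev s" for f g
  proof
    assume 0: "sobolev_dist s f g = 0"
    have "f k = g k" for k
      using sobolev_finite_le[OF sobolev_diff[OF that], of "{k}"] 0 sobolev_weight_pos[of s k]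
      by (simp add: sobolev_dist_def mult_le_0_iff)
    then show "f = g"
      by blast
  qed (simp add: sobolev_dist_def sobolev_norm_alt)
  show "sobolev_dist s f h \<le> sobolev_dist s f g + sobolev_dist s g h"
    if "f \<in> sobolev s" "g \<in> sobolev s" "h \<in> sobolev s" for f g h
    using sobolev_add(2)[OF sobolev_diff[OF that(1,2)] sobolev_diff[OF that(2,3)]]
    by (simp add: sobolev_dist_def)
qed

lemma topspace_sobolev_topology: "topspace (sobolev_topology s) = sobolev s"
  by (simp add: sobolev_topology_def Metric_space.topspace_mtopology[OF Metric_space_sobolev])


section \<open>Convergence in law\<close>

text \<open>
  A random element of a topological space only has to take its values in the space almost surely.
  This is needed for sums of random series, which lie in a Sobolev space outside a null set only.
\<close>

definition random_element :: "'w measure \<Rightarrow> 'a topology \<Rightarrow> ('w \<Rightarrow> 'a) \<Rightarrow> bool" where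
  "random_element M T \<xi> \<longleftrightarrow> prob_space M \<and>
     (\<forall>U. openin T U \<longrightarrow> \<xi> -` U \<inter> space M \<in> sets M) \<and>
     (AE \<omega> in M. \<xi> \<omega> \<in> topspace T)"

text \<open>
  Test functions are arbitrary outside the space, so the expectations are restricted
  to the event (of probability one) that the random element lies in the space.
\<close>

definition expectation_of :: "'w measure \<Rightarrow> 'a topology \<Rightarrow> ('w \<Rightarrow> 'a) \<Rightarrow> ('a \<Rightarrow> real) \<Rightarrow> real" where
  "expectation_of M T \<xi> f = (LINT \<omega>:\<xi> -` topspace T \<inter> space M|M. f (\<xi> \<omega>))"

definition converges_in_law ::
  "'a topology \<Rightarrow> (nat \<Rightarrow> 'w measure) \<Rightarrow> (nat \<Rightarrow> 'w \<Rightarrow> 'a) \<Rightarrow> 'v measure \<Rightarrow> ('v \<Rightarrow> 'a) \<Rightarrow> bool" where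
  "converges_in_law T M \<xi> N \<eta> \<longleftrightarrow>
     (\<forall>n. random_element (M n) T (\<xi> n)) \<and> random_element N T \<eta> \<and>
     (\<forall>f. continuous_map T euclideanreal f \<and> bounded (f ` topspace T) \<longrightarrow>
        (\<lambda>n. expectation_of (M n) T (\<xi> n) f) \<longlonglongrightarrow> expectation_of N T \<eta> f)"


section \<open>The circular beta-ensemble\<close>

definition ordered_angles :: "nat \<Rightarrow> (nat \<Rightarrow> real) set" where
  "ordered_angles n =
     {x. (\<forall>j\<in>{1..n}. x j \<in> {0..2 * pi}) \<and> (\<forall>j\<in>{1..n}. \<forall>k\<in>{1..n}. j \<le> k \<longrightarrow> x j \<le> x k)}"

definition cbe_Z :: "nat \<Rightarrow> real \<Rightarrow> real" where
  "cbe_Z n \<beta> = Gamma (1 + real n * \<beta> / 2) / Gamma (1 + \<beta> / 2) ^ n"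

definition cbe_density :: "nat \<Rightarrow> real \<Rightarrow> (nat \<Rightarrow> real) \<Rightarrow> real" where
  "cbe_density n \<beta> x =
     fact n / cbe_Z n \<beta> *
     (\<Prod>(j, k)\<in>{(j, k). j \<in> {1..n} \<and> k \<in> {1..n} \<and> j < k}.
        cmod (exp (\<i> * complex_of_real (x j)) - exp (\<i> * complex_of_real (x k))) powr \<beta>) *
     (\<Prod>j\<in>{1..n}. 1 / (2 * pi))"

definition circular_beta_ensemble :: "nat \<Rightarrow> real \<Rightarrow> (nat \<Rightarrow> real) measure" where
  "circular_beta_ensemble n \<beta> =
     density (Pi\<^sub>M {1..n} (\<lambda>_. lborel))
       (\<lambda>x. ennreal (cbe_density n \<beta> x * indicator (ordered_angles n) x))"


section \<open>The characteristic polynomial and its logarithm\<close>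

definition char_poly :: "nat \<Rightarrow> (nat \<Rightarrow> real) \<Rightarrow> real \<Rightarrow> complex" where
  "char_poly n x \<theta> = (\<Prod>j\<in>{1..n}. 1 - exp (\<i> * complex_of_real (x j - \<theta>)))"

text \<open>
  On the right half plane the principal branch has imaginary part in the required interval,
  see the two lemmas below. The zeros of the characteristic polynomial, where the value of
  \<open>Ln 0\<close> is unspecified, are finitely many angles modulo \<open>2 * pi\<close> and do not
  affect the Fourier coefficients.
\<close>

definition log_char_poly :: "nat \<Rightarrow> (nat \<Rightarrow> real) \<Rightarrow> real \<Rightarrow> complex" where
  "log_char_poly n x \<theta> = (\<Sum>j\<in>{1..n}. Ln (1 - exp (\<i> * complex_of_real (x j - \<theta>))))"

lemma Im_Ln_one_minus_cis:
  assumes "exp (\<i> * complex_of_real t) \<noteq> 1"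
  shows "Im (Ln (1 - exp (\<i> * complex_of_real t))) \<in> {- pi / 2<..pi / 2}"
proof -
  have "cos t \<noteq> 1"
  proof
    assume c: "cos t = 1"
    with sin_cos_squared_add[of t] have "sin t = 0"
      by simp
    with c have "exp (\<i> * complex_of_real t) = 1"
      by (simp add: exp_Euler sin_of_real cos_of_real)
    with assms show False ..
  qed
  with cos_le_one[of t] have "cos t < 1"
    by linarith
  then have "0 < Re (1 - exp (\<i> * complex_of_real t))"
    by (simp add: Re_exp)
  from Re_Ln_pos_lt_imp[OF this] show ?thesis
    by auto
qed

lemma exp_log_char_poly:
  assumes "char_poly n x \<theta> \<noteq> 0"
  shows "exp (log_char_poly n x \<theta>) = char_poly n x \<theta>"
  using assms by (auto simp: char_poly_def log_char_poly_def exp_sum intro!: prod.cong)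

definition fourier_coeff :: "(real \<Rightarrow> complex) \<Rightarrow> int \<Rightarrow> complex" where
  "fourier_coeff f k =
     1 / (2 * complex_of_real pi) * (CLBINT \<theta>:{0..2 * pi}. f \<theta> * exp (- \<i> * of_int k * complex_of_real \<theta>))"

definition X_n :: "nat \<Rightarrow> (nat \<Rightarrow> real) \<Rightarrow> int \<Rightarrow> complex" where
  "X_n n x = fourier_coeff (\<lambda>\<theta>. complex_of_real (Re (log_char_poly n x \<theta>)))"

definition Y_n :: "nat \<Rightarrow> (nat \<Rightarrow> real) \<Rightarrow> int \<Rightarrow> complex" where
  "Y_n n x = fourier_coeff (\<lambda>\<theta>. complex_of_real (Im (log_char_poly n x \<theta>)))"


section \<open>The limiting fields\<close>

definition (in prob_space) standard_complex_gaussian :: "('a \<Rightarrow> complex) \<Rightarrow> bool" where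
  "standard_complex_gaussian Z \<longleftrightarrow>
     indep_var borel (\<lambda>\<omega>. Re (Z \<omega>)) borel (\<lambda>\<omega>. Im (Z \<omega>)) \<and>
     distributed M lborel (\<lambda>\<omega>. Re (Z \<omega>)) (normal_density 0 (sqrt (1 / 2))) \<and>
     distributed M lborel (\<lambda>\<omega>. Im (Z \<omega>)) (normal_density 0 (sqrt (1 / 2)))"

text \<open>The coefficient sequence of the function \<open>\<theta> \<mapsto> exp (\<i> * m * \<theta>)\<close>.\<close>

definition fourier_mode :: "int \<Rightarrow> int \<Rightarrow> complex" where
  "fourier_mode m k = (if k = m then 1 else 0)"

text \<open>
  The series are formal Fourier series, summed coefficient by coefficient: for each \<open>k\<close>
  at most one term of the sum over \<open>j\<close> is nonzero.
\<close>

definition X_field :: "(nat \<Rightarrow> complex) \<Rightarrow> int \<Rightarrow> complex" where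
  "X_field z k = 1 / 2 * (\<Sum>\<^sub>\<infinity>j\<in>{1..}. 1 / complex_of_real (sqrt (real j)) *
     (z j * fourier_mode (- int j) k + cnj (z j) * fourier_mode (int j) k))"

definition Y_field :: "(nat \<Rightarrow> complex) \<Rightarrow> int \<Rightarrow> complex" where
  "Y_field z k = 1 / 2 * (\<Sum>\<^sub>\<infinity>j\<in>{1..}. \<i> / complex_of_real (sqrt (real j)) *
     (- z j * fourier_mode (- int j) k + cnj (z j) * fourier_mode (int j) k))"

definition scale_seq :: "real \<Rightarrow> (int \<Rightarrow> complex) \<Rightarrow> int \<Rightarrow> complex" where
  "scale_seq c f k = complex_of_real c * f k"

end

theory Submission
  imports Defs
begin

text \<open>
  Up to explicit scalar factors the Fourier coefficients of \<open>X_n\<close> and \<open>Y_n\<close> of index \<open>m\<close> and \<open>- m\<close> are the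
  power sum \<open>p m = (\<Sum>j. exp (\<i> m x j))\<close> and its conjugate. Integration by parts against the density
  of the ensemble gives loop equations. Applied to monomials they say that the generator
  of the circular Dyson Brownian motion acts triangularly on the symmetric polynomials of degree \<open>m\<close>, with eigenvalues
  at least \<open>\<beta> / 2 * m * (n - m)\<close>; since it is symmetric, comparing with the Dirichlet form of
  \<open>p m\<close> bounds the second moment of \<open>p m\<close> by \<open>4 m / \<beta>\<close> for \<open>2 m \<le> n\<close>. Applied to \<open>exp (\<i> t L)\<close>, with \<open>L\<close>
  a real linear combination of power sums, they turn in the limit into \<open>\<phi>' t = - t V \<phi> t\<close> for the
  characteristic function, so that finitely many power sums become Gaussian. Boxes \<open>\<bar>p m\<bar> \<le> R m powr \<alpha>\<close> with
  \<open>1 < \<alpha> < s + 1 / 2\<close> are compact in the Sobolev space of order \<open>- s\<close>, and by the moment bound they carry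
  all but \<open>O(1 / R\<^sup>2)\<close> of the mass; on such a box a continuous function is a uniform limit of trigonometric functions of
  finitely many coefficients.
\<close>


section \<open>Convergence of expectations from trigonometric functionals\<close>

text \<open>The second moment comes from an inequality between two quadratic forms, because
  \<open>p m\<close> is in general no eigenvector of the generator. Its Dirichlet form is
  nevertheless exact: each summand depends on one angle and has modulus 1, so the form equals
  \<open>m\<^sup>2 * n\<close> times the mass. Dividing by the spectral bound gives
  \<open>2 m n / (\<beta> (n - m))\<close>, which is at most \<open>4 m / \<beta>\<close> for
  \<open>2 m \<le> n\<close> and blows up at \<open>m = n\<close>. For larger \<open>m\<close> the
  trivial bound of \<open>p m\<close> by \<open>n < 2 m\<close> takes over: it already lies in every
  box with \<open>R \<ge> 2\<close>. The two regimes together make tightness uniform in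
  \<open>n\<close>. The obstacle in the loop equations is the cotangent produced by differentiating
  the weight. Exchanging two angles replaces the monomial next to it by an antisymmetric difference,
  which is divisible by the difference of the two points, so a polynomial of the same degree
  results. All integrals are taken over the torus with the symmetric, unnormalized weight; the
  ordered ensemble is one of \<open>n!\<close> equal pieces of it, and the mass is identified from
  the assumption that the ensemble is the law of a random variable.\<close>

definition seq_functional :: "(nat \<Rightarrow> complex) \<Rightarrow> nat \<Rightarrow> (nat \<Rightarrow> complex) \<Rightarrow> real" where
  "seq_functional c K q = (\<Sum>r\<le>K. Re (c r * q r))"

inductive trig_function :: "((nat \<Rightarrow> complex) \<Rightarrow> real) \<Rightarrow> bool" where
  cosine: "trig_function (\<lambda>q. cos (seq_functional c K q))"
| sine: "trig_function (\<lambda>q. sin (seq_functional c K q))"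
| add: "trig_function f \<Longrightarrow> trig_function g \<Longrightarrow> trig_function (\<lambda>q. f q + g q)"
| scale: "trig_function f \<Longrightarrow> trig_function (\<lambda>q. a * f q)"

lemma seq_functional_extend:
  "K \<le> K' \<Longrightarrow> seq_functional c K q = seq_functional (\<lambda>r. if r \<le> K then c r else 0) K' q"
  unfolding seq_functional_def
  by (intro sum.mono_neutral_cong_left) auto

lemma seq_functional_add:
  obtains c'' K'' where "\<And>q. seq_functional c K q + a * seq_functional c' K' q = seq_functional c'' K'' q"
proof
  show "seq_functional c K q + a * seq_functional c' K' q =
     seq_functional (\<lambda>r. (if r \<le> K then c r else 0) + of_real a * (if r \<le> K' then c' r else 0)) (max K K') q" for q
    by (subst seq_functional_extend[of K "max K K'"], simp,
        subst seq_functional_extend[of K' "max K K'"], simp)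
       (simp only: seq_functional_def sum_distrib_left sum.distrib[symmetric], rule sum.cong, simp_all add: algebra_simps)
qed

text \<open>Product-to-sum formulas: the frequencies of a product are sums and differences, and the
  functionals are closed under both. So the span of the sines and cosines is an algebra.\<close>

lemma trig_function_mult_cos_sin:
  assumes "trig_function g"
  shows "trig_function (\<lambda>q. cos (seq_functional c K q) * g q)"
    and "trig_function (\<lambda>q. sin (seq_functional c K q) * g q)"
proof -
  have prod_to_sum: "cos a * cos b = 1/2 * cos (a - b) + 1/2 * cos (a + b)"
    "sin a * cos b = 1/2 * sin (a + b) + 1/2 * sin (a - b)"
    "cos a * sin b = 1/2 * sin (a + b) + (-1/2) * sin (a - b)"
    "sin a * sin b = 1/2 * cos (a - b) + (-1/2) * cos (a + b)" for a b :: real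
    by (simp_all add: cos_add cos_diff sin_add sin_diff field_simps)
  have "trig_function (\<lambda>q. cos (seq_functional c K q) * g q) \<and>
        trig_function (\<lambda>q. sin (seq_functional c K q) * g q)"
    using assms
  proof (induction rule: trig_function.induct)
    case (cosine c' K')
    obtain c1 K1 where 1: "\<And>q. seq_functional c K q + 1 * seq_functional c' K' q = seq_functional c1 K1 q"
      using seq_functional_add[of c K 1 c' K'] by blast
    obtain c2 K2 where 2: "\<And>q. seq_functional c K q + (-1) * seq_functional c' K' q = seq_functional c2 K2 q"
      using seq_functional_add[of c K "-1" c' K'] by blast
    note 12 = 1[simplified, symmetric] 2[simplified, symmetric]
    have "trig_function (\<lambda>q. 1/2 * cos (seq_functional c2 K2 q) + 1/2 * cos (seq_functional c1 K1 q))"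
      "trig_function (\<lambda>q. 1/2 * sin (seq_functional c1 K1 q) + 1/2 * sin (seq_functional c2 K2 q))"
      by (intro trig_function.intros)+
    then show ?case unfolding 12 by (simp only: prod_to_sum)
  next
    case (sine c' K')
    obtain c1 K1 where 1: "\<And>q. seq_functional c K q + 1 * seq_functional c' K' q = seq_functional c1 K1 q"
      using seq_functional_add[of c K 1 c' K'] by blast
    obtain c2 K2 where 2: "\<And>q. seq_functional c K q + (-1) * seq_functional c' K' q = seq_functional c2 K2 q"
      using seq_functional_add[of c K "-1" c' K'] by blast
    note 12 = 1[simplified, symmetric] 2[simplified, symmetric]
    have "trig_function (\<lambda>q. 1/2 * sin (seq_functional c1 K1 q) + (-1/2) * sin (seq_functional c2 K2 q))"
      "trig_function (\<lambda>q. 1/2 * cos (seq_functional c2 K2 q) + (-1/2) * cos (seq_functional c1 K1 q))"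
      by (intro trig_function.intros)+
    then show ?case unfolding 12 by (simp only: prod_to_sum)
  next
    case (add f g)
    then show ?case
      unfolding distrib_left by (intro conjI trig_function.add) simp_all
  next
    case (scale f a)
    then show ?case
      unfolding mult.left_commute[of _ a] by (intro conjI trig_function.scale) simp_all
  qed
  then show "trig_function (\<lambda>q. cos (seq_functional c K q) * g q)"
    and "trig_function (\<lambda>q. sin (seq_functional c K q) * g q)" by auto
qed

lemma trig_function_mult:
  assumes "trig_function f" "trig_function g"
  shows "trig_function (\<lambda>q. f q * g q)"
  using assms
proof (induction rule: trig_function.induct)
  case (add f1 f2)
  then show ?case unfolding distrib_right by (intro trig_function.add) simp_all
next
  case (scale f a)
  then show ?case unfolding mult.assoc by (intro trig_function.scale) simp_all
qed (rule trig_function_mult_cos_sin, assumption)+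

lemma trig_function_const: "trig_function (\<lambda>_. a)"
  using trig_function.scale[OF trig_function.cosine[of "\<lambda>_. 0" 0], of a]
  by (simp add: seq_functional_def)

lemma trig_function_sum:
  "finite I \<Longrightarrow> (\<And>i. i \<in> I \<Longrightarrow> trig_function (f i)) \<Longrightarrow> trig_function (\<lambda>q. \<Sum>i\<in>I. f i q)"
  by (induction I rule: finite_induct) (simp_all add: trig_function_const trig_function.add)

lemma trig_function_power: "trig_function f \<Longrightarrow> trig_function (\<lambda>q. f q ^ i)"
  by (induction i) (simp_all add: trig_function_const trig_function_mult)

lemma continuous_on_seq_functional: "continuous_on UNIV (seq_functional c K)"
  unfolding seq_functional_def[abs_def]
  by (intro continuous_on_sum continuous_on_Re continuous_on_mult continuous_on_const
      continuous_on_product_coordinates)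

lemma trig_function_continuous: "trig_function f \<Longrightarrow> continuous_on UNIV f"
proof (induction rule: trig_function.induct)
  case (cosine c K)
  show ?case by (rule continuous_on_cos[OF continuous_on_seq_functional])
next
  case (sine c K)
  show ?case by (rule continuous_on_sin[OF continuous_on_seq_functional])
qed (simp_all add: continuous_on_add continuous_on_mult_left)

lemma trig_function_bounded: "trig_function f \<Longrightarrow> \<exists>B. \<forall>q. \<bar>f q\<bar> \<le> B"
proof (induction rule: trig_function.induct)
  case (add f g)
  then obtain B C where "\<And>q. \<bar>f q\<bar> \<le> B" "\<And>q. \<bar>g q\<bar> \<le> C" by blast
  then have "\<bar>f q + g q\<bar> \<le> B + C" for q by (meson abs_triangle_ineq add_mono order_trans)
  then show ?case by blast
next
  case (scale f a)
  then obtain B where "\<And>q. \<bar>f q\<bar> \<le> B" by blast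
  then have "\<bar>a * f q\<bar> \<le> \<bar>a\<bar> * B" for q by (simp add: abs_mult mult_left_mono)
  then show ?case by blast
next
  case (cosine c K)
  show ?case by (rule exI[of _ 1]) simp
next
  case (sine c K)
  show ?case by (rule exI[of _ 1]) simp
qed

definition seq_box :: "(nat \<Rightarrow> real) \<Rightarrow> (nat \<Rightarrow> complex) set" where
  "seq_box \<rho> = {q. \<forall>r. cmod (q r) \<le> \<rho> r}"

text \<open>Tychonoff: a box is a product of closed discs. The topology is that of coordinatewise
  convergence.\<close>

lemma compact_seq_box: "compact (seq_box \<rho>)"
proof -
  have "seq_box \<rho> = PiE UNIV (\<lambda>r. cball 0 (\<rho> r))"
    by (auto simp: seq_box_def PiE_def Pi_def)
  moreover have "compactin (product_topology (\<lambda>i::nat. euclidean :: complex topology) UNIV) (PiE UNIV (\<lambda>r. cball 0 (\<rho> r)))"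
    by (subst compactin_PiE) simp
  ultimately show ?thesis
    unfolding euclidean_product_topology compactin_euclidean_iff by simp
qed

lemma closed_seq_box: "closed (seq_box \<rho>)"
  by (rule compact_imp_closed[OF compact_seq_box])

lemma function_ring_on_seq_box: "function_ring_on (Collect trig_function) (seq_box \<rho>)"
proof
  show "compact (seq_box \<rho>)" by (rule compact_seq_box)
  show "continuous_on (seq_box \<rho>) f" if "f \<in> Collect trig_function" for f
    using that continuous_on_subset[OF trig_function_continuous[of f] subset_UNIV] by simp
  show "(\<lambda>_. c) \<in> Collect trig_function" for c by (simp add: trig_function_const)
  show "\<exists>f\<in>Collect trig_function. f p \<noteq> f q" if "p \<in> seq_box \<rho>" "q \<in> seq_box \<rho>" "p \<noteq> q" for p q
  proof -
    from that(3) obtain r where r: "p r \<noteq> q r" by blast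
    define d where "d = cmod (p r - q r)"
    have "d > 0" using r by (simp add: d_def)
    \<comment> \<open>Scaled so that the functional takes values at \<open>p\<close> and
      \<open>q\<close> that differ by exactly 1. If cosine and sine both agreed at the two points,
      the cosine of 1 would be 1.\<close>
    define c where "c = (\<lambda>i. if i = r then cnj (p r - q r) / of_real (d\<^sup>2) else 0)"
    have lin: "seq_functional c r w = Re (c r * w r)" for w
    proof -
      have "seq_functional c r w = (\<Sum>i\<in>{r}. Re (c i * w i))"
        unfolding seq_functional_def by (intro sum.mono_neutral_right) (auto simp: c_def)
      then show ?thesis by simp
    qed
    have "c r * (p r - q r) = of_real (d\<^sup>2) / of_real (d\<^sup>2)"
      unfolding c_def d_def complex_norm_square by simp
    then have "c r * (p r - q r) = 1" using \<open>d > 0\<close> by simp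
    then have "Re (c r * p r - c r * q r) = 1" by (simp only: right_diff_distrib one_complex.sel)
    then have diff: "seq_functional c r p - seq_functional c r q = 1"
      unfolding lin by (simp only: minus_complex.sel)
    show ?thesis
    proof (cases "cos (seq_functional c r p) = cos (seq_functional c r q)")
      case False
      then show ?thesis
        by (intro bexI[of _ "\<lambda>q. cos (seq_functional c r q)"]) (simp_all add: trig_function.cosine)
    next
      case True
      have "sin (seq_functional c r p) \<noteq> sin (seq_functional c r q)"
      proof
        assume "sin (seq_functional c r p) = sin (seq_functional c r q)"
        then have "cos (seq_functional c r p - seq_functional c r q) = 1"
          unfolding cos_diff True by (simp only: sin_cos_squared_add3)
        then have "cos (1::real) = 1" unfolding diff .
        moreover have "cos (1::real) < cos 0"
          by (rule cos_monotone_0_pi) (use pi_gt3 in auto)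
        ultimately show False by simp
      qed
      then show ?thesis
        by (intro bexI[of _ "\<lambda>q. sin (seq_functional c r q)"]) (simp_all add: trig_function.sine)
    qed
  qed
next
  show "(\<lambda>x. f x + g x) \<in> Collect trig_function"
    if "f \<in> Collect trig_function" "g \<in> Collect trig_function" for f g
    using that by (simp add: trig_function.add)
  show "(\<lambda>x. f x * g x) \<in> Collect trig_function"
    if "f \<in> Collect trig_function" "g \<in> Collect trig_function" for f g
    using that by (simp add: trig_function_mult)
qed

text \<open>A polynomial in a trigonometric function stays in the algebra; the clamp itself would
  leave it.\<close>

lemma clamp_polynomial_approx:
  fixes B C :: real
  assumes "e > 0"
  obtains a n where "\<And>t. \<bar>t\<bar> \<le> C \<Longrightarrow> \<bar>max (- B) (min B t) - (\<Sum>i\<le>n. a i * t ^ i)\<bar> < e"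
proof -
  have "continuous_on {-C..C} (\<lambda>t. max (- B) (min B t))"
    by (intro continuous_intros)
  from Stone_Weierstrass_real_polynomial_function[OF compact_Icc this assms]
  obtain g where g: "real_polynomial_function g"
    "\<And>t. t \<in> {-C..C} \<Longrightarrow> \<bar>max (- B) (min B t) - g t\<bar> < e" by blast
  from g(1) obtain a n where "g = (\<lambda>t. \<Sum>i\<le>n. a i * t ^ i)"
    by (auto simp: real_polynomial_function_iff_sum)
  then show thesis using g(2) that[of a n] by (auto simp: abs_le_iff)
qed

lemma expectation_close:
  fixes f g :: "'a \<Rightarrow> real"
  assumes "prob_space M" and [measurable]: "f \<in> borel_measurable M" "g \<in> borel_measurable M" "S \<in> sets M"
    and B: "\<And>w. w \<in> space M \<Longrightarrow> \<bar>f w\<bar> \<le> B" "\<And>w. w \<in> space M \<Longrightarrow> \<bar>g w\<bar> \<le> B"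
    and e: "e \<ge> 0" "\<And>w. w \<in> S \<Longrightarrow> \<bar>f w - g w\<bar> \<le> e"
    and S: "measure M (space M - S) \<le> d" and "B \<ge> 0"
  shows "\<bar>(LINT w|M. f w) - (LINT w|M. g w)\<bar> \<le> e + 2 * B * d"
proof -
  interpret prob_space M by fact
  have [simp]: "integrable M f" "integrable M g"
    using B by (auto intro!: integrable_const_bound[where B=B])
  have [simp]: "integrable M (indicat_real (space M - S))"
    by (auto intro!: integrable_const_bound[where B=1] split: split_indicator)
  have "\<bar>(LINT w|M. f w) - (LINT w|M. g w)\<bar> = \<bar>LINT w|M. f w - g w\<bar>" by simp
  also have "\<dots> \<le> (LINT w|M. \<bar>f w - g w\<bar>)" by (rule integral_abs_bound)
  also have "\<dots> \<le> (LINT w|M. e + 2 * B * indicator (space M - S) w)"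
  proof (rule integral_mono)
    show "\<bar>f w - g w\<bar> \<le> e + 2 * B * indicator (space M - S) w" if "w \<in> space M" for w
      using B[OF that] e that by (cases "w \<in> S") auto
  qed auto
  also have "\<dots> = e + 2 * B * measure M (space M - S)" by (simp add: prob_space)
  also have "\<dots> \<le> e + 2 * B * d" using S \<open>B \<ge> 0\<close> by (simp add: mult_left_mono)
  finally show ?thesis .
qed

lemma trig_function_measurable: "trig_function f \<Longrightarrow> f \<in> borel_measurable borel"
  by (intro borel_measurable_continuous_onI trig_function_continuous)

lemma trig_function_integrable:
  assumes h: "trig_function h" and "prob_space M" and Q: "Q \<in> M \<rightarrow>\<^sub>M borel"
  shows "integrable M (\<lambda>w. h (Q w))"
proof -
  interpret prob_space M by fact
  obtain B where "\<And>q. \<bar>h q\<bar> \<le> B" using trig_function_bounded[OF h] by blast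
  then show ?thesis using measurable_compose[OF Q trig_function_measurable[OF h]]
    by (auto intro!: integrable_const_bound[where B=B])
qed

lemma trig_function_expectation_tendsto:
  assumes f: "trig_function f"
    and prob: "\<And>n. prob_space (M n)" "prob_space N"
    and meas: "\<And>n. Q n \<in> M n \<rightarrow>\<^sub>M borel" "R \<in> N \<rightarrow>\<^sub>M borel"
    and cos: "\<And>c K. (\<lambda>n. LINT w|M n. cos (seq_functional c K (Q n w))) \<longlonglongrightarrow> (LINT w|N. cos (seq_functional c K (R w)))"
    and sin: "\<And>c K. (\<lambda>n. LINT w|M n. sin (seq_functional c K (Q n w))) \<longlonglongrightarrow> (LINT w|N. sin (seq_functional c K (R w)))"
  shows "(\<lambda>n. LINT w|M n. f (Q n w)) \<longlonglongrightarrow> (LINT w|N. f (R w))"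
  using f
proof (induction rule: trig_function.induct)
  case (add f g)
  note int = trig_function_integrable
  have "(\<lambda>n. (LINT w|M n. f (Q n w)) + (LINT w|M n. g (Q n w))) \<longlonglongrightarrow> (LINT w|N. f (R w)) + (LINT w|N. g (R w))"
    using add.IH by (rule tendsto_add)
  then show ?case
    by (simp only: Bochner_Integration.integral_add[OF int[OF add.hyps(1) prob(1) meas(1)] int[OF add.hyps(2) prob(1) meas(1)]]
      Bochner_Integration.integral_add[OF int[OF add.hyps(1) prob(2) meas(2)] int[OF add.hyps(2) prob(2) meas(2)]])
next
  case (scale f a)
  then show ?case by (simp add: tendsto_mult_left)
qed (rule cos sin)+

text \<open>
  The trigonometric functions approximate \<open>g\<close> only on a compact box, so their values are
  clamped to \<open>[-B, B]\<close>; on the bounded range of a trigonometric function the clamp is a uniform limit of polynomials,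
  hence the clamped function is a uniform limit of trigonometric functions.
\<close>

proposition expectation_tendsto_if_tight:
  fixes g :: "(nat \<Rightarrow> complex) \<Rightarrow> real"
  assumes prob: "\<And>n. prob_space (M n)" "prob_space N"
    and meas: "\<And>n. Q n \<in> M n \<rightarrow>\<^sub>M borel" "R \<in> N \<rightarrow>\<^sub>M borel"
    and cos: "\<And>c K. (\<lambda>n. LINT w|M n. cos (seq_functional c K (Q n w))) \<longlonglongrightarrow> (LINT w|N. cos (seq_functional c K (R w)))"
    and sin: "\<And>c K. (\<lambda>n. LINT w|M n. sin (seq_functional c K (Q n w))) \<longlonglongrightarrow> (LINT w|N. sin (seq_functional c K (R w)))"
    and tight: "\<And>e. e > 0 \<Longrightarrow> \<exists>\<rho>\<in>P. (\<forall>n. measure (M n) {w \<in> space (M n). Q n w \<notin> seq_box \<rho>} \<le> e) \<and>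
         measure N {w \<in> space N. R w \<notin> seq_box \<rho>} \<le> e"
    and g: "g \<in> borel_measurable borel" "\<And>q. \<bar>g q\<bar> \<le> B" "\<And>\<rho>. \<rho> \<in> P \<Longrightarrow> continuous_on (seq_box \<rho>) g"
  shows "(\<lambda>n. LINT w|M n. g (Q n w)) \<longlonglongrightarrow> (LINT w|N. g (R w))"
proof (rule LIMSEQ_I)
  fix e :: real assume "e > 0"
  have "B \<ge> 0" using g(2)[of undefined] by linarith
  \<comment> \<open>Off the box both \<open>g\<close> and its approximant are bounded by
    \<open>B + e\<close>, so a mass of at most \<open>d\<close> contributes at most
    \<open>e / 6\<close>; the approximation error on the box is another
    \<open>e / 6\<close>.\<close>
  define d where "d = e / (12 * (B + e + 1))"
  have "d > 0" using \<open>e > 0\<close> \<open>B \<ge> 0\<close> by (simp add: d_def)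
  obtain \<rho> where \<rho>: "\<rho> \<in> P" and tM: "\<And>n. measure (M n) {w \<in> space (M n). Q n w \<notin> seq_box \<rho>} \<le> d"
    and tN: "measure N {w \<in> space N. R w \<notin> seq_box \<rho>} \<le> d"
    using tight[OF \<open>d > 0\<close>] by blast
  interpret function_ring_on "Collect trig_function" "seq_box \<rho>" by (rule function_ring_on_seq_box)
  obtain t where t: "trig_function t" "\<And>q. q \<in> seq_box \<rho> \<Longrightarrow> \<bar>g q - t q\<bar> < e / 12"
    using Stone_Weierstrass_basic[OF g(3)[OF \<rho>], of "e / 12"] \<open>e > 0\<close> by auto
  obtain C where C: "\<And>q. \<bar>t q\<bar> \<le> C" using trig_function_bounded[OF t(1)] by blast
  obtain a m where am: "\<And>x. \<bar>x\<bar> \<le> C \<Longrightarrow> \<bar>max (- B) (min B x) - (\<Sum>i\<le>m. a i * x ^ i)\<bar> < e / 12"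
    using clamp_polynomial_approx[of "e/12" C B] \<open>e > 0\<close> by (metis divide_pos_pos zero_less_numeral)
  define h where "h = (\<lambda>q. \<Sum>i\<le>m. a i * t q ^ i)"
  have h: "trig_function h"
    unfolding h_def by (intro trig_function_sum trig_function.scale trig_function_power t) auto
  have hq: "h q = (\<Sum>i\<le>m. a i * t q ^ i)" for q by (simp add: h_def)
  have hB: "\<bar>h q\<bar> \<le> B + e" for q
    using am[OF C, of q] \<open>e > 0\<close> \<open>B \<ge> 0\<close> unfolding hq by linarith
  have hg: "\<bar>g q - h q\<bar> \<le> e / 6" if "q \<in> seq_box \<rho>" for q
    using am[OF C, of q] t(2)[OF that] g(2)[of q] unfolding hq by linarith
  have small: "e / 6 + 2 * (B + e) * d \<le> e / 3"
  proof -
    have "2 * (B + e) * d = (e / 6) * ((B + e) / (B + e + 1))"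
      using \<open>e > 0\<close> \<open>B \<ge> 0\<close> by (simp add: d_def field_simps)
    also have "\<dots> \<le> (e / 6) * 1"
      using \<open>e > 0\<close> \<open>B \<ge> 0\<close> by (intro mult_left_mono) (auto simp: divide_le_eq)
    finally show ?thesis by simp
  qed
  have close: "\<bar>(LINT w|M'. g (Q' w)) - (LINT w|M'. h (Q' w))\<bar> \<le> e / 3"
    if "prob_space M'" and [measurable]: "Q' \<in> M' \<rightarrow>\<^sub>M borel"
      and "measure M' {w \<in> space M'. Q' w \<notin> seq_box \<rho>} \<le> d" for M' :: "'x measure" and Q'
  proof -
    have [measurable]: "seq_box \<rho> \<in> sets borel" using closed_seq_box by (rule borel_closed)
    note [measurable] = g(1) trig_function_measurable[OF h]
    have "\<bar>(LINT w|M'. g (Q' w)) - (LINT w|M'. h (Q' w))\<bar> \<le> e / 6 + 2 * (B + e) * d"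
    proof (rule expectation_close[OF that(1), where S="{w \<in> space M'. Q' w \<in> seq_box \<rho>}"])
      have "space M' - {w \<in> space M'. Q' w \<in> seq_box \<rho>} = {w \<in> space M'. Q' w \<notin> seq_box \<rho>}" by auto
      then show "measure M' (space M' - {w \<in> space M'. Q' w \<in> seq_box \<rho>}) \<le> d" using that(3) by simp
      show "\<bar>g (Q' w)\<bar> \<le> B + e" for w using g(2)[of "Q' w"] \<open>e > 0\<close> by simp
    qed (use hB hg \<open>e > 0\<close> \<open>B \<ge> 0\<close> in auto)
    with small show ?thesis by simp
  qed
  have "(\<lambda>n. LINT w|M n. h (Q n w)) \<longlonglongrightarrow> (LINT w|N. h (R w))"
    by (rule trig_function_expectation_tendsto[OF h prob meas cos sin])
  from LIMSEQ_D[OF this, of "e / 3"] \<open>e > 0\<close>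
  obtain n0 where n0: "\<And>n. n \<ge> n0 \<Longrightarrow> \<bar>(LINT w|M n. h (Q n w)) - (LINT w|N. h (R w))\<bar> < e / 3"
    unfolding real_norm_def by auto
  show "\<exists>n0. \<forall>n\<ge>n0. norm ((LINT w|M n. g (Q n w)) - (LINT w|N. g (R w))) < e"
  proof (intro exI allI impI)
    fix n assume "n \<ge> n0"
    from n0[OF this] close[OF prob(1) meas(1) tM, of n] close[OF prob(2) meas(2) tN]
    show "norm ((LINT w|M n. g (Q n w)) - (LINT w|N. g (R w))) < e"
      unfolding real_norm_def by linarith
  qed
qed

section \<open>Fourier coefficients of the logarithm\<close>

text \<open>One summand of the logarithm. For \<open>r < 1\<close> the singularity is moved off the
  circle and the power series can be integrated termwise; the summand itself is the case
  \<open>r = 1\<close>.\<close>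

definition log_factor :: "real \<Rightarrow> real \<Rightarrow> real \<Rightarrow> complex" where
  "log_factor r x \<theta> = Ln (1 - of_real r * exp (\<i> * complex_of_real (x - \<theta>)))"

lemma integral_exp_int:
  "(CLBINT \<theta>:{0..2 * pi}. exp (\<i> * of_int k * complex_of_real \<theta>)) = (if k = 0 then 2 * of_real pi else 0)"
proof (cases "k = 0")
  case True
  then show ?thesis by (simp add: set_lebesgue_integral_def scaleR_conv_of_real)
next
  case False
  let ?F = "\<lambda>\<theta>. exp (\<i> * of_int k * complex_of_real \<theta>) / (\<i> * of_int k)"
  have "(CLBINT \<theta>. indicator {0..2 * pi} \<theta> *\<^sub>R exp (\<i> * of_int k * complex_of_real \<theta>)) = ?F (2 * pi) - ?F 0"
  proof (rule integral_FTC_atLeastAtMost)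
    show "(?F has_vector_derivative exp (\<i> * of_int k * complex_of_real \<theta>)) (at \<theta> within {0..2 * pi})" for \<theta>
    proof -
      have "((\<lambda>z. exp (\<i> * of_int k * z) / (\<i> * of_int k)) has_field_derivative exp (\<i> * of_int k * complex_of_real \<theta>)) (at (of_real \<theta>))"
        using False by (auto intro!: derivative_eq_intros)
      from has_vector_derivative_real_field[OF this] show ?thesis
        by (rule has_vector_derivative_at_within)
    qed
    show "continuous_on {0..2 * pi} (\<lambda>\<theta>. exp (\<i> * of_int k * complex_of_real \<theta>))"
      by (intro continuous_intros)
  qed simp
  also have "exp (\<i> * of_int k * complex_of_real (2 * pi)) = 1"
    by (auto simp: exp_eq_1 intro!: exI[of _ k])
  finally show ?thesis using False by (simp add: set_lebesgue_integral_def)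
qed

lemma measurable_exp_int [measurable]:
  "(\<lambda>\<theta>. exp (\<i> * of_int k * complex_of_real \<theta>)) \<in> borel_measurable borel"
  by (intro borel_measurable_continuous_onI continuous_intros)

lemma set_integrable_bounded_circle:
  fixes f :: "real \<Rightarrow> complex"
  assumes "f \<in> borel_measurable borel" "\<And>t. cmod (f t) \<le> B"
  shows "set_integrable lborel {0..2 * pi} f"
  unfolding set_integrable_def
  by (rule integrableI_bounded_set_indicator[where B=B]) (use assms in auto)

lemma log_factor_sums:
  assumes "0 \<le> r" "r < 1"
  shows "(\<lambda>m. - (of_real r ^ Suc m * exp (\<i> * of_nat (Suc m) * complex_of_real (x - \<theta>)) / of_nat (Suc m))) sums log_factor r x \<theta>"
proof -
  let ?z = "- (of_real r * exp (\<i> * complex_of_real (x - \<theta>)))"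
  have "cmod ?z < 1" using assms by (simp add: norm_mult)
  from Ln_series[OF this]
  have "(\<lambda>m. (- 1) ^ Suc m / of_nat m * ?z ^ m) sums log_factor r x \<theta>"
    by (simp add: log_factor_def)
  \<comment> \<open>The term of index 0 is a division by 0, hence 0, so it can be split off and the
    series starts at 1.\<close>
  then have "(\<lambda>m. (- 1) ^ Suc m / of_nat m * ?z ^ m) sums (log_factor r x \<theta> + (- 1) ^ Suc 0 / of_nat 0 * ?z ^ 0)"
    by simp
  then have "(\<lambda>m. (- 1) ^ Suc (Suc m) / of_nat (Suc m) * ?z ^ Suc m) sums log_factor r x \<theta>"
    by (rule sums_Suc_iff[THEN iffD2])
  moreover have "(- 1) ^ Suc (Suc m) / of_nat (Suc m) * ?z ^ Suc m =
    - (of_real r ^ Suc m * exp (\<i> * of_nat (Suc m) * complex_of_real (x - \<theta>)) / of_nat (Suc m))" for m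
  proof -
    have "?z ^ Suc m = (- 1) ^ Suc m * (of_real r ^ Suc m * exp (\<i> * complex_of_real (x - \<theta>)) ^ Suc m)"
      by (simp only: power_minus[of "_ * _"] power_mult_distrib)
    also have "exp (\<i> * complex_of_real (x - \<theta>)) ^ Suc m = exp (\<i> * of_nat (Suc m) * complex_of_real (x - \<theta>))"
      unfolding exp_of_nat_mult[symmetric] by (simp only: mult_ac)
    finally have hz: "?z ^ Suc m = (- 1) ^ Suc m * (of_real r ^ Suc m * exp (\<i> * of_nat (Suc m) * complex_of_real (x - \<theta>)))" .
    have "(- 1) ^ Suc (Suc m) / of_nat (Suc m) * ?z ^ Suc m =
      ((- 1) ^ Suc (Suc m) * (- 1) ^ Suc m) * (of_real r ^ Suc m * exp (\<i> * of_nat (Suc m) * complex_of_real (x - \<theta>)) / of_nat (Suc m))"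
      unfolding hz by (simp only: divide_inverse mult_ac)
    also have "(- 1 :: complex) ^ Suc (Suc m) * (- 1) ^ Suc m = - 1"
      by (simp flip: power_mult_distrib)
    finally show ?thesis by (simp only: mult_minus1)
  qed
  ultimately show ?thesis by (simp only:)
qed

text \<open>The Fourier coefficients of the summand at \<open>r = 1\<close>. Only negative
  frequencies occur, since the expansion is in positive powers of
  \<open>exp (\<i> * (x - \<theta>))\<close>.\<close>

definition log_coeff :: "real \<Rightarrow> int \<Rightarrow> complex" where
  "log_coeff x k = (if k < 0 then - (exp (\<i> * of_int (- k) * complex_of_real x) / of_int (- k)) else 0)"

lemma exp_i_eq_1_iff_Re: "Re (exp (\<i> * complex_of_real t)) = 1 \<longleftrightarrow> exp (\<i> * complex_of_real t) = 1"
proof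
  assume "Re (exp (\<i> * complex_of_real t)) = 1"
  then have c: "cos t = 1" by (simp add: Re_exp)
  with sin_cos_squared_add[of t] have "sin t = 0" by simp
  with c show "exp (\<i> * complex_of_real t) = 1" by (simp add: complex_eq_iff Re_exp Im_exp)
qed simp

text \<open>On the open set where the argument of \<open>Ln\<close> has positive real part the
  function is continuous; elsewhere the argument is 0, which happens for \<open>r = 1\<close> only,
  and the function is the constant \<open>Ln 0\<close>.\<close>

lemma measurable_log_factor [measurable]:
  assumes "0 \<le> r" "r \<le> 1"
  shows "log_factor r x \<in> borel_measurable borel"
proof -
  let ?z = "\<lambda>\<theta>. 1 - of_real r * exp (\<i> * complex_of_real (x - \<theta>))"
  let ?A = "{\<theta>. 0 < Re (?z \<theta>)}"
  have cz: "continuous_on UNIV ?z" by (intro continuous_intros)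
  have A: "open ?A"
    by (intro open_Collect_less continuous_intros cz)
  have z0: "?z \<theta> = 0" if "\<theta> \<notin> ?A" for \<theta>
  proof -
    let ?u = "exp (\<i> * complex_of_real (x - \<theta>))"
    have le: "Re ?u \<le> 1" using complex_Re_le_cmod[of ?u] by simp
    have ge: "1 \<le> r * Re ?u" using that by simp
    have "r * Re ?u \<le> r * 1" using le assms by (intro mult_left_mono) auto
    then have "r = 1" using ge assms by linarith
    then have "Re ?u = 1" using ge le by simp
    then show ?thesis using \<open>r = 1\<close> exp_i_eq_1_iff_Re[of "x - \<theta>"] by simp
  qed
  have "log_factor r x = (\<lambda>\<theta>. if \<theta> \<in> ?A then Ln (?z \<theta>) else Ln 0)"
    using z0 by (auto simp: log_factor_def fun_eq_iff)
  moreover have "(\<lambda>\<theta>. if \<theta> \<in> ?A then Ln (?z \<theta>) else Ln 0) \<in> borel_measurable borel"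
  proof (rule borel_measurable_continuous_on_if)
    show "continuous_on ?A (\<lambda>\<theta>. Ln (?z \<theta>))"
      by (intro continuous_on_Ln' continuous_on_subset[OF cz]) (auto simp: complex_nonpos_Reals_iff)
  qed (use A in auto)
  ultimately show ?thesis by simp
qed

text \<open>Termwise integration, dominated by a geometric series. Orthogonality leaves at most the
  one term with \<open>Suc m = - k\<close>.\<close>

lemma log_factor_fourier:
  assumes r: "0 \<le> r" "r < 1"
  shows "(CLBINT \<theta>:{0..2 * pi}. log_factor r x \<theta> * exp (- \<i> * of_int k * complex_of_real \<theta>)) =
    2 * of_real pi * (of_real r ^ nat (- k) * log_coeff x k)"
proof -
  let ?e = "\<lambda>\<theta>. exp (- \<i> * of_int k * complex_of_real \<theta>)"
  define f where "f = (\<lambda>m \<theta>. indicator {0..2 * pi} \<theta> *\<^sub>R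
    (- (of_real r ^ Suc m * exp (\<i> * of_nat (Suc m) * complex_of_real (x - \<theta>)) / of_nat (Suc m)) * ?e \<theta>))"
  define c where "c = (\<lambda>m. - (of_real r ^ Suc m * exp (\<i> * of_nat (Suc m) * complex_of_real x) / of_nat (Suc m)) *
    (if - int (Suc m) - k = 0 then 2 * of_real pi else 0))"
  have f_eq: "f m \<theta> = - (of_real r ^ Suc m * exp (\<i> * of_nat (Suc m) * complex_of_real x) / of_nat (Suc m)) *
    (indicator {0..2 * pi} \<theta> *\<^sub>R exp (\<i> * of_int (- int (Suc m) - k) * complex_of_real \<theta>))" for m \<theta>
  proof -
    have "exp (\<i> * of_nat (Suc m) * complex_of_real (x - \<theta>)) * ?e \<theta> =
      exp (\<i> * of_nat (Suc m) * complex_of_real x) * exp (\<i> * of_int (- int (Suc m) - k) * complex_of_real \<theta>)"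
      unfolding exp_add[symmetric] by (rule arg_cong[where f=exp]) (simp add: algebra_simps)
    then show ?thesis unfolding f_def by (simp add: scaleR_conv_of_real mult_ac)
  qed
  have int_f: "(LINT \<theta>|lborel. f m \<theta>) = c m" for m
    unfolding f_eq integral_mult_right_zero c_def integral_exp_int[symmetric] set_lebesgue_integral_def ..
  have f_int: "integrable lborel (f m)" for m
  proof -
    have "set_integrable lborel {0..2 * pi} (\<lambda>\<theta>. exp (\<i> * of_int (- int (Suc m) - k) * complex_of_real \<theta>))"
      by (rule set_integrable_bounded_circle[where B=1]) (auto simp del: of_int_diff of_int_minus)
    then show ?thesis unfolding f_eq[abs_def] set_integrable_def by (intro integrable_mult_right)
  qed
  have norm_f: "norm (f m \<theta>) = r ^ Suc m / real (Suc m) * indicator {0..2 * pi} \<theta>" for m \<theta>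
  proof -
    have 1: "cmod (exp (\<i> * of_nat (Suc m) * complex_of_real (x - \<theta>))) = 1" "cmod (?e \<theta>) = 1"
      by (simp_all del: of_nat_Suc)
    show ?thesis
      unfolding f_def norm_scaleR norm_mult norm_divide norm_minus_cancel norm_power norm_of_nat 1 norm_of_real
      using r by (simp del: of_nat_Suc)
  qed
  have "(\<lambda>m. LINT \<theta>|lborel. f m \<theta>) sums (LINT \<theta>|lborel. (\<Sum>m. f m \<theta>))"
  proof (rule sums_integral[OF f_int])
    have "r ^ Suc m / real (Suc m) * y \<le> r ^ m" if "0 \<le> y" "y \<le> 1" for m y
    proof -
      have "r ^ Suc m / real (Suc m) \<le> r ^ m / 1"
        using r by (intro frac_le) (auto simp: mult_left_le_one_le)
      then show ?thesis using that r mult_mono[of "r ^ Suc m / real (Suc m)" "r ^ m" y 1] by simp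
    qed
    then have "norm (f m \<theta>) \<le> r ^ m" for m \<theta>
      unfolding norm_f by (simp split: split_indicator)
    then have "norm (norm (f m \<theta>)) \<le> r ^ m" for m \<theta> by simp
    then show "AE \<theta> in lborel. summable (\<lambda>m. norm (f m \<theta>))"
      using r by (intro always_eventually allI summable_comparison_test'[OF summable_geometric[of r], where N=0]) auto
    have "(LINT \<theta>|lborel. norm (f m \<theta>)) = r ^ Suc m / real (Suc m) * (2 * pi)" for m
      unfolding norm_f by simp
    moreover have "summable (\<lambda>m. r ^ Suc m / real (Suc m) * (2 * pi))"
    proof (intro summable_mult2 summable_comparison_test'[OF summable_geometric[of r], where N=0])
      show "norm (r ^ Suc m / real (Suc m)) \<le> r ^ m" for m
      proof -
        have "r ^ Suc m / real (Suc m) \<le> r ^ m / 1"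
          using r by (intro frac_le) (auto simp: mult_left_le_one_le)
        moreover have "0 \<le> r ^ Suc m / real (Suc m)" using r by (intro divide_nonneg_nonneg zero_le_power) auto
        ultimately show ?thesis unfolding real_norm_def by (simp only: abs_of_nonneg div_by_1)
      qed
    qed (use r in auto)
    ultimately show "summable (\<lambda>m. LINT \<theta>|lborel. norm (f m \<theta>))" by simp
  qed
  moreover have "(\<Sum>m. f m \<theta>) = indicator {0..2 * pi} \<theta> *\<^sub>R (log_factor r x \<theta> * ?e \<theta>)" for \<theta>
    unfolding f_def by (intro sums_unique[symmetric] sums_scaleR_right sums_mult2 log_factor_sums r)
  ultimately have sums: "c sums (CLBINT \<theta>:{0..2 * pi}. log_factor r x \<theta> * ?e \<theta>)"
    unfolding int_f set_lebesgue_integral_def by simp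
  have "c sums (2 * of_real pi * (of_real r ^ nat (- k) * log_coeff x k))"
  proof (cases "k < 0")
    case True
    then obtain m where m: "k = - int (Suc m)"
      by (metis neg_int_cases not_less_zero of_nat_less_0_iff old.nat.exhaust of_nat_0 neg_0_less_iff_less minus_zero less_irrefl)
    have "c sums (\<Sum>i\<in>{m}. c i)"
      by (rule sums_finite) (auto simp: c_def m)
    then show ?thesis by (simp add: c_def m log_coeff_def mult_ac del: of_nat_Suc)
  next
    case False
    then have "c = (\<lambda>_. 0)" by (auto simp: c_def fun_eq_iff)
    then show ?thesis using False by (simp add: log_coeff_def)
  qed
  with sums show ?thesis by (rule sums_unique2)
qed

text \<open>The distance \<open>1 - r\<close> between \<open>u\<close> and \<open>r * u\<close> is
  itself at most the modulus of \<open>1 - r * u\<close>. This makes the logarithmic singularity at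
  \<open>r = 1\<close> a majorant for every \<open>r\<close>.\<close>

lemma norm_one_minus_ge:
  fixes u :: complex
  assumes "cmod u = 1" "0 \<le> r" "r \<le> 1"
  shows "cmod (1 - u) / 2 \<le> cmod (1 - of_real r * u)"
proof -
  have "1 - u = (1 - of_real r * u) - of_real (1 - r) * u" by (simp add: algebra_simps)
  then have "cmod (1 - u) \<le> cmod (1 - of_real r * u) + cmod (of_real (1 - r) * u)"
    by (metis norm_triangle_ineq4)
  also have "cmod (of_real (1 - r) * u) = 1 - r" using assms by (simp add: norm_mult del: of_real_diff)
  also have "1 - r \<le> cmod (1 - of_real r * u)"
    using norm_triangle_ineq2[of 1 "of_real r * u"] assms by (simp add: norm_mult)
  finally show ?thesis by simp
qed

text \<open>The modulus of \<open>1 - r * u\<close> is at most 2, so the offset \<open>ln 2\<close>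
  makes the function nonnegative and Fatou's lemma applicable.\<close>

definition log_defect :: "real \<Rightarrow> real \<Rightarrow> real \<Rightarrow> real" where
  "log_defect r x \<theta> = ln 2 - Re (log_factor r x \<theta>)"

lemma log_defect_nonneg:
  assumes "0 \<le> r" "r \<le> 1" and False: "1 - of_real r * exp (\<i> * complex_of_real (x - \<theta>)) \<noteq> 0"
  shows "0 \<le> log_defect r x \<theta>"
proof -
  have "cmod (1 - of_real r * exp (\<i> * complex_of_real (x - \<theta>))) \<le> 1 + r * 1"
    using norm_triangle_ineq4[of 1 "of_real r * exp (\<i> * complex_of_real (x - \<theta>))"] assms by (simp add: norm_mult)
  then have "ln (cmod (1 - of_real r * exp (\<i> * complex_of_real (x - \<theta>)))) \<le> ln 2"
    using False assms by (subst ln_le_cancel_iff) auto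
  then show ?thesis using False by (simp add: log_defect_def log_factor_def)
qed

lemma AE_exp_neq_1: "AE \<theta> in lborel. exp (\<i> * complex_of_real (x - \<theta>)) \<noteq> 1"
proof (rule AE_I')
  have "{\<theta>. exp (\<i> * complex_of_real (x - \<theta>)) = 1} \<subseteq> range (\<lambda>k::int. x - 2 * pi * of_int k)"
  proof
    fix \<theta> assume "\<theta> \<in> {\<theta>. exp (\<i> * complex_of_real (x - \<theta>)) = 1}"
    then obtain k :: int where "x - \<theta> = of_int (2 * k) * pi"
      by (auto simp: exp_eq_1)
    then have "\<theta> = x - 2 * pi * of_int k" by (simp add: algebra_simps)
    then show "\<theta> \<in> range (\<lambda>k::int. x - 2 * pi * of_int k)" by blast
  qed
  then have "countable {\<theta>. exp (\<i> * complex_of_real (x - \<theta>)) = 1}"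
    by (rule countable_subset) simp
  then show "{\<theta>. exp (\<i> * complex_of_real (x - \<theta>)) = 1} \<in> null_sets lborel"
    by (rule countable_imp_null_set_lborel)
qed auto

definition radius_seq :: "nat \<Rightarrow> real" where
  "radius_seq i = 1 - 1 / real (Suc i)"

lemma radius_seq_bounds: "0 \<le> radius_seq i" "radius_seq i < 1"
  by (auto simp: radius_seq_def)

lemma radius_seq_tendsto: "radius_seq \<longlonglongrightarrow> 1"
proof -
  have "(\<lambda>i. 1 - 1 / real (Suc i)) \<longlonglongrightarrow> 1 - 0"
    by (intro tendsto_diff tendsto_const LIMSEQ_Suc lim_1_over_n)
  then show ?thesis by (simp add: radius_seq_def[abs_def])
qed

lemma log_factor_tendsto:
  assumes "exp (\<i> * complex_of_real (x - \<theta>)) \<noteq> 1"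
  shows "(\<lambda>i. log_factor (radius_seq i) x \<theta>) \<longlonglongrightarrow> log_factor 1 x \<theta>"
proof -
  let ?u = "exp (\<i> * complex_of_real (x - \<theta>))"
  have "Re ?u \<noteq> 1" using assms by (simp only: exp_i_eq_1_iff_Re not_False_eq_True)
  then have "Re ?u < 1" using complex_Re_le_cmod[of ?u] by simp
  then have "1 - of_real 1 * ?u \<notin> \<real>\<^sub>\<le>\<^sub>0"
    by (auto simp: complex_nonpos_Reals_iff)
  then show ?thesis
    unfolding log_factor_def
    by (intro tendsto_Ln tendsto_intros tendsto_of_real radius_seq_tendsto) auto
qed

text \<open>Fatou along radii tending to 1. For \<open>r < 1\<close> the coefficient of index 0
  vanishes, so the integral of the defect is \<open>2 * pi * ln 2\<close> for every radius, which
  bounds the limit without an estimate of the singularity.\<close>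

lemma log_defect_integrable: "integrable lborel (\<lambda>\<theta>. indicator {0..2 * pi} \<theta> * log_defect 1 x \<theta>)"
proof (rule integrableI_nonneg)
  show "(\<lambda>\<theta>. indicator {0..2 * pi} \<theta> * log_defect 1 x \<theta>) \<in> borel_measurable lborel"
    unfolding log_defect_def by measurable
  show "AE \<theta> in lborel. 0 \<le> indicator {0..2 * pi} \<theta> * log_defect 1 x \<theta>"
    using AE_exp_neq_1[of x]
  proof eventually_elim
    case (elim \<theta>)
    then show ?case using log_defect_nonneg[of 1 x \<theta>] by (simp split: split_indicator)
  qed
  let ?g = "\<lambda>i \<theta>. ennreal (indicator {0..2 * pi} \<theta> * log_defect (radius_seq i) x \<theta>)"
  have "(\<integral>\<^sup>+ \<theta>. ennreal (indicator {0..2 * pi} \<theta> * log_defect 1 x \<theta>) \<partial>lborel) \<le> (\<integral>\<^sup>+ \<theta>. liminf (\<lambda>i. ?g i \<theta>) \<partial>lborel)"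
  proof (rule nn_integral_mono_AE)
    show "AE \<theta> in lborel. ennreal (indicator {0..2 * pi} \<theta> * log_defect 1 x \<theta>) \<le> liminf (\<lambda>i. ?g i \<theta>)"
      using AE_exp_neq_1[of x]
    proof eventually_elim
      case (elim \<theta>)
      have "(\<lambda>i. ?g i \<theta>) \<longlonglongrightarrow> ennreal (indicator {0..2 * pi} \<theta> * log_defect 1 x \<theta>)"
        unfolding log_defect_def
        by (intro tendsto_ennrealI tendsto_intros log_factor_tendsto elim)
      then show ?case by (subst lim_imp_Liminf) auto
    qed
  qed
  also have "\<dots> \<le> liminf (\<lambda>i. \<integral>\<^sup>+ \<theta>. ?g i \<theta> \<partial>lborel)"
    unfolding log_defect_def using radius_seq_bounds by (intro nn_integral_liminf) (simp add: less_imp_le)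
  also have "(\<lambda>i. \<integral>\<^sup>+ \<theta>. ?g i \<theta> \<partial>lborel) = (\<lambda>i. ennreal (2 * pi * ln 2))"
  proof (rule ext)
    fix i
    let ?r = "radius_seq i"
    \<comment> \<open>A crude bound that depends on the radius; it serves only for integrability at
      a fixed one.\<close>
    have bound: "cmod (log_factor ?r x \<theta>) \<le> \<bar>ln (1 - ?r)\<bar> + ln 2 + pi" for \<theta>
    proof -
      let ?z = "1 - of_real ?r * exp (\<i> * complex_of_real (x - \<theta>))"
      have ge: "1 - ?r \<le> cmod ?z"
        using norm_triangle_ineq2[of 1 "of_real ?r * exp (\<i> * complex_of_real (x - \<theta>))"] radius_seq_bounds[of i]
        by (simp add: norm_mult)
      have le: "cmod ?z \<le> 2"
        using norm_triangle_ineq4[of 1 "of_real ?r * exp (\<i> * complex_of_real (x - \<theta>))"] radius_seq_bounds[of i]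
        by (simp add: norm_mult)
      have pos: "0 < 1 - ?r" using radius_seq_bounds[of i] by simp
      then have nz: "?z \<noteq> 0" using ge by (metis less_le_not_le norm_zero)
      have "ln (1 - ?r) \<le> ln (cmod ?z)" "ln (cmod ?z) \<le> ln 2"
        using ge le pos nz by (simp_all add: ln_le_cancel_iff)
      moreover have "0 \<le> ln (2::real)" by simp
      ultimately have "\<bar>ln (cmod ?z)\<bar> \<le> \<bar>ln (1 - ?r)\<bar> + ln 2" by linarith
      moreover have "\<bar>Im (Ln ?z)\<bar> \<le> pi" using mpi_less_Im_Ln[OF nz] Im_Ln_le_pi[OF nz] by simp
      moreover have "cmod (Ln ?z) \<le> \<bar>Re (Ln ?z)\<bar> + \<bar>Im (Ln ?z)\<bar>" by (rule cmod_le)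
      ultimately show ?thesis using nz by (simp add: log_factor_def)
    qed
    have int: "set_integrable lborel {0..2 * pi} (log_factor ?r x)"
      by (rule set_integrable_bounded_circle[OF measurable_log_factor bound]) (use radius_seq_bounds[of i] in auto)
    have int2: "integrable lborel (\<lambda>\<theta>. indicator {0..2 * pi} \<theta> * Re (log_factor ?r x \<theta>))"
      using integrable_Re[OF int[unfolded set_integrable_def]] by simp
    have "(LINT \<theta>|lborel. indicator {0..2 * pi} \<theta> * Re (log_factor ?r x \<theta>)) = Re (CLBINT \<theta>:{0..2 * pi}. log_factor ?r x \<theta>)"
      unfolding set_lebesgue_integral_def using integral_Re[OF int[unfolded set_integrable_def]] by simp
    also have "\<dots> = 0"
      using log_factor_fourier[OF radius_seq_bounds, of i x 0] by (simp add: log_coeff_def)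
    finally have zero: "(LINT \<theta>|lborel. indicator {0..2 * pi} \<theta> * Re (log_factor ?r x \<theta>)) = 0" .
    have int3: "integrable lborel (\<lambda>\<theta>. indicator {0..2 * pi} \<theta> * ln 2 :: real)"
      by (intro integrable_mult_left) simp
    have eq: "(\<lambda>\<theta>. indicator {0..2 * pi} \<theta> * log_defect ?r x \<theta>) = (\<lambda>\<theta>. indicator {0..2 * pi} \<theta> * ln 2 - indicator {0..2 * pi} \<theta> * Re (log_factor ?r x \<theta>))"
      by (simp add: log_defect_def right_diff_distrib fun_eq_iff)
    have "(\<integral>\<^sup>+ \<theta>. ?g i \<theta> \<partial>lborel) = ennreal (LINT \<theta>|lborel. indicator {0..2 * pi} \<theta> * log_defect ?r x \<theta>)"
    proof (rule nn_integral_eq_integral)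
      show "integrable lborel (\<lambda>\<theta>. indicator {0..2 * pi} \<theta> * log_defect ?r x \<theta>)"
        unfolding eq by (intro Bochner_Integration.integrable_diff int2 int3)
      show "AE \<theta> in lborel. 0 \<le> indicator {0..2 * pi} \<theta> * log_defect ?r x \<theta>"
      proof (rule always_eventually, rule allI)
        fix \<theta>
        have "1 - of_real ?r * exp (\<i> * complex_of_real (x - \<theta>)) \<noteq> 0"
        proof
          assume "1 - of_real ?r * exp (\<i> * complex_of_real (x - \<theta>)) = 0"
          then have "cmod (of_real ?r * exp (\<i> * complex_of_real (x - \<theta>))) = cmod 1" by simp
          then have "?r = 1" using radius_seq_bounds[of i] by (simp add: norm_mult)
          then show False using radius_seq_bounds[of i] by simp
        qed
        then show "0 \<le> indicator {0..2 * pi} \<theta> * log_defect ?r x \<theta>"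
          using log_defect_nonneg[of ?r x \<theta>] radius_seq_bounds[of i] by (simp split: split_indicator)
      qed
    qed
    also have "(LINT \<theta>|lborel. indicator {0..2 * pi} \<theta> * log_defect ?r x \<theta>) = 2 * pi * ln 2"
      unfolding eq Bochner_Integration.integral_diff[OF int3 int2] zero by simp
    finally show "(\<integral>\<^sup>+ \<theta>. ?g i \<theta> \<partial>lborel) = ennreal (2 * pi * ln 2)" .
  qed
  also have "liminf (\<lambda>i::nat. ennreal (2 * pi * ln 2)) < \<infinity>" by (simp add: Liminf_const)
  finally show "(\<integral>\<^sup>+ \<theta>. ennreal (indicator {0..2 * pi} \<theta> * log_defect 1 x \<theta>) \<partial>lborel) < \<infinity>" .
qed

text \<open>The argument of \<open>Ln\<close> has modulus between half its modulus at
  \<open>r = 1\<close> and 2, and the imaginary part of \<open>Ln\<close> is at most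
  \<open>pi\<close>. The majorant is the same for all radii.\<close>

lemma norm_log_factor_le:
  assumes u: "exp (\<i> * complex_of_real (x - \<theta>)) \<noteq> 1" and r: "0 \<le> r" "r \<le> 1"
  shows "cmod (log_factor r x \<theta>) \<le> log_defect 1 x \<theta> + (ln 2 + pi)"
proof -
  let ?u = "exp (\<i> * complex_of_real (x - \<theta>))"
  let ?z = "1 - of_real r * ?u"
  have u0: "1 - ?u \<noteq> 0" using u by simp
  have ge: "cmod (1 - ?u) / 2 \<le> cmod ?z" by (rule norm_one_minus_ge[OF _ r]) simp
  have pos: "0 < cmod (1 - ?u) / 2" using u0 by simp
  have nz: "?z \<noteq> 0" using ge pos by (metis less_le_not_le norm_zero)
  have le: "cmod ?z \<le> 2"
    using norm_triangle_ineq4[of 1 "of_real r * ?u"] r by (simp add: norm_mult)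
  have "ln (cmod (1 - ?u) / 2) \<le> ln (cmod ?z)"
    by (rule ln_le_cancel_iff[THEN iffD2, OF pos _ ge]) (use nz in simp)
  moreover have "ln (cmod ?z) \<le> ln 2"
    by (rule ln_le_cancel_iff[THEN iffD2, OF _ _ le]) (use nz in simp_all)
  moreover have "ln (cmod (1 - ?u) / 2) = - log_defect 1 x \<theta>"
    using u0 by (simp add: log_defect_def log_factor_def ln_div)
  moreover have "0 \<le> log_defect 1 x \<theta>" by (rule log_defect_nonneg) (use u in auto)
  moreover have "0 \<le> ln (2::real)" by simp
  ultimately have "\<bar>ln (cmod ?z)\<bar> \<le> log_defect 1 x \<theta> + ln 2" by linarith
  moreover have "\<bar>Im (Ln ?z)\<bar> \<le> pi" using mpi_less_Im_Ln[OF nz] Im_Ln_le_pi[OF nz] by simp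
  moreover have "cmod (Ln ?z) \<le> \<bar>Re (Ln ?z)\<bar> + \<bar>Im (Ln ?z)\<bar>" by (rule cmod_le)
  ultimately show ?thesis using nz by (simp add: log_factor_def)
qed

text \<open>Abel summation: dominated convergence along \<open>radius_seq\<close>, where the factor
  \<open>r ^ nat (- k)\<close> tends to 1.\<close>

lemma log_factor_1_fourier:
  shows "set_integrable lborel {0..2 * pi} (\<lambda>\<theta>. log_factor 1 x \<theta> * exp (- \<i> * of_int k * complex_of_real \<theta>))"
    and "(CLBINT \<theta>:{0..2 * pi}. log_factor 1 x \<theta> * exp (- \<i> * of_int k * complex_of_real \<theta>)) = 2 * of_real pi * log_coeff x k"
proof -
  let ?s = "\<lambda>r \<theta>. indicator {0..2 * pi} \<theta> *\<^sub>R (log_factor r x \<theta> * exp (- \<i> * of_int k * complex_of_real \<theta>))"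
  let ?w = "\<lambda>\<theta>. indicator {0..2 * pi} \<theta> * log_defect 1 x \<theta> + indicator {0..2 * pi} \<theta> * (ln 2 + pi)"
  have [measurable]: "(\<lambda>\<theta>. exp (- \<i> * of_int k * complex_of_real \<theta>)) \<in> borel_measurable borel"
    by (intro borel_measurable_continuous_onI continuous_intros)
  have w: "integrable lborel ?w"
    by (intro Bochner_Integration.integrable_add log_defect_integrable integrable_mult_left) simp
  have lim: "AE \<theta> in lborel. (\<lambda>i. ?s (radius_seq i) \<theta>) \<longlonglongrightarrow> ?s 1 \<theta>"
    using AE_exp_neq_1[of x]
    by eventually_elim (intro tendsto_scaleR tendsto_const tendsto_mult log_factor_tendsto)
  have bound: "AE \<theta> in lborel. norm (?s r \<theta>) \<le> ?w \<theta>" if "0 \<le> r" "r \<le> 1" for r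
    using AE_exp_neq_1[of x]
  proof eventually_elim
    case (elim \<theta>)
    have "cmod (exp (- \<i> * of_int k * complex_of_real \<theta>)) = 1" by simp
    then show ?case
      using norm_log_factor_le[OF elim that] by (simp add: norm_mult split: split_indicator)
  qed
  have meas: "?s r \<in> borel_measurable lborel" if "0 \<le> r" "r \<le> 1" for r using that by simp
  have meas1: "?s 1 \<in> borel_measurable lborel" by (rule meas) auto
  have measr: "?s (radius_seq i) \<in> borel_measurable lborel" for i
    using radius_seq_bounds[of i] by (intro meas) auto
  have b': "AE \<theta> in lborel. norm (?s (radius_seq i) \<theta>) \<le> ?w \<theta>" for i
    using radius_seq_bounds[of i] by (intro bound) auto
  show "set_integrable lborel {0..2 * pi} (\<lambda>\<theta>. log_factor 1 x \<theta> * exp (- \<i> * of_int k * complex_of_real \<theta>))"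
    unfolding set_integrable_def by (rule integrable_dominated_convergence[OF meas1 measr w lim b'])
  have "(\<lambda>i. LINT \<theta>|lborel. ?s (radius_seq i) \<theta>) \<longlonglongrightarrow> (LINT \<theta>|lborel. ?s 1 \<theta>)"
    by (rule integral_dominated_convergence[OF meas1 measr w lim b'])
  moreover have "(\<lambda>i. LINT \<theta>|lborel. ?s (radius_seq i) \<theta>) \<longlonglongrightarrow> 2 * of_real pi * (of_real 1 ^ nat (- k) * log_coeff x k)"
    unfolding log_factor_fourier[OF radius_seq_bounds, unfolded set_lebesgue_integral_def]
    by (intro tendsto_intros tendsto_of_real radius_seq_tendsto)
  ultimately show "(CLBINT \<theta>:{0..2 * pi}. log_factor 1 x \<theta> * exp (- \<i> * of_int k * complex_of_real \<theta>)) = 2 * of_real pi * log_coeff x k"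
    unfolding set_lebesgue_integral_def using LIMSEQ_unique by fastforce
qed

section \<open>The Sobolev topology on coefficient sequences\<close>

text \<open>Real and imaginary part of the logarithm are coded by one sequence \<open>q\<close>, the
  power sums. \<open>Y_map\<close> differs from \<open>X_map\<close> by factors of modulus 1 only,
  so statements about the product space reduce to a single weighted sequence space.\<close>

definition X_map :: "(nat \<Rightarrow> complex) \<Rightarrow> int \<Rightarrow> complex" where
  "X_map q k = (if k < 0 then - q (nat (- k)) / (2 * of_int (- k)) else if 0 < k then - cnj (q (nat k)) / (2 * of_int k) else 0)"

definition Y_map :: "(nat \<Rightarrow> complex) \<Rightarrow> int \<Rightarrow> complex" where
  "Y_map q k = (if k < 0 then \<i> * q (nat (- k)) / (2 * of_int (- k)) else if 0 < k then - \<i> * cnj (q (nat k)) / (2 * of_int k) else 0)"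

lemma X_map_diff: "X_map p k - X_map q k = X_map (\<lambda>m. p m - q m) k"
  by (simp add: X_map_def diff_divide_distrib)

lemma Y_map_diff: "Y_map p k - Y_map q k = Y_map (\<lambda>m. p m - q m) k"
  by (simp add: Y_map_def diff_divide_distrib algebra_simps)

lemma norm_X_map: "cmod (X_map q k) = cmod (q (nat \<bar>k\<bar>)) / (2 * real_of_int \<bar>k\<bar>)"
  by (auto simp: X_map_def norm_divide norm_mult)

lemma norm_Y_map: "cmod (Y_map q k) = cmod (X_map q k)"
  by (auto simp: X_map_def Y_map_def norm_divide norm_mult)

definition seq_sum_square :: "real \<Rightarrow> (nat \<Rightarrow> complex) \<Rightarrow> int \<Rightarrow> real" where
  "seq_sum_square s q k = (cmod (X_map q k))\<^sup>2 * sobolev_weight s k"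

definition seq_space :: "real \<Rightarrow> (nat \<Rightarrow> complex) set" where
  "seq_space s = {q. seq_sum_square s q summable_on UNIV}"

text \<open>The Sobolev distance pulled back along \<open>X_map\<close>. It is only a pseudometric,
  because the entry of index 0 does not enter \<open>X_map\<close>.\<close>

definition seq_dist :: "real \<Rightarrow> (nat \<Rightarrow> complex) \<Rightarrow> (nat \<Rightarrow> complex) \<Rightarrow> real" where
  "seq_dist s p q = sqrt (\<Sum>\<^sub>\<infinity>k. seq_sum_square s (\<lambda>m. p m - q m) k)"

lemma seq_sum_square_nonneg: "0 \<le> seq_sum_square s q k"
  by (simp add: seq_sum_square_def less_imp_le[OF sobolev_weight_pos])

lemma seq_sum_square_0 [simp]: "seq_sum_square s (\<lambda>m. 0) k = 0"
  by (simp add: seq_sum_square_def X_map_def)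

lemma map_mem_sobolev: "X_map q \<in> sobolev s \<longleftrightarrow> q \<in> seq_space s" "Y_map q \<in> sobolev s \<longleftrightarrow> q \<in> seq_space s"
  by (simp_all add: sobolev_def seq_space_def seq_sum_square_def[abs_def] norm_Y_map)

lemma map_dist_sobolev:
  "sobolev_dist s (X_map p) (X_map q) = seq_dist s p q" "sobolev_dist s (Y_map p) (Y_map q) = seq_dist s p q"
  by (simp_all add: sobolev_dist_def sobolev_norm_alt seq_dist_def seq_sum_square_def X_map_diff Y_map_diff norm_Y_map)

lemma seq_dist_commute: "seq_dist s p q = seq_dist s q p"
  using Metric_space.commute[OF Metric_space_sobolev, of s "X_map p" "X_map q"] by (simp add: map_dist_sobolev)

lemma seq_dist_triangle:
  "p \<in> seq_space s \<Longrightarrow> q \<in> seq_space s \<Longrightarrow> u \<in> seq_space s \<Longrightarrow> seq_dist s p u \<le> seq_dist s p q + seq_dist s q u"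
  using Metric_space.triangle[OF Metric_space_sobolev, of "X_map p" s "X_map q" "X_map u"]
  by (simp add: map_dist_sobolev map_mem_sobolev)

abbreviation (input) sobolev_prod :: "real \<Rightarrow> ((int \<Rightarrow> complex) \<times> (int \<Rightarrow> complex)) topology" where
  "sobolev_prod s \<equiv> prod_topology (sobolev_topology s) (sobolev_topology s)"

text \<open>Both components have the same distance \<open>seq_dist\<close>, so the smaller of the
  two radii works for the pair.\<close>

lemma openin_sobolev_prod_preimage:
  assumes U: "openin (sobolev_prod s) U" and q: "(X_map q, Y_map q) \<in> U"
  shows "q \<in> seq_space s \<and> (\<exists>e>0. \<forall>p\<in>seq_space s. seq_dist s q p < e \<longrightarrow> (X_map p, Y_map p) \<in> U)"
proof -
  interpret Metric_space "sobolev s" "sobolev_dist s" by (rule Metric_space_sobolev)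
  have "\<exists>V W. openin (sobolev_topology s) V \<and> openin (sobolev_topology s) W \<and> X_map q \<in> V \<and> Y_map q \<in> W \<and> V \<times> W \<subseteq> U"
    using U q by (simp add: openin_prod_topology_alt)
  then obtain V W where VW: "openin (sobolev_topology s) V" "openin (sobolev_topology s) W"
    "X_map q \<in> V" "Y_map q \<in> W" "V \<times> W \<subseteq> U"
    by (elim exE conjE) rule
  have "\<exists>r>0. mball z r \<subseteq> V" if "openin (sobolev_topology s) V" "z \<in> V" for z V
    using that by (simp add: sobolev_topology_def openin_mtopology)
  from this[OF VW(1,3)] this[OF VW(2,4)]
  obtain a b where a: "a > 0" "mball (X_map q) a \<subseteq> V" and b: "b > 0" "mball (Y_map q) b \<subseteq> W"
    by (elim exE conjE) rule
  have mem: "q \<in> seq_space s"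
    using openin_subset[OF VW(1)] VW(3) by (auto simp: topspace_sobolev_topology map_mem_sobolev)
  moreover have "(X_map p, Y_map p) \<in> U" if p: "p \<in> seq_space s" "seq_dist s q p < min a b" for p
  proof -
    have "X_map p \<in> mball (X_map q) a" "Y_map p \<in> mball (Y_map q) b"
      using p mem by (auto simp: in_mball map_mem_sobolev map_dist_sobolev)
    then have "X_map p \<in> V" "Y_map p \<in> W" using a(2) b(2) by auto
    then show ?thesis using VW(5) by auto
  qed
  ultimately show ?thesis using a(1) b(1) by (intro conjI exI[of _ "min a b"]) auto
qed

text \<open>The cut-off depends on the majorant \<open>g\<close> alone and serves every
  \<open>h\<close> below it. This uniformity is what turns coordinatewise closeness inside a box
  into Sobolev closeness.\<close>

lemma infsum_int_tail:
  fixes g :: "int \<Rightarrow> real"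
  assumes g: "g summable_on UNIV" "\<And>k. 0 \<le> g k" and e: "e > 0"
  shows "\<exists>J::nat. \<forall>h. (\<forall>k. 0 \<le> h k) \<longrightarrow> (\<forall>k. h k \<le> g k) \<longrightarrow> (\<Sum>\<^sub>\<infinity>k. h k) \<le> (\<Sum>k\<in>{- int J..int J}. h k) + e"
proof -
  have "(sum g \<longlongrightarrow> infsum g UNIV) (finite_subsets_at_top UNIV)"
    using has_sum_infsum[OF g(1)] by (simp add: has_sum_def)
  then have "\<forall>\<^sub>F F in finite_subsets_at_top UNIV. dist (sum g F) (infsum g UNIV) < e"
    using e by (rule tendstoD)
  then have "\<exists>F. finite F \<and> F \<subseteq> UNIV \<and> (\<forall>F'. finite F' \<and> F \<subseteq> F' \<and> F' \<subseteq> UNIV \<longrightarrow> dist (sum g F') (infsum g UNIV) < e)"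
    by (simp only: eventually_finite_subsets_at_top)
  then obtain F where F: "finite F" "\<And>F'. finite F' \<Longrightarrow> F \<subseteq> F' \<Longrightarrow> dist (sum g F') (infsum g UNIV) < e"
    by (elim exE conjE) simp
  define J where "J = (\<Sum>k\<in>F. nat \<bar>k\<bar>)"
  let ?I = "{- int J..int J}"
  have "F \<subseteq> ?I"
  proof
    fix k assume "k \<in> F"
    then have "nat \<bar>k\<bar> \<le> J" unfolding J_def using F(1) by (intro member_le_sum) auto
    then show "k \<in> ?I" by auto
  qed
  then have d: "dist (sum g ?I) (infsum g UNIV) < e" using F(2) by simp
  have split: "infsum f UNIV = sum f ?I + infsum f (UNIV - ?I)" if "f summable_on UNIV" for f :: "int \<Rightarrow> real"
    using infsum_Un_disjoint[of f ?I "UNIV - ?I"] that summable_on_subset_banach[OF that] by simp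
  show ?thesis
  proof (intro exI[of _ J] allI impI)
    fix h :: "int \<Rightarrow> real" assume h: "\<forall>k. 0 \<le> h k" "\<forall>k. h k \<le> g k"
    have hs: "h summable_on UNIV"
      by (rule summable_on_comparison_test[OF g(1)]) (use h in auto)
    have "infsum h (UNIV - ?I) \<le> infsum g (UNIV - ?I)"
      using h by (intro infsum_mono summable_on_subset_banach[OF hs] summable_on_subset_banach[OF g(1)]) auto
    also have "\<dots> \<le> e" using split[OF g(1)] d unfolding dist_real_def by linarith
    finally show "(\<Sum>\<^sub>\<infinity>k. h k) \<le> (\<Sum>k\<in>?I. h k) + e" unfolding split[OF hs] by simp
  qed
qed

text \<open>A truncation always lies in the space and depends on finitely many coordinates, so its
  distance to a fixed point is continuous for coordinatewise convergence.\<close>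

definition seq_truncate :: "nat \<Rightarrow> (nat \<Rightarrow> complex) \<Rightarrow> nat \<Rightarrow> complex" where
  "seq_truncate J q = (\<lambda>m. if m \<le> J then q m else 0)"

lemma X_map_truncate: "X_map (seq_truncate J q) k = (if k \<in> {- int J..int J} then X_map q k else 0)"
  by (auto simp: X_map_def seq_truncate_def)

lemma seq_sum_square_truncate:
  "seq_sum_square s (seq_truncate J q) k = (if k \<in> {- int J..int J} then seq_sum_square s q k else 0)"
  by (simp add: seq_sum_square_def X_map_truncate)

lemma infsum_seq_truncate:
  "seq_sum_square s (seq_truncate J q) summable_on UNIV"
  "(\<Sum>\<^sub>\<infinity>k. seq_sum_square s (seq_truncate J q) k) = (\<Sum>k\<in>{- int J..int J}. seq_sum_square s q k)"
proof -
  have "(seq_sum_square s (seq_truncate J q) has_sum (\<Sum>k\<in>{- int J..int J}. seq_sum_square s (seq_truncate J q) k)) UNIV"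
    by (rule has_sum_finite_neutralI[where B = "{- int J..int J}"]) (auto simp: seq_sum_square_truncate)
  also have "(\<Sum>k\<in>{- int J..int J}. seq_sum_square s (seq_truncate J q) k) = (\<Sum>k\<in>{- int J..int J}. seq_sum_square s q k)"
    by (rule sum.cong) (auto simp: seq_sum_square_truncate)
  finally have "(seq_sum_square s (seq_truncate J q) has_sum (\<Sum>k\<in>{- int J..int J}. seq_sum_square s q k)) UNIV" .
  then show "seq_sum_square s (seq_truncate J q) summable_on UNIV"
    "(\<Sum>\<^sub>\<infinity>k. seq_sum_square s (seq_truncate J q) k) = (\<Sum>k\<in>{- int J..int J}. seq_sum_square s q k)"
    by (rule has_sum_imp_summable, rule infsumI)
qed

lemma seq_truncate_mem: "seq_truncate J q \<in> seq_space s"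
  by (simp add: seq_space_def infsum_seq_truncate)

lemma seq_truncate_diff: "(\<lambda>m. seq_truncate J p m - seq_truncate J q m) = seq_truncate J (\<lambda>m. p m - q m)"
  by (auto simp: seq_truncate_def)

lemma seq_dist_truncate_tendsto:
  assumes q: "q \<in> seq_space s" and e: "e > 0"
  shows "\<forall>\<^sub>F J in sequentially. seq_dist s (seq_truncate J q) q < e"
proof -
  have g: "seq_sum_square s q summable_on UNIV" using q by (simp add: seq_space_def)
  have e2: "0 < (e / 2)\<^sup>2" using e by simp
  from infsum_int_tail[OF g seq_sum_square_nonneg e2]
  obtain J0 where J0: "\<forall>h. (\<forall>k. 0 \<le> h k) \<longrightarrow> (\<forall>k. h k \<le> seq_sum_square s q k) \<longrightarrow>
      (\<Sum>\<^sub>\<infinity>k. h k) \<le> (\<Sum>k\<in>{- int J0..int J0}. h k) + (e / 2)\<^sup>2" ..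
  have "seq_dist s (seq_truncate J q) q < e" if J: "J0 \<le> J" for J
  proof -
    let ?h = "seq_sum_square s (\<lambda>m. seq_truncate J q m - q m)"
    have h: "?h k = (if k \<in> {- int J..int J} then 0 else seq_sum_square s q k)" for k
      unfolding seq_sum_square_def X_map_diff[symmetric] X_map_truncate by simp
    have "(\<Sum>\<^sub>\<infinity>k. ?h k) \<le> (\<Sum>k\<in>{- int J0..int J0}. ?h k) + (e / 2)\<^sup>2"
      by (rule J0[rule_format]) (auto simp: h seq_sum_square_nonneg)
    also have "(\<Sum>k\<in>{- int J0..int J0}. ?h k) = 0"
      using J by (intro sum.neutral) (auto simp: h)
    finally have "seq_dist s (seq_truncate J q) q \<le> e / 2"
      unfolding seq_dist_def using e by (intro real_le_lsqrt) (auto intro!: infsum_nonneg seq_sum_square_nonneg)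
    then show ?thesis using e by simp
  qed
  then show ?thesis unfolding eventually_sequentially by blast
qed

lemma continuous_on_X_map: "continuous_on UNIV (\<lambda>q. X_map q k)"
proof -
  consider "k < 0" | "0 < k" | "k = 0" by linarith
  then show ?thesis
  proof cases
    case 1
    then show ?thesis unfolding X_map_def
      by (simp, intro continuous_on_divide continuous_on_minus continuous_on_const continuous_on_product_coordinates) auto
  next
    case 2
    then show ?thesis unfolding X_map_def
      by (simp, intro continuous_on_divide continuous_on_minus continuous_on_cnj continuous_on_const continuous_on_product_coordinates) auto
  qed (simp add: X_map_def)
qed

lemma continuous_on_partial_sum:
  "continuous_on UNIV (\<lambda>q. \<Sum>k\<in>I. seq_sum_square s (\<lambda>m. q m - p m) k)"
  unfolding seq_sum_square_def X_map_diff[symmetric]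
  by (intro continuous_on_sum continuous_on_mult continuous_on_power continuous_on_norm continuous_on_diff
      continuous_on_X_map continuous_on_const)

text \<open>The distance between two truncations at \<open>J\<close> is a finite sum of continuous
  functions of the coordinates; the triangle inequality transfers this to the distance from
  \<open>u\<close>.\<close>

lemma open_truncate_ball:
  assumes u: "u \<in> seq_space s"
  shows "open {q. seq_dist s (seq_truncate J q) u < d}"
  unfolding open_subopen[of "{q. seq_dist s (seq_truncate J q) u < d}"]
proof
  fix p assume "p \<in> {q. seq_dist s (seq_truncate J q) u < d}"
  then have p: "seq_dist s (seq_truncate J p) u < d" by simp
  define e where "e = d - seq_dist s (seq_truncate J p) u"
  let ?T = "{q. (\<Sum>k\<in>{- int J..int J}. seq_sum_square s (\<lambda>m. q m - p m) k) < e\<^sup>2}"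
  have e: "e > 0" using p by (simp add: e_def)
  have "open ?T" by (intro open_Collect_less continuous_on_partial_sum continuous_on_const)
  moreover have "p \<in> ?T" using e by simp
  moreover have "?T \<subseteq> {q. seq_dist s (seq_truncate J q) u < d}"
  proof
    fix q assume "q \<in> ?T"
    then have "seq_dist s (seq_truncate J q) (seq_truncate J p) < e"
      unfolding seq_dist_def seq_truncate_diff infsum_seq_truncate(2) using e
      by (intro real_less_lsqrt) (auto intro!: sum_nonneg seq_sum_square_nonneg)
    moreover have "seq_dist s (seq_truncate J q) u \<le> seq_dist s (seq_truncate J q) (seq_truncate J p) + seq_dist s (seq_truncate J p) u"
      by (intro seq_dist_triangle seq_truncate_mem u)
    ultimately show "q \<in> {q. seq_dist s (seq_truncate J q) u < d}" by (simp add: e_def)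
  qed
  ultimately show "\<exists>T. open T \<and> p \<in> T \<and> T \<subseteq> {q. seq_dist s (seq_truncate J q) u < d}" by blast
qed

text \<open>Two countable quantifiers over closed conditions on the coordinates, which is the form
  needed for measurability.\<close>

lemma seq_space_iff_bounded:
  "q \<in> seq_space s \<longleftrightarrow> (\<exists>B::nat. \<forall>J::nat. (\<Sum>k\<in>{- int J..int J}. seq_sum_square s q k) \<le> real B)"
proof
  assume "q \<in> seq_space s"
  then have q: "seq_sum_square s q summable_on UNIV" by (simp add: seq_space_def)
  obtain B :: nat where "infsum (seq_sum_square s q) UNIV \<le> real B" using real_arch_simple by blast
  moreover have "(\<Sum>k\<in>{- int J..int J}. seq_sum_square s q k) \<le> infsum (seq_sum_square s q) UNIV" for J
    by (rule finite_sum_le_infsum[OF q]) (auto simp: seq_sum_square_nonneg)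
  ultimately have "(\<Sum>k\<in>{- int J..int J}. seq_sum_square s q k) \<le> real B" for J
    by (rule order_trans[rotated])
  then show "\<exists>B::nat. \<forall>J::nat. (\<Sum>k\<in>{- int J..int J}. seq_sum_square s q k) \<le> real B" by blast
next
  assume "\<exists>B::nat. \<forall>J::nat. (\<Sum>k\<in>{- int J..int J}. seq_sum_square s q k) \<le> real B"
  then obtain B :: nat where B: "\<And>J::nat. (\<Sum>k\<in>{- int J..int J}. seq_sum_square s q k) \<le> real B" by blast
  have "sum (seq_sum_square s q) F \<le> real B" if F: "finite F" for F
  proof -
    define J where "J = (\<Sum>k\<in>F. nat \<bar>k\<bar>)"
    have "F \<subseteq> {- int J..int J}"
    proof
      fix k assume "k \<in> F"
      then have "nat \<bar>k\<bar> \<le> J" unfolding J_def using F by (intro member_le_sum) auto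
      then show "k \<in> {- int J..int J}" by auto
    qed
    then have "sum (seq_sum_square s q) F \<le> (\<Sum>k\<in>{- int J..int J}. seq_sum_square s q k)"
      by (intro sum_mono2) (auto simp: seq_sum_square_nonneg)
    then show ?thesis using B[of J] by simp
  qed
  then show "q \<in> seq_space s"
    unfolding seq_space_def mem_Collect_eq
    by (intro nonneg_bdd_above_summable_on) (auto simp: seq_sum_square_nonneg bdd_above_def)
qed

lemma seq_space_borel: "seq_space s \<in> sets borel"
proof -
  have "closed {q. (\<Sum>k\<in>{- int J..int J}. seq_sum_square s q k) \<le> real B}" for J B :: nat
    using continuous_on_partial_sum[of s "\<lambda>_. 0" "{- int J..int J}"]
    by (intro closed_Collect_le continuous_on_const) simp
  then have "(\<Union>B::nat. \<Inter>J::nat. {q. (\<Sum>k\<in>{- int J..int J}. seq_sum_square s q k) \<le> real B}) \<in> sets borel"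
    by (intro sets.countable_UN sets.countable_INT image_subsetI borel_closed) auto
  also have "(\<Union>B::nat. \<Inter>J::nat. {q. (\<Sum>k\<in>{- int J..int J}. seq_sum_square s q k) \<le> real B}) = seq_space s"
    by (intro set_eqI) (simp add: seq_space_iff_bounded)
  finally show ?thesis .
qed

text \<open>
  The Sobolev topology is finer than the topology of coefficientwise convergence, but a point \<open>q\<close> of the
  space lies in an open set iff small balls of a fixed radius around its truncations eventually
  do; the latter is a Borel condition on the coefficients.
\<close>

lemma openin_sobolev_prod_borel:
  assumes U: "openin (sobolev_prod s) U"
  shows "{q. (X_map q, Y_map q) \<in> U} \<in> sets borel"
proof -
  define U' where "U' = {q. (X_map q, Y_map q) \<in> U}"
  \<comment> \<open>The quantifier over \<open>u\<close> is uncountable, but the complement is a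
    union of open sets, so every \<open>E i J\<close> is closed. Only the quantifiers over
    \<open>i\<close> and \<open>J\<close> have to be countable.\<close>
  define E where "E = (\<lambda>i J. {q. \<forall>u\<in>seq_space s. seq_dist s (seq_truncate J q) u < 1 / real (Suc i) \<longrightarrow> u \<in> U'})"
  have E: "closed (E i J)" for i J
  proof -
    have "- E i J = (\<Union>u\<in>seq_space s - U'. {q. seq_dist s (seq_truncate J q) u < 1 / real (Suc i)})"
      by (auto simp: E_def)
    then show ?thesis unfolding closed_def by (auto intro!: open_truncate_ball)
  qed
  have eq: "U' = seq_space s \<inter> (\<Union>i::nat. \<Union>J0::nat. \<Inter>J\<in>{J0..}. E i J)"
  proof (intro equalityI subsetI IntI)
    fix q assume q: "q \<in> U'"
    then obtain e where e: "q \<in> seq_space s" "e > 0" "\<And>p. p \<in> seq_space s \<Longrightarrow> seq_dist s q p < e \<Longrightarrow> p \<in> U'"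
      using openin_sobolev_prod_preimage[OF U, of q] unfolding U'_def by auto
    show "q \<in> seq_space s" by (rule e)
    \<comment> \<open>Half of \<open>e\<close> is spent on the distance from \<open>q\<close> to its
      truncation and half on the ball around the truncation.\<close>
    obtain i where i: "1 / real (Suc i) < e / 2" using e(2) nat_approx_posE[of "e / 2"] by auto
    obtain J0 where J0: "\<And>J. J0 \<le> J \<Longrightarrow> seq_dist s (seq_truncate J q) q < e / 2"
      using seq_dist_truncate_tendsto[OF e(1), of "e / 2"] e(2) unfolding eventually_sequentially by auto
    have "q \<in> E i J" if J: "J0 \<le> J" for J
      unfolding E_def
    proof (intro CollectI ballI impI)
      fix u assume u: "u \<in> seq_space s" "seq_dist s (seq_truncate J q) u < 1 / real (Suc i)"
      have "seq_dist s q u \<le> seq_dist s q (seq_truncate J q) + seq_dist s (seq_truncate J q) u"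
        by (intro seq_dist_triangle seq_truncate_mem u e)
      also have "\<dots> < e" using J0[OF J] u(2) i by (simp add: seq_dist_commute[of s q])
      finally show "u \<in> U'" using e(3)[OF u(1)] by simp
    qed
    then show "q \<in> (\<Union>i::nat. \<Union>J0::nat. \<Inter>J\<in>{J0..}. E i J)" by blast
  next
    fix q assume "q \<in> seq_space s \<inter> (\<Union>i::nat. \<Union>J0::nat. \<Inter>J\<in>{J0..}. E i J)"
    then obtain i J0 where q: "q \<in> seq_space s" "\<And>J. J0 \<le> J \<Longrightarrow> q \<in> E i J" by blast
    obtain J1 where J1: "\<And>J. J1 \<le> J \<Longrightarrow> seq_dist s (seq_truncate J q) q < 1 / real (Suc i)"
      using seq_dist_truncate_tendsto[OF q(1), of "1 / real (Suc i)"] unfolding eventually_sequentially by auto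
    \<comment> \<open>Conversely \<open>q\<close> itself lies in the ball around a late truncation,
      so it can be taken for \<open>u\<close>.\<close>
    show "q \<in> U'"
      using q(2)[of "max J0 J1"] J1[of "max J0 J1"] q(1) unfolding E_def by simp
  qed
  have "seq_space s \<inter> (\<Union>i::nat. \<Union>J0::nat. \<Inter>J\<in>{J0..}. E i J) \<in> sets borel"
    by (intro sets.Int seq_space_borel sets.countable_UN sets.countable_INT' image_subsetI borel_closed E) auto
  then show ?thesis unfolding eq[symmetric] U'_def .
qed

text \<open>On a box with summable radii the tails are uniformly small, so coordinatewise
  convergence implies convergence in the Sobolev space, where \<open>f\<close> is
  continuous.\<close>

lemma continuous_on_box_sobolev:
  fixes f :: "(int \<Rightarrow> complex) \<times> (int \<Rightarrow> complex) \<Rightarrow> real"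
  assumes f: "continuous_map (sobolev_prod s) euclideanreal f"
    and \<rho>: "seq_sum_square s (\<lambda>m. complex_of_real (\<rho> m)) summable_on UNIV"
  shows "seq_box \<rho> \<subseteq> seq_space s" "continuous_on (seq_box \<rho>) (\<lambda>q. f (X_map q, Y_map q))"
proof -
  let ?g = "seq_sum_square s (\<lambda>m. complex_of_real (\<rho> m))"
  have mono: "seq_sum_square s p k \<le> seq_sum_square s q k" if "\<And>m. cmod (p m) \<le> cmod (q m)" for p q k
    unfolding seq_sum_square_def norm_X_map using that
    by (intro mult_right_mono power_mono divide_right_mono) (auto simp: less_imp_le[OF sobolev_weight_pos])
  have \<rho>0: "0 \<le> \<rho> m" if "q \<in> seq_box \<rho>" for q m
    using that norm_ge_zero[of "q m"] order_trans[of 0 "cmod (q m)" "\<rho> m"] unfolding seq_box_def by blast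
  show sub: "seq_box \<rho> \<subseteq> seq_space s"
  proof
    fix q assume q: "q \<in> seq_box \<rho>"
    have "seq_sum_square s q k \<le> ?g k" for k
      by (rule mono) (use q \<rho>0[OF q] in \<open>auto simp: seq_box_def\<close>)
    then show "q \<in> seq_space s"
      unfolding seq_space_def mem_Collect_eq
      by (intro summable_on_comparison_test[OF \<rho>]) (auto simp: seq_sum_square_nonneg)
  qed
  show "continuous_on (seq_box \<rho>) (\<lambda>q. f (X_map q, Y_map q))"
    unfolding continuous_on_topological
  proof (intro ballI allI impI)
    fix q B assume q: "q \<in> seq_box \<rho>" and B: "open B" "f (X_map q, Y_map q) \<in> B"
    define U where "U = {z \<in> topspace (sobolev_prod s). f z \<in> B}"
    have U: "openin (sobolev_prod s) U"
      unfolding U_def using f B(1) by (intro openin_continuous_map_preimage[OF f]) simp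
    have qs: "q \<in> seq_space s" using q sub by blast
    have "(X_map q, Y_map q) \<in> U"
      using B(2) qs by (simp add: U_def topspace_sobolev_topology map_mem_sobolev)
    then obtain e where e: "e > 0" "\<And>p. p \<in> seq_space s \<Longrightarrow> seq_dist s q p < e \<Longrightarrow> (X_map p, Y_map p) \<in> U"
      using openin_sobolev_prod_preimage[OF U] by blast
    \<comment> \<open>Two points of the box differ by at most \<open>2 * \<rho> m\<close> in each
      coordinate; squared, this gives the factor 4.\<close>
    have g4: "(\<lambda>k. 4 * ?g k) summable_on UNIV" by (rule summable_on_cmult_right[OF \<rho>])
    have e2: "0 < e\<^sup>2 / 2" using e(1) by simp
    have g40: "0 \<le> 4 * ?g k" for k by (simp add: seq_sum_square_nonneg)
    from infsum_int_tail[OF g4 g40 e2]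
    obtain J where J: "\<forall>h. (\<forall>k. 0 \<le> h k) \<longrightarrow> (\<forall>k. h k \<le> 4 * ?g k) \<longrightarrow>
        (\<Sum>\<^sub>\<infinity>k. h k) \<le> (\<Sum>k\<in>{- int J..int J}. h k) + e\<^sup>2 / 2" ..
    let ?T = "{p. (\<Sum>k\<in>{- int J..int J}. seq_sum_square s (\<lambda>m. p m - q m) k) < e\<^sup>2 / 2}"
    have "open ?T" by (intro open_Collect_less continuous_on_partial_sum continuous_on_const)
    moreover have "q \<in> ?T" using e by simp
    moreover have "f (X_map p, Y_map p) \<in> B" if p: "p \<in> seq_box \<rho>" "p \<in> ?T" for p
    proof -
      have le: "seq_sum_square s (\<lambda>m. p m - q m) k \<le> 4 * ?g k" for k
      proof -
        have "seq_sum_square s (\<lambda>m. p m - q m) k \<le> seq_sum_square s (\<lambda>m. 2 * complex_of_real (\<rho> m)) k"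
        proof (rule mono)
          fix m
          have "cmod (p m - q m) \<le> \<rho> m + \<rho> m"
            using p(1) q norm_triangle_ineq4[of "p m" "q m"] unfolding seq_box_def
            by (smt (verit) mem_Collect_eq)
          then show "cmod (p m - q m) \<le> cmod (2 * complex_of_real (\<rho> m))"
            using \<rho>0[OF q, of m] by (simp add: norm_mult)
        qed
        also have "\<dots> = 4 * ?g k"
          unfolding seq_sum_square_def norm_X_map by (simp add: norm_mult power_divide power_mult_distrib)
        finally show ?thesis .
      qed
      have "(\<Sum>\<^sub>\<infinity>k. seq_sum_square s (\<lambda>m. p m - q m) k) \<le> (\<Sum>k\<in>{- int J..int J}. seq_sum_square s (\<lambda>m. p m - q m) k) + e\<^sup>2 / 2"
        by (rule J[rule_format]) (rule seq_sum_square_nonneg le)+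
      also have "\<dots> < e\<^sup>2" using p(2) by simp
      finally have "seq_dist s p q < e"
        unfolding seq_dist_def using e(1) by (intro real_less_lsqrt) (auto intro!: infsum_nonneg seq_sum_square_nonneg)
      then have "(X_map p, Y_map p) \<in> U"
        using e(2)[of p] p(1) sub seq_dist_commute[of s p q] by auto
      then show ?thesis by (simp add: U_def)
    qed
    ultimately show "\<exists>A. open A \<and> q \<in> A \<and> (\<forall>p\<in>seq_box \<rho>. p \<in> A \<longrightarrow> f (X_map p, Y_map p) \<in> B)" by blast
  qed
qed

section \<open>A lower bound for triangular symmetric operators\<close>

text \<open>Along the line \<open>a + t * e\<close> the form is affine in \<open>t\<close>, since
  its quadratic coefficient \<open>B e e\<close> vanishes. A nonnegative affine function has slope
  0.\<close>

lemma psd_null_vector: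
  fixes B :: "'a \<Rightarrow> 'a \<Rightarrow> real"
  assumes fin: "finite A" and sym: "\<And>a b. a \<in> A \<Longrightarrow> b \<in> A \<Longrightarrow> B a b = B b a"
    and psd: "\<And>c. 0 \<le> (\<Sum>a\<in>A. \<Sum>b\<in>A. c a * c b * B a b)"
    and e: "e \<in> A" "B e e = 0" and a: "a \<in> A"
  shows "B a e = 0"
proof (cases "a = e")
  case False
  have two: "(\<Sum>x\<in>A. c x * f x) = c a * f a + c e * f e"
    if "\<And>x. x \<noteq> a \<Longrightarrow> x \<noteq> e \<Longrightarrow> c x = 0" for c f :: "'a \<Rightarrow> real"
  proof -
    have "(\<Sum>x\<in>A. c x * f x) = (\<Sum>x\<in>{a, e}. c x * f x)"
      using fin e a that by (intro sum.mono_neutral_right) auto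
    then show ?thesis using False by simp
  qed
  have ineq: "0 \<le> B a a + 2 * t * B a e" for t
  proof -
    define c where "c = (\<lambda>x. if x = a then 1 else if x = e then t else (0::real))"
    have "(\<Sum>x\<in>A. \<Sum>y\<in>A. c x * c y * B x y) = (\<Sum>x\<in>A. c x * (\<Sum>y\<in>A. c y * B x y))"
      by (simp add: sum_distrib_left mult.assoc)
    also have "\<dots> = (\<Sum>x\<in>A. c x * (B x a + t * B x e))"
      using False by (subst two[of c]) (auto simp: c_def)
    also have "\<dots> = (B a a + t * B a e) + t * (B e a + t * B e e)"
      using False by (subst two[of c]) (auto simp: c_def)
    also have "\<dots> = B a a + 2 * t * B a e"
      using sym[of e a] e a by simp
    finally show ?thesis using psd[of c] by simp
  qed
  show ?thesis
  proof (rule ccontr)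
    assume "B a e \<noteq> 0"
    then show False
      \<comment> \<open>At this \<open>t\<close> the affine function takes the value -1.\<close>
      using ineq[of "- (B a a + 1) / (2 * B a e)"] by (simp add: field_simps)
  qed
qed (use e in simp)

text \<open>
  Induction on the size of \<open>A\<close>: an element \<open>e\<close> of least rank is an eigenvector of \<open>D\<close>,
  and the compression of \<open>D\<close> to the orthogonal complement of \<open>e\<close> is again triangular and
  symmetric with respect to the Schur complement of the form.
\<close>

lemma triangular_symmetric_lower_bound:
  fixes D B :: "'a \<Rightarrow> 'a \<Rightarrow> real" and r :: "'a \<Rightarrow> nat"
  assumes "finite A"
    and "\<And>a b. a \<in> A \<Longrightarrow> b \<in> A \<Longrightarrow> B a b = B b a"
    and "\<And>c. 0 \<le> (\<Sum>a\<in>A. \<Sum>b\<in>A. c a * c b * B a b)"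
    and "\<And>a b. a \<in> A \<Longrightarrow> b \<in> A \<Longrightarrow> a \<noteq> b \<Longrightarrow> D a b \<noteq> 0 \<Longrightarrow> r b < r a"
    and "\<And>a. a \<in> A \<Longrightarrow> \<kappa> \<le> D a a"
    and "\<And>a b. a \<in> A \<Longrightarrow> b \<in> A \<Longrightarrow> (\<Sum>d\<in>A. D a d * B b d) = (\<Sum>d\<in>A. D b d * B a d)"
  shows "\<kappa> * (\<Sum>a\<in>A. \<Sum>b\<in>A. c a * c b * B a b)
    \<le> (\<Sum>a\<in>A. \<Sum>b\<in>A. c a * c b * (\<Sum>d\<in>A. D a d * B b d))"
  using assms
proof (induction "card A" arbitrary: A B c)
  case 0
  then show ?case by simp
next
  case (Suc k)
  note fin = Suc.prems(1) and sym = Suc.prems(2) and psd = Suc.prems(3) and tri = Suc.prems(4)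
    and diag = Suc.prems(5) and adj = Suc.prems(6)
  have "A \<noteq> {}" using Suc.hyps(2) by auto
  define e where "e = arg_min_on r A"
  have e: "e \<in> A" "\<And>b. b \<in> A \<Longrightarrow> r e \<le> r b"
    using arg_min_if_finite[OF fin \<open>A \<noteq> {}\<close>, of r] unfolding e_def by (auto simp: not_less)
  have De: "D e b = 0" if "b \<in> A" "b \<noteq> e" for b
    using tri[of e b] e that by (metis not_less)
  define A' where "A' = A - {e}"
  have A: "A = insert e A'" and eA': "e \<notin> A'" and fin': "finite A'"
    using e fin by (auto simp: A'_def)
  \<comment> \<open>The Schur complement. If \<open>B e e = 0\<close>, then \<open>e\<close> is a
    null vector and the quotient is 0, so \<open>B'\<close> is \<open>B\<close> and the formulas
    below stay valid without a case distinction.\<close>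
  define B' where "B' = (\<lambda>a b. B a b - B a e * B e b / B e e)"
  have null: "B a e = 0" if "B e e = 0" "a \<in> A" for a
    using psd_null_vector[OF fin sym psd e(1) that] .
  have null': "B e a = 0" if "B e e = 0" "a \<in> A" for a
    using null[OF that] sym[of e a] e that by simp
  have B'e: "B' a e = 0" "B' e a = 0" if "a \<in> A" for a
    using null[OF _ that] null'[OF _ that] by (cases "B e e = 0"; simp add: B'_def)+
  have Beq: "B a b = B' a b + B a e * B b e / B e e" if "a \<in> A" "b \<in> A" for a b
    using sym[of e b] e that by (simp add: B'_def)
  have Bee: "0 \<le> B e e"
  proof -
    define c where "c = (\<lambda>a. if a = e then 1 else (0::real))"
    have pick: "(\<Sum>x\<in>A. c x * f x) = f e" for f
    proof -
      have "(\<Sum>x\<in>A. c x * f x) = (\<Sum>x\<in>{e}. c x * f x)"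
        using fin e by (intro sum.mono_neutral_right) (auto simp: c_def)
      then show ?thesis by (simp add: c_def)
    qed
    have "(\<Sum>a\<in>A. \<Sum>b\<in>A. c a * c b * B a b) = (\<Sum>a\<in>A. c a * (\<Sum>b\<in>A. c b * B a b))"
      by (simp add: sum_distrib_left mult.assoc)
    then show ?thesis using psd[of c] unfolding pick by simp
  qed
  have sumB: "(\<Sum>a\<in>A. \<Sum>b\<in>A. c a * c b * B a b) =
      (\<Sum>a\<in>A'. \<Sum>b\<in>A'. c a * c b * B' a b) + (\<Sum>a\<in>A. c a * B a e)\<^sup>2 / B e e" for c
  proof -
    have "(\<Sum>a\<in>A. \<Sum>b\<in>A. c a * c b * B a b) =
      (\<Sum>a\<in>A. \<Sum>b\<in>A. c a * c b * B' a b + (c a * B a e) * (c b * B b e) / B e e)"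
      by (intro sum.cong refl) (simp add: Beq algebra_simps)
    also have "\<dots> = (\<Sum>a\<in>A. \<Sum>b\<in>A. c a * c b * B' a b) +
        (\<Sum>a\<in>A. \<Sum>b\<in>A. (c a * B a e) * (c b * B b e)) / B e e"
      by (simp add: sum.distrib sum_divide_distrib)
    also have "(\<Sum>a\<in>A. \<Sum>b\<in>A. (c a * B a e) * (c b * B b e)) = (\<Sum>a\<in>A. c a * B a e)\<^sup>2"
      by (simp add: power2_eq_square sum_product)
    also have "(\<Sum>a\<in>A. \<Sum>b\<in>A. c a * c b * B' a b) = (\<Sum>a\<in>A'. \<Sum>b\<in>A'. c a * c b * B' a b)"
      unfolding A using fin' eA' B'e A by simp
    finally show ?thesis .
  qed
  have eig: "(\<Sum>d\<in>A. D b d * B e d) = D e e * B b e" if "b \<in> A" for b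
  proof -
    have "(\<Sum>d\<in>A. D b d * B e d) = (\<Sum>d\<in>A. D e d * B b d)"
      using adj[OF e(1) that] by simp
    also have "\<dots> = (\<Sum>d\<in>{e}. D e d * B b d)"
      using fin e De by (intro sum.mono_neutral_right) auto
    finally show ?thesis by simp
  qed
  have DB: "(\<Sum>d\<in>A. D a d * B b d) =
      (\<Sum>d\<in>A'. D a d * B' b d) + D e e * (B a e * B b e) / B e e" if "a \<in> A" "b \<in> A" for a b
  proof -
    have "(\<Sum>d\<in>A. D a d * B b d) = (\<Sum>d\<in>A. D a d * B' b d + (D a d * B e d) * B b e / B e e)"
    proof (intro sum.cong refl)
      fix d assume "d \<in> A"
      then show "D a d * B b d = D a d * B' b d + (D a d * B e d) * B b e / B e e"
        using Beq[OF that(2), of d] sym[OF e(1), of d] by (simp add: algebra_simps)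
    qed
    also have "\<dots> = (\<Sum>d\<in>A. D a d * B' b d) + (\<Sum>d\<in>A. D a d * B e d) * B b e / B e e"
      by (simp add: sum.distrib sum_divide_distrib sum_distrib_right)
    also have "(\<Sum>d\<in>A. D a d * B' b d) = (\<Sum>d\<in>A'. D a d * B' b d)"
      unfolding A using fin' eA' B'e that by simp
    finally show ?thesis using eig[OF that(1)] by simp
  qed
  have DB0: "(\<Sum>d\<in>A'. D e d * B' b d) = 0" for b
    using De by (intro sum.neutral) (auto simp: A'_def)
  have DB1: "(\<Sum>d\<in>A'. D a d * B' e d) = 0" for a
    using B'e by (intro sum.neutral) (auto simp: A'_def)
  have IH: "\<kappa> * (\<Sum>a\<in>A'. \<Sum>b\<in>A'. c a * c b * B' a b)
    \<le> (\<Sum>a\<in>A'. \<Sum>b\<in>A'. c a * c b * (\<Sum>d\<in>A'. D a d * B' b d))"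
  proof (rule Suc.hyps(1))
    show "k = card A'" using Suc.hyps(2) fin e by (simp add: A'_def)
    show "B' a b = B' b a" if "a \<in> A'" "b \<in> A'" for a b
      using that e sym[of a b] sym[of a e] sym[of b e] by (simp add: B'_def A'_def)
    show "r b < r a" if "a \<in> A'" "b \<in> A'" "a \<noteq> b" "D a b \<noteq> 0" for a b
      using that tri by (auto simp: A'_def)
    show "\<kappa> \<le> D a a" if "a \<in> A'" for a using that diag by (auto simp: A'_def)
    show "(\<Sum>d\<in>A'. D a d * B' b d) = (\<Sum>d\<in>A'. D b d * B' a d)" if "a \<in> A'" "b \<in> A'" for a b
      using adj[of a b] DB[of a b] DB[of b a] that by (simp add: A mult.commute)
    show "0 \<le> (\<Sum>a\<in>A'. \<Sum>b\<in>A'. c a * c b * B' a b)" for c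
    proof -
      \<comment> \<open>The value at \<open>e\<close> makes the combination orthogonal to
        \<open>e\<close>; the square in \<open>sumB\<close> drops out and the Schur form inherits
        nonnegativity.\<close>
      define c' where "c' = c(e := - (\<Sum>a\<in>A'. c a * B a e) / B e e)"
      have eq: "(\<Sum>a\<in>A'. \<Sum>b\<in>A'. c' a * c' b * B' a b) = (\<Sum>a\<in>A'. \<Sum>b\<in>A'. c a * c b * B' a b)"
        using eA' by (intro sum.cong refl) (auto simp: c'_def)
      have "(\<Sum>a\<in>A'. c' a * B a e) = (\<Sum>a\<in>A'. c a * B a e)"
        using eA' by (intro sum.cong refl) (auto simp: c'_def)
      then have "(\<Sum>a\<in>A. c' a * B a e)\<^sup>2 / B e e = 0"
        using eA' fin' by (cases "B e e = 0") (simp_all add: A c'_def)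
      then show ?thesis using psd[of c'] sumB[of c'] eq by linarith
    qed
  qed (rule fin')
  have "(\<Sum>a\<in>A. \<Sum>b\<in>A. c a * c b * (\<Sum>d\<in>A. D a d * B b d)) =
      (\<Sum>a\<in>A. \<Sum>b\<in>A. c a * c b * (\<Sum>d\<in>A'. D a d * B' b d)
         + D e e * ((c a * B a e) * (c b * B b e)) / B e e)"
  proof (intro sum.cong refl)
    fix a b assume "a \<in> A" "b \<in> A"
    from DB[OF this] show "c a * c b * (\<Sum>d\<in>A. D a d * B b d) = c a * c b * (\<Sum>d\<in>A'. D a d * B' b d)
         + D e e * ((c a * B a e) * (c b * B b e)) / B e e"
      by (simp only: distrib_left) (simp add: mult_ac)
  qed
  also have "\<dots> = (\<Sum>a\<in>A. \<Sum>b\<in>A. c a * c b * (\<Sum>d\<in>A'. D a d * B' b d)) +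
     D e e * (\<Sum>a\<in>A. c a * B a e)\<^sup>2 / B e e"
    unfolding power2_eq_square sum_product sum.distrib
    by (simp add: sum_divide_distrib sum_distrib_left)
  also have "(\<Sum>a\<in>A. \<Sum>b\<in>A. c a * c b * (\<Sum>d\<in>A'. D a d * B' b d)) =
     (\<Sum>a\<in>A'. \<Sum>b\<in>A'. c a * c b * (\<Sum>d\<in>A'. D a d * B' b d))"
    using DB0 DB1 fin' eA' by (subst (1 2) A) simp
  finally have "(\<Sum>a\<in>A. \<Sum>b\<in>A. c a * c b * (\<Sum>d\<in>A. D a d * B b d)) =
     (\<Sum>a\<in>A'. \<Sum>b\<in>A'. c a * c b * (\<Sum>d\<in>A'. D a d * B' b d)) +
     D e e * (\<Sum>a\<in>A. c a * B a e)\<^sup>2 / B e e" .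
  \<comment> \<open>On the component along \<open>e\<close> the operator acts by the eigenvalue
    \<open>D e e\<close>, which is at least \<kappa>; the complement is covered by the induction
    hypothesis.\<close>
  moreover have "\<kappa> * (\<Sum>a\<in>A. c a * B a e)\<^sup>2 / B e e \<le> D e e * (\<Sum>a\<in>A. c a * B a e)\<^sup>2 / B e e"
    using diag[OF e(1)] Bee by (intro divide_right_mono mult_right_mono) auto
  ultimately show ?case
    using IH sumB[of c] by (simp add: algebra_simps)
qed

section \<open>The uniform probability measure on the torus\<close>

definition circle_measure :: "real measure" where
  "circle_measure = density lborel (\<lambda>t. ennreal (indicator {0..2 * pi} t / (2 * pi)))"

definition torus :: "nat \<Rightarrow> (nat \<Rightarrow> real) measure" where
  "torus n = Pi\<^sub>M {1..n} (\<lambda>_. circle_measure)"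

lemma sets_circle_measure [simp, measurable_cong]: "sets circle_measure = sets borel"
  by (simp add: circle_measure_def)

lemma space_circle_measure [simp]: "space circle_measure = UNIV"
  by (simp add: circle_measure_def)

lemma sets_torus [measurable_cong]: "sets (torus n) = sets (Pi\<^sub>M {1..n} (\<lambda>_. borel))"
  unfolding torus_def by (intro sets_PiM_cong) auto

lemma space_torus: "space (torus n) = extensional {1..n}"
  by (auto simp: torus_def space_PiM PiE_def)

lemma prob_space_circle_measure: "prob_space circle_measure"
proof
  have "emeasure circle_measure (space circle_measure)
      = (\<integral>\<^sup>+ t. ennreal (1 / (2 * pi)) * indicator {0..2 * pi} t \<partial>lborel)"
    by (auto simp: circle_measure_def emeasure_density intro!: nn_integral_cong split: split_indicator)
  also have "\<dots> = ennreal (1 / (2 * pi)) * ennreal (2 * pi)"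
    by (subst nn_integral_cmult_indicator) auto
  also have "\<dots> = 1"
    by (subst ennreal_mult[symmetric]) auto
  finally show "emeasure circle_measure (space circle_measure) = 1" .
qed

lemma prob_space_torus: "prob_space (torus n)"
  unfolding torus_def by (intro prob_space_PiM prob_space_circle_measure)

lemma integral_circle_measure:
  fixes f :: "real \<Rightarrow> complex"
  assumes "f \<in> borel_measurable borel"
  shows "(LINT t|circle_measure. f t) = (1 / (2 * pi)) *\<^sub>R (LINT t:{0..2 * pi}|lborel. f t)"
proof -
  have "(LINT t|circle_measure. f t) = (LINT t|lborel. (indicator {0..2 * pi} t / (2 * pi)) *\<^sub>R f t)"
    unfolding circle_measure_def using assms by (intro integral_density) auto
  also have "\<dots> = (LINT t|lborel. (1 / (2 * pi)) *\<^sub>R (indicator {0..2 * pi} t *\<^sub>R f t))"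
    by (intro Bochner_Integration.integral_cong) auto
  also have "\<dots> = (1 / (2 * pi)) *\<^sub>R (LINT t|lborel. indicator {0..2 * pi} t *\<^sub>R f t)"
    by (rule integral_scaleR_right)
  finally show ?thesis unfolding set_lebesgue_integral_def .
qed

lemma integrable_torus_bounded:
  fixes f :: "(nat \<Rightarrow> real) \<Rightarrow> 'a :: {banach, second_countable_topology}"
  assumes "f \<in> borel_measurable (torus n)" "\<And>x. norm (f x) \<le> B"
  shows "integrable (torus n) f"
proof -
  interpret prob_space "torus n" by (rule prob_space_torus)
  show ?thesis by (rule integrable_const_bound[where B=B]) (use assms in auto)
qed

lemma integral_torus_permute:
  fixes f :: "(nat \<Rightarrow> real) \<Rightarrow> 'a :: {banach, second_countable_topology}"
  assumes f: "f \<in> borel_measurable (torus n)" and p: "p permutes {1..n}"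
  shows "(LINT x|torus n. f (x \<circ> p)) = (LINT x|torus n. f x)"
proof -
  have "distr (torus n) (torus n) (\<lambda>x. \<lambda>i\<in>{1..n}. x (p i)) = torus n"
    unfolding torus_def
    by (rule distr_PiM_reindex[where M="\<lambda>_. circle_measure"])
       (use p permutes_in_image[OF p] prob_space_circle_measure in \<open>auto simp: permutes_inj_on simp del: atLeastAtMost_iff\<close>)
  then have "(LINT x|torus n. f x) = (LINT x|distr (torus n) (torus n) (\<lambda>x. \<lambda>i\<in>{1..n}. x (p i)). f x)"
    by simp
  also have "\<dots> = (LINT x|torus n. f (\<lambda>i\<in>{1..n}. x (p i)))"
  proof (rule integral_distr[OF _ f])
    show "(\<lambda>x. \<lambda>i\<in>{1..n}. x (p i)) \<in> torus n \<rightarrow>\<^sub>M torus n"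
      unfolding torus_def
      by (rule measurable_restrict, rule measurable_component_singleton)
         (use permutes_in_image[OF p] in \<open>simp del: atLeastAtMost_iff\<close>)
  qed
  also have "\<dots> = (LINT x|torus n. f (x \<circ> p))"
  proof (rule Bochner_Integration.integral_cong[OF refl])
    fix x assume "x \<in> space (torus n)"
    \<comment> \<open>Outside \<open>{1..n}\<close> the permutation is the identity and
      \<open>x\<close> is \<open>undefined\<close>, so the restriction changes nothing.\<close>
    then have "(\<lambda>i\<in>{1..n}. x (p i)) = x \<circ> p"
      using p by (auto simp: space_torus extensional_def restrict_def permutes_def)
    then show "f (\<lambda>i\<in>{1..n}. x (p i)) = f (x \<circ> p)" by simp
  qed
  finally show ?thesis ..
qed

section \<open>Integration by parts on the torus\<close>

text \<open>What integration by parts takes: bounded measurable partial derivatives, and equal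
  values at both ends of each period, so that boundary terms cancel. The derivatives
  \<open>F' j\<close> are carried along explicitly, which makes the closure lemmas below a calculus
  of derivatives.\<close>

definition smooth_torus :: "nat \<Rightarrow> ((nat \<Rightarrow> real) \<Rightarrow> complex) \<Rightarrow> (nat \<Rightarrow> (nat \<Rightarrow> real) \<Rightarrow> complex) \<Rightarrow> bool" where
  "smooth_torus n F F' \<longleftrightarrow> F \<in> borel_measurable (torus n) \<and> (\<forall>j\<in>{1..n}. F' j \<in> borel_measurable (torus n)) \<and>
     (\<exists>B. \<forall>x. cmod (F x) \<le> B \<and> (\<forall>j\<in>{1..n}. cmod (F' j x) \<le> B)) \<and>
     (\<forall>j\<in>{1..n}. \<forall>x t. ((\<lambda>t. F (x(j := t))) has_vector_derivative F' j (x(j := t))) (at t)) \<and>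
     (\<forall>j\<in>{1..n}. \<forall>x. F (x(j := 0)) = F (x(j := 2 * pi)))"

lemma smooth_torusI:
  assumes "F \<in> borel_measurable (torus n)" "\<And>j. j \<in> {1..n} \<Longrightarrow> F' j \<in> borel_measurable (torus n)"
    "\<And>x. cmod (F x) \<le> B" "\<And>j x. j \<in> {1..n} \<Longrightarrow> cmod (F' j x) \<le> C"
    "\<And>j x t. j \<in> {1..n} \<Longrightarrow> ((\<lambda>t. F (x(j := t))) has_vector_derivative F' j (x(j := t))) (at t)"
    "\<And>j x. j \<in> {1..n} \<Longrightarrow> F (x(j := 0)) = F (x(j := 2 * pi))"
  shows "smooth_torus n F F'"
proof -
  have "\<forall>x. cmod (F x) \<le> max B C \<and> (\<forall>j\<in>{1..n}. cmod (F' j x) \<le> max B C)"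
    using assms(3,4) by (meson max.coboundedI1 max.coboundedI2)
  then show ?thesis unfolding smooth_torus_def using assms by blast
qed

lemma smooth_torusD:
  assumes "smooth_torus n F F'"
  shows "F \<in> borel_measurable (torus n)" "j \<in> {1..n} \<Longrightarrow> F' j \<in> borel_measurable (torus n)"
    "j \<in> {1..n} \<Longrightarrow> ((\<lambda>t. F (x(j := t))) has_vector_derivative F' j (x(j := t))) (at t)"
    "j \<in> {1..n} \<Longrightarrow> F (x(j := 0)) = F (x(j := 2 * pi))"
    "\<exists>B\<ge>0. (\<forall>x. cmod (F x) \<le> B) \<and> (\<forall>j\<in>{1..n}. \<forall>x. cmod (F' j x) \<le> B)"
proof -
  show "\<exists>B\<ge>0. (\<forall>x. cmod (F x) \<le> B) \<and> (\<forall>j\<in>{1..n}. \<forall>x. cmod (F' j x) \<le> B)"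
  proof -
    obtain B where B: "\<And>x. cmod (F x) \<le> B" "\<And>x j. j \<in> {1..n} \<Longrightarrow> cmod (F' j x) \<le> B"
      using assms unfolding smooth_torus_def by blast
    have "B \<ge> 0" using B(1)[of undefined] norm_ge_zero order_trans by blast
    with B show ?thesis by blast
  qed
qed (use assms in \<open>auto simp: smooth_torus_def\<close>)

lemma smooth_torus_const: "smooth_torus n (\<lambda>_. c) (\<lambda>_ _. 0)"
  by (rule smooth_torusI[where B="cmod c" and C=0]) auto

lemma smooth_torus_add:
  assumes "smooth_torus n F F'" "smooth_torus n G G'"
  shows "smooth_torus n (\<lambda>x. F x + G x) (\<lambda>j x. F' j x + G' j x)"
proof -
  note F = smooth_torusD[OF assms(1)] and G = smooth_torusD[OF assms(2)]
  obtain A where A: "\<And>x. cmod (F x) \<le> A" "\<And>x j. j \<in> {1..n} \<Longrightarrow> cmod (F' j x) \<le> A" using F(5) by blast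
  obtain B where B: "\<And>x. cmod (G x) \<le> B" "\<And>x j. j \<in> {1..n} \<Longrightarrow> cmod (G' j x) \<le> B" using G(5) by blast
  show ?thesis
  proof (rule smooth_torusI[where B="A + B" and C="A + B"])
    show "cmod (F x + G x) \<le> A + B" for x using A(1) B(1) norm_triangle_mono by blast
    show "cmod (F' j x + G' j x) \<le> A + B" if "j \<in> {1..n}" for j x
      using A(2)[OF that] B(2)[OF that] norm_triangle_mono by blast
  qed (use F(1-4) G(1-4) in \<open>auto intro!: has_vector_derivative_add\<close>)
qed

lemma smooth_torus_mult:
  assumes "smooth_torus n F F'" "smooth_torus n G G'"
  shows "smooth_torus n (\<lambda>x. F x * G x) (\<lambda>j x. F x * G' j x + F' j x * G x)"
proof -
  note F = smooth_torusD[OF assms(1)] and G = smooth_torusD[OF assms(2)]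
  obtain A where A: "A \<ge> 0" "\<And>x. cmod (F x) \<le> A" "\<And>x j. j \<in> {1..n} \<Longrightarrow> cmod (F' j x) \<le> A" using F(5) by blast
  obtain B where B: "B \<ge> 0" "\<And>x. cmod (G x) \<le> B" "\<And>x j. j \<in> {1..n} \<Longrightarrow> cmod (G' j x) \<le> B" using G(5) by blast
  show ?thesis
  proof (rule smooth_torusI[where B="A * B" and C="A * B + A * B"])
    show "cmod (F x * G x) \<le> A * B" for x
      using A B by (simp add: norm_mult mult_mono)
    show "cmod (F x * G' j x + F' j x * G x) \<le> A * B + A * B" if "j \<in> {1..n}" for j x
      using A B that by (intro norm_triangle_mono) (simp_all add: norm_mult mult_mono)
    show "((\<lambda>t. F (x(j := t)) * G (x(j := t))) has_vector_derivative
        F (x(j := t)) * G' j (x(j := t)) + F' j (x(j := t)) * G (x(j := t))) (at t)" if "j \<in> {1..n}" for j x t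
      using F(3)[OF that] G(3)[OF that] by (rule has_vector_derivative_mult)
  qed (use F(1,2,4) G(1,2,4) in auto)
qed

lemma smooth_torus_cmult:
  assumes "smooth_torus n F F'"
  shows "smooth_torus n (\<lambda>x. c * F x) (\<lambda>j x. c * F' j x)"
  using smooth_torus_mult[OF smooth_torus_const[of n c] assms] by simp

lemma smooth_torus_sum:
  assumes "finite A" "\<And>i. i \<in> A \<Longrightarrow> smooth_torus n (F i) (F' i)"
  shows "smooth_torus n (\<lambda>x. \<Sum>i\<in>A. F i x) (\<lambda>j x. \<Sum>i\<in>A. F' i j x)"
  using assms
  by (induction A rule: finite_induct) (simp_all add: smooth_torus_add smooth_torus_const)

lemma smooth_torus_cnj:
  assumes "smooth_torus n F F'"
  shows "smooth_torus n (\<lambda>x. cnj (F x)) (\<lambda>j x. cnj (F' j x))"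
proof -
  note F = smooth_torusD[OF assms]
  obtain A where A: "\<And>x. cmod (F x) \<le> A" "\<And>x j. j \<in> {1..n} \<Longrightarrow> cmod (F' j x) \<le> A" using F(5) by blast
  have [measurable]: "cnj \<in> borel_measurable borel"
    by (intro borel_measurable_continuous_onI continuous_intros)
  show ?thesis
    by (rule smooth_torusI[where B=A and C=A])
       (use A F(1-4) in \<open>auto intro: has_vector_derivative_cnj\<close>)
qed

text \<open>With derivatives written as function times logarithmic derivative, a product stays in
  this shape and the logarithmic derivatives add up. Both the monomials and the regularized weight
  are treated this way.\<close>

lemma smooth_torus_log_derivative_prod:
  assumes "finite A" "\<And>i. i \<in> A \<Longrightarrow> smooth_torus n (F i) (\<lambda>j x. F i x * L i j x)"
  shows "smooth_torus n (\<lambda>x. \<Prod>i\<in>A. F i x) (\<lambda>j x. (\<Prod>i\<in>A. F i x) * (\<Sum>i\<in>A. L i j x))"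
  using assms
proof (induction A rule: finite_induct)
  case (insert i A)
  have "smooth_torus n (\<lambda>x. F i x * (\<Prod>i\<in>A. F i x)) (\<lambda>j x. F i x * ((\<Prod>i\<in>A. F i x) * (\<Sum>i\<in>A. L i j x)) +
      (F i x * L i j x) * (\<Prod>i\<in>A. F i x))"
    by (rule smooth_torus_mult) (use insert in auto)
  then show ?case using insert by (simp add: algebra_simps)
qed (simp add: smooth_torus_const)

lemma borel_measurable_cis [measurable]: "cis \<in> borel_measurable borel"
  by (intro borel_measurable_continuous_onI continuous_on_cis continuous_on_id)

lemma measurable_torus_component [measurable]:
  "k \<in> {1..n} \<Longrightarrow> (\<lambda>x. x k) \<in> borel_measurable (torus n)"
  unfolding torus_def using measurable_component_singleton[of k "{1..n}" "\<lambda>_. circle_measure"]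
  by (simp cong: measurable_cong_sets)

lemma smooth_torus_cis_power:
  assumes "k \<in> {1..n}"
  shows "smooth_torus n (\<lambda>x. cis (x k) ^ p) (\<lambda>j x. cis (x k) ^ p * (\<i> * of_nat p * of_bool (j = k)))"
proof (rule smooth_torusI[where B=1 and C="real p"])
  show "((\<lambda>t. cis ((x(j := t)) k) ^ p) has_vector_derivative
      cis ((x(j := t)) k) ^ p * (\<i> * of_nat p * of_bool (j = k))) (at t)" for j x t
  proof (cases "j = k")
    case True
    have "((\<lambda>t. cis (real p * t)) has_vector_derivative (real p) *\<^sub>R (\<i> * cis (real p * t))) (at t)"
      unfolding has_vector_derivative_def
      by (rule derivative_eq_intros refl)+ (simp add: mult.commute)
    moreover have "cis (real p * t) = cis t ^ p" for t
      by (simp add: Complex.DeMoivre)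
    ultimately show ?thesis using True by (simp only: fun_upd_same) (simp add: scaleR_conv_of_real mult_ac)
  qed auto
qed (use assms in \<open>auto simp: norm_power norm_mult cis_2pi\<close>)

text \<open>Fubini with the coordinate \<open>j\<close> innermost, then the fundamental theorem of
  calculus on one period.\<close>

lemma integral_torus_derivative:
  assumes F: "smooth_torus n F F'" and j: "j \<in> {1..n}"
  shows "(LINT x|torus n. F' j x) = 0"
proof -
  interpret P: product_prob_space "\<lambda>_. circle_measure" "{1..n}"
    by (rule product_prob_spaceI) (rule prob_space_circle_measure)
  note D = smooth_torusD[OF F]
  obtain B where B: "\<And>x. cmod (F' j x) \<le> B" using D(5) j by blast
  have ins: "{1..n} = insert j ({1..n} - {j})" using j by auto
  have int: "integrable (torus n) (F' j)"
    by (rule integrable_torus_bounded[OF D(2)[OF j] B])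
  have inner: "(LINT t|circle_measure. F' j (x(j := t))) = 0" if x: "x \<in> space (Pi\<^sub>M ({1..n} - {j}) (\<lambda>_. circle_measure))" for x
  proof -
    have meas: "(\<lambda>t. F' j (x(j := t))) \<in> borel_measurable borel"
    proof -
      have "(\<lambda>t. x(j := t)) \<in> circle_measure \<rightarrow>\<^sub>M torus n"
        unfolding torus_def by (subst ins, rule measurable_fun_upd[where J="{1..n} - {j}"]) (use x in auto)
      from measurable_compose[OF this D(2)[OF j]] show ?thesis
        by (simp cong: measurable_cong_sets)
    qed
    have "((\<lambda>t. F' j (x(j := t))) has_integral F (x(j := 2 * pi)) - F (x(j := 0))) {0..2 * pi}"
      by (rule fundamental_theorem_of_calculus) (simp, rule has_vector_derivative_at_within[OF D(3)[OF j]])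
    then have "integral {0..2 * pi} (\<lambda>t. F' j (x(j := t))) = 0"
      using D(4)[OF j, of x] by (simp add: integral_unique)
    moreover have "set_integrable lborel {0..2 * pi} (\<lambda>t. F' j (x(j := t)))"
      unfolding set_integrable_def
    proof (rule integrableI_bounded_set_indicator[where B=B])
    qed (use meas B in auto)
    ultimately have "(LINT t:{0..2 * pi}|lborel. F' j (x(j := t))) = 0"
      by (simp add: set_borel_integral_eq_integral)
    then show ?thesis by (simp add: integral_circle_measure[OF meas])
  qed
  have "(LINT x|torus n. F' j x) =
      (LINT x|Pi\<^sub>M ({1..n} - {j}) (\<lambda>_. circle_measure). LINT t|circle_measure. F' j (x(j := t)))"
    unfolding torus_def
    by (subst ins, rule P.product_integral_insert) (use int ins in \<open>auto simp: torus_def\<close>)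
  also have "\<dots> = (LINT x|Pi\<^sub>M ({1..n} - {j}) (\<lambda>_. circle_measure). 0)"
    by (rule Bochner_Integration.integral_cong[OF refl inner])
  finally show ?thesis by simp
qed

section \<open>Bounded measurable functions, monomials and permutations of the angles\<close>

definition bounded_measurable :: "nat \<Rightarrow> ((nat \<Rightarrow> real) \<Rightarrow> complex) \<Rightarrow> bool" where
  "bounded_measurable n f \<longleftrightarrow> f \<in> borel_measurable (torus n) \<and> (\<exists>B. \<forall>x. cmod (f x) \<le> B)"

lemma bounded_measurable_const: "bounded_measurable n (\<lambda>_. c)"
  by (auto simp: bounded_measurable_def)

lemma bounded_measurable_add:
  "bounded_measurable n f \<Longrightarrow> bounded_measurable n g \<Longrightarrow> bounded_measurable n (\<lambda>x. f x + g x)"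
  unfolding bounded_measurable_def by (auto intro!: borel_measurable_add) (metis norm_triangle_mono)

lemma bounded_measurable_mult:
  assumes "bounded_measurable n f" "bounded_measurable n g"
  shows "bounded_measurable n (\<lambda>x. f x * g x)"
proof -
  obtain B C where "\<And>x. cmod (f x) \<le> B" "\<And>x. cmod (g x) \<le> C"
    using assms unfolding bounded_measurable_def by blast
  then have "cmod (f x * g x) \<le> B * C" for x
    unfolding norm_mult by (meson mult_mono norm_ge_zero order_trans)
  then show ?thesis using assms by (auto simp: bounded_measurable_def intro: borel_measurable_times)
qed

lemma bounded_measurable_sum:
  "finite A \<Longrightarrow> (\<And>i. i \<in> A \<Longrightarrow> bounded_measurable n (f i)) \<Longrightarrow> bounded_measurable n (\<lambda>x. \<Sum>i\<in>A. f i x)"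
  by (induction A rule: finite_induct) (simp_all add: bounded_measurable_const bounded_measurable_add)

lemma bounded_measurable_cnj:
  assumes "bounded_measurable n f"
  shows "bounded_measurable n (\<lambda>x. cnj (f x))"
proof -
  have [measurable]: "cnj \<in> borel_measurable borel"
    by (intro borel_measurable_continuous_onI continuous_intros)
  show ?thesis using assms by (auto simp: bounded_measurable_def)
qed

lemma bounded_measurable_smooth:
  assumes "smooth_torus n F F'"
  shows "bounded_measurable n F" "j \<in> {1..n} \<Longrightarrow> bounded_measurable n (F' j)"
  using smooth_torusD(1,2,5)[OF assms] unfolding bounded_measurable_def by blast+

lemma integrable_bounded_measurable: "bounded_measurable n f \<Longrightarrow> integrable (torus n) f"
  unfolding bounded_measurable_def using integrable_torus_bounded by blast

definition monomial :: "nat \<Rightarrow> (nat \<Rightarrow> nat) \<Rightarrow> (nat \<Rightarrow> real) \<Rightarrow> complex" where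
  "monomial n a x = (\<Prod>j\<in>{1..n}. cis (x j) ^ a j)"

lemma norm_monomial: "cmod (monomial n a x) = 1"
  by (simp add: monomial_def norm_power flip: prod_norm)

lemma smooth_torus_monomial:
  "smooth_torus n (monomial n a) (\<lambda>j x. monomial n a x * (\<i> * of_nat (a j)) * of_bool (j \<in> {1..n}))"
proof -
  have "smooth_torus n (\<lambda>x. \<Prod>k\<in>{1..n}. cis (x k) ^ a k)
     (\<lambda>j x. (\<Prod>k\<in>{1..n}. cis (x k) ^ a k) * (\<Sum>k\<in>{1..n}. \<i> * of_nat (a k) * of_bool (j = k)))"
    by (rule smooth_torus_log_derivative_prod) (auto intro: smooth_torus_cis_power)
  moreover have "(\<Sum>k\<in>{1..n}. \<i> * of_nat (a k) * of_bool (j = k)) = \<i> * of_nat (a j) * of_bool (j \<in> {1..n})" for j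
    by (simp add: of_bool_def if_distrib[of "\<lambda>y. _ * y"] sum.delta' cong: if_cong)
  ultimately show ?thesis by (simp add: monomial_def[abs_def] mult.assoc)
qed

text \<open>Permuting the exponents amounts to permuting the angles by the inverse; involutions are
  their own inverses.\<close>

lemma monomial_comp_permute:
  assumes "p permutes {1..n}" "\<And>i. p (p i) = i"
  shows "monomial n (a \<circ> p) x = monomial n a (x \<circ> p)"
proof -
  have "(\<Prod>j\<in>{1..n}. cis (x j) ^ a (p j)) = (\<Prod>j\<in>{1..n}. (\<lambda>j. cis (x j) ^ a (p j)) (p j))"
    by (rule prod.permute[OF assms(1), unfolded comp_def])
  then show ?thesis by (simp add: monomial_def assms(2))
qed

definition symmetric_torus :: "nat \<Rightarrow> ((nat \<Rightarrow> real) \<Rightarrow> 'a) \<Rightarrow> bool" where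
  "symmetric_torus n F \<longleftrightarrow> (\<forall>p x. p permutes {1..n} \<longrightarrow> F (x \<circ> p) = F x)"

definition index_pairs :: "nat \<Rightarrow> (nat \<times> nat) set" where
  "index_pairs n = {(j, k). j \<in> {1..n} \<and> k \<in> {1..n} \<and> j < k}"

lemma finite_index_pairs [simp]: "finite (index_pairs n)"
  by (rule finite_subset[of _ "{1..n} \<times> {1..n}"]) (auto simp: index_pairs_def)

text \<open>A permutation acts on unordered pairs, which are coded as increasing ones;
  \<open>min\<close> and \<open>max\<close> put the image pair back in order, and the symmetry of
  \<open>h\<close> makes this harmless.\<close>

lemma prod_index_pairs_permute:
  fixes h :: "nat \<Rightarrow> nat \<Rightarrow> 'a :: comm_monoid_mult"
  assumes p: "p permutes {1..n}" and h: "\<And>j k. h j k = h k j"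
  shows "(\<Prod>(j, k)\<in>index_pairs n. h (p j) (p k)) = (\<Prod>(j, k)\<in>index_pairs n. h j k)"
proof (rule prod.reindex_bij_witness[where
      i="\<lambda>(j, k). (min (inv p j) (inv p k), max (inv p j) (inv p k))" and
      j="\<lambda>(j, k). (min (p j) (p k), max (p j) (p k))"])
  have inv: "inv p (p j) = j" "p (inv p j) = j" for j
    using permutes_inverses[OF p] by auto
  have in1: "p j \<in> {1..n} \<longleftrightarrow> j \<in> {1..n}" "inv p j \<in> {1..n} \<longleftrightarrow> j \<in> {1..n}" for j
    using permutes_in_image[OF p] permutes_in_image[OF permutes_inv[OF p]] by auto
  have inj: "p j = p k \<longleftrightarrow> j = k" "inv p j = inv p k \<longleftrightarrow> j = k" for j k
    using inv by metis+
  note [simp del] = atLeastAtMost_iff One_nat_def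
  fix a assume a: "a \<in> index_pairs n"
  then show "(\<lambda>(j, k). (min (inv p j) (inv p k), max (inv p j) (inv p k)))
      ((\<lambda>(j, k). (min (p j) (p k), max (p j) (p k))) a) = a"
    by (auto simp: index_pairs_def inv min_def max_def)
  show "(\<lambda>(j, k). (min (p j) (p k), max (p j) (p k))) a \<in> index_pairs n"
  proof -
    obtain j k where jk: "a = (j, k)" "j \<in> {1..n}" "k \<in> {1..n}" "j < k" using a by (auto simp: index_pairs_def)
    then have "p j \<noteq> p k" by (simp add: inj)
    then show ?thesis using jk by (cases rule: linorder_cases[of "p j" "p k"]) (simp_all add: index_pairs_def in1)
  qed
  show "(\<lambda>(j, k). (min (p j) (p k), max (p j) (p k)))
      ((\<lambda>(j, k). (min (inv p j) (inv p k), max (inv p j) (inv p k))) a) = a"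
    using a by (auto simp: index_pairs_def inv min_def max_def)
  show "(\<lambda>(j, k). (min (inv p j) (inv p k), max (inv p j) (inv p k))) a \<in> index_pairs n"
  proof -
    obtain j k where jk: "a = (j, k)" "j \<in> {1..n}" "k \<in> {1..n}" "j < k" using a by (auto simp: index_pairs_def)
    then have "inv p j \<noteq> inv p k" by (simp add: inj)
    then show ?thesis using jk by (cases rule: linorder_cases[of "inv p j" "inv p k"]) (simp_all add: index_pairs_def in1)
  qed
  show "(case (\<lambda>(j, k). (min (p j) (p k), max (p j) (p k))) a of (j, k) \<Rightarrow> h j k) =
      (case a of (j, k) \<Rightarrow> h (p j) (p k))"
    using h by (auto simp: min_def max_def split: prod.splits)
qed

lemma sum_index_pairs:
  fixes g :: "nat \<Rightarrow> nat \<Rightarrow> complex"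
  assumes "\<And>j k. g j k = g k j" "\<And>j. g j j = 0"
  shows "(\<Sum>j\<in>{1..n}. \<Sum>k\<in>{1..n}. g j k) = 2 * (\<Sum>(j, k)\<in>index_pairs n. g j k)"
proof -
  have "(\<Sum>j\<in>{1..n}. \<Sum>k\<in>{1..n}. g j k) = (\<Sum>(j, k)\<in>{1..n} \<times> {1..n}. g j k)"
    by (rule sum.cartesian_product)
  also have "\<dots> = (\<Sum>(j, k)\<in>index_pairs n \<union> prod.swap ` index_pairs n. g j k)"
  proof (rule sum.mono_neutral_right)
    show "\<forall>i\<in>{1..n} \<times> {1..n} - (index_pairs n \<union> prod.swap ` index_pairs n). (case i of (j, k) \<Rightarrow> g j k) = 0"
    proof (rule ballI)
      fix i assume i: "i \<in> {1..n} \<times> {1..n} - (index_pairs n \<union> prod.swap ` index_pairs n)"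
      obtain j k where ijk: "i = (j, k)" by (cases i)
      have jk: "j \<in> {1..n}" "k \<in> {1..n}" "(j, k) \<notin> index_pairs n \<union> prod.swap ` index_pairs n"
        using i by (simp_all add: ijk)
      have "\<not> j < k" using jk by (simp add: index_pairs_def)
      moreover have "\<not> k < j"
      proof
        assume "k < j"
        then have "(k, j) \<in> index_pairs n" using jk by (simp add: index_pairs_def)
        then have "prod.swap (k, j) \<in> prod.swap ` index_pairs n" by (rule imageI)
        then show False using jk by simp
      qed
      ultimately show "(case i of (j, k) \<Rightarrow> g j k) = 0" using assms(2) ijk by simp
    qed
    show "index_pairs n \<union> prod.swap ` index_pairs n \<subseteq> {1..n} \<times> {1..n}"
      by (auto simp: index_pairs_def)
  qed simp
  also have "\<dots> = (\<Sum>(j, k)\<in>index_pairs n. g j k) + (\<Sum>(j, k)\<in>prod.swap ` index_pairs n. g j k)"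
    by (rule sum.union_disjoint, simp, simp) (auto simp: index_pairs_def)
  also have "(\<Sum>(j, k)\<in>prod.swap ` index_pairs n. g j k) = (\<Sum>(j, k)\<in>index_pairs n. g j k)"
    by (subst sum.reindex) (auto simp: inj_on_def assms(1) split: prod.splits intro!: sum.cong)
  finally show ?thesis by simp
qed

section \<open>The regularized weight\<close>

text \<open>For \<open>t\<close> the difference of two angles this is the squared chord length
  between the two points of the circle, plus \<epsilon>.\<close>

definition reg_dist :: "real \<Rightarrow> real \<Rightarrow> real" where
  "reg_dist \<epsilon> t = 2 - 2 * cos t + \<epsilon>"

text \<open>
  For \<open>\<epsilon> = 0\<close> this is the density of the ensemble up to a constant; for \<open>\<epsilon> > 0\<close> it is smooth
  also where angles coincide, which is what integration by parts needs when \<open>\<beta>\<close> is small.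
\<close>

definition reg_weight :: "nat \<Rightarrow> real \<Rightarrow> real \<Rightarrow> (nat \<Rightarrow> real) \<Rightarrow> real" where
  "reg_weight n \<beta> \<epsilon> x = (\<Prod>(j, k)\<in>index_pairs n. reg_dist \<epsilon> (x j - x k) powr (\<beta> / 2))"

text \<open>Half the logarithmic derivative of \<open>reg_dist\<close>. For \<epsilon> = 0 it is
  half the cotangent of \<open>t / 2\<close>.\<close>

definition reg_cot :: "real \<Rightarrow> real \<Rightarrow> real" where
  "reg_cot \<epsilon> t = sin t / reg_dist \<epsilon> t"

lemma reg_dist_bounds: "\<epsilon> \<le> reg_dist \<epsilon> t" "reg_dist \<epsilon> t \<le> 4 + \<epsilon>"
  using cos_le_one[of t] cos_ge_minus_one[of t] unfolding reg_dist_def by linarith+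

lemma reg_dist_minus: "reg_dist \<epsilon> (- t) = reg_dist \<epsilon> t"
  by (simp add: reg_dist_def)

lemma reg_cot_minus: "reg_cot \<epsilon> (- t) = - reg_cot \<epsilon> t"
  by (simp add: reg_cot_def reg_dist_minus)

lemma reg_weight_nonneg: "0 \<le> reg_weight n \<beta> \<epsilon> x"
  unfolding reg_weight_def by (intro prod_nonneg) auto

lemma reg_weight_permute:
  assumes "p permutes {1..n}"
  shows "reg_weight n \<beta> \<epsilon> (x \<circ> p) = reg_weight n \<beta> \<epsilon> x"
  unfolding reg_weight_def comp_def
proof (rule prod_index_pairs_permute[OF assms, of "\<lambda>j k. reg_dist \<epsilon> (x j - x k) powr (\<beta> / 2)"])
  show "reg_dist \<epsilon> (x j - x k) powr (\<beta> / 2) = reg_dist \<epsilon> (x k - x j) powr (\<beta> / 2)" for j k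
    using reg_dist_minus[of \<epsilon> "x j - x k"] by simp
qed

lemma measurable_reg_weight [measurable]: "reg_weight n \<beta> \<epsilon> \<in> borel_measurable (torus n)"
  unfolding reg_weight_def[abs_def] split_def
proof (rule borel_measurable_prod)
  fix p assume "p \<in> index_pairs n"
  then have [measurable]: "(\<lambda>x. x (fst p)) \<in> borel_measurable (torus n)" "(\<lambda>x. x (snd p)) \<in> borel_measurable (torus n)"
    by (auto simp: index_pairs_def)
  show "(\<lambda>x. reg_dist \<epsilon> (x (fst p) - x (snd p)) powr (\<beta> / 2)) \<in> borel_measurable (torus n)"
    unfolding reg_dist_def by measurable
qed

lemma reg_weight_le:
  assumes "0 \<le> \<epsilon>" "\<epsilon> \<le> 1" "\<beta> > 0"
  shows "reg_weight n \<beta> \<epsilon> x \<le> (5 powr (\<beta> / 2)) ^ card (index_pairs n)"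
proof -
  have "reg_weight n \<beta> \<epsilon> x \<le> (\<Prod>(j, k)\<in>index_pairs n. 5 powr (\<beta> / 2))"
    unfolding reg_weight_def
  proof (intro prod_mono, clarify)
    fix j k
    have "0 \<le> reg_dist \<epsilon> (x j - x k)" "reg_dist \<epsilon> (x j - x k) \<le> 5"
      using reg_dist_bounds[of \<epsilon> "x j - x k"] assms by auto
    then show "0 \<le> reg_dist \<epsilon> (x j - x k) powr (\<beta> / 2) \<and> reg_dist \<epsilon> (x j - x k) powr (\<beta> / 2) \<le> 5 powr (\<beta> / 2)"
      using assms by (auto intro: powr_mono2)
  qed
  then show ?thesis by (simp add: split_def)
qed

lemma bounded_measurable_reg_weight:
  assumes "0 \<le> \<epsilon>" "\<epsilon> \<le> 1" "\<beta> > 0"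
  shows "bounded_measurable n (\<lambda>x. complex_of_real (reg_weight n \<beta> \<epsilon> x))"
  unfolding bounded_measurable_def
  using reg_weight_le[OF assms] reg_weight_nonneg
  by (auto intro!: exI[of _ "(5 powr (\<beta> / 2)) ^ card (index_pairs n)"])

lemma tendsto_reg_weight:
  assumes "\<beta> > 0" and e: "e \<longlonglongrightarrow> 0" "\<And>i. e i \<ge> 0"
  shows "(\<lambda>i::nat. reg_weight n \<beta> (e i) x) \<longlonglongrightarrow> reg_weight n \<beta> 0 x"
  unfolding reg_weight_def split_def
proof (intro tendsto_prod tendsto_powr')
  fix p
  show "(\<lambda>i. reg_dist (e i) (x (fst p) - x (snd p))) \<longlonglongrightarrow> reg_dist 0 (x (fst p) - x (snd p))"
    unfolding reg_dist_def by (intro tendsto_intros e)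
  show "reg_dist 0 (x (fst p) - x (snd p)) \<noteq> 0 \<or>
      0 < \<beta> / 2 \<and> (\<forall>\<^sub>F i in sequentially. 0 \<le> reg_dist (e i) (x (fst p) - x (snd p)))"
    using assms(1) reg_dist_bounds(1) e(2) by (auto intro!: always_eventually order_trans[OF e(2)])
qed auto

lemma measurable_reg_cot_diff [measurable]:
  assumes "k \<in> {1..n}" "l \<in> {1..n}"
  shows "(\<lambda>x. reg_cot \<epsilon> (x k - x l)) \<in> borel_measurable (torus n)"
proof -
  have [measurable]: "(\<lambda>x. x k) \<in> borel_measurable (torus n)" "(\<lambda>x. x l) \<in> borel_measurable (torus n)"
    using assms by auto
  show ?thesis unfolding reg_cot_def reg_dist_def by measurable
qed

lemma abs_sin_le_reg_dist: "\<bar>sin t\<bar> \<le> sqrt (reg_dist 0 t)"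
proof (rule real_le_rsqrt)
  have "\<bar>sin t\<bar>\<^sup>2 = (1 + cos t) * (1 - cos t)"
    by (simp add: sin_squared_eq algebra_simps) (simp add: power2_eq_square)
  also have "\<dots> \<le> 2 * (1 - cos t)"
    using cos_le_one[of t] by (intro mult_right_mono) auto
  finally show "\<bar>sin t\<bar>\<^sup>2 \<le> reg_dist 0 t"
    by (simp add: reg_dist_def)
qed

lemma norm_cis_diff_eq: "cmod (cis s - cis t) = sqrt (reg_dist 0 (s - t))"
proof -
  have "(cos s - cos t)\<^sup>2 + (sin s - sin t)\<^sup>2 = reg_dist 0 (s - t)"
    using sin_cos_squared_add3[of s] sin_cos_squared_add3[of t]
    unfolding reg_dist_def cos_diff power2_eq_square by (simp add: algebra_simps)
  then show ?thesis by (simp add: cmod_def)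
qed

text \<open>The sine is at most the chord length, and the square of the chord length is at most the
  denominator of \<open>reg_cot\<close>. The bound is uniform in \<epsilon>: one factor of chord
  length pays for the singularity.\<close>

lemma abs_reg_cot_mult_le:
  assumes "\<epsilon> \<ge> 0"
  shows "\<bar>reg_cot \<epsilon> (s - t)\<bar> * cmod (cis s - cis t) \<le> 1"
proof (cases "reg_dist 0 (s - t) = 0")
  case False
  then have pos: "reg_dist 0 (s - t) > 0" using reg_dist_bounds(1)[of 0 "s - t"] by simp
  have "\<bar>sin (s - t)\<bar> * sqrt (reg_dist 0 (s - t)) \<le> reg_dist 0 (s - t)"
    using mult_right_mono[OF abs_sin_le_reg_dist[of "s - t"], of "sqrt (reg_dist 0 (s - t))"] pos by simp
  also have "\<dots> \<le> reg_dist \<epsilon> (s - t)" using assms by (simp add: reg_dist_def)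
  finally show ?thesis using pos \<open>reg_dist 0 (s - t) \<le> reg_dist \<epsilon> (s - t)\<close>
    by (simp add: reg_cot_def norm_cis_diff_eq divide_le_eq)
qed (simp add: norm_cis_diff_eq)

lemma tendsto_reg_cot:
  assumes "e \<longlonglongrightarrow> 0"
  shows "(\<lambda>i::nat. reg_cot (e i) t) \<longlonglongrightarrow> reg_cot 0 t"
proof (cases "reg_dist 0 t = 0")
  case True
  \<comment> \<open>At coinciding angles all numerators vanish, and the limit is the quotient 0 by
    0, which is 0 too.\<close>
  then have "sin t = 0" using abs_sin_le_reg_dist[of t] by simp
  then show ?thesis by (simp add: reg_cot_def)
next
  case False
  then show ?thesis
    unfolding reg_cot_def using assms
    by (intro tendsto_divide) (auto simp: reg_dist_def intro!: tendsto_eq_intros)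
qed

text \<open>The derivative is stated as function times logarithmic derivative, the shape that
  \<open>smooth_torus_log_derivative_prod\<close> expects; \<epsilon> > 0 keeps the base of the
  power away from 0.\<close>

lemma smooth_torus_reg_factor:
  assumes kl: "k \<in> {1..n}" "l \<in> {1..n}" "k \<noteq> l" and e: "\<epsilon> > 0" and b: "\<beta> > 0"
  shows "smooth_torus n (\<lambda>x. complex_of_real (reg_dist \<epsilon> (x k - x l) powr (\<beta> / 2)))
    (\<lambda>j x. complex_of_real (reg_dist \<epsilon> (x k - x l) powr (\<beta> / 2)) *
       complex_of_real (\<beta> * reg_cot \<epsilon> (x k - x l) * (of_bool (j = k) - of_bool (j = l))))"
proof (rule smooth_torusI[where B="(4 + \<epsilon>) powr (\<beta> / 2)" and C="(4 + \<epsilon>) powr (\<beta> / 2) * (\<beta> * (1 / \<epsilon>) * 1)"])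
  have [measurable]: "(\<lambda>x. x k) \<in> borel_measurable (torus n)" "(\<lambda>x. x l) \<in> borel_measurable (torus n)"
    using kl by auto
  have pos: "reg_dist \<epsilon> t > 0" for t using reg_dist_bounds(1)[of \<epsilon> t] e by simp
  have le: "reg_dist \<epsilon> t powr (\<beta> / 2) \<le> (4 + \<epsilon>) powr (\<beta> / 2)" for t
    using reg_dist_bounds(2)[of \<epsilon> t] pos[of t] b by (intro powr_mono2) auto
  have cot: "\<bar>reg_cot \<epsilon> t\<bar> \<le> 1 / \<epsilon>" for t
    unfolding reg_cot_def abs_divide using pos[of t] reg_dist_bounds(1)[of \<epsilon> t] e
    by (intro frac_le) auto
  show "cmod (complex_of_real (reg_dist \<epsilon> (x k - x l) powr (\<beta> / 2))) \<le> (4 + \<epsilon>) powr (\<beta> / 2)" for x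
    using le by simp
  show "cmod (complex_of_real (reg_dist \<epsilon> (x k - x l) powr (\<beta> / 2)) *
       complex_of_real (\<beta> * reg_cot \<epsilon> (x k - x l) * (of_bool (j = k) - of_bool (j = l))))
      \<le> (4 + \<epsilon>) powr (\<beta> / 2) * (\<beta> * (1 / \<epsilon>) * 1)" for j x
    unfolding norm_mult norm_of_real abs_mult
    using le cot b e by (intro mult_mono) (auto simp: of_bool_def)
  show "((\<lambda>t. complex_of_real (reg_dist \<epsilon> ((x(j := t)) k - (x(j := t)) l) powr (\<beta> / 2))) has_vector_derivative
     complex_of_real (reg_dist \<epsilon> ((x(j := t)) k - (x(j := t)) l) powr (\<beta> / 2)) *
     complex_of_real (\<beta> * reg_cot \<epsilon> ((x(j := t)) k - (x(j := t)) l) * (of_bool (j = k) - of_bool (j = l)))) (at t)"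
    for j x t
  proof -
    define u where "u = (\<lambda>t. (x(j := t)) k - (x(j := t)) l)"
    have u: "(u has_real_derivative (of_bool (j = k) - of_bool (j = l))) (at t)"
      using kl(3) unfolding u_def
      by (cases "j = k"; cases "j = l") (auto intro!: derivative_eq_intros)
    have d: "((\<lambda>t. reg_dist \<epsilon> (u t)) has_real_derivative 2 * sin (u t) * (of_bool (j = k) - of_bool (j = l))) (at t)"
      unfolding reg_dist_def using u by (auto intro!: derivative_eq_intros)
    have "((\<lambda>t. reg_dist \<epsilon> (u t) powr (\<beta> / 2)) has_real_derivative
      \<beta> / 2 * reg_dist \<epsilon> (u t) powr (\<beta> / 2 - of_nat 1) * (2 * sin (u t) * (of_bool (j = k) - of_bool (j = l)))) (at t)"
      using d pos by (rule DERIV_fun_powr)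
    also have "\<beta> / 2 * reg_dist \<epsilon> (u t) powr (\<beta> / 2 - of_nat 1) * (2 * sin (u t) * (of_bool (j = k) - of_bool (j = l)))
       = reg_dist \<epsilon> (u t) powr (\<beta> / 2) * (\<beta> * reg_cot \<epsilon> (u t) * (of_bool (j = k) - of_bool (j = l)))"
      using pos[of "u t"] by (simp add: powr_diff reg_cot_def)
    finally have "((\<lambda>t. reg_dist \<epsilon> (u t) powr (\<beta> / 2)) has_real_derivative
        reg_dist \<epsilon> (u t) powr (\<beta> / 2) * (\<beta> * reg_cot \<epsilon> (u t) * (of_bool (j = k) - of_bool (j = l)))) (at t)" .
    from has_vector_derivative_of_real[OF this] show ?thesis
      unfolding u_def of_real_mult[symmetric] .
  qed
  show "complex_of_real (reg_dist \<epsilon> ((x(j := 0)) k - (x(j := 0)) l) powr (\<beta> / 2)) =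
      complex_of_real (reg_dist \<epsilon> ((x(j := 2 * pi)) k - (x(j := 2 * pi)) l) powr (\<beta> / 2))" for j x
    using kl(3) cos_periodic[of "- x l"]  by (auto simp: reg_dist_def cos_diff sin_diff)
qed (use kl in \<open>auto simp: reg_dist_def\<close>)

lemma bounded_measurable_monomial: "bounded_measurable n (monomial n a)"
  by (rule bounded_measurable_smooth[OF smooth_torus_monomial])

lemma smooth_torus_reg_weight:
  assumes "\<epsilon> > 0" "\<beta> > 0"
  shows "smooth_torus n (\<lambda>x. complex_of_real (reg_weight n \<beta> \<epsilon> x))
    (\<lambda>j x. complex_of_real (reg_weight n \<beta> \<epsilon> x) * (\<Sum>(k, l)\<in>index_pairs n.
       complex_of_real (\<beta> * reg_cot \<epsilon> (x k - x l) * (of_bool (j = k) - of_bool (j = l)))))"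
  unfolding reg_weight_def of_real_prod split_def
  by (rule smooth_torus_log_derivative_prod[OF finite_index_pairs], rule smooth_torus_reg_factor)
     (use assms in \<open>auto simp: index_pairs_def\<close>)

lemma bounded_measurable_reg_cot:
  assumes "k \<in> {1..n}" "l \<in> {1..n}" "\<epsilon> > 0"
  shows "bounded_measurable n (\<lambda>x. complex_of_real (reg_cot \<epsilon> (x k - x l)))"
proof -
  have "\<bar>reg_cot \<epsilon> t\<bar> \<le> 1 / \<epsilon>" for t
    unfolding reg_cot_def abs_divide using reg_dist_bounds(1)[of \<epsilon> t] assms
    by (intro frac_le) auto
  then show ?thesis
    using measurable_reg_cot_diff[OF assms(1,2), of \<epsilon>]
    by (auto simp: bounded_measurable_def intro!: exI[of _ "1 / \<epsilon>"])
qed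

lemma transpose_permutes:
  "k \<in> {1..n} \<Longrightarrow> l \<in> {1..n} \<Longrightarrow> Transposition.transpose k l permutes {1..n::nat}"
  by (rule permutes_swap_id)

text \<open>Exchanging the angles \<open>k\<close> and \<open>l\<close> preserves \<open>F\<close>
  and the weight, flips the sign of the cotangent and transposes the exponents. Averaging both forms
  puts next to the cotangent a difference that vanishes where the angles coincide, so the limit
  \<epsilon> -> 0 becomes accessible.\<close>

lemma integral_swap_antisymmetric:
  assumes kl: "k \<in> {1..n}" "l \<in> {1..n}" and F: "symmetric_torus n F" "bounded_measurable n F"
    and e: "\<epsilon> > 0" "\<epsilon> \<le> 1" and b: "\<beta> > 0"
  shows "2 * (LINT x|torus n. F x * monomial n a x * reg_cot \<epsilon> (x k - x l) * reg_weight n \<beta> \<epsilon> x)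
    = (LINT x|torus n. F x * (monomial n a x - monomial n (a \<circ> Transposition.transpose k l) x) *
        reg_cot \<epsilon> (x k - x l) * reg_weight n \<beta> \<epsilon> x)"
proof -
  let ?t = "Transposition.transpose k l"
  let ?f = "\<lambda>a x. F x * monomial n a x * complex_of_real (reg_cot \<epsilon> (x k - x l)) * complex_of_real (reg_weight n \<beta> \<epsilon> x)"
  have bm: "bounded_measurable n (?f a)" for a
    using kl F(2) e b by (intro bounded_measurable_mult bounded_measurable_monomial
      bounded_measurable_reg_cot bounded_measurable_reg_weight) auto
  have t: "?t permutes {1..n}" using kl by (rule transpose_permutes)
  have "(LINT x|torus n. ?f a x) = (LINT x|torus n. ?f a (x \<circ> ?t))"
    by (rule integral_torus_permute[OF _ t, symmetric]) (use bm in \<open>auto simp: bounded_measurable_def\<close>)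
  also have "\<dots> = (LINT x|torus n. - ?f (a \<circ> ?t) x)"
  proof (rule Bochner_Integration.integral_cong[OF refl])
    fix x
    have "F (x \<circ> ?t) = F x" using F(1) t unfolding symmetric_torus_def by blast
    moreover have "monomial n (a \<circ> ?t) x = monomial n a (x \<circ> ?t)"
      by (rule monomial_comp_permute[OF t]) simp
    moreover have "reg_cot \<epsilon> ((x \<circ> ?t) k - (x \<circ> ?t) l) = - reg_cot \<epsilon> (x k - x l)"
      using reg_cot_minus[of \<epsilon> "x k - x l"] by simp
    ultimately show "?f a (x \<circ> ?t) = - ?f (a \<circ> ?t) x"
      by (simp add: reg_weight_permute[OF t])
  qed
  finally have eq: "(LINT x|torus n. ?f a x) = - (LINT x|torus n. ?f (a \<circ> ?t) x)" by simp
  have "(LINT x|torus n. ?f a x - ?f (a \<circ> ?t) x) = (LINT x|torus n. ?f a x) - (LINT x|torus n. ?f (a \<circ> ?t) x)"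
    using bm by (intro Bochner_Integration.integral_diff integrable_bounded_measurable)
  with eq have "2 * (LINT x|torus n. ?f a x) = (LINT x|torus n. ?f a x - ?f (a \<circ> ?t) x)" by simp
  then show ?thesis by (simp add: algebra_simps)
qed

text \<open>Green's formula: the divergence of \<open>F\<close> times the weight times the gradient
  of the monomial integrates to 0. The derivative of the monomial in angle \<open>j\<close> is
  \<open>\<i> * a j\<close> times the monomial, which explains these factors.\<close>

lemma reg_loop_equation:
  assumes F: "smooth_torus n F F'" "symmetric_torus n F" and e: "\<epsilon> > 0" "\<epsilon> \<le> 1" and b: "\<beta> > 0"
  shows "(LINT x|torus n. (\<Sum>j\<in>{1..n}. F' j x * (\<i> * of_nat (a j))) * monomial n a x * reg_weight n \<beta> \<epsilon> x) =
    (LINT x|torus n. F x * of_nat (\<Sum>j\<in>{1..n}. (a j)\<^sup>2) * monomial n a x * reg_weight n \<beta> \<epsilon> x) -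
    (\<Sum>(k, l)\<in>index_pairs n. \<i> * of_real \<beta> / 2 * (of_nat (a k) - of_nat (a l)) *
      (LINT x|torus n. F x * (monomial n a x - monomial n (a \<circ> Transposition.transpose k l) x) *
        reg_cot \<epsilon> (x k - x l) * reg_weight n \<beta> \<epsilon> x))"
proof -
  let ?m = "monomial n a"
  let ?w = "\<lambda>x. complex_of_real (reg_weight n \<beta> \<epsilon> x)"
  let ?L = "\<lambda>j x. \<Sum>(k, l)\<in>index_pairs n. complex_of_real (\<beta> * reg_cot \<epsilon> (x k - x l) * (of_bool (j = k) - of_bool (j = l)))"
  define G' where "G' = (\<lambda>j x. (F x * ?m x) * (?w x * ?L j x) +
    (F x * (?m x * (\<i> * of_nat (a j)) * of_bool (j \<in> {1..n})) + F' j x * ?m x) * ?w x)"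
  have G: "smooth_torus n (\<lambda>x. (F x * ?m x) * ?w x) G'"
    unfolding G'_def
    by (intro smooth_torus_mult F smooth_torus_monomial smooth_torus_reg_weight e b)
  \<comment> \<open>\<open>A\<close>, \<open>B\<close> and \<open>C\<close> collect the derivatives
    that fall on \<open>F\<close>, on the monomial and on the weight.\<close>
  define A where "A = (\<lambda>x. (\<Sum>j\<in>{1..n}. F' j x * (\<i> * of_nat (a j))) * ?m x * ?w x)"
  define B where "B = (\<lambda>x. F x * of_nat (\<Sum>j\<in>{1..n}. (a j)\<^sup>2) * ?m x * ?w x)"
  define C where "C = (\<lambda>(k, l) x. \<i> * of_real \<beta> * (of_nat (a k) - of_nat (a l)) *
    (F x * ?m x * complex_of_real (reg_cot \<epsilon> (x k - x l)) * ?w x))"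
  have Fb: "bounded_measurable n F" by (rule bounded_measurable_smooth[OF F(1)])
  have w: "bounded_measurable n ?w" using e b by (intro bounded_measurable_reg_weight) auto
  have bA: "bounded_measurable n A"
    unfolding A_def by (intro bounded_measurable_mult bounded_measurable_sum bounded_measurable_const
      bounded_measurable_monomial w bounded_measurable_smooth(2)[OF F(1)]) auto
  have bB: "bounded_measurable n B"
    unfolding B_def by (intro bounded_measurable_mult Fb bounded_measurable_const
      bounded_measurable_monomial w)
  have bC: "bounded_measurable n (C p)" if p: "p \<in> index_pairs n" for p
  proof -
    have "fst p \<in> {1..n}" "snd p \<in> {1..n}" using p by (auto simp: index_pairs_def)
    then show ?thesis
      unfolding C_def split_def using e
      by (intro bounded_measurable_mult Fb bounded_measurable_const
        bounded_measurable_monomial w bounded_measurable_reg_cot) auto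
  qed
  have bG: "bounded_measurable n (G' j)" if "j \<in> {1..n}" for j
    using bounded_measurable_smooth(2)[OF G that] .
  have point: "(\<Sum>j\<in>{1..n}. (\<i> * of_nat (a j)) * G' j x) = A x - B x + (\<Sum>p\<in>index_pairs n. C p x)" for x
  proof -
    have "(\<Sum>j\<in>{1..n}. (\<i> * of_nat (a j)) * G' j x) =
       (\<Sum>j\<in>{1..n}. F' j x * (\<i> * of_nat (a j)) * ?m x * ?w x
         - F x * of_nat ((a j)\<^sup>2) * ?m x * ?w x + (F x * ?m x * ?w x) * (\<i> * of_nat (a j) * ?L j x))"
    proof (rule sum.cong[OF refl])
      fix j assume "j \<in> {1..n}"
      then have "of_bool (j \<in> {1..n}) = (1 :: complex)" by simp
      moreover have "\<i> * of_nat (a j) * (\<i> * of_nat (a j)) = - complex_of_nat ((a j)\<^sup>2)"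
        unfolding power2_eq_square of_nat_mult
        by (metis (no_types) i_squared mult.assoc mult.left_commute mult_minus1)
      ultimately show "(\<i> * of_nat (a j)) * G' j x = F' j x * (\<i> * of_nat (a j)) * ?m x * ?w x
         - F x * of_nat ((a j)\<^sup>2) * ?m x * ?w x + (F x * ?m x * ?w x) * (\<i> * of_nat (a j) * ?L j x)"
        unfolding G'_def by algebra
    qed
    also have "\<dots> = A x - B x + (F x * ?m x * ?w x) * (\<Sum>j\<in>{1..n}. \<i> * of_nat (a j) * ?L j x)"
      by (simp add: sum.distrib sum_subtractf A_def B_def sum_distrib_left sum_distrib_right)
    also have "(\<Sum>j\<in>{1..n}. \<i> * of_nat (a j) * ?L j x) =
        (\<Sum>p\<in>index_pairs n. \<Sum>j\<in>{1..n}. \<i> * of_nat (a j) * complex_of_real (\<beta> * reg_cot \<epsilon> (x (fst p) - x (snd p)) * (of_bool (j = fst p) - of_bool (j = snd p))))"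
      unfolding sum_distrib_left split_def by (rule sum.swap)
    also have "\<dots> = (\<Sum>p\<in>index_pairs n. \<i> * of_real \<beta> * (of_nat (a (fst p)) - of_nat (a (snd p))) * complex_of_real (reg_cot \<epsilon> (x (fst p) - x (snd p))))"
    proof (rule sum.cong[OF refl])
      fix p assume p: "p \<in> index_pairs n"
      let ?c = "\<i> * of_real \<beta> * complex_of_real (reg_cot \<epsilon> (x (fst p) - x (snd p)))"
      have pick: "(\<Sum>j\<in>{1..n}. of_nat (a j) * of_bool (j = i)) = complex_of_nat (a i)" if "i \<in> {1..n}" for i
      proof -
        have "(\<Sum>j\<in>{1..n}. complex_of_nat (a j) * of_bool (j = i)) = (\<Sum>j\<in>{i}. of_nat (a j) * of_bool (j = i))"
          using that by (intro sum.mono_neutral_right) auto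
        then show ?thesis by simp
      qed
      have "(\<Sum>j\<in>{1..n}. \<i> * of_nat (a j) * complex_of_real (\<beta> * reg_cot \<epsilon> (x (fst p) - x (snd p)) * (of_bool (j = fst p) - of_bool (j = snd p))))
        = (\<Sum>j\<in>{1..n}. ?c * (of_nat (a j) * of_bool (j = fst p)) - ?c * (of_nat (a j) * of_bool (j = snd p)))"
        by (intro sum.cong refl) (simp add: algebra_simps)
      also have "\<dots> = ?c * of_nat (a (fst p)) - ?c * of_nat (a (snd p))"
        unfolding sum_subtractf sum_distrib_left[symmetric]
        using p by (subst (1 2) pick) (auto simp: index_pairs_def)
      finally show "(\<Sum>j\<in>{1..n}. \<i> * of_nat (a j) * complex_of_real (\<beta> * reg_cot \<epsilon> (x (fst p) - x (snd p)) * (of_bool (j = fst p) - of_bool (j = snd p))))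
        = \<i> * of_real \<beta> * (of_nat (a (fst p)) - of_nat (a (snd p))) * complex_of_real (reg_cot \<epsilon> (x (fst p) - x (snd p)))"
        by (simp add: algebra_simps)
    qed
    also have "(F x * ?m x * ?w x) * \<dots> = (\<Sum>p\<in>index_pairs n. C p x)"
      unfolding sum_distrib_left by (intro sum.cong refl) (simp add: C_def split_def mult_ac)
    finally show ?thesis .
  qed
  have "0 = (\<Sum>j\<in>{1..n}. (\<i> * of_nat (a j)) * (LINT x|torus n. G' j x))"
    using integral_torus_derivative[OF G] by simp
  also have "\<dots> = (LINT x|torus n. (\<Sum>j\<in>{1..n}. (\<i> * of_nat (a j)) * G' j x))"
    by (subst Bochner_Integration.integral_sum)
       (auto intro!: integrable_bounded_measurable bounded_measurable_mult bounded_measurable_const bG)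
  also have "\<dots> = (LINT x|torus n. A x - B x + (\<Sum>p\<in>index_pairs n. C p x))"
    unfolding point ..
  also have "\<dots> = (LINT x|torus n. A x) - (LINT x|torus n. B x) + (\<Sum>p\<in>index_pairs n. LINT x|torus n. C p x)"
    using bA bB bC
    by (simp add: integrable_bounded_measurable bounded_measurable_sum Bochner_Integration.integral_sum)
  also have "(\<Sum>p\<in>index_pairs n. LINT x|torus n. C p x) = (\<Sum>(k, l)\<in>index_pairs n. \<i> * of_real \<beta> / 2 * (of_nat (a k) - of_nat (a l)) *
      (LINT x|torus n. F x * (monomial n a x - monomial n (a \<circ> Transposition.transpose k l) x) *
        reg_cot \<epsilon> (x k - x l) * reg_weight n \<beta> \<epsilon> x))"
  proof (rule sum.cong[OF refl], clarify)
    fix k l assume kl: "(k, l) \<in> index_pairs n"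
    have "2 * (LINT x|torus n. F x * ?m x * complex_of_real (reg_cot \<epsilon> (x k - x l)) * ?w x) =
      (LINT x|torus n. F x * (monomial n a x - monomial n (a \<circ> Transposition.transpose k l) x) *
        reg_cot \<epsilon> (x k - x l) * reg_weight n \<beta> \<epsilon> x)"
      by (rule integral_swap_antisymmetric[OF _ _ F(2) Fb e b]) (use kl in \<open>auto simp: index_pairs_def\<close>)
    then show "(LINT x|torus n. C (k, l) x) = \<i> * of_real \<beta> / 2 * (of_nat (a k) - of_nat (a l)) *
      (LINT x|torus n. F x * (monomial n a x - monomial n (a \<circ> Transposition.transpose k l) x) *
        reg_cot \<epsilon> (x k - x l) * reg_weight n \<beta> \<epsilon> x)"
      unfolding C_def by (simp flip: \<open>2 * _ = _\<close>)
  qed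
  finally show ?thesis
    unfolding A_def B_def by (simp add: algebra_simps)
qed

section \<open>The loop equation\<close>

lemma monomial_upd2:
  assumes "k \<in> {1..n}" "l \<in> {1..n}" "k \<noteq> l"
  shows "monomial n (a(k := p, l := q)) x =
    (\<Prod>j\<in>{1..n} - {k} - {l}. cis (x j) ^ a j) * (cis (x k) ^ p * cis (x l) ^ q)"
proof -
  have "monomial n (a(k := p, l := q)) x = cis (x k) ^ p * (cis (x l) ^ q *
      (\<Prod>j\<in>{1..n} - {k} - {l}. cis (x j) ^ (a(k := p, l := q)) j))"
    unfolding monomial_def using assms
    by (subst prod.remove[of _ k], simp, simp, subst prod.remove[of _ l]) auto
  also have "(\<Prod>j\<in>{1..n} - {k} - {l}. cis (x j) ^ (a(k := p, l := q)) j) = (\<Prod>j\<in>{1..n} - {k} - {l}. cis (x j) ^ a j)"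
    by (intro prod.cong) auto
  finally show ?thesis by (simp only: mult_ac)
qed

lemma comp_transpose_eq_upd:
  assumes "k \<noteq> l"
  shows "a \<circ> Transposition.transpose k l = a(k := a l, l := a k)"
  using assms by (auto simp: fun_eq_iff Transposition.transpose_def)

text \<open>Pulling out the smaller power of \<open>z * y\<close> leaves a difference of two pure
  powers. The factor \<open>z - y\<close> is the chord length that compensates the
  cotangent.\<close>

lemma norm_power_swap_le:
  fixes z y :: complex
  assumes "cmod z = 1" "cmod y = 1"
  shows "cmod (z ^ p * y ^ q - z ^ q * y ^ p) \<le> \<bar>real p - real q\<bar> * cmod (z - y)"
proof -
  have le: "cmod (z ^ p * y ^ q - z ^ q * y ^ p) \<le> \<bar>real p - real q\<bar> * cmod (z - y)" if qp: "q \<le> p" for p q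
  proof -
    obtain d where d: "p = q + d" using qp le_Suc_ex by blast
    have "z ^ p * y ^ q - z ^ q * y ^ p = (z * y) ^ q * (z ^ d - y ^ d)"
      by (simp add: d power_add power_mult_distrib algebra_simps)
    then have "cmod (z ^ p * y ^ q - z ^ q * y ^ p) = cmod (z ^ d - y ^ d)"
      by (simp add: norm_mult norm_power assms)
    also have "\<dots> \<le> d * cmod (z - y)"
      by (rule norm_power_diff) (use assms in auto)
    finally show ?thesis by (simp add: d)
  qed
  show ?thesis
  proof (cases "q \<le> p")
    case False
    then have "cmod (z ^ q * y ^ p - z ^ p * y ^ q) \<le> \<bar>real q - real p\<bar> * cmod (z - y)"
      by (intro le) simp
    then show ?thesis
      unfolding norm_minus_commute[of "z ^ q * y ^ p" "z ^ p * y ^ q"] abs_minus_commute[of "real q" "real p"] .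
  qed (rule le)
qed

text \<open>A divided difference: dividing by \<open>z - y\<close> turns the antisymmetric
  difference into a geometric sum of monomials of the same degree, and the factor
  \<open>z + y\<close> makes the interior ones appear twice. The prefactor \<open>p - q\<close> is
  antisymmetric as well, hence the absolute value, which covers both orders of \<open>p\<close> and
  \<open>q\<close>.\<close>

lemma swap_difference_identity:
  fixes z y :: complex
  shows "(of_nat p - of_nat q) * ((z ^ p * y ^ q - z ^ q * y ^ p) * (z + y)) =
    of_real \<bar>real p - real q\<bar> * ((z - y) * (z ^ p * y ^ q + z ^ q * y ^ p +
      2 * (\<Sum>c\<in>{min p q<..<max p q}. z ^ c * y ^ (p + q - c))))"
proof -
  have geo: "(z ^ p * y ^ q - z ^ q * y ^ p) * (z + y) = (z - y) * (z ^ p * y ^ q + z ^ q * y ^ p +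
      2 * (\<Sum>c\<in>{q<..<p}. z ^ c * y ^ (p + q - c)))" if "q < p" for p q
  proof -
    \<comment> \<open>Multiplying out by \<open>z - y\<close> makes the sum telescope.\<close>
    have "(z - y) * (\<Sum>c\<in>{q<..<p}. z ^ c * y ^ (p + q - c)) =
        (\<Sum>c\<in>{Suc q..<p}. z ^ Suc c * y ^ (Suc (p + q) - Suc c) - z ^ c * y ^ (Suc (p + q) - c))"
      unfolding sum_distrib_left
    proof (rule sum.cong)
      fix c assume "c \<in> {Suc q..<p}"
      then have "Suc (p + q) - c = Suc (p + q - c)" by auto
      then show "(z - y) * (z ^ c * y ^ (p + q - c)) =
          z ^ Suc c * y ^ (Suc (p + q) - Suc c) - z ^ c * y ^ (Suc (p + q) - c)"
        by (simp add: algebra_simps)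
    qed auto
    also have "\<dots> = z ^ p * y ^ (Suc (p + q) - p) - z ^ Suc q * y ^ (Suc (p + q) - Suc q)"
      using that by (intro sum_Suc_diff') auto
    also have "\<dots> = z ^ p * (y * y ^ q) - z * z ^ q * y ^ p"
      by simp
    finally have tel: "(z - y) * (\<Sum>c\<in>{q<..<p}. z ^ c * y ^ (p + q - c)) = z ^ p * (y * y ^ q) - z * z ^ q * y ^ p" .
    have "(z - y) * (z ^ p * y ^ q + z ^ q * y ^ p + 2 * (\<Sum>c\<in>{q<..<p}. z ^ c * y ^ (p + q - c)))
      = (z - y) * (z ^ p * y ^ q + z ^ q * y ^ p) + 2 * ((z - y) * (\<Sum>c\<in>{q<..<p}. z ^ c * y ^ (p + q - c)))"
      by (simp add: algebra_simps)
    then show ?thesis unfolding tel by (simp add: algebra_simps)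
  qed
  consider "q < p" | "p = q" | "p < q" by linarith
  then show ?thesis
  proof cases
    case 1
    then show ?thesis using geo[OF 1] by (simp add: of_nat_diff)
  next
    case 3
    have "(of_nat p - of_nat q) * ((z ^ p * y ^ q - z ^ q * y ^ p) * (z + y)) =
        (of_nat q - of_nat p) * ((z ^ q * y ^ p - z ^ p * y ^ q) * (z + y))"
      by (simp add: algebra_simps)
    also have "\<dots> = of_real \<bar>real p - real q\<bar> * ((z - y) * (z ^ q * y ^ p + z ^ p * y ^ q +
      2 * (\<Sum>c\<in>{p<..<q}. z ^ c * y ^ (q + p - c))))"
      unfolding geo[OF 3] using 3 by simp
    finally show ?thesis
      using 3 by (simp only: min.absorb3 max.absorb4 add.commute[of q p] add.commute[of "z ^ q * y ^ p"])
  qed simp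
qed

text \<open>The classical formula for the cotangent of half the difference of two angles as \<i>
  times the quotient of sum and difference of the points, with the denominator multiplied
  out.\<close>

lemma reg_cot_0_cis:
  "2 * complex_of_real (reg_cot 0 (s - t)) * (cis s - cis t) = \<i> * (cis s + cis t)" if "cis s \<noteq> cis t"
proof -
  let ?u = "s - t"
  have d: "reg_dist 0 ?u \<noteq> 0"
    using that norm_cis_diff_eq[of s t] by auto
  have s: "cis s = cis t * cis ?u" by (simp add: cis_mult)
  have "2 * complex_of_real (sin ?u) * (cis ?u - 1) = \<i> * (cis ?u + 1) * complex_of_real (reg_dist 0 ?u)"
  proof -
    have "2 * (cos ?u * cos ?u) + 2 * (sin ?u * sin ?u) = 2"
      using sin_cos_squared_add3[of ?u] by linarith
    then show ?thesis by (simp add: complex_eq_iff reg_dist_def algebra_simps)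
  qed
  then have "2 * complex_of_real (reg_cot 0 ?u) * (cis ?u - 1) = \<i> * (cis ?u + 1)"
    using d by (simp add: reg_cot_def field_simps)
  then have "cis t * (2 * complex_of_real (reg_cot 0 ?u) * (cis ?u - 1)) = cis t * (\<i> * (cis ?u + 1))" by simp
  then show ?thesis unfolding s by (simp add: algebra_simps)
qed

lemma reg_weight_0_eq_0:
  assumes "(k, l) \<in> index_pairs n" "cis (x k) = cis (x l)"
  shows "reg_weight n \<beta> 0 x = 0"
proof -
  have "reg_dist 0 (x k - x l) = 0"
    using norm_cis_diff_eq[of "x k" "x l"] assms(2) by simp
  then show ?thesis
    unfolding reg_weight_def using assms(1) by (intro prod_zero) (auto intro!: bexI[of _ "(k, l)"])
qed

text \<open>For \<open>c\<close> strictly between the exponents at \<open>k\<close> and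
  \<open>l\<close> the subtraction is exact: the pair keeps its sum while its two members move
  closer together.\<close>

definition squeeze :: "(nat \<Rightarrow> nat) \<Rightarrow> nat \<Rightarrow> nat \<Rightarrow> nat \<Rightarrow> nat \<Rightarrow> nat" where
  "squeeze a k l c = a(k := c, l := a k + a l - c)"

abbreviation between :: "(nat \<Rightarrow> nat) \<Rightarrow> nat \<Rightarrow> nat \<Rightarrow> nat set" where
  "between a k l \<equiv> {min (a k) (a l)<..<max (a k) (a l)}"

text \<open>Here the cotangent disappears: away from coinciding angles \<open>reg_cot_0_cis\<close>
  and \<open>swap_difference_identity\<close> combine after cancelling the difference of the points,
  and at coinciding angles both sides vanish with the weight.\<close>

lemma monomial_squeeze_identity:
  assumes kl: "(k, l) \<in> index_pairs n"
  shows "(of_nat (a k) - of_nat (a l)) * ((monomial n a x - monomial n (a \<circ> Transposition.transpose k l) x) *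
       complex_of_real (reg_cot 0 (x k - x l)) * reg_weight n \<beta> 0 x) =
    \<i> / 2 * of_real \<bar>real (a k) - real (a l)\<bar> * ((monomial n a x + monomial n (a \<circ> Transposition.transpose k l) x +
      2 * (\<Sum>c\<in>between a k l. monomial n (squeeze a k l c) x)) * reg_weight n \<beta> 0 x)"
proof (cases "cis (x k) = cis (x l)")
  case True
  then show ?thesis by (simp add: reg_weight_0_eq_0[OF kl])
next
  case False
  have kl': "k \<in> {1..n}" "l \<in> {1..n}" "k \<noteq> l" using kl by (auto simp: index_pairs_def)
  define z where "z = cis (x k)"
  define y where "y = cis (x l)"
  define R where "R = (\<Prod>j\<in>{1..n} - {k} - {l}. cis (x j) ^ a j)"
  define w where "w = complex_of_real (reg_weight n \<beta> 0 x)"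
  define cot where "cot = complex_of_real (reg_cot 0 (x k - x l))"
  define S where "S = (\<Sum>c\<in>between a k l. z ^ c * y ^ (a k + a l - c))"
  have m: "monomial n (a(k := p, l := q)) x = R * (z ^ p * y ^ q)" for p q
    unfolding R_def z_def y_def by (rule monomial_upd2[OF kl'])
  have m1: "monomial n a x = R * (z ^ a k * y ^ a l)" using m[of "a k" "a l"] by simp
  have m2: "monomial n (a \<circ> Transposition.transpose k l) x = R * (z ^ a l * y ^ a k)"
    unfolding comp_transpose_eq_upd[OF kl'(3)] by (rule m)
  have m3: "(\<Sum>c\<in>between a k l. monomial n (squeeze a k l c) x) = R * S"
    unfolding squeeze_def m S_def sum_distrib_left ..
  have cot: "2 * cot * (z - y) = \<i> * (z + y)"
    unfolding cot_def z_def y_def by (rule reg_cot_0_cis[OF False])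
  have id: "(of_nat (a k) - of_nat (a l)) * ((z ^ a k * y ^ a l - z ^ a l * y ^ a k) * (z + y)) =
    of_real \<bar>real (a k) - real (a l)\<bar> * ((z - y) * (z ^ a k * y ^ a l + z ^ a l * y ^ a k + 2 * S))"
    unfolding S_def by (rule swap_difference_identity)
  define P where "P = z ^ a k * y ^ a l"
  define Q where "Q = z ^ a l * y ^ a k"
  define u where "u = complex_of_nat (a k) - of_nat (a l)"
  define v where "v = complex_of_real \<bar>real (a k) - real (a l)\<bar>"
  have zy: "z - y \<noteq> 0" using False by (simp add: z_def y_def)
  \<comment> \<open>The identity is proved after multiplication by \<open>z - y\<close> and then
    divided by it, which is allowed in this case.\<close>
  have "(z - y) * (2 * (u * ((P - Q) * cot))) = u * (P - Q) * (2 * cot * (z - y))" by (simp add: algebra_simps)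
  also have "\<dots> = \<i> * (u * ((P - Q) * (z + y)))" unfolding cot by (simp add: algebra_simps)
  also have "\<dots> = (z - y) * (\<i> * v * (P + Q + 2 * S))"
    unfolding id[folded P_def Q_def u_def v_def] by (simp add: algebra_simps)
  finally have key: "2 * (u * ((P - Q) * cot)) = \<i> * v * (P + Q + 2 * S)"
    by (rule mult_left_cancel[OF zy, THEN iffD1])
  have "u * ((R * P - R * Q) * cot * w) = (2 * (u * ((P - Q) * cot))) * (R * w / 2)"
    by (simp add: algebra_simps)
  also have "\<dots> = \<i> / 2 * v * ((R * P + R * Q + 2 * (R * S)) * w)"
    unfolding key by (simp add: algebra_simps)
  finally show ?thesis
    unfolding m1 m2 m3 by (simp only: P_def Q_def u_def v_def w_def cot_def)
qed

text \<open>The expectation for unordered angles up to normalization. Leaving it unnormalized keeps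
  every identity linear; the mass is divided out at the end.\<close>

definition weighted_integral :: "nat \<Rightarrow> real \<Rightarrow> ((nat \<Rightarrow> real) \<Rightarrow> complex) \<Rightarrow> complex" where
  "weighted_integral n \<beta> f = (LINT x|torus n. f x * reg_weight n \<beta> 0 x)"

lemma tendsto_weighted_integral:
  assumes g: "bounded_measurable n g" and b: "\<beta> > 0"
  shows "(\<lambda>i. LINT x|torus n. g x * reg_weight n \<beta> (1 / real (Suc i)) x) \<longlonglongrightarrow> weighted_integral n \<beta> g"
proof -
  let ?W = "(5 powr (\<beta> / 2)) ^ card (index_pairs n)"
  obtain B where B: "\<And>x. cmod (g x) \<le> B" using g by (auto simp: bounded_measurable_def)
  show ?thesis
    unfolding weighted_integral_def
  proof (rule integral_dominated_convergence[where w="\<lambda>_. B * ?W"])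
    show "integrable (torus n) (\<lambda>_. B * ?W)"
      by (rule integrable_torus_bounded[where B="\<bar>B * ?W\<bar>"]) auto
    show "AE x in torus n. (\<lambda>i. g x * complex_of_real (reg_weight n \<beta> (1 / real (Suc i)) x))
        \<longlonglongrightarrow> g x * complex_of_real (reg_weight n \<beta> 0 x)"
      by (intro always_eventually allI tendsto_intros tendsto_of_real tendsto_reg_weight b LIMSEQ_Suc lim_1_over_n) auto
    show "AE x in torus n. cmod (g x * complex_of_real (reg_weight n \<beta> (1 / real (Suc i)) x)) \<le> B * ?W" for i
      unfolding norm_mult norm_of_real using B reg_weight_le[of "1 / real (Suc i)" \<beta> n] reg_weight_nonneg b
      by (intro always_eventually allI mult_mono) (auto intro: order_trans[OF norm_ge_zero B])
  qed (use g in \<open>auto simp: bounded_measurable_def\<close>)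
qed

text \<open>Dominated convergence: the difference of monomials is at most a multiple of the chord
  length, and the cotangent times the chord length is at most 1 for every \<epsilon>.\<close>

lemma tendsto_swap_integral:
  assumes kl: "(k, l) \<in> index_pairs n" and F: "bounded_measurable n F" and b: "\<beta> > 0"
  shows "(\<lambda>i. LINT x|torus n. F x * (monomial n a x - monomial n (a \<circ> Transposition.transpose k l) x) *
        reg_cot (1 / real (Suc i)) (x k - x l) * reg_weight n \<beta> (1 / real (Suc i)) x) \<longlonglongrightarrow>
     (LINT x|torus n. F x * (monomial n a x - monomial n (a \<circ> Transposition.transpose k l) x) *
        reg_cot 0 (x k - x l) * reg_weight n \<beta> 0 x)"
proof -
  let ?W = "(5 powr (\<beta> / 2)) ^ card (index_pairs n)"
  let ?d = "\<lambda>x. monomial n a x - monomial n (a \<circ> Transposition.transpose k l) x"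
  have kl': "k \<in> {1..n}" "l \<in> {1..n}" "k \<noteq> l" using kl by (auto simp: index_pairs_def)
  obtain B where B: "\<And>x. cmod (F x) \<le> B" using F by (auto simp: bounded_measurable_def)
  have B0: "B \<ge> 0" by (rule order_trans[OF norm_ge_zero B])
  define K where "K = \<bar>real (a k) - real (a l)\<bar>"
  have d: "cmod (?d x) \<le> K * cmod (cis (x k) - cis (x l))" for x
  proof -
    define R where "R = (\<Prod>j\<in>{1..n} - {k} - {l}. cis (x j) ^ a j)"
    have R: "cmod R = 1" by (simp add: R_def norm_power flip: prod_norm)
    have m: "monomial n (a(k := p, l := q)) x = R * (cis (x k) ^ p * cis (x l) ^ q)" for p q
      unfolding R_def by (rule monomial_upd2[OF kl'])
    have "?d x = R * (cis (x k) ^ a k * cis (x l) ^ a l - cis (x k) ^ a l * cis (x l) ^ a k)"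
      unfolding comp_transpose_eq_upd[OF kl'(3)] m using m[of "a k" "a l"] by (simp add: algebra_simps)
    then have "cmod (?d x) = cmod (cis (x k) ^ a k * cis (x l) ^ a l - cis (x k) ^ a l * cis (x l) ^ a k)"
      by (simp add: norm_mult R)
    also have "\<dots> \<le> K * cmod (cis (x k) - cis (x l))"
      unfolding K_def by (rule norm_power_swap_le) auto
    finally show ?thesis .
  qed
  have dc: "cmod (?d x * complex_of_real (reg_cot \<epsilon> (x k - x l))) \<le> K" if "\<epsilon> \<ge> 0" for x \<epsilon>
  proof -
    have "cmod (?d x * complex_of_real (reg_cot \<epsilon> (x k - x l))) \<le> K * cmod (cis (x k) - cis (x l)) * \<bar>reg_cot \<epsilon> (x k - x l)\<bar>"
      unfolding norm_mult norm_of_real using d by (intro mult_right_mono) auto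
    also have "\<dots> = K * (\<bar>reg_cot \<epsilon> (x k - x l)\<bar> * cmod (cis (x k) - cis (x l)))" by simp
    also have "\<dots> \<le> K * 1"
      using abs_reg_cot_mult_le[OF that] by (intro mult_left_mono) (auto simp: K_def)
    finally show ?thesis by simp
  qed
  note [measurable] = measurable_reg_cot_diff[OF kl'(1,2)]
  have [measurable]: "monomial n a \<in> borel_measurable (torus n)" for a
    using bounded_measurable_monomial by (auto simp: bounded_measurable_def)
  have [measurable]: "F \<in> borel_measurable (torus n)" using F by (auto simp: bounded_measurable_def)
  show ?thesis
  proof (rule integral_dominated_convergence[where w="\<lambda>_. B * K * ?W"])
    show "integrable (torus n) (\<lambda>_. B * K * ?W)"
      by (rule integrable_torus_bounded[where B="\<bar>B * K * ?W\<bar>"]) auto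
    show "AE x in torus n. (\<lambda>i. F x * ?d x * reg_cot (1 / real (Suc i)) (x k - x l) * reg_weight n \<beta> (1 / real (Suc i)) x)
        \<longlonglongrightarrow> F x * ?d x * reg_cot 0 (x k - x l) * reg_weight n \<beta> 0 x"
      by (intro always_eventually allI tendsto_mult tendsto_const tendsto_of_real tendsto_reg_weight
          tendsto_reg_cot b LIMSEQ_Suc lim_1_over_n) auto
    show "AE x in torus n. cmod (F x * ?d x * reg_cot (1 / real (Suc i)) (x k - x l) * reg_weight n \<beta> (1 / real (Suc i)) x)
        \<le> B * K * ?W" for i
    proof (intro always_eventually allI)
      fix x
      have "cmod (F x * ?d x * reg_cot (1 / real (Suc i)) (x k - x l) * reg_weight n \<beta> (1 / real (Suc i)) x) =
        cmod (F x) * cmod (?d x * reg_cot (1 / real (Suc i)) (x k - x l)) * reg_weight n \<beta> (1 / real (Suc i)) x"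
        by (simp add: norm_mult reg_weight_nonneg mult.assoc)
      also have "\<dots> \<le> B * K * ?W"
        using B dc[of "1 / real (Suc i)"] B0 b
        by (intro mult_mono reg_weight_le reg_weight_nonneg mult_nonneg_nonneg) (auto simp: K_def)
      finally show "cmod (F x * ?d x * reg_cot (1 / real (Suc i)) (x k - x l) * reg_weight n \<beta> (1 / real (Suc i)) x)
        \<le> B * K * ?W" .
    qed
  qed measurable
qed

lemma weighted_integral_add:
  assumes "bounded_measurable n f" "bounded_measurable n g" "\<beta> > 0"
  shows "weighted_integral n \<beta> (\<lambda>x. f x + g x) = weighted_integral n \<beta> f + weighted_integral n \<beta> g"
  unfolding weighted_integral_def distrib_right using assms
  by (intro Bochner_Integration.integral_add integrable_bounded_measurable bounded_measurable_mult
    bounded_measurable_reg_weight) auto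

lemma weighted_integral_cmult:
  "weighted_integral n \<beta> (\<lambda>x. c * f x) = c * weighted_integral n \<beta> f"
  unfolding weighted_integral_def mult.assoc by (rule integral_mult_right_zero)

lemma weighted_integral_sum:
  assumes "finite A" "\<And>i. i \<in> A \<Longrightarrow> bounded_measurable n (f i)" "\<beta> > 0"
  shows "weighted_integral n \<beta> (\<lambda>x. \<Sum>i\<in>A. f i x) = (\<Sum>i\<in>A. weighted_integral n \<beta> (f i))"
  using assms
proof (induction A rule: finite_induct)
  case empty
  then show ?case by (simp add: weighted_integral_def)
next
  case (insert i A)
  have "weighted_integral n \<beta> (\<lambda>x. f i x + (\<Sum>i\<in>A. f i x)) =
      weighted_integral n \<beta> (f i) + weighted_integral n \<beta> (\<lambda>x. \<Sum>i\<in>A. f i x)"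
    by (rule weighted_integral_add[OF _ bounded_measurable_sum]) (use insert in simp_all)
  then show ?case using insert by simp
qed

lemma weighted_integral_permute:
  assumes "bounded_measurable n f" "p permutes {1..n}" "\<beta> > 0"
  shows "weighted_integral n \<beta> (\<lambda>x. f (x \<circ> p)) = weighted_integral n \<beta> f"
proof -
  have "weighted_integral n \<beta> (\<lambda>x. f (x \<circ> p)) = (LINT x|torus n. (\<lambda>x. f x * complex_of_real (reg_weight n \<beta> 0 x)) (x \<circ> p))"
    by (simp add: weighted_integral_def reg_weight_permute[OF assms(2)])
  also have "\<dots> = weighted_integral n \<beta> f"
    unfolding weighted_integral_def
    by (rule integral_torus_permute[OF _ assms(2)]) (use assms(1) in \<open>auto simp: bounded_measurable_def\<close>)
  finally show ?thesis .
qed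

text \<open>Reflecting \<open>c\<close> at the midpoint of the two exponents exchanges the roles of
  \<open>k\<close> and \<open>l\<close>.\<close>

lemma squeeze_commute:
  assumes "k \<noteq> l"
  shows "(\<Sum>c\<in>between a l k. f (squeeze a l k c)) = (\<Sum>c\<in>between a k l. f (squeeze a k l c))"
proof (rule sum.reindex_bij_witness[where i="\<lambda>c. a k + a l - c" and j="\<lambda>c. a k + a l - c"])
  fix c assume "c \<in> between a l k"
  then have "squeeze a k l (a k + a l - c) = squeeze a l k c"
    using assms by (auto simp: squeeze_def fun_eq_iff)
  then show "f (squeeze a k l (a k + a l - c)) = f (squeeze a l k c)" by simp
qed auto

text \<open>The limit \<epsilon> -> 0 of \<open>reg_loop_equation\<close>. Since \<open>F\<close> is
  symmetric, a monomial and its transposed monomial have the same integral, so end terms and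
  interior terms get the same factor. The right-hand side pairs \<open>F\<close> with minus the
  generator applied to the monomial.\<close>

theorem loop_equation:
  assumes F: "smooth_torus n F F'" "symmetric_torus n F" and b: "\<beta> > 0"
  defines "I \<equiv> \<lambda>a. weighted_integral n \<beta> (\<lambda>x. F x * monomial n a x)"
  shows "weighted_integral n \<beta> (\<lambda>x. (\<Sum>j\<in>{1..n}. F' j x * (\<i> * of_nat (a j))) * monomial n a x) =
    of_nat (\<Sum>j\<in>{1..n}. (a j)\<^sup>2) * I a +
    of_real (\<beta> / 4) * (\<Sum>k\<in>{1..n}. \<Sum>l\<in>{1..n}. of_real \<bar>real (a k) - real (a l)\<bar> *
      (I a + (\<Sum>c\<in>between a k l. I (squeeze a k l c))))"
proof -
  let ?e = "\<lambda>i. 1 / real (Suc i)"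
  let ?swap = "\<lambda>k l. LINT x|torus n. F x * (monomial n a x - monomial n (a \<circ> Transposition.transpose k l) x) *
        reg_cot 0 (x k - x l) * reg_weight n \<beta> 0 x"
  have Fb: "bounded_measurable n F" by (rule bounded_measurable_smooth[OF F(1)])
  have bI: "bounded_measurable n (\<lambda>x. F x * monomial n a x)" for a
    by (intro bounded_measurable_mult Fb bounded_measurable_monomial)
  have bA: "bounded_measurable n (\<lambda>x. (\<Sum>j\<in>{1..n}. F' j x * (\<i> * of_nat (a j))) * monomial n a x)"
    by (intro bounded_measurable_mult bounded_measurable_sum bounded_measurable_const
      bounded_measurable_monomial bounded_measurable_smooth(2)[OF F(1)]) auto
  have bB: "bounded_measurable n (\<lambda>x. F x * of_nat (\<Sum>j\<in>{1..n}. (a j)\<^sup>2) * monomial n a x)"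
    by (intro bounded_measurable_mult bounded_measurable_const bounded_measurable_monomial Fb)
  have swap: "\<i> * of_real \<beta> / 2 * (of_nat (a k) - of_nat (a l)) * ?swap k l =
     - (of_real (\<beta> / 2) * (of_real \<bar>real (a k) - real (a l)\<bar> * (I a + (\<Sum>c\<in>between a k l. I (squeeze a k l c)))))"
    if kl: "(k, l) \<in> index_pairs n" for k l
  proof -
    let ?t = "Transposition.transpose k l"
    let ?v = "complex_of_real \<bar>real (a k) - real (a l)\<bar>"
    have kl': "k \<in> {1..n}" "l \<in> {1..n}" "k \<noteq> l" using kl by (auto simp: index_pairs_def)
    have t: "?t permutes {1..n}" using kl'(1,2) by (rule transpose_permutes)
    have It: "I (a \<circ> ?t) = I a"
    proof -
      have "I (a \<circ> ?t) = weighted_integral n \<beta> (\<lambda>x. (\<lambda>x. F x * monomial n a x) (x \<circ> ?t))"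
        using F(2) t by (simp add: I_def monomial_comp_permute[OF t] symmetric_torus_def)
      also have "\<dots> = I a" unfolding I_def by (rule weighted_integral_permute[OF bI t b])
      finally show ?thesis .
    qed
    have "(of_nat (a k) - of_nat (a l)) * ?swap k l =
      (LINT x|torus n. F x * ((of_nat (a k) - of_nat (a l)) * ((monomial n a x - monomial n (a \<circ> ?t) x) *
       complex_of_real (reg_cot 0 (x k - x l)) * reg_weight n \<beta> 0 x)))"
      unfolding integral_mult_right_zero[symmetric]
      by (intro Bochner_Integration.integral_cong refl) (simp add: mult_ac)
    also have "\<dots> = weighted_integral n \<beta> (\<lambda>x. \<i> / 2 * ?v * ((F x * monomial n a x + F x * monomial n (a \<circ> ?t) x) +
      2 * (\<Sum>c\<in>between a k l. F x * monomial n (squeeze a k l c) x)))"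
      unfolding monomial_squeeze_identity[OF kl] weighted_integral_def
      by (intro Bochner_Integration.integral_cong refl) (simp add: algebra_simps sum_distrib_left)
    also have "\<dots> = \<i> / 2 * ?v * ((I a + I (a \<circ> ?t)) + 2 * (\<Sum>c\<in>between a k l. I (squeeze a k l c)))"
      unfolding weighted_integral_cmult I_def
      by (subst weighted_integral_add, intro bounded_measurable_add bI,
          intro bounded_measurable_mult bounded_measurable_const bounded_measurable_sum bI, simp, rule b,
          subst weighted_integral_add[OF bI bI b], unfold weighted_integral_cmult,
          subst weighted_integral_sum[OF _ bI b], simp_all)
    finally show ?thesis unfolding It mult.assoc[of "\<i> * of_real \<beta> / 2"] by (simp add: algebra_simps)
  qed
  let ?lhs = "\<lambda>i. LINT x|torus n. (\<Sum>j\<in>{1..n}. F' j x * (\<i> * of_nat (a j))) * monomial n a x * reg_weight n \<beta> (?e i) x"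
  have "?lhs \<longlonglongrightarrow> weighted_integral n \<beta> (\<lambda>x. (\<Sum>j\<in>{1..n}. F' j x * (\<i> * of_nat (a j))) * monomial n a x)"
    by (rule tendsto_weighted_integral[OF bA b])
  moreover have "?lhs \<longlonglongrightarrow> weighted_integral n \<beta> (\<lambda>x. F x * of_nat (\<Sum>j\<in>{1..n}. (a j)\<^sup>2) * monomial n a x) -
      (\<Sum>(k, l)\<in>index_pairs n. \<i> * of_real \<beta> / 2 * (of_nat (a k) - of_nat (a l)) * ?swap k l)"
  proof -
    have "?lhs = (\<lambda>i. (LINT x|torus n. F x * of_nat (\<Sum>j\<in>{1..n}. (a j)\<^sup>2) * monomial n a x * reg_weight n \<beta> (?e i) x) -
    (\<Sum>(k, l)\<in>index_pairs n. \<i> * of_real \<beta> / 2 * (of_nat (a k) - of_nat (a l)) *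
      (LINT x|torus n. F x * (monomial n a x - monomial n (a \<circ> Transposition.transpose k l) x) *
        reg_cot (?e i) (x k - x l) * reg_weight n \<beta> (?e i) x)))"
      by (rule ext, rule reg_loop_equation[OF F _ _ b]) auto
    moreover have "\<dots> \<longlonglongrightarrow> weighted_integral n \<beta> (\<lambda>x. F x * of_nat (\<Sum>j\<in>{1..n}. (a j)\<^sup>2) * monomial n a x) -
      (\<Sum>(k, l)\<in>index_pairs n. \<i> * of_real \<beta> / 2 * (of_nat (a k) - of_nat (a l)) * ?swap k l)"
      unfolding split_def
      by (intro tendsto_diff tendsto_weighted_integral[OF bB b] tendsto_sum tendsto_mult tendsto_const
        tendsto_swap_integral Fb b) simp
    ultimately show ?thesis by simp
  qed
  ultimately have "weighted_integral n \<beta> (\<lambda>x. (\<Sum>j\<in>{1..n}. F' j x * (\<i> * of_nat (a j))) * monomial n a x) =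
     weighted_integral n \<beta> (\<lambda>x. F x * of_nat (\<Sum>j\<in>{1..n}. (a j)\<^sup>2) * monomial n a x) -
      (\<Sum>(k, l)\<in>index_pairs n. \<i> * of_real \<beta> / 2 * (of_nat (a k) - of_nat (a l)) * ?swap k l)"
    by (rule LIMSEQ_unique)
  also have "(\<Sum>(k, l)\<in>index_pairs n. \<i> * of_real \<beta> / 2 * (of_nat (a k) - of_nat (a l)) * ?swap k l) =
    - (of_real (\<beta> / 2) * (\<Sum>(k, l)\<in>index_pairs n. of_real \<bar>real (a k) - real (a l)\<bar> * (I a + (\<Sum>c\<in>between a k l. I (squeeze a k l c)))))"
    unfolding sum_distrib_left sum_negf[symmetric] by (rule sum.cong[OF refl], clarify, rule swap)
  also have "weighted_integral n \<beta> (\<lambda>x. F x * of_nat (\<Sum>j\<in>{1..n}. (a j)\<^sup>2) * monomial n a x) = of_nat (\<Sum>j\<in>{1..n}. (a j)\<^sup>2) * I a"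
    unfolding I_def weighted_integral_cmult[symmetric] by (simp only: mult_ac)
  \<comment> \<open>Passing from increasing pairs to all pairs halves the constant, whence
    \<open>\<beta> / 4\<close> in place of \<open>\<beta> / 2\<close>.\<close>
  also have "(\<Sum>(k, l)\<in>index_pairs n. of_real \<bar>real (a k) - real (a l)\<bar> * (I a + (\<Sum>c\<in>between a k l. I (squeeze a k l c)))) =
    (\<Sum>k\<in>{1..n}. \<Sum>l\<in>{1..n}. of_real \<bar>real (a k) - real (a l)\<bar> * (I a + (\<Sum>c\<in>between a k l. I (squeeze a k l c)))) / 2"
    (is "sum (\<lambda>(k, l). ?g k l) _ = _")
  proof (subst sum_index_pairs)
    show "?g k l = ?g l k" for k l
    proof (cases "k = l")
      case False
      then show ?thesis
        using squeeze_commute[OF False, of I a] by (simp only: abs_minus_commute[of "real (a k)"])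
    qed simp
  qed simp_all
  finally show ?thesis by simp
qed

section \<open>The Dirichlet form on symmetric monomials\<close>

definition power_sum :: "nat \<Rightarrow> nat \<Rightarrow> (nat \<Rightarrow> real) \<Rightarrow> complex" where
  "power_sum n m x = (\<Sum>j\<in>{1..n}. cis (x j) ^ m)"

lemma monomial_permute:
  assumes "p permutes {1..n}"
  shows "monomial n (a \<circ> p) (x \<circ> p) = monomial n a x"
proof -
  have "(\<Prod>j\<in>{1..n}. cis (x j) ^ a j) = (\<Prod>j\<in>{1..n}. cis (x (p j)) ^ a (p j))"
    by (rule prod.permute[OF assms, unfolded comp_def])
  then show ?thesis by (simp add: monomial_def)
qed

lemma cnj_weighted_integral: "cnj (weighted_integral n \<beta> f) = weighted_integral n \<beta> (\<lambda>x. cnj (f x))"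
proof -
  have "(LINT x|torus n. cnj (f x * complex_of_real (reg_weight n \<beta> 0 x))) =
      cnj (LINT x|torus n. f x * complex_of_real (reg_weight n \<beta> 0 x))"
    by (rule Bochner_Integration.integral_cnj)
  then show ?thesis by (simp add: weighted_integral_def)
qed

definition monomial_form :: "nat \<Rightarrow> real \<Rightarrow> (nat \<Rightarrow> nat) \<Rightarrow> (nat \<Rightarrow> nat) \<Rightarrow> complex" where
  "monomial_form n \<beta> b a = weighted_integral n \<beta> (\<lambda>x. cnj (monomial n b x) * monomial n a x)"

definition perms :: "nat \<Rightarrow> (nat \<Rightarrow> nat) set" where
  "perms n = {p. p permutes {1..n}}"

lemma mem_perms: "p \<in> perms n \<longleftrightarrow> p permutes {1..n}"
  by (simp add: perms_def)

lemma finite_perms [simp]: "finite (perms n)"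
  unfolding perms_def by (rule finite_permutations) simp

lemma monomial_form_commute: "monomial_form n \<beta> b a = cnj (monomial_form n \<beta> a b)"
  by (simp add: monomial_form_def cnj_weighted_integral mult.commute)

lemma bounded_measurable_monomial_product:
  "bounded_measurable n (\<lambda>x. cnj (monomial n b x) * monomial n a x)"
  by (intro bounded_measurable_mult bounded_measurable_cnj bounded_measurable_monomial)

lemma monomial_form_permute:
  assumes p: "p permutes {1..n}" and b: "\<beta> > 0"
  shows "monomial_form n \<beta> (b \<circ> p) (a \<circ> p) = monomial_form n \<beta> b a"
proof -
  have "monomial_form n \<beta> (b \<circ> p) (a \<circ> p) =
      weighted_integral n \<beta> (\<lambda>x. (\<lambda>x. cnj (monomial n (b \<circ> p) x) * monomial n (a \<circ> p) x) (x \<circ> p))"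
    unfolding monomial_form_def
    by (rule weighted_integral_permute[OF bounded_measurable_monomial_product p b, symmetric])
  then show ?thesis by (simp add: monomial_form_def monomial_permute[OF p])
qed

text \<open>An inner product of symmetrized monomials. The weight is symmetric, so symmetrizing
  \<open>a\<close> as well would only multiply by the number of permutations. The real part makes it
  a real form, as \<open>triangular_symmetric_lower_bound\<close> requires.\<close>

definition sym_form :: "nat \<Rightarrow> real \<Rightarrow> (nat \<Rightarrow> nat) \<Rightarrow> (nat \<Rightarrow> nat) \<Rightarrow> real" where
  "sym_form n \<beta> b a = Re (\<Sum>p\<in>perms n. monomial_form n \<beta> (b \<circ> p) a)"

text \<open>The integral of the scalar product of gradients: differentiation multiplies a monomial
  by \<i> times an exponent, and the two factors \<i> cancel because one side is conjugated.\<close>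

definition dirichlet_form :: "nat \<Rightarrow> real \<Rightarrow> (nat \<Rightarrow> nat) \<Rightarrow> (nat \<Rightarrow> nat) \<Rightarrow> real" where
  "dirichlet_form n \<beta> b a =
     Re (\<Sum>p\<in>perms n. \<Sum>j\<in>{1..n}. of_nat (b (p j)) * of_nat (a j) * monomial_form n \<beta> (b \<circ> p) a)"

lemma sum_perms_inv: "(\<Sum>p\<in>perms n. f (inv p)) = (\<Sum>p\<in>perms n. f p)"
  by (rule sum.reindex_bij_witness[where i=inv and j=inv])
     (auto simp: mem_perms permutes_inv permutes_inv_inv)

lemma monomial_form_swap:
  assumes p: "p permutes {1..n}" and b: "\<beta> > 0"
  shows "monomial_form n \<beta> (b \<circ> p) a = cnj (monomial_form n \<beta> (a \<circ> inv p) b)"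
proof -
  have "b \<circ> p \<circ> inv p = b" using permutes_inverses(1)[OF p] by (auto simp: fun_eq_iff)
  then show ?thesis
    using monomial_form_permute[OF permutes_inv[OF p] b, of "b \<circ> p" a]
      monomial_form_commute[of n \<beta> b "a \<circ> inv p"] by simp
qed

lemma sym_form_commute:
  assumes b: "\<beta> > 0"
  shows "sym_form n \<beta> b a = sym_form n \<beta> a b"
proof -
  have "(\<Sum>p\<in>perms n. monomial_form n \<beta> (b \<circ> p) a) = (\<Sum>p\<in>perms n. cnj (monomial_form n \<beta> (a \<circ> inv p) b))"
    by (rule sum.cong[OF refl], rule monomial_form_swap[OF _ b]) (simp add: mem_perms)
  also have "\<dots> = (\<Sum>p\<in>perms n. cnj (monomial_form n \<beta> (a \<circ> p) b))"
    by (rule sum_perms_inv)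
  also have "\<dots> = cnj (\<Sum>p\<in>perms n. monomial_form n \<beta> (a \<circ> p) b)" by simp
  finally show ?thesis by (simp only: sym_form_def cnj.sel)
qed

lemma dirichlet_form_commute:
  assumes b: "\<beta> > 0"
  shows "dirichlet_form n \<beta> b a = dirichlet_form n \<beta> a b"
proof -
  let ?g = "\<lambda>a b p. \<Sum>j\<in>{1..n}. of_nat (b (p j)) * of_nat (a j) * monomial_form n \<beta> (b \<circ> p) a"
  have "(\<Sum>p\<in>perms n. ?g a b p) = (\<Sum>p\<in>perms n. cnj (?g b a (inv p)))"
  proof (rule sum.cong[OF refl])
    fix p assume "p \<in> perms n"
    then have p: "p permutes {1..n}" by (simp add: mem_perms)
    have "(\<Sum>j\<in>{1..n}. of_nat (b (p j)) * complex_of_nat (a j)) = (\<Sum>j\<in>{1..n}. of_nat (b j) * of_nat (a (inv p j)))"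
      using sum.permute[OF p, of "\<lambda>j. of_nat (b j) * complex_of_nat (a (inv p j))"] permutes_inverses(2)[OF p]
      by (simp add: comp_def)
    then show "?g a b p = cnj (?g b a (inv p))"
      unfolding monomial_form_swap[OF p b]
      by (simp only: sum_distrib_right[symmetric] complex_cnj_mult cnj_sum complex_cnj_of_nat mult.commute)
         (simp only: sum_distrib_left)
  qed
  also have "\<dots> = (\<Sum>p\<in>perms n. cnj (?g b a p))" by (rule sum_perms_inv)
  also have "\<dots> = cnj (\<Sum>p\<in>perms n. ?g b a p)" by simp
  finally show ?thesis by (simp only: dirichlet_form_def cnj.sel)
qed

lemma sum_perms_comp:
  assumes "q permutes {1..n}"
  shows "(\<Sum>p\<in>perms n. f (p \<circ> q)) = (\<Sum>p\<in>perms n. f p)"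
proof (rule sum.reindex_bij_witness[where i="\<lambda>p. p \<circ> inv q" and j="\<lambda>p. p \<circ> q"])
  have "q \<circ> inv q = id" "inv q \<circ> q = id" using permutes_inv_o[OF assms] by auto
  then show "p \<circ> q \<circ> inv q = p" "p \<circ> inv q \<circ> q = p" for p :: "nat \<Rightarrow> nat"
    by (simp_all add: comp_assoc)
qed (use assms in \<open>auto simp: mem_perms intro: permutes_compose permutes_inv\<close>)

lemma weighted_integral_norm_square_nonneg:
  "0 \<le> Re (weighted_integral n \<beta> (\<lambda>x. cnj (f x) * f x))"
proof -
  have "weighted_integral n \<beta> (\<lambda>x. cnj (f x) * f x) =
      (LINT x|torus n. complex_of_real ((cmod (f x))\<^sup>2 * reg_weight n \<beta> 0 x))"
    unfolding weighted_integral_def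
    by (intro Bochner_Integration.integral_cong refl)
       (simp add: complex_norm_square mult.commute del: of_real_power)
  also have "\<dots> = complex_of_real (LINT x|torus n. (cmod (f x))\<^sup>2 * reg_weight n \<beta> 0 x)"
    by (rule integral_complex_of_real)
  finally show ?thesis by (simp add: integral_nonneg_AE reg_weight_nonneg)
qed

text \<open>Up to the number of permutations, the quadratic form is the integral of the squared
  modulus of the symmetrized combination \<open>S\<close>.\<close>

lemma sym_form_nonneg:
  assumes A: "finite A" and b: "\<beta> > 0"
  shows "0 \<le> (\<Sum>a\<in>A. \<Sum>b\<in>A. c a * c b * sym_form n \<beta> a b)"
proof -
  let ?N = "of_nat (card (perms n)) :: complex"
  define S where "S = (\<lambda>x. \<Sum>a\<in>A. \<Sum>p\<in>perms n. of_real (c a) * monomial n (a \<circ> p) x)"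
  have "id \<in> perms n" by (simp add: mem_perms permutes_id)
  then have N: "card (perms n) > 0" by (auto simp: card_gt_0_iff)
  have avg: "(\<Sum>p\<in>perms n. \<Sum>q\<in>perms n. monomial_form n \<beta> (a \<circ> p) (d \<circ> q)) =
      ?N * (\<Sum>p\<in>perms n. monomial_form n \<beta> (a \<circ> p) d)" for a d
  proof -
    have "(\<Sum>p\<in>perms n. \<Sum>q\<in>perms n. monomial_form n \<beta> (a \<circ> p) (d \<circ> q)) =
      (\<Sum>q\<in>perms n. \<Sum>p\<in>perms n. monomial_form n \<beta> (a \<circ> p) (d \<circ> q))"
      by (rule sum.swap)
    also have "\<dots> = (\<Sum>q\<in>perms n. \<Sum>p\<in>perms n. monomial_form n \<beta> (a \<circ> p) d)"
    proof (rule sum.cong[OF refl])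
      fix q assume "q \<in> perms n"
      then have q: "q permutes {1..n}" by (simp add: mem_perms)
      have "(\<Sum>p\<in>perms n. monomial_form n \<beta> (a \<circ> p) (d \<circ> q)) = (\<Sum>p\<in>perms n. monomial_form n \<beta> (a \<circ> (p \<circ> q)) (d \<circ> q))"
        by (rule sum_perms_comp[OF q, symmetric])
      also have "\<dots> = (\<Sum>p\<in>perms n. monomial_form n \<beta> (a \<circ> p) d)"
        by (simp only: o_assoc monomial_form_permute[OF q b])
      finally show "(\<Sum>p\<in>perms n. monomial_form n \<beta> (a \<circ> p) (d \<circ> q)) = (\<Sum>p\<in>perms n. monomial_form n \<beta> (a \<circ> p) d)" .
    qed
    finally show ?thesis by simp
  qed
  have "weighted_integral n \<beta> (\<lambda>x. cnj (S x) * S x) =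
    weighted_integral n \<beta> (\<lambda>x. \<Sum>a\<in>A. \<Sum>p\<in>perms n. \<Sum>d\<in>A. \<Sum>q\<in>perms n.
       of_real (c a * c d) * (cnj (monomial n (a \<circ> p) x) * monomial n (d \<circ> q) x))"
    unfolding S_def cnj_sum sum_distrib_left sum_distrib_right complex_cnj_mult complex_cnj_complex_of_real
  proof (rule arg_cong[where f="weighted_integral n \<beta>"], rule ext)
    fix x
    show "(\<Sum>d\<in>A. \<Sum>q\<in>perms n. \<Sum>a\<in>A. \<Sum>p\<in>perms n. complex_of_real (c a) * cnj (monomial n (a \<circ> p) x) * (complex_of_real (c d) * monomial n (d \<circ> q) x)) =
      (\<Sum>a\<in>A. \<Sum>p\<in>perms n. \<Sum>d\<in>A. \<Sum>q\<in>perms n. complex_of_real (c a * c d) * (cnj (monomial n (a \<circ> p) x) * monomial n (d \<circ> q) x))"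
      by (subst (2) sum.swap, subst sum.swap, subst (3) sum.swap, subst (2) sum.swap) (simp add: mult_ac)
  qed
  also have "\<dots> = (\<Sum>a\<in>A. \<Sum>p\<in>perms n. \<Sum>d\<in>A. \<Sum>q\<in>perms n. of_real (c a * c d) * monomial_form n \<beta> (a \<circ> p) (d \<circ> q))"
    unfolding monomial_form_def weighted_integral_cmult[symmetric]
    by (simp add: weighted_integral_sum A b bounded_measurable_sum bounded_measurable_mult
        bounded_measurable_const bounded_measurable_monomial_product)
  also have "\<dots> = (\<Sum>a\<in>A. \<Sum>d\<in>A. of_real (c a * c d) * (\<Sum>p\<in>perms n. \<Sum>q\<in>perms n. monomial_form n \<beta> (a \<circ> p) (d \<circ> q)))"
    unfolding sum_distrib_left by (intro sum.cong refl sum.swap)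
  also have "\<dots> = ?N * (\<Sum>a\<in>A. \<Sum>d\<in>A. of_real (c a * c d) * (\<Sum>p\<in>perms n. monomial_form n \<beta> (a \<circ> p) d))"
    unfolding avg by (simp add: sum_distrib_left mult_ac)
  finally have "Re (weighted_integral n \<beta> (\<lambda>x. cnj (S x) * S x)) =
      real (card (perms n)) * (\<Sum>a\<in>A. \<Sum>d\<in>A. c a * c d * sym_form n \<beta> a d)"
    by (simp add: sym_form_def del: of_real_mult)
  with weighted_integral_norm_square_nonneg[of n \<beta> S] N show ?thesis
    by (auto simp: zero_le_mult_iff)
qed

text \<open>The coefficient with which the generator, up to sign, reproduces the monomial itself; by
  triangularity these are its eigenvalues.\<close>

definition diag_entry :: "nat \<Rightarrow> real \<Rightarrow> (nat \<Rightarrow> nat) \<Rightarrow> real" where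
  "diag_entry n \<beta> a = real (\<Sum>j\<in>{1..n}. (a j)\<^sup>2) + \<beta> / 4 * (\<Sum>k\<in>{1..n}. \<Sum>l\<in>{1..n}. \<bar>real (a k) - real (a l)\<bar>)"

text \<open>The loop equation with \<open>F\<close> the conjugate of a symmetrized monomial;
  differentiating \<open>F\<close> turns its left-hand side into the Dirichlet form.\<close>

lemma sym_monomial_equation:
  assumes b: "\<beta> > 0"
  shows "dirichlet_form n \<beta> b a = diag_entry n \<beta> a * sym_form n \<beta> b a +
    \<beta> / 4 * (\<Sum>k\<in>{1..n}. \<Sum>l\<in>{1..n}. \<bar>real (a k) - real (a l)\<bar> * (\<Sum>c\<in>between a k l. sym_form n \<beta> b (squeeze a k l c)))"
proof -
  define S where "S = (\<lambda>x. \<Sum>p\<in>perms n. monomial n (b \<circ> p) x)"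
  define S' where "S' = (\<lambda>j x. \<Sum>p\<in>perms n. monomial n (b \<circ> p) x * (\<i> * of_nat ((b \<circ> p) j)) * of_bool (j \<in> {1..n}))"
  have F: "smooth_torus n (\<lambda>x. cnj (S x)) (\<lambda>j x. cnj (S' j x))"
    unfolding S_def S'_def by (intro smooth_torus_cnj smooth_torus_sum smooth_torus_monomial) simp
  have sym: "symmetric_torus n (\<lambda>x. cnj (S x))"
    unfolding symmetric_torus_def
  proof (intro allI impI)
    fix q x assume q: "q permutes {1..n}"
    have "S (x \<circ> q) = (\<Sum>p\<in>perms n. monomial n (b \<circ> (p \<circ> q)) (x \<circ> q))"
      unfolding S_def by (rule sum_perms_comp[OF q, symmetric])
    also have "\<dots> = S x" unfolding S_def by (simp only: o_assoc monomial_permute[OF q])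
    finally show "cnj (S (x \<circ> q)) = cnj (S x)" by simp
  qed
  have I: "weighted_integral n \<beta> (\<lambda>x. cnj (S x) * monomial n a x) = (\<Sum>p\<in>perms n. monomial_form n \<beta> (b \<circ> p) a)" for a
    unfolding S_def cnj_sum sum_distrib_right monomial_form_def
    by (rule weighted_integral_sum[OF _ bounded_measurable_monomial_product b]) simp
  have "weighted_integral n \<beta> (\<lambda>x. (\<Sum>j\<in>{1..n}. cnj (S' j x) * (\<i> * of_nat (a j))) * monomial n a x) =
     weighted_integral n \<beta> (\<lambda>x. \<Sum>p\<in>perms n. (\<Sum>j\<in>{1..n}. of_nat (b (p j)) * of_nat (a j)) * (cnj (monomial n (b \<circ> p) x) * monomial n a x))"
  proof (rule arg_cong[where f="weighted_integral n \<beta>"], rule ext)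
    fix x
    have "(\<Sum>j\<in>{1..n}. cnj (S' j x) * (\<i> * of_nat (a j))) * monomial n a x =
       (\<Sum>j\<in>{1..n}. \<Sum>p\<in>perms n. of_nat (b (p j)) * of_nat (a j) * (cnj (monomial n (b \<circ> p) x) * monomial n a x))"
      unfolding sum_distrib_right
    proof (rule sum.cong[OF refl])
      fix j assume "j \<in> {1..n}"
      then have "cnj (S' j x) = (\<Sum>p\<in>perms n. cnj (monomial n (b \<circ> p) x) * (- \<i> * of_nat (b (p j))))"
        by (simp add: S'_def)
      then show "cnj (S' j x) * (\<i> * of_nat (a j)) * monomial n a x =
          (\<Sum>p\<in>perms n. of_nat (b (p j)) * of_nat (a j) * (cnj (monomial n (b \<circ> p) x) * monomial n a x))"
        by (simp only: sum_distrib_right) (rule sum.cong[OF refl], simp add: mult_ac)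
    qed
    also have "\<dots> = (\<Sum>p\<in>perms n. \<Sum>j\<in>{1..n}. of_nat (b (p j)) * of_nat (a j) * (cnj (monomial n (b \<circ> p) x) * monomial n a x))"
      by (rule sum.swap)
    finally show "(\<Sum>j\<in>{1..n}. cnj (S' j x) * (\<i> * of_nat (a j))) * monomial n a x =
      (\<Sum>p\<in>perms n. (\<Sum>j\<in>{1..n}. of_nat (b (p j)) * of_nat (a j)) * (cnj (monomial n (b \<circ> p) x) * monomial n a x))"
      by (simp only: sum_distrib_right)
  qed
  also have "\<dots> = (\<Sum>p\<in>perms n. (\<Sum>j\<in>{1..n}. of_nat (b (p j)) * of_nat (a j)) * monomial_form n \<beta> (b \<circ> p) a)"
    unfolding monomial_form_def weighted_integral_cmult[symmetric]
    by (rule weighted_integral_sum[OF _ _ b])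
       (auto intro!: bounded_measurable_mult bounded_measurable_const bounded_measurable_cnj bounded_measurable_monomial)
  finally have lhs: "Re (weighted_integral n \<beta> (\<lambda>x. (\<Sum>j\<in>{1..n}. cnj (S' j x) * (\<i> * of_nat (a j))) * monomial n a x)) =
     dirichlet_form n \<beta> b a"
    by (simp add: dirichlet_form_def sum_distrib_right)
  have R: "Re (of_real r * z) = r * Re z" for r z by simp
  have N: "Re (of_nat k * z) = real k * Re z" for k z by simp
  have "dirichlet_form n \<beta> b a = real (\<Sum>j\<in>{1..n}. (a j)\<^sup>2) * sym_form n \<beta> b a +
    \<beta> / 4 * (\<Sum>k\<in>{1..n}. \<Sum>l\<in>{1..n}. \<bar>real (a k) - real (a l)\<bar> * (sym_form n \<beta> b a + (\<Sum>c\<in>between a k l. sym_form n \<beta> b (squeeze a k l c))))"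
    unfolding lhs[symmetric] loop_equation[OF F sym b] I sym_form_def
    by (simp only: plus_complex.sel Re_sum R N)
  then show ?thesis
    by (simp add: diag_entry_def distrib_left distrib_right sum.distrib sum_distrib_right)
qed

text \<open>Exponents vanish off \<open>{1..n}\<close>, so the set is finite and serves as index set
  of a matrix.\<close>

definition degree_exponents :: "nat \<Rightarrow> nat \<Rightarrow> (nat \<Rightarrow> nat) set" where
  "degree_exponents n m = {a. (\<forall>j. j \<notin> {1..n} \<longrightarrow> a j = 0) \<and> (\<Sum>j\<in>{1..n}. a j) = m}"

lemma finite_degree_exponents: "finite (degree_exponents n m)"
proof (rule finite_subset)
  show "degree_exponents n m \<subseteq> {a. \<forall>j. (j \<in> {1..n} \<longrightarrow> a j \<in> {..m}) \<and> (j \<notin> {1..n} \<longrightarrow> a j = 0)}"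
    unfolding degree_exponents_def using member_le_sum[of _ "{1..n}"] by fastforce
  show "finite {a. \<forall>j. (j \<in> {1..n} \<longrightarrow> a j \<in> {..m}) \<and> (j \<notin> {1..n} \<longrightarrow> a j = (0::nat))}"
    by (rule finite_set_of_finite_funs) auto
qed

lemma sum_upd2:
  fixes g :: "nat \<Rightarrow> nat \<Rightarrow> 'a :: comm_monoid_add"
  assumes "k \<in> {1..n}" "l \<in> {1..n}" "k \<noteq> l"
  shows "(\<Sum>j\<in>{1..n}. g j ((a(k := p, l := q)) j)) = g k p + (g l q + (\<Sum>j\<in>{1..n} - {k} - {l}. g j (a j)))"
proof -
  have "(\<Sum>j\<in>{1..n}. g j ((a(k := p, l := q)) j)) = g k p + (g l q + (\<Sum>j\<in>{1..n} - {k} - {l}. g j ((a(k := p, l := q)) j)))"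
    using assms by (subst sum.remove[of _ k], simp, simp, subst sum.remove[of _ l]) auto
  also have "(\<Sum>j\<in>{1..n} - {k} - {l}. g j ((a(k := p, l := q)) j)) = (\<Sum>j\<in>{1..n} - {k} - {l}. g j (a j))"
    by (intro sum.cong) auto
  finally show ?thesis .
qed

lemma squeeze_in_degree_exponents:
  assumes a: "a \<in> degree_exponents n m" and kl: "k \<in> {1..n}" "l \<in> {1..n}" and c: "c \<in> between a k l"
  shows "squeeze a k l c \<in> degree_exponents n m"
proof -
  have ne: "k \<noteq> l" using c by auto
  have "(\<Sum>j\<in>{1..n}. squeeze a k l c j) = c + (a k + a l - c + (\<Sum>j\<in>{1..n} - {k} - {l}. a j))"
    unfolding squeeze_def by (rule sum_upd2[OF kl ne, of "\<lambda>_ y. y"])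
  also have "\<dots> = a k + (a l + (\<Sum>j\<in>{1..n} - {k} - {l}. a j))" using c by auto
  also have "\<dots> = (\<Sum>j\<in>{1..n}. a j)"
    using sum_upd2[OF kl ne, of "\<lambda>_ y. y" a "a k" "a l"] by simp
  finally show ?thesis using a kl by (auto simp: degree_exponents_def squeeze_def)
qed

lemma squeeze_sum_squares_less:
  assumes kl: "k \<in> {1..n}" "l \<in> {1..n}" and c: "c \<in> between a k l"
  shows "(\<Sum>j\<in>{1..n}. (squeeze a k l c j)\<^sup>2) < (\<Sum>j\<in>{1..n}. (a j)\<^sup>2)"
proof -
  have ne: "k \<noteq> l" using c by auto
  define R where "R = (\<Sum>j\<in>{1..n} - {k} - {l}. (a j)\<^sup>2)"
  have 1: "(\<Sum>j\<in>{1..n}. (squeeze a k l c j)\<^sup>2) = c\<^sup>2 + ((a k + a l - c)\<^sup>2 + R)"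
    unfolding squeeze_def R_def by (rule sum_upd2[OF kl ne, of "\<lambda>_ y. y\<^sup>2"])
  have 2: "(\<Sum>j\<in>{1..n}. (a j)\<^sup>2) = (a k)\<^sup>2 + ((a l)\<^sup>2 + R)"
    using sum_upd2[OF kl ne, of "\<lambda>_ y. y\<^sup>2" a "a k" "a l"] by (simp add: R_def)
  obtain p q where pq: "{p, q} = {a k, a l}" "q < c" "c < p"
    using c by (cases "a k < a l") (auto simp: insert_commute)
  have s: "a k + a l = p + q" "(a k)\<^sup>2 + (a l)\<^sup>2 = p\<^sup>2 + q\<^sup>2"
    using pq(1) by (auto simp: doubleton_eq_iff)
  \<comment> \<open>In these variables the loss in the sum of squares is
    \<open>2 * Suc u * Suc v\<close>.\<close>
  obtain u v where uv: "c = q + Suc u" "p = c + Suc v"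
    using pq(2,3) by (metis add_Suc_right less_iff_Suc_add)
  have "c\<^sup>2 + (p + q - c)\<^sup>2 < p\<^sup>2 + q\<^sup>2"
    unfolding uv by (simp add: power2_eq_square algebra_simps)
  then show ?thesis unfolding 1 2 using s by simp
qed

text \<open>Exponents with sum \<open>m\<close> have at most \<open>m\<close> nonzero entries, so at
  least \<open>n - m\<close> are zero. The pairs of a nonzero and a zero entry, in both orders,
  already contribute \<open>2 * m * (n - m)\<close> to the double sum.\<close>

lemma diag_entry_ge:
  assumes a: "a \<in> degree_exponents n m" and b: "\<beta> > 0" and mn: "m \<le> n"
  shows "\<beta> / 2 * (real m * (real n - real m)) \<le> diag_entry n \<beta> a"
proof -
  define Z where "Z = {j\<in>{1..n}. a j = 0}"
  define P where "P = {j\<in>{1..n}. a j \<noteq> 0}"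
  have ZP: "{1..n} = Z \<union> P" "Z \<inter> P = {}" "finite Z" "finite P" by (auto simp: Z_def P_def)
  have sumP: "(\<Sum>j\<in>P. a j) = m"
    using a unfolding degree_exponents_def P_def by (auto simp: sum.If_cases intro!: sum.mono_neutral_left)
  have "card P \<le> (\<Sum>j\<in>P. a j)"
    using sum_mono[of P "\<lambda>_. 1" a] by (auto simp: P_def)
  moreover have "n = card Z + card P"
    using card_Un_disjoint[OF ZP(3,4,2)] by (simp flip: ZP(1))
  ultimately have cZ: "real n - real m \<le> real (card Z)" using sumP by linarith
  let ?g = "\<lambda>k l. \<bar>real (a k) - real (a l)\<bar>"
  have PZ: "(\<Sum>k\<in>P. \<Sum>l\<in>Z. ?g k l) = real m * real (card Z)"
  proof -
    have "(\<Sum>k\<in>P. \<Sum>l\<in>Z. ?g k l) = (\<Sum>k\<in>P. \<Sum>l\<in>Z. real (a k))"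
      by (intro sum.cong refl) (auto simp: Z_def)
    also have "\<dots> = (\<Sum>k\<in>P. real (a k)) * real (card Z)"
      by (simp add: sum_distrib_right mult.commute[of "real (card Z)"])
    also have "(\<Sum>k\<in>P. real (a k)) = real m" by (simp add: sumP flip: of_nat_sum)
    finally show ?thesis .
  qed
  have "2 * (real m * real (card Z)) = (\<Sum>k\<in>P. \<Sum>l\<in>Z. ?g k l) + (\<Sum>k\<in>Z. \<Sum>l\<in>P. ?g k l)"
    using PZ sum.swap[of ?g P Z] by (simp add: abs_minus_commute)
  also have "\<dots> \<le> (\<Sum>k\<in>P. \<Sum>l\<in>{1..n}. ?g k l) + (\<Sum>k\<in>Z. \<Sum>l\<in>{1..n}. ?g k l)"
    by (intro add_mono sum_mono sum_mono2) (auto simp: Z_def P_def)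
  also have "\<dots> = (\<Sum>k\<in>{1..n}. \<Sum>l\<in>{1..n}. ?g k l)"
    by (subst (3) ZP(1), subst sum.union_disjoint) (use ZP in auto)
  finally have "2 * (real m * real (card Z)) \<le> (\<Sum>k\<in>{1..n}. \<Sum>l\<in>{1..n}. ?g k l)" .
  moreover have "real m * (real n - real m) \<le> real m * real (card Z)"
    using cZ by (intro mult_left_mono) auto
  ultimately have "2 * (real m * (real n - real m)) \<le> (\<Sum>k\<in>{1..n}. \<Sum>l\<in>{1..n}. ?g k l)" by linarith
  then have "\<beta> / 4 * (2 * (real m * (real n - real m))) \<le> \<beta> / 4 * (\<Sum>k\<in>{1..n}. \<Sum>l\<in>{1..n}. ?g k l)"
    using b by (intro mult_left_mono) auto
  moreover have "0 \<le> real (\<Sum>j\<in>{1..n}. (a j)\<^sup>2)" by (rule of_nat_0_le_iff)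
  ultimately show ?thesis unfolding diag_entry_def by simp
qed

text \<open>
  Squeezing two exponents towards each other decreases the sum of their squares, so the operator is triangular
  with respect to that rank.
\<close>

definition operator_entry :: "nat \<Rightarrow> real \<Rightarrow> (nat \<Rightarrow> nat) \<Rightarrow> (nat \<Rightarrow> nat) \<Rightarrow> real" where
  "operator_entry n \<beta> a d = diag_entry n \<beta> a * of_bool (d = a) +
    \<beta> / 4 * (\<Sum>k\<in>{1..n}. \<Sum>l\<in>{1..n}. \<bar>real (a k) - real (a l)\<bar> * (\<Sum>c\<in>between a k l. of_bool (d = squeeze a k l c)))"

text \<open>The matrix form of \<open>sym_monomial_equation\<close>. Squeezing preserves the degree,
  so every monomial that occurs there has its row in the matrix.\<close>

lemma sum_operator_entry:
  assumes a: "a \<in> degree_exponents n m" and b: "\<beta> > 0"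
  shows "(\<Sum>d\<in>degree_exponents n m. operator_entry n \<beta> a d * sym_form n \<beta> b d) = dirichlet_form n \<beta> b a"
proof -
  let ?A = "degree_exponents n m"
  have pick: "(\<Sum>d\<in>?A. of_bool (d = e) * f d) = f e" if "e \<in> ?A" for e and f :: "_ \<Rightarrow> real"
  proof -
    have "(\<Sum>d\<in>?A. of_bool (d = e) * f d) = (\<Sum>d\<in>{e}. of_bool (d = e) * f d)"
      using that finite_degree_exponents by (intro sum.mono_neutral_right) auto
    then show ?thesis by simp
  qed
  let ?h = "\<lambda>k l. \<bar>real (a k) - real (a l)\<bar>"
  have "(\<Sum>d\<in>?A. operator_entry n \<beta> a d * sym_form n \<beta> b d) =
    (\<Sum>d\<in>?A. diag_entry n \<beta> a * (of_bool (d = a) * sym_form n \<beta> b d)) +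
    (\<Sum>d\<in>?A. \<Sum>k\<in>{1..n}. \<Sum>l\<in>{1..n}. \<Sum>c\<in>between a k l. \<beta> / 4 * ?h k l * (of_bool (d = squeeze a k l c) * sym_form n \<beta> b d))"
    unfolding sum.distrib[symmetric]
    by (intro sum.cong refl) (simp only: operator_entry_def distrib_right sum_distrib_left sum_distrib_right mult.assoc)
  also have "(\<Sum>d\<in>?A. diag_entry n \<beta> a * (of_bool (d = a) * sym_form n \<beta> b d)) = diag_entry n \<beta> a * sym_form n \<beta> b a"
    unfolding sum_distrib_left[symmetric] pick[OF a] ..
  also have "(\<Sum>d\<in>?A. \<Sum>k\<in>{1..n}. \<Sum>l\<in>{1..n}. \<Sum>c\<in>between a k l. \<beta> / 4 * ?h k l * (of_bool (d = squeeze a k l c) * sym_form n \<beta> b d)) =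
    (\<Sum>k\<in>{1..n}. \<Sum>l\<in>{1..n}. \<Sum>c\<in>between a k l. \<Sum>d\<in>?A. \<beta> / 4 * ?h k l * (of_bool (d = squeeze a k l c) * sym_form n \<beta> b d))"
    by (subst sum.swap, rule sum.cong[OF refl], subst sum.swap, rule sum.cong[OF refl], rule sum.swap)
  also have "\<dots> = (\<Sum>k\<in>{1..n}. \<Sum>l\<in>{1..n}. \<Sum>c\<in>between a k l. \<beta> / 4 * ?h k l * sym_form n \<beta> b (squeeze a k l c))"
    unfolding sum_distrib_left[symmetric]
    by (intro sum.cong refl arg_cong2[where f="(*)"] pick squeeze_in_degree_exponents[OF a]) auto
  also have "\<dots> = \<beta> / 4 * (\<Sum>k\<in>{1..n}. \<Sum>l\<in>{1..n}. ?h k l * (\<Sum>c\<in>between a k l. sym_form n \<beta> b (squeeze a k l c)))"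
    by (simp only: sum_distrib_left mult.assoc)
  finally show ?thesis unfolding sym_monomial_equation[OF b] .
qed

text \<open>The operator is symmetric for \<open>sym_form\<close> because pairing it with either
  argument gives the symmetric \<open>dirichlet_form\<close>. The bound for quadratic forms is then
  tested on the single exponent \<open>a\<close>.\<close>

lemma spectral_gap:
  assumes a: "a \<in> degree_exponents n m" and b: "\<beta> > 0" and mn: "m \<le> n"
  shows "\<beta> / 2 * (real m * (real n - real m)) * sym_form n \<beta> a a \<le> dirichlet_form n \<beta> a a"
proof -
  let ?A = "degree_exponents n m"
  let ?\<kappa> = "\<beta> / 2 * (real m * (real n - real m))"
  let ?D = "operator_entry n \<beta>"
  let ?B = "sym_form n \<beta>"
  define c where "c = (\<lambda>d. of_bool (d = a) :: real)"
  have pick: "(\<Sum>d\<in>?A. c d * f d) = f a" for f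
  proof -
    have "(\<Sum>d\<in>?A. c d * f d) = (\<Sum>d\<in>{a}. c d * f d)"
      using a finite_degree_exponents by (intro sum.mono_neutral_right) (auto simp: c_def)
    then show ?thesis by (simp add: c_def)
  qed
  have "?\<kappa> * (\<Sum>a\<in>?A. \<Sum>b\<in>?A. c a * c b * ?B a b)
    \<le> (\<Sum>a\<in>?A. \<Sum>b\<in>?A. c a * c b * (\<Sum>d\<in>?A. ?D a d * ?B b d))"
  proof (rule triangular_symmetric_lower_bound[where r="\<lambda>a. \<Sum>j\<in>{1..n}. (a j)\<^sup>2"])
    show "finite ?A" by (rule finite_degree_exponents)
    show "?B a d = ?B d a" for a d by (rule sym_form_commute[OF b])
    show "0 \<le> (\<Sum>a\<in>?A. \<Sum>d\<in>?A. c a * c d * ?B a d)" for c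
      by (rule sym_form_nonneg[OF finite_degree_exponents b])
    show "(\<Sum>d\<in>?A. ?D a d * ?B e d) = (\<Sum>d\<in>?A. ?D e d * ?B a d)" if "a \<in> ?A" "e \<in> ?A" for a e
      using sum_operator_entry[OF that(1) b, of e] sum_operator_entry[OF that(2) b, of a]
        dirichlet_form_commute[OF b, of n e a] by simp
    show "?\<kappa> \<le> ?D a a" if "a \<in> ?A" for a
    proof -
      have "0 \<le> \<beta> / 4 * (\<Sum>k\<in>{1..n}. \<Sum>l\<in>{1..n}. \<bar>real (a k) - real (a l)\<bar> * (\<Sum>c\<in>between a k l. of_bool (a = squeeze a k l c)))"
        using b by (intro mult_nonneg_nonneg sum_nonneg) auto
      then show ?thesis using diag_entry_ge[OF that b mn] unfolding operator_entry_def by simp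
    qed
    show "(\<Sum>j\<in>{1..n}. (d j)\<^sup>2) < (\<Sum>j\<in>{1..n}. (a j)\<^sup>2)" if "a \<noteq> d" "?D a d \<noteq> 0" for a d
    proof (rule ccontr)
      assume not: "\<not> ?thesis"
      have "d \<noteq> squeeze a k l c" if "k \<in> {1..n}" "l \<in> {1..n}" "c \<in> between a k l" for k l c
        using squeeze_sum_squares_less[OF that] not by auto
      then have "(\<Sum>k\<in>{1..n}. \<Sum>l\<in>{1..n}. \<bar>real (a k) - real (a l)\<bar> * (\<Sum>c\<in>between a k l. of_bool (d = squeeze a k l c))) = 0"
        by (intro sum.neutral ballI) (simp del: atLeastAtMost_iff)
      then have "?D a d = 0" using \<open>a \<noteq> d\<close> unfolding operator_entry_def by simp
      then show False using \<open>?D a d \<noteq> 0\<close> by simp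
    qed
  qed
  moreover have "(\<Sum>a\<in>?A. \<Sum>b\<in>?A. c a * c b * f a b) = f a a" for f
    using pick[of "\<lambda>e. f e a"] pick[of "f _"] by (simp only: mult.assoc sum_distrib_left[symmetric])
  ultimately show ?thesis unfolding sum_operator_entry[OF a b, symmetric] by simp
qed

section \<open>Power sums\<close>

definition single_exponent :: "nat \<Rightarrow> nat \<Rightarrow> nat \<Rightarrow> nat" where
  "single_exponent m j = (\<lambda>i. if i = j then m else 0)"

lemma monomial_single:
  assumes "j \<in> {1..n}"
  shows "monomial n (single_exponent m j) x = cis (x j) ^ m"
proof -
  have "(\<Prod>i\<in>{1..n}. cis (x i) ^ single_exponent m j i) = (\<Prod>i\<in>{j}. cis (x i) ^ single_exponent m j i)"
    using assms by (intro prod.mono_neutral_right) (auto simp: single_exponent_def)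
  then show ?thesis by (simp add: monomial_def single_exponent_def)
qed

lemma power_sum_eq: "power_sum n m x = (\<Sum>j\<in>{1..n}. monomial n (single_exponent m j) x)"
  unfolding power_sum_def by (intro sum.cong refl) (simp add: monomial_single del: atLeastAtMost_iff)

lemma smooth_torus_power_sum:
  "smooth_torus n (power_sum n m) (\<lambda>j x. \<i> * of_nat m * cis (x j) ^ m * of_bool (j \<in> {1..n}))"
proof -
  have "smooth_torus n (\<lambda>x. \<Sum>k\<in>{1..n}. cis (x k) ^ m)
    (\<lambda>j x. \<Sum>k\<in>{1..n}. cis (x k) ^ m * (\<i> * of_nat m * of_bool (j = k)))"
    by (intro smooth_torus_sum smooth_torus_cis_power) auto
  moreover have "(\<Sum>k\<in>{1..n}. cis (x k) ^ m * (\<i> * of_nat m * of_bool (j = k))) =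
     \<i> * of_nat m * cis (x j) ^ m * of_bool (j \<in> {1..n})" for j :: nat and x :: "nat \<Rightarrow> real"
  proof (cases "j \<in> {1..n}")
    case True
    then have "(\<Sum>k\<in>{1..n}. cis (x k) ^ m * (\<i> * of_nat m * of_bool (j = k))) =
      (\<Sum>k\<in>{j}. cis (x k) ^ m * (\<i> * of_nat m * of_bool (j = k)))"
      by (intro sum.mono_neutral_right) auto
    then show ?thesis using True by simp
  qed (auto intro!: sum.neutral)
  ultimately show ?thesis by (simp add: power_sum_def[abs_def])
qed

lemma bounded_measurable_power_sum: "bounded_measurable n (power_sum n m)"
  by (rule bounded_measurable_smooth[OF smooth_torus_power_sum])

lemma power_sum_permute:
  assumes "p permutes {1..n}"
  shows "power_sum n m (x \<circ> p) = power_sum n m x"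
  unfolding power_sum_def using sum.permute[OF assms, of "\<lambda>j. cis (x j) ^ m"] by (simp add: comp_def)

lemma norm_power_sum_le: "cmod (power_sum n m x) \<le> real n"
  unfolding power_sum_def by (rule order_trans[OF norm_sum]) (simp add: norm_power)

text \<open>Composition with a transposition is a bijection, so each value of \<open>p 1\<close> is
  taken equally often. The count \<open>N\<close> is left unevaluated since it cancels in
  \<open>power_sum_second_moment\<close>.\<close>

lemma sum_perms_fix:
  fixes f :: "nat \<Rightarrow> complex"
  assumes "1 \<in> {1..n}"
  defines "N \<equiv> card {p \<in> perms n. p 1 = 1}"
  shows "(\<Sum>p\<in>perms n. f (p 1)) = of_nat N * (\<Sum>j\<in>{1..n}. f j)"
proof -
  have "(\<Sum>p\<in>perms n. f (p 1)) = (\<Sum>j\<in>{1..n}. \<Sum>p\<in>{p \<in> perms n. p 1 = j}. f (p 1))"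
  proof (rule sum.group[symmetric])
    show "(\<lambda>p. p 1) ` perms n \<subseteq> {1..n}"
      using assms(1) by (auto simp: mem_perms permutes_in_image simp del: atLeastAtMost_iff)
  qed auto
  also have "\<dots> = (\<Sum>j\<in>{1..n}. of_nat N * f j)"
  proof (rule sum.cong[OF refl])
    fix j assume j: "j \<in> {1..n}"
    let ?t = "Transposition.transpose 1 j"
    have t: "?t permutes {1..n}" by (rule transpose_permutes[OF assms(1) j])
    have "bij_betw (\<lambda>p. ?t \<circ> p) {p \<in> perms n. p 1 = 1} {p \<in> perms n. p 1 = j}"
      by (rule bij_betw_byWitness[where f'="\<lambda>p. ?t \<circ> p"])
         (use t in \<open>auto simp: mem_perms o_assoc[symmetric] fun_eq_iff intro: permutes_compose\<close>)
    then have "card {p \<in> perms n. p 1 = j} = N" unfolding N_def by (simp add: bij_betw_same_card)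
    moreover have "(\<Sum>p\<in>{p \<in> perms n. p 1 = j}. f (p 1)) = (\<Sum>p\<in>{p \<in> perms n. p 1 = j}. f j)"
      by (rule sum.cong) auto
    ultimately show "(\<Sum>p\<in>{p \<in> perms n. p 1 = j}. f (p 1)) = of_nat N * f j" by simp
  qed
  finally show ?thesis by (simp add: sum_distrib_left)
qed

text \<open>The exponent \<open>m\<close> at the index 1 symmetrizes to a multiple of the power sum,
  so its \<open>sym_form\<close> is \<open>N / n\<close> times the second moment. Its Dirichlet form
  is \<open>N * m\<^sup>2\<close> times the mass. The spectral gap compares the two.\<close>

lemma power_sum_second_moment:
  assumes b: "\<beta> > 0" and m: "0 < m" "m < n"
  shows "Re (weighted_integral n \<beta> (\<lambda>x. cnj (power_sum n m x) * power_sum n m x)) \<le>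
    2 * real m * real n / (\<beta> * (real n - real m)) * Re (weighted_integral n \<beta> (\<lambda>_. 1))"
proof -
  have one: "1 \<in> {1..n}" using m by simp
  define N where "N = card {p \<in> perms n. p 1 = 1}"
  define a where "a = single_exponent m 1"
  define E where "E = Re (weighted_integral n \<beta> (\<lambda>x. cnj (power_sum n m x) * power_sum n m x))"
  define Z where "Z = Re (weighted_integral n \<beta> (\<lambda>_. 1))"
  have "id \<in> {p \<in> perms n. p 1 = 1}" by (simp add: mem_perms permutes_id)
  then have N: "N > 0" unfolding N_def by (auto simp: card_gt_0_iff)
  have bm: "bounded_measurable n (\<lambda>x. cnj (power_sum n m x) * monomial n a x)" for a
    by (intro bounded_measurable_mult bounded_measurable_cnj bounded_measurable_power_sum bounded_measurable_monomial)
  have a: "a \<in> degree_exponents n m"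
  proof -
    have "(\<Sum>j\<in>{1..n}. a j) = (\<Sum>j\<in>{1}. a j)"
      using one by (intro sum.mono_neutral_right) (auto simp: a_def single_exponent_def)
    then show ?thesis using one by (auto simp: degree_exponents_def a_def single_exponent_def)
  qed
  have comp: "a \<circ> inv p = single_exponent m (p 1)" if "p permutes {1..n}" for p
  proof -
    have "inv p x = 1 \<longleftrightarrow> x = p 1" for x
      using permutes_inverses[OF that] by metis
    then show ?thesis by (simp add: a_def single_exponent_def fun_eq_iff)
  qed
  have sym_eq: "real n * sym_form n \<beta> a a = real N * E"
  proof -
    have "(\<Sum>p\<in>perms n. monomial_form n \<beta> (a \<circ> p) a) = (\<Sum>p\<in>perms n. monomial_form n \<beta> (a \<circ> inv p) a)"
      by (rule sum_perms_inv[symmetric])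
    also have "\<dots> = (\<Sum>p\<in>perms n. monomial_form n \<beta> (single_exponent m (p 1)) a)"
      by (rule sum.cong[OF refl]) (simp add: comp mem_perms)
    also have "\<dots> = of_nat N * (\<Sum>j\<in>{1..n}. monomial_form n \<beta> (single_exponent m j) a)"
      unfolding N_def by (rule sum_perms_fix[OF one])
    also have "(\<Sum>j\<in>{1..n}. monomial_form n \<beta> (single_exponent m j) a) = weighted_integral n \<beta> (\<lambda>x. cnj (power_sum n m x) * monomial n a x)"
      unfolding power_sum_eq cnj_sum sum_distrib_right monomial_form_def
      by (rule weighted_integral_sum[OF _ bounded_measurable_monomial_product b, symmetric]) simp
    finally have 1: "sym_form n \<beta> a a = real N * Re (weighted_integral n \<beta> (\<lambda>x. cnj (power_sum n m x) * monomial n a x))"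
      by (simp only: sym_form_def) simp
    have 2: "weighted_integral n \<beta> (\<lambda>x. cnj (power_sum n m x) * monomial n (single_exponent m j) x) =
        weighted_integral n \<beta> (\<lambda>x. cnj (power_sum n m x) * monomial n a x)" if j: "j \<in> {1..n}" for j
    proof -
      let ?t = "Transposition.transpose 1 j"
      have t: "?t permutes {1..n}" by (rule transpose_permutes[OF one j])
      have "weighted_integral n \<beta> (\<lambda>x. cnj (power_sum n m x) * monomial n a x) =
        weighted_integral n \<beta> (\<lambda>x. (\<lambda>x. cnj (power_sum n m x) * monomial n a x) (x \<circ> ?t))"
        by (rule weighted_integral_permute[OF bm t b, symmetric])
      then show ?thesis
        unfolding a_def power_sum_permute[OF t] monomial_single[OF one] monomial_single[OF j] by simp
    qed
    have "weighted_integral n \<beta> (\<lambda>x. cnj (power_sum n m x) * power_sum n m x) =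
       (\<Sum>j\<in>{1..n}. weighted_integral n \<beta> (\<lambda>x. cnj (power_sum n m x) * monomial n (single_exponent m j) x))"
      unfolding power_sum_eq[of n m] sum_distrib_left
      unfolding power_sum_eq[of n m, symmetric]
      by (rule weighted_integral_sum[OF _ bm b]) simp
    also have "\<dots> = of_nat n * weighted_integral n \<beta> (\<lambda>x. cnj (power_sum n m x) * monomial n a x)"
      using 2 by simp
    finally show ?thesis unfolding 1 E_def by simp
  qed
  have dir_eq: "dirichlet_form n \<beta> a a = real N * (real m)\<^sup>2 * Z"
  proof -
    \<comment> \<open>The product of exponents vanishes unless \<open>j = 1\<close> and
      \<open>p 1 = 1\<close>; then the two monomials are conjugate to each other and their product
      is 1.\<close>
    have inner: "(\<Sum>j\<in>{1..n}. of_nat (a (p j)) * of_nat (a j) * monomial_form n \<beta> (a \<circ> p) a) =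
       (if p 1 = 1 then of_nat m ^ 2 * weighted_integral n \<beta> (\<lambda>_. 1) else 0)" if "p \<in> perms n" for p
    proof -
      have p: "p permutes {1..n}" using that by (simp add: mem_perms)
      have "(\<Sum>j\<in>{1..n}. of_nat (a (p j)) * of_nat (a j) * monomial_form n \<beta> (a \<circ> p) a) =
        (\<Sum>j\<in>{1}. of_nat (a (p j)) * of_nat (a j) * monomial_form n \<beta> (a \<circ> p) a)"
        using one by (intro sum.mono_neutral_right) (auto simp: a_def single_exponent_def)
      also have "\<dots> = of_nat (a (p 1)) * of_nat m * monomial_form n \<beta> (a \<circ> p) a"
        by (simp add: a_def single_exponent_def)
      also have "\<dots> = (if p 1 = 1 then of_nat m ^ 2 * weighted_integral n \<beta> (\<lambda>_. 1) else 0)"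
      proof (cases "p 1 = 1")
        case True
        have "p j = 1 \<longleftrightarrow> j = 1" for j using True permutes_inj[OF p] by (metis injD)
        then have "a \<circ> p = a" by (auto simp: a_def single_exponent_def fun_eq_iff)
        moreover have "cnj (monomial n a x) * monomial n a x = 1" for x
          using complex_norm_square[of "monomial n a x"] by (simp add: norm_monomial mult.commute)
        ultimately show ?thesis using True by (simp add: monomial_form_def power2_eq_square a_def single_exponent_def)
      qed (simp add: a_def single_exponent_def)
      finally show ?thesis .
    qed
    have "(\<Sum>p\<in>perms n. \<Sum>j\<in>{1..n}. of_nat (a (p j)) * of_nat (a j) * monomial_form n \<beta> (a \<circ> p) a) =
      (\<Sum>p\<in>perms n. if p 1 = 1 then of_nat m ^ 2 * weighted_integral n \<beta> (\<lambda>_. 1) else 0)"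
      by (rule sum.cong[OF refl inner])
    also have "\<dots> = of_nat N * (of_nat m ^ 2 * weighted_integral n \<beta> (\<lambda>_. 1))"
      by (simp add: N_def sum.inter_filter[symmetric])
    finally have "(\<Sum>p\<in>perms n. \<Sum>j\<in>{1..n}. of_nat (a (p j)) * of_nat (a j) * monomial_form n \<beta> (a \<circ> p) a) =
      complex_of_real (real N * (real m)\<^sup>2) * weighted_integral n \<beta> (\<lambda>_. 1)" by simp
    then show ?thesis
      unfolding dirichlet_form_def Z_def by (simp only: Re_complex_of_real times_complex.sel Im_complex_of_real)
  qed
  have "\<beta> / 2 * (real m * (real n - real m)) * sym_form n \<beta> a a \<le> real N * (real m)\<^sup>2 * Z"
    using spectral_gap[OF a b] m dir_eq by simp
  then have "\<beta> / 2 * (real m * (real n - real m)) * (real n * sym_form n \<beta> a a) \<le> real n * (real N * (real m)\<^sup>2 * Z)"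
    using m mult_left_mono[of _ _ "real n"] by (simp add: mult_ac)
  then have "(real N * real m) * (\<beta> / 2 * (real n - real m) * E) \<le> (real N * real m) * (real n * real m * Z)"
    unfolding sym_eq by (simp add: power2_eq_square mult_ac)
  then have "\<beta> / 2 * (real n - real m) * E \<le> real n * real m * Z"
    using N m by (simp add: mult_le_cancel_left_pos)
  then show ?thesis
    unfolding E_def[symmetric] Z_def[symmetric] using b m by (simp add: field_simps)
qed

text \<open>Only the pairs that contain \<open>j\<close> have different exponents, and each of them
  is counted in two orders.\<close>

lemma single_exponent_difference_sum:
  fixes g :: "nat \<Rightarrow> nat \<Rightarrow> complex"
  assumes j: "j \<in> {1..n}" and g: "\<And>k l. k \<noteq> l \<Longrightarrow> g k l = g l k"
  shows "(\<Sum>k\<in>{1..n}. \<Sum>l\<in>{1..n}. of_real \<bar>real (single_exponent m j k) - real (single_exponent m j l)\<bar> * g k l) =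
    2 * of_nat m * (\<Sum>l\<in>{1..n} - {j}. g j l)"
proof -
  let ?h = "\<lambda>k l. of_real \<bar>real (single_exponent m j k) - real (single_exponent m j l)\<bar> * g k l"
  have jj: "(\<Sum>l\<in>{1..n}. ?h j l) = of_nat m * (\<Sum>l\<in>{1..n} - {j}. g j l)"
    using j by (subst sum.remove[OF _ j]) (auto simp: single_exponent_def sum_distrib_left intro!: sum.cong)
  have "(\<Sum>l\<in>{1..n}. ?h k l) = of_nat m * g j k" if "k \<in> {1..n} - {j}" for k
  proof -
    have "(\<Sum>l\<in>{1..n}. ?h k l) = (\<Sum>l\<in>{j}. ?h k l)"
      using j that by (intro sum.mono_neutral_right) (auto simp: single_exponent_def)
    then show ?thesis using that g[of k j] by (simp add: single_exponent_def)
  qed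
  then have "(\<Sum>k\<in>{1..n} - {j}. \<Sum>l\<in>{1..n}. ?h k l) = (\<Sum>k\<in>{1..n} - {j}. of_nat m * g j k)"
    by (intro sum.cong refl)
  moreover have "(\<Sum>k\<in>{1..n}. \<Sum>l\<in>{1..n}. ?h k l) = (\<Sum>l\<in>{1..n}. ?h j l) + (\<Sum>k\<in>{1..n} - {j}. \<Sum>l\<in>{1..n}. ?h k l)"
    by (rule sum.remove[OF _ j]) simp
  ultimately show ?thesis
    unfolding jj sum_distrib_left[symmetric] by simp
qed

text \<open>The loop equation with exponent \<open>m\<close> at a single angle, divided by
  \<open>m\<close> and summed over the angles. Completing the sums over \<open>l\<close> different
  from \<open>j\<close> to products of power sums costs one \<open>power_sum n m\<close> for each of
  the \<open>m - 1\<close> values of \<open>c\<close>; this turns the factor \<open>n - 1\<close>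
  into \<open>n - m\<close>.\<close>

theorem power_sum_loop_equation:
  assumes F: "smooth_torus n F F'" "symmetric_torus n F" and b: "\<beta> > 0" and m: "0 < m"
  shows "weighted_integral n \<beta> (\<lambda>x. \<Sum>j\<in>{1..n}. F' j x * \<i> * cis (x j) ^ m) =
    of_real (real m + \<beta> / 2 * (real n - real m)) * weighted_integral n \<beta> (\<lambda>x. F x * power_sum n m x) +
    of_real (\<beta> / 2) * (\<Sum>c\<in>{0<..<m}. weighted_integral n \<beta> (\<lambda>x. F x * (power_sum n c x * power_sum n (m - c) x)))"
proof -
  define J where "J = weighted_integral n \<beta>"
  have Fb: "bounded_measurable n F" by (rule bounded_measurable_smooth[OF F(1)])
  note F'b = bounded_measurable_smooth(2)[OF F(1)]
  have cis: "bounded_measurable n (\<lambda>x. cis (x j) ^ c)" if "j \<in> {1..n}" for j c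
    by (rule bounded_measurable_smooth[OF smooth_torus_cis_power[OF that]])
  note bm = bounded_measurable_mult bounded_measurable_const Fb F'b cis
  let ?e = "single_exponent m"
  have main: "of_nat m * J (\<lambda>x. F' j x * \<i> * cis (x j) ^ m) = of_nat m *
    (of_nat m * J (\<lambda>x. F x * cis (x j) ^ m) + of_real (\<beta> / 2) *
      (\<Sum>l\<in>{1..n} - {j}. J (\<lambda>x. F x * cis (x j) ^ m) + (\<Sum>c\<in>{0<..<m}. J (\<lambda>x. F x * (cis (x j) ^ c * cis (x l) ^ (m - c))))))"
    if j: "j \<in> {1..n}" for j
  proof -
    let ?I = "\<lambda>a. weighted_integral n \<beta> (\<lambda>x. F x * monomial n a x)"
    let ?g = "\<lambda>k l. ?I (?e j) + (\<Sum>c\<in>between (?e j) k l. ?I (squeeze (?e j) k l c))"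
    have "(\<Sum>i\<in>{1..n}. F' i x * (\<i> * of_nat (?e j i))) * monomial n (?e j) x = of_nat m * (F' j x * \<i> * cis (x j) ^ m)" for x
    proof -
      have "(\<Sum>i\<in>{1..n}. F' i x * (\<i> * of_nat (?e j i))) = (\<Sum>i\<in>{j}. F' i x * (\<i> * of_nat (?e j i)))"
        using j by (intro sum.mono_neutral_right) (auto simp: single_exponent_def)
      then show ?thesis unfolding monomial_single[OF j] by (simp add: single_exponent_def)
    qed
    then have "of_nat m * J (\<lambda>x. F' j x * \<i> * cis (x j) ^ m) =
      weighted_integral n \<beta> (\<lambda>x. (\<Sum>i\<in>{1..n}. F' i x * (\<i> * of_nat (?e j i))) * monomial n (?e j) x)"
      by (simp add: J_def weighted_integral_cmult)
    also have "\<dots> = of_nat (\<Sum>i\<in>{1..n}. (?e j i)\<^sup>2) * ?I (?e j) +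
      of_real (\<beta> / 4) * (\<Sum>k\<in>{1..n}. \<Sum>l\<in>{1..n}. of_real \<bar>real (?e j k) - real (?e j l)\<bar> * ?g k l)"
      by (rule loop_equation[OF F b])
    also have "(\<Sum>k\<in>{1..n}. \<Sum>l\<in>{1..n}. of_real \<bar>real (?e j k) - real (?e j l)\<bar> * ?g k l) =
      2 * of_nat m * (\<Sum>l\<in>{1..n} - {j}. ?g j l)"
      by (rule single_exponent_difference_sum[OF j])
         (rule arg_cong2[where f="(+)", OF refl squeeze_commute[where f="?I"]], simp)
    also have "(\<Sum>i\<in>{1..n}. (?e j i)\<^sup>2) = m\<^sup>2"
    proof -
      have "(\<Sum>i\<in>{1..n}. (?e j i)\<^sup>2) = (\<Sum>i\<in>{j}. (?e j i)\<^sup>2)"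
        using j by (intro sum.mono_neutral_right) (auto simp: single_exponent_def)
      then show ?thesis by (simp add: single_exponent_def)
    qed
    also have "(\<Sum>l\<in>{1..n} - {j}. ?g j l) =
      (\<Sum>l\<in>{1..n} - {j}. J (\<lambda>x. F x * cis (x j) ^ m) + (\<Sum>c\<in>{0<..<m}. J (\<lambda>x. F x * (cis (x j) ^ c * cis (x l) ^ (m - c)))))"
    proof (rule sum.cong[OF refl])
      fix l assume l: "l \<in> {1..n} - {j}"
      have "monomial n (squeeze (?e j) j l c) x = cis (x j) ^ c * cis (x l) ^ (m - c)" for c x
      proof -
        have "(\<Prod>i\<in>{1..n} - {j} - {l}. cis (x i) ^ ?e j i) = 1"
          by (rule prod.neutral) (auto simp: single_exponent_def)
        then show ?thesis
          unfolding squeeze_def using l j by (subst monomial_upd2) (auto simp: single_exponent_def)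
      qed
      moreover have "between (?e j) j l = {0<..<m}" using l by (auto simp: single_exponent_def)
      ultimately show "?g j l = J (\<lambda>x. F x * cis (x j) ^ m) + (\<Sum>c\<in>{0<..<m}. J (\<lambda>x. F x * (cis (x j) ^ c * cis (x l) ^ (m - c))))"
        unfolding J_def monomial_single[OF j] by simp
    qed
    finally show ?thesis unfolding monomial_single[OF j] J_def[symmetric]
      by (simp add: power2_eq_square algebra_simps)
  qed
  have eq: "J (\<lambda>x. F' j x * \<i> * cis (x j) ^ m) =
    of_nat m * J (\<lambda>x. F x * cis (x j) ^ m) + of_real (\<beta> / 2) *
      (\<Sum>l\<in>{1..n} - {j}. J (\<lambda>x. F x * cis (x j) ^ m) + (\<Sum>c\<in>{0<..<m}. J (\<lambda>x. F x * (cis (x j) ^ c * cis (x l) ^ (m - c)))))"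
    if j: "j \<in> {1..n}" for j
    using main[OF that] m by simp
  have pm: "(\<Sum>j\<in>{1..n}. J (\<lambda>x. F x * cis (x j) ^ m)) = J (\<lambda>x. F x * power_sum n m x)"
    unfolding J_def power_sum_def sum_distrib_left
    by (rule weighted_integral_sum[symmetric, OF _ _ b]) (auto intro!: bm)
  \<comment> \<open>The missing diagonal \<open>l = j\<close> of the product of two power sums is
    the power sum of the total index \<open>m\<close>.\<close>
  have pc: "(\<Sum>j\<in>{1..n}. \<Sum>l\<in>{1..n} - {j}. J (\<lambda>x. F x * (cis (x j) ^ c * cis (x l) ^ (m - c)))) =
     J (\<lambda>x. F x * (power_sum n c x * power_sum n (m - c) x)) - J (\<lambda>x. F x * power_sum n m x)" if c: "c \<in> {0<..<m}" for c
  proof -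
    have "J (\<lambda>x. F x * (power_sum n c x * power_sum n (m - c) x)) =
      J (\<lambda>x. \<Sum>j\<in>{1..n}. \<Sum>l\<in>{1..n}. F x * (cis (x j) ^ c * cis (x l) ^ (m - c)))"
      unfolding power_sum_def unfolding sum_product unfolding sum_distrib_left ..
    also have "\<dots> = (\<Sum>j\<in>{1..n}. \<Sum>l\<in>{1..n}. J (\<lambda>x. F x * (cis (x j) ^ c * cis (x l) ^ (m - c))))"
      unfolding J_def
      by (subst weighted_integral_sum[OF _ _ b], simp, intro bounded_measurable_sum bm, simp_all del: atLeastAtMost_iff,
          intro sum.cong refl weighted_integral_sum[OF _ _ b] bm, simp_all del: atLeastAtMost_iff)
    also have "\<dots> = (\<Sum>j\<in>{1..n}. J (\<lambda>x. F x * cis (x j) ^ m) + (\<Sum>l\<in>{1..n} - {j}. J (\<lambda>x. F x * (cis (x j) ^ c * cis (x l) ^ (m - c)))))"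
    proof (rule sum.cong[OF refl])
      fix j assume j: "j \<in> {1..n}"
      have "cis (x j) ^ c * cis (x j) ^ (m - c) = cis (x j) ^ m" for x :: "nat \<Rightarrow> real"
        using c by (simp flip: power_add)
      then show "(\<Sum>l\<in>{1..n}. J (\<lambda>x. F x * (cis (x j) ^ c * cis (x l) ^ (m - c)))) =
        J (\<lambda>x. F x * cis (x j) ^ m) + (\<Sum>l\<in>{1..n} - {j}. J (\<lambda>x. F x * (cis (x j) ^ c * cis (x l) ^ (m - c))))"
        by (subst sum.remove[OF _ j]) simp_all
    qed
    finally show ?thesis unfolding sum.distrib pm by simp
  qed
  have "J (\<lambda>x. \<Sum>j\<in>{1..n}. F' j x * \<i> * cis (x j) ^ m) = (\<Sum>j\<in>{1..n}. J (\<lambda>x. F' j x * \<i> * cis (x j) ^ m))"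
    unfolding J_def by (rule weighted_integral_sum[OF _ _ b]) (auto intro!: bm simp del: atLeastAtMost_iff)
  also have "\<dots> = (\<Sum>j\<in>{1..n}. of_nat m * J (\<lambda>x. F x * cis (x j) ^ m) + of_real (\<beta> / 2) *
      (of_nat (n - 1) * J (\<lambda>x. F x * cis (x j) ^ m) + (\<Sum>l\<in>{1..n} - {j}. \<Sum>c\<in>{0<..<m}. J (\<lambda>x. F x * (cis (x j) ^ c * cis (x l) ^ (m - c))))))"
  proof (rule sum.cong[OF refl])
    fix j assume j: "j \<in> {1..n}"
    then have "card ({1..n} - {j}) = n - 1" by simp
    then show "J (\<lambda>x. F' j x * \<i> * cis (x j) ^ m) = of_nat m * J (\<lambda>x. F x * cis (x j) ^ m) + of_real (\<beta> / 2) *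
      (of_nat (n - 1) * J (\<lambda>x. F x * cis (x j) ^ m) + (\<Sum>l\<in>{1..n} - {j}. \<Sum>c\<in>{0<..<m}. J (\<lambda>x. F x * (cis (x j) ^ c * cis (x l) ^ (m - c)))))"
      unfolding eq[OF j] sum.distrib sum_constant by (simp only:)
  qed
  also have "\<dots> = of_nat m * J (\<lambda>x. F x * power_sum n m x) + of_real (\<beta> / 2) *
      (of_nat (n - 1) * J (\<lambda>x. F x * power_sum n m x) + (\<Sum>j\<in>{1..n}. \<Sum>l\<in>{1..n} - {j}. \<Sum>c\<in>{0<..<m}. J (\<lambda>x. F x * (cis (x j) ^ c * cis (x l) ^ (m - c)))))"
    unfolding sum.distrib sum_distrib_left[symmetric] sum.distrib pm ..
  also have "(\<Sum>j\<in>{1..n}. \<Sum>l\<in>{1..n} - {j}. \<Sum>c\<in>{0<..<m}. J (\<lambda>x. F x * (cis (x j) ^ c * cis (x l) ^ (m - c)))) =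
     (\<Sum>c\<in>{0<..<m}. \<Sum>j\<in>{1..n}. \<Sum>l\<in>{1..n} - {j}. J (\<lambda>x. F x * (cis (x j) ^ c * cis (x l) ^ (m - c))))"
    by (subst (2) sum.swap, rule sum.cong[OF refl], rule sum.swap)
  also have "\<dots> = (\<Sum>c\<in>{0<..<m}. J (\<lambda>x. F x * (power_sum n c x * power_sum n (m - c) x))) - of_nat (m - 1) * J (\<lambda>x. F x * power_sum n m x)"
  proof -
    have "(\<Sum>c\<in>{0<..<m}. \<Sum>j\<in>{1..n}. \<Sum>l\<in>{1..n} - {j}. J (\<lambda>x. F x * (cis (x j) ^ c * cis (x l) ^ (m - c)))) =
      (\<Sum>c\<in>{0<..<m}. J (\<lambda>x. F x * (power_sum n c x * power_sum n (m - c) x)) - J (\<lambda>x. F x * power_sum n m x))"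
      by (rule sum.cong[OF refl pc])
    then show ?thesis by (simp only: sum_subtractf) simp
  qed
  finally have res: "J (\<lambda>x. \<Sum>j\<in>{1..n}. F' j x * \<i> * cis (x j) ^ m) = of_nat m * J (\<lambda>x. F x * power_sum n m x) + of_real (\<beta> / 2) *
      (of_nat (n - 1) * J (\<lambda>x. F x * power_sum n m x) + ((\<Sum>c\<in>{0<..<m}. J (\<lambda>x. F x * (power_sum n c x * power_sum n (m - c) x))) - of_nat (m - 1) * J (\<lambda>x. F x * power_sum n m x)))" .
  show ?thesis
  proof (cases "n = 0")
    case True
    then show ?thesis by (simp add: power_sum_def weighted_integral_def)
  next
    case False
    then have nm: "complex_of_nat (n - 1) = of_nat n - 1" "complex_of_nat (m - 1) = of_nat m - 1"
      using m by (simp_all add: of_nat_diff)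
    show ?thesis unfolding J_def[symmetric] res nm by (simp add: field_simps)
  qed
qed

section \<open>The loop equation for characteristic functions of linear statistics\<close>

lemma smooth_torus_exp_i:
  assumes F: "smooth_torus n F F'" and real: "\<And>x. Im (F x) = 0"
  shows "smooth_torus n (\<lambda>x. exp (\<i> * F x)) (\<lambda>j x. \<i> * F' j x * exp (\<i> * F x))"
proof -
  note D = smooth_torusD[OF F]
  obtain B where B: "\<And>x j. j \<in> {1..n} \<Longrightarrow> cmod (F' j x) \<le> B" using D(5) by blast
  have [measurable]: "(exp :: complex \<Rightarrow> complex) \<in> borel_measurable borel"
    by (intro borel_measurable_continuous_onI continuous_intros)
  show ?thesis
  proof (rule smooth_torusI[where B=1 and C=B])
    fix j x t assume j: "j \<in> {1..n}"
    have "((\<lambda>t. \<i> * F (x(j := t))) has_vector_derivative \<i> * F' j (x(j := t))) (at t)"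
      by (rule has_vector_derivative_mult_right[OF D(3)[OF j]])
    from field_vector_diff_chain_at[OF this DERIV_exp]
    show "((\<lambda>t. exp (\<i> * F (x(j := t)))) has_vector_derivative \<i> * F' j (x(j := t)) * exp (\<i> * F (x(j := t)))) (at t)"
      by (simp add: comp_def)
    show "cmod (\<i> * F' j x * exp (\<i> * F x)) \<le> B" for x
      using B[OF j] real by (simp add: norm_mult)
    show "exp (\<i> * F (x(j := 0))) = exp (\<i> * F (x(j := 2 * pi)))"
      using D(4)[OF j, of x] by simp
  qed (use D(1,2) real in auto)
qed

lemma norm_weighted_integral_le:
  assumes f: "bounded_measurable n f" and h: "bounded_measurable n (\<lambda>x. complex_of_real (h x))"
    and le: "\<And>x. cmod (f x) \<le> h x" and b: "\<beta> > 0"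
  shows "cmod (weighted_integral n \<beta> f) \<le> Re (weighted_integral n \<beta> (\<lambda>x. complex_of_real (h x)))"
proof -
  have ih: "integrable (torus n) (\<lambda>x. complex_of_real (h x) * complex_of_real (reg_weight n \<beta> 0 x))"
    using h b by (intro integrable_bounded_measurable bounded_measurable_mult bounded_measurable_reg_weight) auto
  have if': "integrable (torus n) (\<lambda>x. f x * complex_of_real (reg_weight n \<beta> 0 x))"
    using f b by (intro integrable_bounded_measurable bounded_measurable_mult bounded_measurable_reg_weight) auto
  have ih': "integrable (torus n) (\<lambda>x. h x * reg_weight n \<beta> 0 x)"
    using integrable_Re[OF ih] by simp
  have "cmod (weighted_integral n \<beta> f) \<le> (LINT x|torus n. cmod (f x * complex_of_real (reg_weight n \<beta> 0 x)))"
    unfolding weighted_integral_def by (rule integral_norm_bound)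
  also have "\<dots> \<le> (LINT x|torus n. h x * reg_weight n \<beta> 0 x)"
  proof (rule integral_mono[OF integrable_norm[OF if'] ih'])
    show "cmod (f x * complex_of_real (reg_weight n \<beta> 0 x)) \<le> h x * reg_weight n \<beta> 0 x" for x
      using le[of x] reg_weight_nonneg[of n \<beta> 0 x] by (simp add: norm_mult mult_right_mono)
  qed
  also have "\<dots> = Re (weighted_integral n \<beta> (\<lambda>x. complex_of_real (h x)))"
    unfolding weighted_integral_def of_real_mult[symmetric] integral_complex_of_real by (rule Re_complex_of_real[symmetric])
  finally show ?thesis .
qed

definition total_weight :: "nat \<Rightarrow> real \<Rightarrow> real" where
  "total_weight n \<beta> = Re (weighted_integral n \<beta> (\<lambda>_. 1))"

lemma weighted_integral_1: "weighted_integral n \<beta> (\<lambda>_. 1) = of_real (total_weight n \<beta>)"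
  unfolding total_weight_def weighted_integral_def by simp

lemma total_weight_nonneg: "0 \<le> total_weight n \<beta>"
  using weighted_integral_norm_square_nonneg[of n \<beta> "\<lambda>_. 1"] by (simp add: total_weight_def)

text \<open>The power sum of integer index \<open>m - r\<close>, negative indices meaning
  conjugates. For \<open>r = m\<close> it is the constant \<open>n\<close>.\<close>

definition fourier_mono :: "nat \<Rightarrow> nat \<Rightarrow> nat \<Rightarrow> (nat \<Rightarrow> real) \<Rightarrow> complex" where
  "fourier_mono n m r x = (if r \<le> m then power_sum n (m - r) x else cnj (power_sum n (r - m) x))"

lemma sum_cis_cnj: "(\<Sum>j\<in>{1..n}. cnj (cis (x j)) ^ r * cis (x j) ^ m) = fourier_mono n m r x"
proof -
  have inv: "cnj (cis t) ^ r * cis t ^ m = (if r \<le> m then cis t ^ (m - r) else cnj (cis t) ^ (r - m))" for t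
  proof -
    have 1: "cnj (cis t) ^ k * cis t ^ k = 1" for k
      by (simp flip: power_mult_distrib add: cis_cnj cis_mult)
    show ?thesis
    proof (cases "r \<le> m")
      case True
      then have "cis t ^ m = cis t ^ r * cis t ^ (m - r)" by (simp flip: power_add)
      then show ?thesis using True 1[of r] by (simp add: mult.assoc[symmetric])
    next
      case False
      then have "cnj (cis t) ^ r = cnj (cis t) ^ (r - m) * cnj (cis t) ^ m" by (simp flip: power_add)
      then show ?thesis using False 1[of m] by (simp add: mult.assoc)
    qed
  qed
  show ?thesis by (simp add: inv fourier_mono_def power_sum_def)
qed

lemma power_sum_second_moment_le:
  assumes b: "\<beta> > 0" and m: "0 < m" "2 * m \<le> n"
  shows "Re (weighted_integral n \<beta> (\<lambda>x. complex_of_real ((cmod (power_sum n m x))\<^sup>2))) \<le> 4 * real m / \<beta> * total_weight n \<beta>"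
proof -
  have "real n / (real n - real m) \<le> 2"
    using m by (simp add: divide_le_eq)
  then have "2 * real m / \<beta> * (real n / (real n - real m)) \<le> 2 * real m / \<beta> * 2"
    using b by (intro mult_left_mono) auto
  then have le: "2 * real m * real n / (\<beta> * (real n - real m)) \<le> 4 * real m / \<beta>" by simp
  have "Re (weighted_integral n \<beta> (\<lambda>x. cnj (power_sum n m x) * power_sum n m x)) \<le>
    2 * real m * real n / (\<beta> * (real n - real m)) * total_weight n \<beta>"
    unfolding total_weight_def by (rule power_sum_second_moment) (use b m in auto)
  also have "\<dots> \<le> 4 * real m / \<beta> * total_weight n \<beta>"
    using le total_weight_nonneg by (rule mult_right_mono)
  finally show ?thesis
    unfolding complex_norm_square by (simp only: mult.commute)
qed

lemma bounded_measurable_norm_square: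
  "bounded_measurable n f \<Longrightarrow> bounded_measurable n (\<lambda>x. complex_of_real ((cmod (f x))\<^sup>2))"
  unfolding complex_norm_square by (intro bounded_measurable_mult bounded_measurable_cnj)

text \<open>A modulus is at most 1 plus its square, so the second moment controls the first. The
  function \<open>f\<close> stands for a power sum or its conjugate.\<close>

lemma norm_weighted_power_sum_le:
  assumes b: "\<beta> > 0" and F: "bounded_measurable n F" "\<And>x. cmod (F x) \<le> 1"
    and f: "bounded_measurable n f" "\<And>x. cmod (f x) = cmod (power_sum n m x)" and m: "0 < m" "2 * m \<le> n" "m \<le> K"
  shows "cmod (weighted_integral n \<beta> (\<lambda>x. F x * f x)) \<le> (1 + 4 * real K / \<beta>) * total_weight n \<beta>"
proof -
  have bm: "bounded_measurable n (\<lambda>x. complex_of_real ((cmod (power_sum n m x))\<^sup>2))"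
    by (rule bounded_measurable_norm_square[OF bounded_measurable_power_sum])
  have bh: "bounded_measurable n (\<lambda>x. complex_of_real (1 + (cmod (power_sum n m x))\<^sup>2))"
    unfolding of_real_add by (intro bounded_measurable_add bm bounded_measurable_const)
  have "cmod (weighted_integral n \<beta> (\<lambda>x. F x * f x)) \<le>
    Re (weighted_integral n \<beta> (\<lambda>x. complex_of_real (1 + (cmod (power_sum n m x))\<^sup>2)))"
  proof (rule norm_weighted_integral_le[OF bounded_measurable_mult[OF F(1) f(1)] bh _ b])
    fix x
    have "cmod (F x * f x) \<le> 1 * cmod (power_sum n m x)"
      unfolding norm_mult f(2) using F(2) by (intro mult_right_mono) auto
    also have "\<dots> \<le> 1 + (cmod (power_sum n m x))\<^sup>2"
    proof -
      have "0 \<le> (cmod (power_sum n m x) - 1)\<^sup>2 + (cmod (power_sum n m x))\<^sup>2 + 1" by simp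
      then show ?thesis by (simp add: power2_eq_square algebra_simps)
    qed
    finally show "cmod (F x * f x) \<le> 1 + (cmod (power_sum n m x))\<^sup>2" .
  qed
  also have "\<dots> = total_weight n \<beta> + Re (weighted_integral n \<beta> (\<lambda>x. complex_of_real ((cmod (power_sum n m x))\<^sup>2)))"
    unfolding of_real_add of_real_1
    by (subst weighted_integral_add[OF bounded_measurable_const bm b]) (simp add: weighted_integral_1)
  also have "\<dots> \<le> total_weight n \<beta> + 4 * real m / \<beta> * total_weight n \<beta>"
    by (intro add_left_mono power_sum_second_moment_le b m)
  also have "\<dots> \<le> total_weight n \<beta> + 4 * real K / \<beta> * total_weight n \<beta>"
    using b m total_weight_nonneg by (intro add_left_mono mult_right_mono divide_right_mono) auto
  finally show ?thesis by (simp add: algebra_simps)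
qed

lemma norm_weighted_power_sum_product_le:
  assumes b: "\<beta> > 0" and F: "bounded_measurable n F" "\<And>x. cmod (F x) \<le> 1"
    and m: "0 < m" "2 * m \<le> n" "m \<le> K" "0 < l" "2 * l \<le> n" "l \<le> K"
  shows "cmod (weighted_integral n \<beta> (\<lambda>x. F x * (power_sum n m x * power_sum n l x))) \<le> (8 * real K / \<beta>) * total_weight n \<beta>"
proof -
  have bm: "bounded_measurable n (\<lambda>x. complex_of_real ((cmod (power_sum n m x))\<^sup>2))" for m
    by (rule bounded_measurable_norm_square[OF bounded_measurable_power_sum])
  have bh: "bounded_measurable n (\<lambda>x. complex_of_real ((cmod (power_sum n m x))\<^sup>2 + (cmod (power_sum n l x))\<^sup>2))"
    unfolding of_real_add by (intro bounded_measurable_add bm)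
  have "cmod (weighted_integral n \<beta> (\<lambda>x. F x * (power_sum n m x * power_sum n l x))) \<le>
    Re (weighted_integral n \<beta> (\<lambda>x. complex_of_real ((cmod (power_sum n m x))\<^sup>2 + (cmod (power_sum n l x))\<^sup>2)))"
  proof (rule norm_weighted_integral_le[OF _ bh _ b])
    show "bounded_measurable n (\<lambda>x. F x * (power_sum n m x * power_sum n l x))"
      by (intro bounded_measurable_mult F bounded_measurable_power_sum)
    fix x
    have "cmod (F x * (power_sum n m x * power_sum n l x)) \<le> 1 * (cmod (power_sum n m x) * cmod (power_sum n l x))"
      unfolding norm_mult using F(2) by (intro mult_right_mono) auto
    also have "\<dots> \<le> (cmod (power_sum n m x))\<^sup>2 + (cmod (power_sum n l x))\<^sup>2"
    proof -
      have "0 \<le> (cmod (power_sum n m x) - cmod (power_sum n l x))\<^sup>2 + (cmod (power_sum n m x))\<^sup>2 + (cmod (power_sum n l x))\<^sup>2" by simp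
      then show ?thesis by (simp add: power2_eq_square algebra_simps)
    qed
    finally show "cmod (F x * (power_sum n m x * power_sum n l x)) \<le> (cmod (power_sum n m x))\<^sup>2 + (cmod (power_sum n l x))\<^sup>2" .
  qed
  also have "\<dots> = Re (weighted_integral n \<beta> (\<lambda>x. complex_of_real ((cmod (power_sum n m x))\<^sup>2))) + Re (weighted_integral n \<beta> (\<lambda>x. complex_of_real ((cmod (power_sum n l x))\<^sup>2)))"
    unfolding of_real_add by (subst weighted_integral_add[OF bm bm b]) simp
  also have "\<dots> \<le> 4 * real m / \<beta> * total_weight n \<beta> + 4 * real l / \<beta> * total_weight n \<beta>"
    by (intro add_mono power_sum_second_moment_le b m)
  also have "\<dots> \<le> 4 * real K / \<beta> * total_weight n \<beta> + 4 * real K / \<beta> * total_weight n \<beta>"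
    using b m total_weight_nonneg by (intro add_mono mult_right_mono divide_right_mono) auto
  finally show ?thesis by (simp add: algebra_simps)
qed

definition linear_statistic :: "(nat \<Rightarrow> complex) \<Rightarrow> nat \<Rightarrow> nat \<Rightarrow> (nat \<Rightarrow> real) \<Rightarrow> real" where
  "linear_statistic c K n x = (\<Sum>r\<in>{1..K}. Re (c r * power_sum n r x))"

lemma smooth_torus_linear_statistic:
  "smooth_torus n (\<lambda>x. complex_of_real (linear_statistic c K n x))
    (\<lambda>j x. of_bool (j \<in> {1..n}) * (\<i> / 2 * (\<Sum>r\<in>{1..K}. of_nat r * (c r * cis (x j) ^ r - cnj (c r) * cnj (cis (x j)) ^ r))))"
proof -
  have "smooth_torus n (\<lambda>x. \<Sum>r\<in>{1..K}. (1 / 2) * (c r * power_sum n r x + cnj (c r * power_sum n r x)))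
    (\<lambda>j x. \<Sum>r\<in>{1..K}. (1 / 2) * (c r * (\<i> * of_nat r * cis (x j) ^ r * of_bool (j \<in> {1..n})) + cnj (c r * (\<i> * of_nat r * cis (x j) ^ r * of_bool (j \<in> {1..n})))))"
    by (intro smooth_torus_sum smooth_torus_add smooth_torus_cmult smooth_torus_cnj smooth_torus_power_sum) simp
  moreover have "(\<Sum>r\<in>{1..K}. (1 / 2) * (c r * power_sum n r x + cnj (c r * power_sum n r x))) = complex_of_real (linear_statistic c K n x)" for x
  proof -
    have "(1 / 2) * (z + cnj z) = complex_of_real (Re z)" for z
      by (simp add: complex_eq_iff)
    then show ?thesis by (simp only: linear_statistic_def of_real_sum)
  qed
  moreover have "(\<Sum>r\<in>{1..K}. (1 / 2) * (c r * (\<i> * of_nat r * cis (x j) ^ r * of_bool (j \<in> {1..n})) + cnj (c r * (\<i> * of_nat r * cis (x j) ^ r * of_bool (j \<in> {1..n}))))) =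
    of_bool (j \<in> {1..n}) * (\<i> / 2 * (\<Sum>r\<in>{1..K}. of_nat r * (c r * cis (x j) ^ r - cnj (c r) * cnj (cis (x j)) ^ r)))" for j :: nat and x :: "nat \<Rightarrow> real"
    unfolding sum_distrib_left by (intro sum.cong refl) (simp add: algebra_simps)
  ultimately show ?thesis by (simp only:)
qed

lemma linear_statistic_permute:
  "p permutes {1..n} \<Longrightarrow> linear_statistic c K n (x \<circ> p) = linear_statistic c K n x"
  by (simp add: linear_statistic_def power_sum_permute)

definition char_statistic :: "(nat \<Rightarrow> complex) \<Rightarrow> nat \<Rightarrow> nat \<Rightarrow> real \<Rightarrow> (nat \<Rightarrow> real) \<Rightarrow> complex" where
  "char_statistic c K n t x = exp (\<i> * complex_of_real (t * linear_statistic c K n x))"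

lemma norm_char_statistic: "cmod (char_statistic c K n t x) = 1"
  by (simp add: char_statistic_def)

lemma smooth_torus_char_statistic:
  "smooth_torus n (char_statistic c K n t)
    (\<lambda>j x. \<i> * (of_real t * (of_bool (j \<in> {1..n}) * (\<i> / 2 * (\<Sum>r\<in>{1..K}. of_nat r * (c r * cis (x j) ^ r - cnj (c r) * cnj (cis (x j)) ^ r))))) * char_statistic c K n t x)"
  unfolding char_statistic_def[abs_def] of_real_mult
  by (rule smooth_torus_exp_i[OF smooth_torus_cmult[OF smooth_torus_linear_statistic]]) simp

lemma bounded_measurable_char_statistic: "bounded_measurable n (char_statistic c K n t)"
  by (rule bounded_measurable_smooth[OF smooth_torus_char_statistic])

lemma symmetric_torus_char_statistic: "symmetric_torus n (char_statistic c K n t)"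
  by (simp add: symmetric_torus_def char_statistic_def linear_statistic_permute)

lemma bounded_measurable_fourier_mono: "bounded_measurable n (fourier_mono n m r)"
  unfolding fourier_mono_def[abs_def]
  by (cases "r \<le> m") (simp_all add: bounded_measurable_power_sum bounded_measurable_cnj)

text \<open>
  In the loop equation for \<open>exp (i t L)\<close> only the term with \<open>power_sum n 0 = n\<close> on the left and
  the diagonal term on the right are of order \<open>n\<close>.
\<close>

lemma char_statistic_power_sum_approx:
  assumes b: "\<beta> > 0"
  obtains C where "\<And>n t m. 4 * K \<le> n \<Longrightarrow> \<bar>t\<bar> \<le> 1 \<Longrightarrow> m \<in> {1..K} \<Longrightarrow>
    cmod (of_nat n * (of_real (\<beta> / 2) * weighted_integral n \<beta> (\<lambda>x. char_statistic c K n t x * power_sum n m x) -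
      \<i> * of_real t / 2 * of_nat m * cnj (c m) * weighted_integral n \<beta> (char_statistic c K n t))) \<le> C * total_weight n \<beta>"
proof -
  \<comment> \<open>The constant of \<open>norm_weighted_power_sum_le\<close> for indices up to
    \<open>2 * K\<close>, because the index \<open>m + r\<close> occurs. The second moment bound at
    this index is where \<open>4 * K \<le> n\<close> comes from.\<close>
  define A where "A = 1 + 8 * real K / \<beta>"
  define C where "C = (real K * (1 + \<beta> / 2)) * A + \<beta> / 2 * (real K * (16 * real K / \<beta>)) + (\<Sum>r\<in>{1..K}. real r * cmod (c r) * A)"
  show thesis
  proof (rule that[of C])
    fix n m :: nat and t :: real
    assume n: "4 * K \<le> n" and t: "\<bar>t\<bar> \<le> 1" and m: "m \<in> {1..K}"
    define F where "F = char_statistic c K n t"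
    define J where "J = weighted_integral n \<beta>"
    define Z where "Z = total_weight n \<beta>"
    have Z: "Z \<ge> 0" by (simp add: Z_def total_weight_nonneg)
    have A: "A \<ge> 0" using b by (simp add: A_def)
    have Fb: "bounded_measurable n F" unfolding F_def by (rule bounded_measurable_char_statistic)
    have F1: "cmod (F x) \<le> 1" for x by (simp add: F_def norm_char_statistic)
    have Jp: "cmod (J (\<lambda>x. F x * power_sum n r x)) \<le> A * Z" if "r \<in> {1..2 * K}" for r
      using norm_weighted_power_sum_le[OF b Fb F1 bounded_measurable_power_sum refl, of r "2 * K"] that n
      by (simp add: J_def A_def Z_def)
    have Jq: "cmod (J (\<lambda>x. F x * fourier_mono n m r x)) \<le> A * Z" if "r \<in> {1..K}" "r \<noteq> m" for r
    proof -
      define k where "k = (if r \<le> m then m - r else r - m)"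
      have "cmod (fourier_mono n m r x) = cmod (power_sum n k x)" for x
        by (simp add: fourier_mono_def k_def)
      moreover have "0 < k" "2 * k \<le> n" "k \<le> 2 * K" using that n m by (auto simp: k_def)
      ultimately show ?thesis
        using norm_weighted_power_sum_le[OF b Fb F1 bounded_measurable_fourier_mono[of n m r], of k "2 * K"]
        by (simp add: J_def A_def Z_def)
    qed
    have Jpp: "cmod (J (\<lambda>x. F x * (power_sum n r x * power_sum n (m - r) x))) \<le> 16 * real K / \<beta> * Z" if "r \<in> {0<..<m}" for r
      using norm_weighted_power_sum_product_le[OF b Fb F1, of r "2 * K" "m - r"] that n m
      by (auto simp: J_def Z_def)
    let ?S = "\<Sum>r\<in>{1..K}. (- \<i> * of_real t / 2 * of_nat r) * (c r * J (\<lambda>x. F x * power_sum n (m + r) x) - cnj (c r) * J (\<lambda>x. F x * fourier_mono n m r x))"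
    have bmp: "bounded_measurable n (\<lambda>x. F x * power_sum n k x)" for k
      by (intro bounded_measurable_mult Fb bounded_measurable_power_sum)
    have bmf: "bounded_measurable n (\<lambda>x. F x * fourier_mono n m k x)" for k
      by (intro bounded_measurable_mult Fb bounded_measurable_fourier_mono)
    have lhs: "weighted_integral n \<beta> (\<lambda>x. \<Sum>j\<in>{1..n}.
        (\<i> * (of_real t * (of_bool (j \<in> {1..n}) * (\<i> / 2 * (\<Sum>r\<in>{1..K}. of_nat r * (c r * cis (x j) ^ r - cnj (c r) * cnj (cis (x j)) ^ r))))) * char_statistic c K n t x) * \<i> * cis (x j) ^ m) = ?S"
    proof -
      have "(\<Sum>j\<in>{1..n}.
        (\<i> * (of_real t * (of_bool (j \<in> {1..n}) * (\<i> / 2 * (\<Sum>r\<in>{1..K}. of_nat r * (c r * cis (x j) ^ r - cnj (c r) * cnj (cis (x j)) ^ r))))) * char_statistic c K n t x) * \<i> * cis (x j) ^ m) =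
        (\<Sum>r\<in>{1..K}. (- \<i> * of_real t / 2 * of_nat r) * (c r * (F x * power_sum n (m + r) x) + (- cnj (c r)) * (F x * fourier_mono n m r x)))" for x
      proof -
        have "(\<Sum>j\<in>{1..n}.
          (\<i> * (of_real t * (of_bool (j \<in> {1..n}) * (\<i> / 2 * (\<Sum>r\<in>{1..K}. of_nat r * (c r * cis (x j) ^ r - cnj (c r) * cnj (cis (x j)) ^ r))))) * char_statistic c K n t x) * \<i> * cis (x j) ^ m) =
          (\<Sum>j\<in>{1..n}. \<Sum>r\<in>{1..K}. (- \<i> * of_real t / 2 * of_nat r * F x) * (c r * cis (x j) ^ (m + r) - cnj (c r) * (cnj (cis (x j)) ^ r * cis (x j) ^ m)))"
        proof (rule sum.cong[OF refl])
          have alg: "(\<i> * (T * (1 * (\<i> / 2 * S))) * X) * \<i> * Y = (- \<i> * T / 2 * X * Y) * S" for T S X Y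
            by (simp add: algebra_simps)
          fix j assume "j \<in> {1..n}"
          then have "of_bool (j \<in> {1..n}) = (1::complex)" by simp
          moreover have "(\<i> * (of_real t * (1 * (\<i> / 2 * (\<Sum>r\<in>{1..K}. of_nat r * (c r * cis (x j) ^ r - cnj (c r) * cnj (cis (x j)) ^ r))))) * char_statistic c K n t x) * \<i> * cis (x j) ^ m =
            (- \<i> * of_real t / 2 * F x * cis (x j) ^ m) * (\<Sum>r\<in>{1..K}. of_nat r * (c r * cis (x j) ^ r - cnj (c r) * cnj (cis (x j)) ^ r))"
            unfolding F_def by (rule alg)
          ultimately show "(\<i> * (of_real t * (of_bool (j \<in> {1..n}) * (\<i> / 2 * (\<Sum>r\<in>{1..K}. of_nat r * (c r * cis (x j) ^ r - cnj (c r) * cnj (cis (x j)) ^ r))))) * char_statistic c K n t x) * \<i> * cis (x j) ^ m =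
            (\<Sum>r\<in>{1..K}. (- \<i> * of_real t / 2 * of_nat r * F x) * (c r * cis (x j) ^ (m + r) - cnj (c r) * (cnj (cis (x j)) ^ r * cis (x j) ^ m)))"
            by (simp only: sum_distrib_left) (simp add: power_add algebra_simps)
        qed
        also have "\<dots> = (\<Sum>r\<in>{1..K}. \<Sum>j\<in>{1..n}. (- \<i> * of_real t / 2 * of_nat r * F x) * (c r * cis (x j) ^ (m + r) - cnj (c r) * (cnj (cis (x j)) ^ r * cis (x j) ^ m)))"
          by (rule sum.swap)
        also have "\<dots> = (\<Sum>r\<in>{1..K}. (- \<i> * of_real t / 2 * of_nat r * F x) * (c r * power_sum n (m + r) x - cnj (c r) * fourier_mono n m r x))"
          unfolding sum_distrib_left[symmetric] sum_subtractf sum_cis_cnj power_sum_def[of n "m + _", symmetric] ..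
        also have "\<dots> = (\<Sum>r\<in>{1..K}. (- \<i> * of_real t / 2 * of_nat r) * (c r * (F x * power_sum n (m + r) x) + (- cnj (c r)) * (F x * fourier_mono n m r x)))"
          by (intro sum.cong refl) (simp add: algebra_simps)
        finally show ?thesis .
      qed
      then have "weighted_integral n \<beta> (\<lambda>x. \<Sum>j\<in>{1..n}.
        (\<i> * (of_real t * (of_bool (j \<in> {1..n}) * (\<i> / 2 * (\<Sum>r\<in>{1..K}. of_nat r * (c r * cis (x j) ^ r - cnj (c r) * cnj (cis (x j)) ^ r))))) * char_statistic c K n t x) * \<i> * cis (x j) ^ m) =
        weighted_integral n \<beta> (\<lambda>x. \<Sum>r\<in>{1..K}. (- \<i> * of_real t / 2 * of_nat r) * (c r * (F x * power_sum n (m + r) x) + (- cnj (c r)) * (F x * fourier_mono n m r x)))"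
        by simp
      also have "\<dots> = (\<Sum>r\<in>{1..K}. weighted_integral n \<beta> (\<lambda>x. (- \<i> * of_real t / 2 * of_nat r) * (c r * (F x * power_sum n (m + r) x) + (- cnj (c r)) * (F x * fourier_mono n m r x))))"
        by (rule weighted_integral_sum[OF _ _ b], simp)
           (intro bounded_measurable_mult[OF bounded_measurable_const] bounded_measurable_add bmp bmf)
      also have "\<dots> = ?S"
      proof (rule sum.cong[OF refl])
        fix r
        show "weighted_integral n \<beta> (\<lambda>x. (- \<i> * of_real t / 2 * of_nat r) * (c r * (F x * power_sum n (m + r) x) + (- cnj (c r)) * (F x * fourier_mono n m r x))) =
          (- \<i> * of_real t / 2 * of_nat r) * (c r * J (\<lambda>x. F x * power_sum n (m + r) x) - cnj (c r) * J (\<lambda>x. F x * fourier_mono n m r x))"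
          unfolding weighted_integral_cmult
          by (subst weighted_integral_add[OF _ _ b]; (intro bounded_measurable_mult[OF bounded_measurable_const] bmp bmf)?)
             (unfold weighted_integral_cmult J_def, simp only: mult_minus_left add_uminus_conv_diff)
      qed
      finally show ?thesis .
    qed
    have loop: "?S = of_real (real m + \<beta> / 2 * (real n - real m)) * J (\<lambda>x. F x * power_sum n m x) +
      of_real (\<beta> / 2) * (\<Sum>r\<in>{0<..<m}. J (\<lambda>x. F x * (power_sum n r x * power_sum n (m - r) x)))"
      unfolding J_def F_def unfolding lhs[unfolded J_def F_def, symmetric]
      by (rule power_sum_loop_equation[OF smooth_torus_char_statistic symmetric_torus_char_statistic b]) (use m in simp)
    \<comment> \<open>The summands of the left-hand side without the term
      \<open>fourier_mono n m m\<close>, which is of order \<open>n\<close> and is kept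
      apart.\<close>
    define T where "T = (\<lambda>r. (- \<i> * of_real t / 2 * of_nat r) * (c r * J (\<lambda>x. F x * power_sum n (m + r) x) - (if r = m then 0 else cnj (c r) * J (\<lambda>x. F x * fourier_mono n m r x))))"
    have Jm: "J (\<lambda>x. F x * fourier_mono n m m x) = of_nat n * J F"
      unfolding J_def fourier_mono_def
      by (simp add: power_sum_def mult.commute[of _ "of_nat n"] weighted_integral_cmult)
    have S: "?S = \<i> * of_real t / 2 * of_nat m * cnj (c m) * (of_nat n * J F) + (\<Sum>r\<in>{1..K}. T r)"
    proof -
      have "?S = (\<Sum>r\<in>{1..K}. (if r = m then \<i> * of_real t / 2 * of_nat m * cnj (c m) * (of_nat n * J F) else 0) + T r)"
        by (intro sum.cong refl) (simp add: T_def Jm algebra_simps)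
      then show ?thesis using m by (simp add: sum.distrib)
    qed
    have eq: "of_nat n * (of_real (\<beta> / 2) * J (\<lambda>x. F x * power_sum n m x) - \<i> * of_real t / 2 * of_nat m * cnj (c m) * J F) =
      (\<Sum>r\<in>{1..K}. T r) - of_real (real m * (1 - \<beta> / 2)) * J (\<lambda>x. F x * power_sum n m x)
        - of_real (\<beta> / 2) * (\<Sum>r\<in>{0<..<m}. J (\<lambda>x. F x * (power_sum n r x * power_sum n (m - r) x)))"
    proof -
      have "(\<Sum>r\<in>{1..K}. T r) = of_real (real m + \<beta> / 2 * (real n - real m)) * J (\<lambda>x. F x * power_sum n m x) +
        of_real (\<beta> / 2) * (\<Sum>r\<in>{0<..<m}. J (\<lambda>x. F x * (power_sum n r x * power_sum n (m - r) x))) -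
        \<i> * of_real t / 2 * of_nat m * cnj (c m) * (of_nat n * J F)"
        using loop unfolding S by (metis add_diff_cancel_left')
      then show ?thesis by (simp only:) (simp add: field_simps)
    qed
    have nT: "cmod (T r) \<le> real r * cmod (c r) * A * Z" if r: "r \<in> {1..K}" for r
    proof -
      have "cmod (T r) = (\<bar>t\<bar> * real r / 2) * cmod (c r * J (\<lambda>x. F x * power_sum n (m + r) x) - (if r = m then 0 else cnj (c r) * J (\<lambda>x. F x * fourier_mono n m r x)))"
        by (simp add: T_def norm_mult norm_divide)
      also have "\<dots> \<le> (1 * real r / 2) * (cmod (c r) * (A * Z) + cmod (c r) * (A * Z))"
      proof (intro mult_mono divide_right_mono order_trans[OF norm_triangle_ineq4] add_mono)
        show "cmod (c r * J (\<lambda>x. F x * power_sum n (m + r) x)) \<le> cmod (c r) * (A * Z)"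
          unfolding norm_mult using r m by (intro mult_left_mono Jp) auto
        show "cmod (if r = m then 0 else cnj (c r) * J (\<lambda>x. F x * fourier_mono n m r x)) \<le> cmod (c r) * (A * Z)"
          using r Jq[of r] A Z by (auto simp: norm_mult intro!: mult_left_mono)
      qed (use t A Z in auto)
      finally show ?thesis by (simp add: mult_ac)
    qed
    have "cmod (of_nat n * (of_real (\<beta> / 2) * J (\<lambda>x. F x * power_sum n m x) - \<i> * of_real t / 2 * of_nat m * cnj (c m) * J F)) \<le>
      (\<Sum>r\<in>{1..K}. real r * cmod (c r) * A * Z) + (real K * (1 + \<beta> / 2)) * (A * Z) + \<beta> / 2 * (real K * (16 * real K / \<beta> * Z))"
      unfolding eq
    proof (intro order_trans[OF norm_triangle_ineq4] add_mono)
      show "cmod (\<Sum>r\<in>{1..K}. T r) \<le> (\<Sum>r\<in>{1..K}. real r * cmod (c r) * A * Z)"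
        by (rule sum_norm_le[OF nT])
      have "\<bar>real m * (1 - \<beta> / 2)\<bar> \<le> real K * (1 + \<beta> / 2)"
        unfolding abs_mult using m b by (intro mult_mono) (auto simp: abs_le_iff)
      then show "cmod (of_real (real m * (1 - \<beta> / 2)) * J (\<lambda>x. F x * power_sum n m x)) \<le> (real K * (1 + \<beta> / 2)) * (A * Z)"
        unfolding norm_mult norm_of_real using m b A Z by (intro mult_mono Jp) auto
      have "cmod (\<Sum>r\<in>{0<..<m}. J (\<lambda>x. F x * (power_sum n r x * power_sum n (m - r) x))) \<le> (\<Sum>r\<in>{0<..<m}. 16 * real K / \<beta> * Z)"
        by (rule sum_norm_le[OF Jpp])
      also have "\<dots> \<le> real K * (16 * real K / \<beta> * Z)"
        using m b Z by (simp only: sum_constant) (intro mult_right_mono, auto)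
      finally show "cmod (of_real (\<beta> / 2) * (\<Sum>r\<in>{0<..<m}. J (\<lambda>x. F x * (power_sum n r x * power_sum n (m - r) x)))) \<le> \<beta> / 2 * (real K * (16 * real K / \<beta> * Z))"
        unfolding norm_mult norm_of_real using b by (intro mult_mono) auto
    qed
    also have "\<dots> = C * Z"
      unfolding C_def sum_distrib_right[symmetric] by (simp add: algebra_simps)
    finally show "cmod (of_nat n * (of_real (\<beta> / 2) * weighted_integral n \<beta> (\<lambda>x. char_statistic c K n t x * power_sum n m x) -
      \<i> * of_real t / 2 * of_nat m * cnj (c m) * weighted_integral n \<beta> (char_statistic c K n t))) \<le> C * total_weight n \<beta>"
      unfolding J_def F_def Z_def .
  qed
qed

section \<open>The characteristic functional\<close>

text \<open>The statistic is bounded for fixed \<open>n\<close>, so the second order Taylor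
  remainder of the exponential, integrated against the weight, is quadratic in the
  increment.\<close>

lemma char_statistic_has_vector_derivative:
  assumes b: "\<beta> > 0"
  shows "((\<lambda>t. weighted_integral n \<beta> (char_statistic c K n t)) has_vector_derivative
     weighted_integral n \<beta> (\<lambda>x. \<i> * (complex_of_real (linear_statistic c K n x) * char_statistic c K n t x))) (at t)"
    (is "(?J has_vector_derivative ?D) _")
proof -
  let ?L = "linear_statistic c K n"
  let ?d = "\<lambda>x. \<i> * (complex_of_real (?L x) * char_statistic c K n t x)"
  obtain B where B: "\<And>x. cmod (complex_of_real (?L x)) \<le> B" "B \<ge> 0"
    using smooth_torusD(5)[OF smooth_torus_linear_statistic[of n c K]] by blast
  have bL: "bounded_measurable n (\<lambda>x. complex_of_real (?L x))"
    by (rule bounded_measurable_smooth[OF smooth_torus_linear_statistic])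
  have bd: "bounded_measurable n ?d"
    by (intro bounded_measurable_mult bounded_measurable_const bL bounded_measurable_char_statistic)
  define Z where "Z = total_weight n \<beta>"
  have est: "cmod (?J (t + h) - ?J t - h *\<^sub>R ?D) \<le> h\<^sup>2 * (B\<^sup>2 * Z)" for h
  proof -
    let ?r = "\<lambda>x. char_statistic c K n (t + h) x + ((- 1) * char_statistic c K n t x + (- of_real h) * ?d x)"
    have br: "bounded_measurable n ?r"
      by (intro bounded_measurable_add bounded_measurable_mult bounded_measurable_const bL bounded_measurable_char_statistic)
    have "weighted_integral n \<beta> ?r = ?J (t + h) + ((- 1) * ?J t + (- of_real h) * ?D)"
    proof -
      have "weighted_integral n \<beta> (\<lambda>x. (- 1) * char_statistic c K n t x + (- of_real h) * ?d x) =
        weighted_integral n \<beta> (\<lambda>x. (- 1) * char_statistic c K n t x) + weighted_integral n \<beta> (\<lambda>x. (- of_real h) * ?d x)"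
        by (rule weighted_integral_add[OF _ _ b])
           (intro bounded_measurable_mult bounded_measurable_const bL bounded_measurable_char_statistic)+
      moreover have "weighted_integral n \<beta> ?r = ?J (t + h) +
        weighted_integral n \<beta> (\<lambda>x. (- 1) * char_statistic c K n t x + (- of_real h) * ?d x)"
        by (rule weighted_integral_add[OF _ _ b])
           (intro bounded_measurable_add bounded_measurable_mult bounded_measurable_const bL bounded_measurable_char_statistic)+
      ultimately show ?thesis by (simp only: weighted_integral_cmult)
    qed
    then have "?J (t + h) - ?J t - h *\<^sub>R ?D = weighted_integral n \<beta> ?r"
      by (simp add: scaleR_conv_of_real)
    also have "cmod \<dots> \<le> Re (weighted_integral n \<beta> (\<lambda>x. complex_of_real (h\<^sup>2 * B\<^sup>2)))"
    proof (rule norm_weighted_integral_le[OF br bounded_measurable_const _ b])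
      fix x
      have "char_statistic c K n (t + h) x = char_statistic c K n t x * iexp (h * ?L x)"
        by (simp add: char_statistic_def distrib_right distrib_left exp_add)
      then have "?r x = char_statistic c K n t x * (iexp (h * ?L x) - (\<Sum>k\<le>1. (\<i> * (h * ?L x)) ^ k / fact k))"
        by (simp add: algebra_simps)
      then have "cmod (?r x) \<le> \<bar>h * ?L x\<bar> ^ Suc 1 / fact (Suc 1)"
        using iexp_approx1[of "h * ?L x" 1] by (simp only: norm_mult norm_char_statistic mult_1)
      also have "\<dots> \<le> (h * ?L x)\<^sup>2"
      proof -
        have "\<bar>y\<bar> ^ Suc 1 / fact (Suc 1) \<le> y\<^sup>2" for y :: real
          by (simp add: power2_eq_square)
        then show ?thesis .
      qed
      also have "\<dots> = h\<^sup>2 * \<bar>?L x\<bar>\<^sup>2" by (simp add: power_mult_distrib)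
      also have "\<dots> \<le> h\<^sup>2 * B\<^sup>2"
        using B by (intro mult_left_mono power_mono) auto
      finally show "cmod (?r x) \<le> h\<^sup>2 * B\<^sup>2" .
    qed
    also have "weighted_integral n \<beta> (\<lambda>x. complex_of_real (h\<^sup>2 * B\<^sup>2)) = complex_of_real (h\<^sup>2 * B\<^sup>2) * complex_of_real Z"
      using weighted_integral_cmult[of n \<beta> "complex_of_real (h\<^sup>2 * B\<^sup>2)" "\<lambda>_. 1"]
      unfolding weighted_integral_1 Z_def mult_1_right .
    finally show ?thesis by (simp only: Re_complex_of_real mult.assoc of_real_mult[symmetric])
  qed
  show ?thesis
    unfolding has_vector_derivative_def
  proof (rule has_derivativeI_sandwich[where e=1 and H="\<lambda>y. \<bar>y - t\<bar> * (B\<^sup>2 * Z)"])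
    show "norm (?J y - ?J t - (y - t) *\<^sub>R ?D) / norm (y - t) \<le> \<bar>y - t\<bar> * (B\<^sup>2 * Z)" if "y \<noteq> t" for y
      using est[of "y - t"] that by (simp add: divide_le_eq power2_eq_square mult_ac abs_mult_self_eq flip: abs_mult)
    show "((\<lambda>y. \<bar>y - t\<bar> * (B\<^sup>2 * Z)) \<longlongrightarrow> 0) (at t)"
      by (rule tendsto_eq_intros refl)+ simp
  qed (auto intro: bounded_linear_scaleR_left)
qed

lemma cnj_char_statistic: "cnj (char_statistic c K n t x) = char_statistic c K n (- t) x"
  by (simp add: char_statistic_def exp_cnj)

text \<open>The statistic is half the sum of \<open>c m * power_sum n m\<close> and its conjugate.
  Conjugation replaces \<open>t\<close> by \<open>- t\<close>, so the approximation enters with both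
  signs and both halves give the same main term. Together they make \<open>V\<close> the limiting
  variance.\<close>

lemma char_statistic_derivative_approx:
  fixes c :: "nat \<Rightarrow> complex" and K :: nat
  assumes b: "\<beta> > 0"
  defines "V \<equiv> (\<Sum>r\<in>{1..K}. real r * (cmod (c r))\<^sup>2) / \<beta>"
  obtains C where "C \<ge> 0" "\<And>n t. 4 * K \<le> n \<Longrightarrow> 0 < n \<Longrightarrow> \<bar>t\<bar> \<le> 1 \<Longrightarrow>
    cmod (weighted_integral n \<beta> (\<lambda>x. \<i> * (complex_of_real (linear_statistic c K n x) * char_statistic c K n t x))
      + of_real (t * V) * weighted_integral n \<beta> (char_statistic c K n t)) \<le> C / real n * total_weight n \<beta>"
proof -
  obtain C where C: "\<And>n t m. 4 * K \<le> n \<Longrightarrow> \<bar>t\<bar> \<le> 1 \<Longrightarrow> m \<in> {1..K} \<Longrightarrow>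
    cmod (of_nat n * (of_real (\<beta> / 2) * weighted_integral n \<beta> (\<lambda>x. char_statistic c K n t x * power_sum n m x) -
      \<i> * of_real t / 2 * of_nat m * cnj (c m) * weighted_integral n \<beta> (char_statistic c K n t))) \<le> C * total_weight n \<beta>"
    using char_statistic_power_sum_approx[OF b, of K c] by blast
  define C' where "C' = (\<Sum>r\<in>{1..K}. cmod (c r) * (2 * \<bar>C\<bar> / \<beta>))"
  show thesis
  proof (rule that[of C'])
    show "C' \<ge> 0" using b by (auto simp: C'_def intro!: sum_nonneg)
    fix n :: nat and t :: real assume n: "4 * K \<le> n" "0 < n" and t: "\<bar>t\<bar> \<le> 1"
    let ?J = "weighted_integral n \<beta>"
    let ?F = "char_statistic c K n"
    define Z where "Z = total_weight n \<beta>"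
    \<comment> \<open>The error in the approximation of the mixed moment, after division by
      \<open>n * \<beta> / 2\<close>.\<close>
    define e where "e = (\<lambda>m t. ?J (\<lambda>x. ?F t x * power_sum n m x) - \<i> * of_real t * of_nat m * cnj (c m) / of_real \<beta> * ?J (?F t))"
    have Z: "Z \<ge> 0" by (simp add: Z_def total_weight_nonneg)
    have e: "cmod (e m t) \<le> 2 * \<bar>C\<bar> / \<beta> / real n * Z" if "m \<in> {1..K}" "\<bar>t\<bar> \<le> 1" for m t
    proof -
      have h: "of_nat n * (of_real (\<beta> / 2) * ?J (\<lambda>x. ?F t x * power_sum n m x) - \<i> * of_real t / 2 * of_nat m * cnj (c m) * ?J (?F t))
        = of_real (real n * \<beta> / 2) * e m t"
        using b by (simp add: e_def field_simps)
      have "cmod (of_real (real n * \<beta> / 2) * e m t) \<le> C * Z"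
        unfolding h[symmetric] Z_def by (rule C[OF n(1) that(2,1)])
      then have "real n * \<beta> / 2 * cmod (e m t) \<le> C * Z"
        unfolding norm_mult norm_of_real using b by simp
      also have "\<dots> \<le> \<bar>C\<bar> * Z" using Z by (intro mult_right_mono) auto
      finally show ?thesis using b n by (simp add: field_simps)
    qed
    have cF: "?J (\<lambda>x. ?F t x * cnj (power_sum n m x)) = cnj (?J (\<lambda>x. ?F (- t) x * power_sum n m x))" for m
      unfolding cnj_weighted_integral complex_cnj_mult cnj_char_statistic by simp
    have cF0: "cnj (?J (?F (- t))) = ?J (?F t)"
      unfolding cnj_weighted_integral cnj_char_statistic by simp
    have bp: "bounded_measurable n (\<lambda>x. ?F t x * power_sum n m x)" "bounded_measurable n (\<lambda>x. ?F t x * cnj (power_sum n m x))" for m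
      by (intro bounded_measurable_mult bounded_measurable_char_statistic bounded_measurable_cnj bounded_measurable_power_sum)+
    have "?J (\<lambda>x. \<i> * (complex_of_real (linear_statistic c K n x) * ?F t x)) =
      ?J (\<lambda>x. \<Sum>m\<in>{1..K}. (\<i> / 2) * (c m * (?F t x * power_sum n m x) + cnj (c m) * (?F t x * cnj (power_sum n m x))))"
    proof (rule arg_cong[where f="?J"], rule ext)
      fix x
      have half: "complex_of_real (Re z) = (z + cnj z) / 2" for z by (simp add: complex_eq_iff)
      show "\<i> * (complex_of_real (linear_statistic c K n x) * ?F t x) =
        (\<Sum>m\<in>{1..K}. (\<i> / 2) * (c m * (?F t x * power_sum n m x) + cnj (c m) * (?F t x * cnj (power_sum n m x))))"
        unfolding linear_statistic_def of_real_sum half sum_distrib_left sum_distrib_right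
        by (intro sum.cong refl) (simp add: algebra_simps)
    qed
    also have "\<dots> = (\<Sum>m\<in>{1..K}. (\<i> / 2) * (c m * ?J (\<lambda>x. ?F t x * power_sum n m x) + cnj (c m) * ?J (\<lambda>x. ?F t x * cnj (power_sum n m x))))"
    proof (subst weighted_integral_sum[OF _ _ b])
      show "bounded_measurable n (\<lambda>x. (\<i> / 2) * (c m * (?F t x * power_sum n m x) + cnj (c m) * (?F t x * cnj (power_sum n m x))))" for m
        by (intro bounded_measurable_mult[OF bounded_measurable_const] bounded_measurable_add bp)
      show "(\<Sum>m\<in>{1..K}. ?J (\<lambda>x. (\<i> / 2) * (c m * (?F t x * power_sum n m x) + cnj (c m) * (?F t x * cnj (power_sum n m x))))) =
        (\<Sum>m\<in>{1..K}. (\<i> / 2) * (c m * ?J (\<lambda>x. ?F t x * power_sum n m x) + cnj (c m) * ?J (\<lambda>x. ?F t x * cnj (power_sum n m x))))"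
      proof (rule sum.cong[OF refl])
        fix m
        have "?J (\<lambda>x. c m * (?F t x * power_sum n m x) + cnj (c m) * (?F t x * cnj (power_sum n m x))) =
          ?J (\<lambda>x. c m * (?F t x * power_sum n m x)) + ?J (\<lambda>x. cnj (c m) * (?F t x * cnj (power_sum n m x)))"
          by (rule weighted_integral_add[OF _ _ b]) (intro bounded_measurable_mult[OF bounded_measurable_const] bp)+
        then show "?J (\<lambda>x. (\<i> / 2) * (c m * (?F t x * power_sum n m x) + cnj (c m) * (?F t x * cnj (power_sum n m x)))) =
          (\<i> / 2) * (c m * ?J (\<lambda>x. ?F t x * power_sum n m x) + cnj (c m) * ?J (\<lambda>x. ?F t x * cnj (power_sum n m x)))"
          by (simp only: weighted_integral_cmult)
      qed
    qed simp
    also have "\<dots> = (\<Sum>m\<in>{1..K}. (\<i> / 2) * (c m * e m t + cnj (c m * e m (- t))) - of_real (t * (real m * (cmod (c m))\<^sup>2 / \<beta>)) * ?J (?F t))"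
    proof (rule sum.cong[OF refl])
      fix m
      have 1: "?J (\<lambda>x. ?F t x * power_sum n m x) = e m t + \<i> * of_real t * of_nat m * cnj (c m) / of_real \<beta> * ?J (?F t)"
        by (simp add: e_def)
      have 2: "?J (\<lambda>x. ?F t x * cnj (power_sum n m x)) = cnj (e m (- t)) + \<i> * of_real t * of_nat m * c m / of_real \<beta> * ?J (?F t)"
        unfolding cF using cF0 by (simp add: e_def)
      show "(\<i> / 2) * (c m * ?J (\<lambda>x. ?F t x * power_sum n m x) + cnj (c m) * ?J (\<lambda>x. ?F t x * cnj (power_sum n m x))) =
        (\<i> / 2) * (c m * e m t + cnj (c m * e m (- t))) - of_real (t * (real m * (cmod (c m))\<^sup>2 / \<beta>)) * ?J (?F t)"
        unfolding 1 2 using b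
        by (simp only: of_real_mult of_real_divide complex_norm_square of_real_of_nat_eq complex_cnj_mult) (simp add: field_simps)
    qed
    also have "\<dots> = (\<Sum>m\<in>{1..K}. (\<i> / 2) * (c m * e m t + cnj (c m * e m (- t)))) - of_real (t * V) * ?J (?F t)"
      by (simp add: sum_subtractf V_def sum_distrib_left sum_distrib_right sum_divide_distrib)
    finally have eq: "?J (\<lambda>x. \<i> * (complex_of_real (linear_statistic c K n x) * ?F t x)) + of_real (t * V) * ?J (?F t) =
      (\<Sum>m\<in>{1..K}. (\<i> / 2) * (c m * e m t + cnj (c m * e m (- t))))" by simp
    have "cmod (\<Sum>m\<in>{1..K}. (\<i> / 2) * (c m * e m t + cnj (c m * e m (- t)))) \<le> (\<Sum>m\<in>{1..K}. cmod (c m) * (2 * \<bar>C\<bar> / \<beta>) / real n * Z)"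
    proof (rule sum_norm_le)
      fix m assume m: "m \<in> {1..K}"
      have "cmod ((\<i> / 2) * (c m * e m t + cnj (c m * e m (- t)))) \<le> 1 / 2 * (cmod (c m * e m t) + cmod (cnj (c m * e m (- t))))"
      proof -
        have "cmod ((\<i> / 2) * z) = 1 / 2 * cmod z" for z by (simp add: norm_mult norm_divide)
        then show ?thesis by (simp only:) (intro mult_left_mono norm_triangle_ineq, simp)
      qed
      also have "\<dots> = 1 / 2 * (cmod (c m) * cmod (e m t) + cmod (c m) * cmod (e m (- t)))"
        by (simp add: norm_mult)
      also have "\<dots> \<le> 1 / 2 * (cmod (c m) * (2 * \<bar>C\<bar> / \<beta> / real n * Z) + cmod (c m) * (2 * \<bar>C\<bar> / \<beta> / real n * Z))"
        by (intro mult_left_mono add_mono e m) (use t in auto)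
      finally show "cmod ((\<i> / 2) * (c m * e m t + cnj (c m * e m (- t)))) \<le> cmod (c m) * (2 * \<bar>C\<bar> / \<beta>) / real n * Z"
        by (simp add: mult_ac)
    qed
    also have "\<dots> = C' / real n * Z" by (simp add: C'_def sum_divide_distrib sum_distrib_right)
    finally show "cmod (?J (\<lambda>x. \<i> * (complex_of_real (linear_statistic c K n x) * ?F t x)) + of_real (t * V) * ?J (?F t)) \<le> C' / real n * total_weight n \<beta>"
      unfolding eq Z_def .
  qed
qed

text \<open>An integrating factor turns the approximate differential equation into a function with
  derivative of order \<open>1 / n\<close>, so over the unit interval it stays that close to its
  value at 0. The endpoint \<open>t = 1\<close> suffices, as \<open>c\<close> is arbitrary.\<close>

theorem char_statistic_limit:
  assumes b: "\<beta> > 0" and Z: "\<And>n. total_weight n \<beta> > 0"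
  shows "(\<lambda>n. weighted_integral n \<beta> (char_statistic c K n 1) / of_real (total_weight n \<beta>)) \<longlonglongrightarrow>
    complex_of_real (exp (- (\<Sum>r\<in>{1..K}. real r * (cmod (c r))\<^sup>2) / (2 * \<beta>)))"
proof -
  define V where "V = (\<Sum>r\<in>{1..K}. real r * (cmod (c r))\<^sup>2) / \<beta>"
  obtain C where C: "C \<ge> 0" "\<And>n t. 4 * K \<le> n \<Longrightarrow> 0 < n \<Longrightarrow> \<bar>t\<bar> \<le> 1 \<Longrightarrow>
    cmod (weighted_integral n \<beta> (\<lambda>x. \<i> * (complex_of_real (linear_statistic c K n x) * char_statistic c K n t x))
      + of_real (t * V) * weighted_integral n \<beta> (char_statistic c K n t)) \<le> C / real n * total_weight n \<beta>"
    using char_statistic_derivative_approx[OF b, of K c] unfolding V_def by blast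
  have V: "V \<ge> 0" using b by (auto simp: V_def intro!: divide_nonneg_pos sum_nonneg)
  let ?E = "\<lambda>n t. weighted_integral n \<beta> (char_statistic c K n t) / complex_of_real (total_weight n \<beta>)"
  have bound: "cmod (of_real (exp (V / 2)) * ?E n 1 - 1) \<le> exp (V / 2) * C / real n" if n: "4 * K \<le> n" "0 < n" for n
  proof -
    let ?J = "\<lambda>t. weighted_integral n \<beta> (char_statistic c K n t)"
    define D where "D = (\<lambda>t. weighted_integral n \<beta> (\<lambda>x. \<i> * (complex_of_real (linear_statistic c K n x) * char_statistic c K n t x)))"
    define W where "W = total_weight n \<beta>"
    have W: "W > 0" using Z by (simp add: W_def)
    \<comment> \<open>The exponential is the reciprocal of the solution of the limiting equation, so
      \<psi> would be constant if the error were 0.\<close>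
    define \<psi> where "\<psi> = (\<lambda>t. complex_of_real (exp (V * t\<^sup>2 / 2)) * ?J t)"
    define \<psi>' where "\<psi>' = (\<lambda>t. complex_of_real (exp (V * t\<^sup>2 / 2)) * (D t + of_real (t * V) * ?J t))"
    have \<psi>: "(\<psi> has_vector_derivative \<psi>' t) (at t)" for t
    proof -
      have "((\<lambda>t. exp (V * t\<^sup>2 / 2)) has_real_derivative exp (V * t\<^sup>2 / 2) * (t * V)) (at t)"
        by (auto intro!: derivative_eq_intros)
      then have "((\<lambda>t. complex_of_real (exp (V * t\<^sup>2 / 2))) has_vector_derivative complex_of_real (exp (V * t\<^sup>2 / 2) * (t * V))) (at t)"
        by (rule has_vector_derivative_of_real)
      from has_vector_derivative_mult[OF this char_statistic_has_vector_derivative[OF b, of n c K t]]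
      show ?thesis unfolding \<psi>_def \<psi>'_def D_def by (simp add: algebra_simps)
    qed
    have "norm (\<psi> 1 - \<psi> 0) \<le> (exp (V / 2) * (C / real n * W)) * 1 - (exp (V / 2) * (C / real n * W)) * 0"
    proof (rule differentiable_bound_general[where \<phi>="\<lambda>t. (exp (V / 2) * (C / real n * W)) * t" and \<phi>'="\<lambda>_. exp (V / 2) * (C / real n * W)" and f'=\<psi>'])
      show "continuous_on {0..1} \<psi>"
        by (intro continuous_at_imp_continuous_on ballI has_vector_derivative_continuous[OF \<psi>])
      show "continuous_on {0..1} (\<lambda>t. (exp (V / 2) * (C / real n * W)) * t)"
        by (intro continuous_intros)
      show "((\<lambda>t. (exp (V / 2) * (C / real n * W)) * t) has_vector_derivative exp (V / 2) * (C / real n * W)) (at t)" for t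
        by (rule has_vector_derivative_eq_rhs, rule has_vector_derivative_mult_right, rule has_vector_derivative_id) simp
      fix t :: real assume t: "0 < t" "t < 1"
      show "(\<psi> has_vector_derivative \<psi>' t) (at t)" by (rule \<psi>)
      have "V * t\<^sup>2 \<le> V * 1"
        using V t by (intro mult_left_mono) (auto simp: power_le_one)
      then have "exp (V * t\<^sup>2 / 2) \<le> exp (V / 2)" by simp
      then show "norm (\<psi>' t) \<le> exp (V / 2) * (C / real n * W)"
        unfolding \<psi>'_def norm_mult norm_of_real abs_exp_cancel using C(2)[OF n, of t] t W_def D_def
        by (intro mult_mono) auto
    qed simp
    moreover have "\<psi> 1 = of_real (exp (V / 2)) * ?J 1" by (simp add: \<psi>_def)
    moreover have "\<psi> 0 = of_real W"
    proof -
      have "char_statistic c K n 0 = (\<lambda>_. 1)" by (simp add: char_statistic_def fun_eq_iff)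
      then show ?thesis by (simp add: \<psi>_def weighted_integral_1 W_def)
    qed
    ultimately have "cmod (of_real (exp (V / 2)) * ?J 1 - of_real W) \<le> exp (V / 2) * (C / real n * W)" by simp
    then have "cmod (of_real (exp (V / 2)) * ?J 1 - of_real W) / W \<le> exp (V / 2) * C / real n"
      using W by (simp add: divide_le_eq)
    moreover have "of_real (exp (V / 2)) * ?E n 1 - 1 = (of_real (exp (V / 2)) * ?J 1 - of_real W) / of_real W"
      using W by (simp add: W_def diff_divide_distrib)
    ultimately show ?thesis using W by (simp add: norm_divide)
  qed
  have "(\<lambda>n. of_real (exp (V / 2)) * ?E n 1 - 1) \<longlonglongrightarrow> 0"
  proof (rule Lim_null_comparison)
    show "\<forall>\<^sub>F n in sequentially. cmod (of_real (exp (V / 2)) * ?E n 1 - 1) \<le> exp (V / 2) * C / real n"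
      using eventually_ge_at_top[of "4 * K"] eventually_gt_at_top[of 0]
      by eventually_elim (rule bound)
    show "(\<lambda>n. exp (V / 2) * C / real n) \<longlonglongrightarrow> 0"
      by (rule lim_const_over_n)
  qed
  then have "(\<lambda>n. of_real (exp (- V / 2)) * ((of_real (exp (V / 2)) * ?E n 1 - 1) + 1)) \<longlonglongrightarrow> of_real (exp (- V / 2)) * (0 + 1)"
    by (intro tendsto_intros)
  moreover have "complex_of_real (exp (- V / 2)) * of_real (exp (V / 2)) = 1"
    unfolding of_real_mult[symmetric] exp_add[symmetric] by simp
  ultimately have "(\<lambda>n. ?E n 1) \<longlonglongrightarrow> of_real (exp (- V / 2))"
    by (simp add: mult.assoc[symmetric])
  then show ?thesis by (simp add: V_def mult.commute)
qed

section \<open>The circular beta-ensemble on the torus\<close>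

lemma measurable_cube_density [measurable]:
  "(\<lambda>x. \<Prod>j\<in>{1..n}. indicator {0..2 * pi} (x j) / (2 * pi)) \<in> borel_measurable (Pi\<^sub>M {1..n} (\<lambda>_. lborel))"
proof (rule borel_measurable_prod)
  fix j assume "j \<in> {1..n}"
  then have [measurable]: "(\<lambda>x. x j) \<in> borel_measurable (Pi\<^sub>M {1..n} (\<lambda>_. lborel))"
    using measurable_component_singleton[of j "{1..n}" "\<lambda>_. lborel :: real measure"] by simp
  show "(\<lambda>x. indicator {0..2 * pi} (x j) / (2 * pi)) \<in> borel_measurable (Pi\<^sub>M {1..n} (\<lambda>_. lborel))"
    by measurable
qed

lemma torus_eq_density:
  "torus n = density (Pi\<^sub>M {1..n} (\<lambda>_. lborel)) (\<lambda>x. ennreal (\<Prod>j\<in>{1..n}. indicator {0..2 * pi} (x j) / (2 * pi)))"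
    (is "_ = density ?P ?f")
proof -
  interpret L: product_sigma_finite "\<lambda>_::nat. lborel :: real measure" by standard
  interpret C: product_prob_space "\<lambda>_. circle_measure" "{1..n}"
    by (rule product_prob_spaceI) (rule prob_space_circle_measure)
  have "density ?P ?f = Pi\<^sub>M {1..n} (\<lambda>_. circle_measure)"
  proof (rule C.PiM_eqI)
    show "sets (density ?P ?f) = sets (Pi\<^sub>M {1..n} (\<lambda>_. circle_measure))"
      unfolding sets_density by (rule sets_PiM_cong) auto
    fix A assume A: "\<And>i. i \<in> {1..n} \<Longrightarrow> A i \<in> sets circle_measure"
    then have A': "A i \<in> sets borel" if "i \<in> {1..n}" for i using that by simp
    let ?g = "\<lambda>i t. ennreal (indicator {0..2 * pi} t / (2 * pi)) * indicator (A i) t"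
    have "emeasure (density ?P ?f) (PiE {1..n} A) = (\<integral>\<^sup>+ x. ?f x * indicator (PiE {1..n} A) x \<partial>?P)"
    proof (rule emeasure_density)
      show "?f \<in> borel_measurable ?P" by measurable
      show "PiE {1..n} A \<in> sets ?P" using A' by (intro sets_PiM_I_finite) auto
    qed
    also have "\<dots> = (\<integral>\<^sup>+ x. (\<Prod>i\<in>{1..n}. ?g i (x i)) \<partial>?P)"
    proof (rule nn_integral_cong)
      fix x assume x: "x \<in> space ?P"
      have "indicator (PiE {1..n} A) x = (\<Prod>i\<in>{1..n}. indicator (A i) (x i) :: ennreal)"
      proof (cases "x \<in> PiE {1..n} A")
        case True
        then show ?thesis by (auto simp: PiE_def Pi_def intro!: prod.neutral[symmetric])
      next
        case False
        then obtain i where "i \<in> {1..n}" "x i \<notin> A i" using x by (auto simp: space_PiM PiE_def Pi_def)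
        then have "(\<Prod>i\<in>{1..n}. indicator (A i) (x i) :: ennreal) = 0" by (intro prod_zero bexI[of _ i]) auto
        then show ?thesis using False by simp
      qed
      then show "?f x * indicator (PiE {1..n} A) x = (\<Prod>i\<in>{1..n}. ?g i (x i))"
        by (simp add: prod.distrib prod_ennreal)
    qed
    also have "\<dots> = (\<Prod>i\<in>{1..n}. \<integral>\<^sup>+ t. ?g i t \<partial>lborel)"
      using A' by (intro L.product_nn_integral_prod) auto
    also have "\<dots> = (\<Prod>i\<in>{1..n}. emeasure circle_measure (A i))"
      using A' by (intro prod.cong refl) (simp add: circle_measure_def emeasure_density)
    finally show "emeasure (density ?P ?f) (PiE {1..n} A) = (\<Prod>i\<in>{1..n}. emeasure circle_measure (A i))" .
  qed simp
  then show ?thesis by (simp add: torus_def)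
qed

section \<open>From ordered to unordered angles\<close>

definition sorted_tuple :: "nat \<Rightarrow> (nat \<Rightarrow> real) \<Rightarrow> bool" where
  "sorted_tuple n x \<longleftrightarrow> (\<forall>j\<in>{1..n}. \<forall>k\<in>{1..n}. j \<le> k \<longrightarrow> x j \<le> x k)"

lemma card_sorting_permutations:
  fixes x :: "nat \<Rightarrow> real"
  assumes inj: "inj_on x {1..n}"
  shows "card {p \<in> perms n. sorted_tuple n (x \<circ> p)} = 1"
proof -
  let ?I = "{1..n}"
  \<comment> \<open>The rank of an entry: a permutation because the entries are distinct. Its
    inverse sorts the tuple.\<close>
  define r where "r = (\<lambda>j. if j \<in> ?I then card {k \<in> ?I. x k \<le> x j} else j)"
  have less: "r j < r k" if "j \<in> ?I" "k \<in> ?I" "x j < x k" for j k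
  proof -
    define A where "A = {i \<in> ?I. x i \<le> x j}"
    define B where "B = {i \<in> ?I. x i \<le> x k}"
    have "A \<subseteq> B" unfolding A_def B_def using that(3) by auto
    moreover have kB: "k \<in> B" and kA: "k \<notin> A" unfolding A_def B_def using that by auto
    moreover have "finite B" unfolding B_def by simp
    ultimately have "card A < card B" by (metis psubsetI psubset_card_mono)
    then show ?thesis using that(1,2) unfolding r_def A_def B_def by simp
  qed
  have "inj_on r ?I"
  proof (rule inj_onI)
    fix j k assume jk: "j \<in> ?I" "k \<in> ?I" "r j = r k"
    have "\<not> x j < x k" "\<not> x k < x j" using less[OF jk(1,2)] less[OF jk(2,1)] jk(3) by auto
    then have "x j = x k" by simp
    then show "j = k" by (rule inj_onD[OF inj _ jk(1,2)])
  qed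
  moreover have "r ` ?I \<subseteq> ?I"
  proof
    fix i assume "i \<in> r ` ?I"
    then obtain j where j: "j \<in> ?I" "i = card {k \<in> ?I. x k \<le> x j}" by (auto simp: r_def)
    have "{k \<in> ?I. x k \<le> x j} \<noteq> {}" using j by auto
    then have "1 \<le> i" using j(2) by (simp add: Suc_le_eq card_gt_0_iff)
    moreover have "i \<le> card ?I" unfolding j(2) by (intro card_mono) auto
    ultimately show "i \<in> ?I" by simp
  qed
  ultimately have "bij_betw r ?I ?I"
    by (simp add: bij_betw_def endo_inj_surj)
  then have r: "r permutes ?I"
    by (rule bij_imp_permutes) (auto simp: r_def)
  have sorted: "sorted_tuple n (x \<circ> inv r)"
    unfolding sorted_tuple_def
  proof (intro ballI impI)
    fix j k assume jk: "j \<in> ?I" "k \<in> ?I" "j \<le> k"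
    have in': "inv r j \<in> ?I" "inv r k \<in> ?I"
      using permutes_in_image[OF permutes_inv[OF r]] jk by auto
    show "(x \<circ> inv r) j \<le> (x \<circ> inv r) k"
    proof (rule ccontr)
      assume "\<not> ?thesis"
      then have "r (inv r k) < r (inv r j)" using in' by (intro less) auto
      then show False using jk permutes_inverses(1)[OF r] by simp
    qed
  qed
  have unique: "p = inv r" if p: "p permutes ?I" and s: "sorted_tuple n (x \<circ> p)" for p
  proof -
    have "r (p j) = j" if j: "j \<in> ?I" for j
    proof -
      have pj: "p j \<in> ?I" using permutes_in_image[OF p] j by blast
      \<comment> \<open>If \<open>p\<close> sorts the tuple, the entries below the one at
        \<open>p j\<close> sit at the images of the indices up to \<open>j\<close>, so its rank is
        \<open>j\<close> and \<open>p\<close> is forced to be the inverse of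
        \<open>r\<close>.\<close>
      have "{k \<in> ?I. x k \<le> x (p j)} = p ` {..j} \<inter> ?I"
      proof (intro equalityI subsetI)
        fix k assume k: "k \<in> {k \<in> ?I. x k \<le> x (p j)}"
        have "k \<in> p ` ?I" unfolding permutes_image[OF p] using k by simp
        then obtain i where i: "i \<in> ?I" "k = p i" by blast
        have "i \<le> j"
        proof (rule ccontr)
          assume "\<not> i \<le> j"
          then have "x (p j) \<le> x (p i)" using s i(1) j unfolding sorted_tuple_def by simp
          moreover have "x (p i) \<le> x (p j)" "p i \<in> ?I" using k i(2) by auto
          ultimately have "p j = p i" using inj_onD[OF inj _ pj, of "p i"] by simp
          then have "j = i" by (rule injD[OF permutes_inj[OF p]])
          then show False using \<open>\<not> i \<le> j\<close> by simp
        qed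
        then show "k \<in> p ` {..j} \<inter> ?I" using i k by auto
      next
        fix k assume "k \<in> p ` {..j} \<inter> ?I"
        then obtain i where i: "i \<le> j" "k = p i" "k \<in> ?I" by blast
        have "i \<in> ?I" using permutes_in_image[OF p, of i] i(2,3) by simp
        then show "k \<in> {k \<in> ?I. x k \<le> x (p j)}" using s i j unfolding sorted_tuple_def by simp
      qed
      also have "\<dots> = p ` {1..j}"
      proof -
        have "p i \<in> ?I \<longleftrightarrow> 1 \<le> i" if "i \<le> j" for i
          using permutes_in_image[OF p, of i] that j by auto
        then show ?thesis by auto
      qed
      finally have "r (p j) = card (p ` {1..j})" using pj by (simp add: r_def)
      also have "\<dots> = j"
        using permutes_inj_on[OF p, of "{1..j}"] by (simp add: card_image)
      finally show ?thesis .
    qed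
    then have rp: "r (p j) = j" for j
      using permutes_not_in[OF p, of j] permutes_not_in[OF r, of j] by (cases "j \<in> ?I") simp_all
    show ?thesis
    proof (rule ext)
      fix j
      show "p j = inv r j" using permutes_inverses(2)[OF r, of "p j"] unfolding rp by simp
    qed
  qed
  have "{p \<in> perms n. sorted_tuple n (x \<circ> p)} = {inv r}"
  proof (intro equalityI subsetI)
    fix p assume "p \<in> {p \<in> perms n. sorted_tuple n (x \<circ> p)}"
    then show "p \<in> {inv r}" using unique[of p] by (simp add: mem_perms)
  next
    fix p assume "p \<in> {inv r}"
    then show "p \<in> {p \<in> perms n. sorted_tuple n (x \<circ> p)}"
      using sorted permutes_inv[OF r] by (simp add: mem_perms)
  qed
  then show ?thesis by simp
qed

lemma reg_weight_0_eq:
  "reg_weight n \<beta> 0 x = (\<Prod>(j, k)\<in>index_pairs n. cmod (exp (\<i> * complex_of_real (x j)) - exp (\<i> * complex_of_real (x k))) powr \<beta>)"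
  unfolding reg_weight_def
proof (rule prod.cong[OF refl], clarify)
  fix j k
  have "cmod (cis (x j) - cis (x k)) powr \<beta> = (sqrt (reg_dist 0 (x j - x k))) powr \<beta>"
    by (simp add: norm_cis_diff_eq)
  also have "\<dots> = reg_dist 0 (x j - x k) powr (\<beta> / 2)"
  proof -
    have "sqrt (reg_dist 0 (x j - x k)) = reg_dist 0 (x j - x k) powr (1 / 2)"
      by (rule powr_half_sqrt[OF reg_dist_bounds(1), symmetric])
    then show ?thesis by (simp only: powr_powr) simp
  qed
  finally show "reg_dist 0 (x j - x k) powr (\<beta> / 2) = cmod (exp (\<i> * complex_of_real (x j)) - exp (\<i> * complex_of_real (x k))) powr \<beta>"
    by (simp add: cis_conv_exp)
qed

lemma cbe_density_eq:
  "cbe_density n \<beta> x * indicator (ordered_angles n) x =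
    (\<Prod>j\<in>{1..n}. indicator {0..2 * pi} (x j) / (2 * pi)) * (fact n / cbe_Z n \<beta> * (of_bool (sorted_tuple n x) * reg_weight n \<beta> 0 x))"
proof -
  have ind: "(indicator (ordered_angles n) x :: real) = (\<Prod>j\<in>{1..n}. indicator {0..2 * pi} (x j)) * of_bool (sorted_tuple n x)"
  proof (cases "\<forall>j\<in>{1..n}. x j \<in> {0..2 * pi}")
    case True
    then have "(\<Prod>j\<in>{1..n}. indicator {0..2 * pi} (x j)) = (1 :: real)" by (intro prod.neutral) auto
    then show ?thesis using True by (simp add: ordered_angles_def sorted_tuple_def indicator_def)
  next
    case False
    then obtain j where "j \<in> {1..n}" "x j \<notin> {0..2 * pi}" by blast
    then have "(\<Prod>j\<in>{1..n}. indicator {0..2 * pi} (x j)) = (0 :: real)" by (intro prod_zero bexI[of _ j]) auto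
    moreover have "x \<notin> ordered_angles n" using False by (auto simp: ordered_angles_def)
    ultimately show ?thesis by (simp only: indicator_simps mult_zero_left not_False_eq_True if_False)
  qed
  have "(\<Prod>j\<in>{1..n}. indicator {0..2 * pi} (x j) / (2 * pi)) = (\<Prod>j\<in>{1..n}. indicator {0..2 * pi} (x j)) * (\<Prod>j\<in>{1..n}. 1 / (2 * pi))"
    by (simp only: prod.distrib[symmetric] times_divide_eq_right mult_1_right)
  then show ?thesis
    unfolding ind cbe_density_def reg_weight_0_eq index_pairs_def by (simp only: mult_ac)
qed

lemma measurable_sorted_tuple: "{x \<in> space (torus n). sorted_tuple n x} \<in> sets (torus n)"
proof -
  have "{x \<in> space (torus n). \<forall>j\<in>{1..n}. \<forall>k\<in>{j..n}. x j \<le> x k} \<in> sets (torus n)"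
    by (intro sets.sets_Collect_finite_All borel_measurable_le measurable_torus_component) auto
  moreover have "sorted_tuple n x \<longleftrightarrow> (\<forall>j\<in>{1..n}. \<forall>k\<in>{j..n}. x j \<le> x k)" for x
    by (auto simp: sorted_tuple_def)
  ultimately show ?thesis by (simp only:)
qed

lemma measurable_of_bool_sorted:
  "(\<lambda>x. of_bool (sorted_tuple n x) :: 'a :: {second_countable_topology, zero_neq_one}) \<in> borel_measurable (torus n)"
  unfolding of_bool_def by (intro measurable_If measurable_const measurable_sorted_tuple) simp_all

lemma circular_beta_ensemble_eq:
  "circular_beta_ensemble n \<beta> = density (torus n) (\<lambda>x. ennreal (fact n / cbe_Z n \<beta> * (of_bool (sorted_tuple n x) * reg_weight n \<beta> 0 x)))"
proof -
  let ?P = "Pi\<^sub>M {1..n} (\<lambda>_. lborel :: real measure)"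
  have s: "sets (torus n) = sets ?P" unfolding torus_eq_density by simp
  have fm: "(\<lambda>x. ennreal (\<Prod>j\<in>{1..n}. indicator {0..2 * pi} (x j) / (2 * pi))) \<in> borel_measurable ?P"
    by (rule measurable_compose[OF measurable_cube_density measurable_ennreal])
  have gm: "(\<lambda>x. ennreal (fact n / cbe_Z n \<beta> * (of_bool (sorted_tuple n x) * reg_weight n \<beta> 0 x))) \<in> borel_measurable ?P"
    unfolding measurable_cong_sets[OF s[symmetric] refl]
    by (intro measurable_compose[OF _ measurable_ennreal] borel_measurable_times borel_measurable_const
        measurable_reg_weight measurable_of_bool_sorted)
  have nonneg: "0 \<le> (\<Prod>j\<in>{1..n}. indicator {0..2 * pi} (x j) / (2 * pi))" for x :: "nat \<Rightarrow> real"
    by (intro prod_nonneg) auto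
  show ?thesis
    unfolding circular_beta_ensemble_def cbe_density_eq torus_eq_density density_density_eq[OF fm gm]
      ennreal_mult'[OF nonneg] ..
qed

text \<open>Exactly one permutation sorts distinct entries. If two entries coincide several may do
  so, but then the weight is 0.\<close>

lemma sum_sorted_permutations:
  assumes b: "\<beta> > 0"
  shows "(\<Sum>p\<in>perms n. of_bool (sorted_tuple n (x \<circ> p)) * reg_weight n \<beta> 0 x) = reg_weight n \<beta> 0 x"
proof (cases "inj_on x {1..n}")
  case True
  have "(\<Sum>p\<in>perms n. of_bool (sorted_tuple n (x \<circ> p)) :: real) = card {p \<in> perms n. sorted_tuple n (x \<circ> p)}"
    unfolding of_bool_def by (subst sum.inter_filter[symmetric]) simp_all
  then show ?thesis
    unfolding sum_distrib_right[symmetric] card_sorting_permutations[OF True] by simp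
next
  case False
  then obtain j k where jk: "j \<in> {1..n}" "k \<in> {1..n}" "x j = x k" "j < k"
  proof -
    from False obtain j k where "j \<in> {1..n}" "k \<in> {1..n}" "x j = x k" "j \<noteq> k"
      unfolding inj_on_def by blast
    then show thesis using that[of j k] that[of k j] by (cases "j < k") simp_all
  qed
  then have "reg_weight n \<beta> 0 x = 0" by (intro reg_weight_0_eq_0[of j k]) (auto simp: index_pairs_def)
  then show ?thesis by simp
qed

text \<open>The permuted copies of the chamber of ordered angles cover the torus up to weight 0 and,
  by symmetry of \<open>h\<close> and of the weight, contribute equally. The factor
  \<open>n!\<close> is the one in the density of the ensemble.\<close>

lemma weighted_integral_eq_sorted:
  fixes h :: "(nat \<Rightarrow> real) \<Rightarrow> complex"
  assumes b: "\<beta> > 0" and h: "bounded_measurable n h" "symmetric_torus n h"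
  shows "fact n * (LINT x|torus n. of_bool (sorted_tuple n x) * complex_of_real (reg_weight n \<beta> 0 x) * h x) = weighted_integral n \<beta> h"
proof -
  let ?f = "\<lambda>x. of_bool (sorted_tuple n x) * complex_of_real (reg_weight n \<beta> 0 x) * h x"
  have wb: "bounded_measurable n (\<lambda>x. complex_of_real (reg_weight n \<beta> 0 x))"
    using b by (intro bounded_measurable_reg_weight) auto
  have sb: "bounded_measurable n (\<lambda>x. of_bool (sorted_tuple n (x \<circ> p)))" if p: "p permutes {1..n}" for p
  proof -
    have "(\<lambda>x. of_bool (sorted_tuple n (x \<circ> p)) :: complex) \<in> borel_measurable (torus n)"
    proof -
      have "(\<lambda>x. x \<circ> p) \<in> torus n \<rightarrow>\<^sub>M torus n"
      proof -
        have "(\<lambda>x. \<lambda>i\<in>{1..n}. x (p i)) \<in> torus n \<rightarrow>\<^sub>M torus n"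
          unfolding torus_def
          by (rule measurable_restrict, rule measurable_component_singleton)
             (use permutes_in_image[OF p] in \<open>simp del: atLeastAtMost_iff\<close>)
        moreover have "(\<lambda>i\<in>{1..n}. x (p i)) = x \<circ> p" if "x \<in> space (torus n)" for x
          using p that by (auto simp: space_torus extensional_def restrict_def permutes_def)
        ultimately show ?thesis
          using measurable_cong[of "torus n" "\<lambda>x. \<lambda>i\<in>{1..n}. x (p i)" "\<lambda>x. x \<circ> p" "torus n"] by (simp only:)
      qed
      from measurable_compose[OF this measurable_of_bool_sorted] show ?thesis .
    qed
    moreover have "cmod (of_bool P) \<le> 1" for P by (cases P) simp_all
    ultimately show ?thesis unfolding bounded_measurable_def by blast
  qed
  have fb: "bounded_measurable n ?f"
    using bounded_measurable_mult[OF bounded_measurable_mult[OF sb[OF permutes_id] wb] h(1)] by (simp only: comp_id)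
  have "weighted_integral n \<beta> h = (LINT x|torus n. (\<Sum>p\<in>perms n. of_bool (sorted_tuple n (x \<circ> p)) * complex_of_real (reg_weight n \<beta> 0 x) * h x))"
    unfolding weighted_integral_def
  proof (rule Bochner_Integration.integral_cong[OF refl])
    fix x
    have "(\<Sum>p\<in>perms n. of_bool (sorted_tuple n (x \<circ> p)) * complex_of_real (reg_weight n \<beta> 0 x)) =
      complex_of_real (\<Sum>p\<in>perms n. of_bool (sorted_tuple n (x \<circ> p)) * reg_weight n \<beta> 0 x)" by simp
    also have "\<dots> = complex_of_real (reg_weight n \<beta> 0 x)"
      by (simp only: sum_sorted_permutations[OF b])
    finally have e: "(\<Sum>p\<in>perms n. of_bool (sorted_tuple n (x \<circ> p)) * complex_of_real (reg_weight n \<beta> 0 x)) =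
      complex_of_real (reg_weight n \<beta> 0 x)" .
    have "(\<Sum>p\<in>perms n. of_bool (sorted_tuple n (x \<circ> p)) * complex_of_real (reg_weight n \<beta> 0 x) * h x) =
      (\<Sum>p\<in>perms n. of_bool (sorted_tuple n (x \<circ> p)) * complex_of_real (reg_weight n \<beta> 0 x)) * h x"
      by (rule sum_distrib_right[symmetric])
    then show "h x * complex_of_real (reg_weight n \<beta> 0 x) =
      (\<Sum>p\<in>perms n. of_bool (sorted_tuple n (x \<circ> p)) * complex_of_real (reg_weight n \<beta> 0 x) * h x)"
      unfolding e by (simp only: mult.commute)
  qed
  also have "\<dots> = (\<Sum>p\<in>perms n. LINT x|torus n. of_bool (sorted_tuple n (x \<circ> p)) * complex_of_real (reg_weight n \<beta> 0 x) * h x)"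
    by (rule Bochner_Integration.integral_sum,
        rule integrable_bounded_measurable[OF bounded_measurable_mult[OF bounded_measurable_mult[OF sb wb] h(1)]])
       (simp only: mem_perms)
  also have "\<dots> = (\<Sum>p\<in>perms n. LINT x|torus n. ?f x)"
  proof (rule sum.cong[OF refl])
    fix p assume "p \<in> perms n"
    then have p: "p permutes {1..n}" by (simp add: mem_perms)
    have hp: "h (x \<circ> p) = h x" for x using h(2) p by (simp add: symmetric_torus_def)
    have "(LINT x|torus n. ?f (x \<circ> p)) = (LINT x|torus n. ?f x)"
      by (rule integral_torus_permute[OF fb[unfolded bounded_measurable_def, THEN conjunct1] p])
    then show "(LINT x|torus n. of_bool (sorted_tuple n (x \<circ> p)) * complex_of_real (reg_weight n \<beta> 0 x) * h x) = (LINT x|torus n. ?f x)"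
      by (simp only: reg_weight_permute[OF p] hp)
  qed
  also have "\<dots> = of_nat (card (perms n)) * (LINT x|torus n. ?f x)" by simp
  also have "card (perms n) = fact n" unfolding perms_def by (rule card_permutations) simp_all
  finally show ?thesis by (simp only: of_nat_fact)
qed

lemma circular_beta_ensemble_expectation:
  fixes h :: "(nat \<Rightarrow> real) \<Rightarrow> complex"
  assumes b: "\<beta> > 0" and h: "bounded_measurable n h" "symmetric_torus n h"
  shows "(LINT x|circular_beta_ensemble n \<beta>. h x) = weighted_integral n \<beta> h / of_real (cbe_Z n \<beta>)"
proof -
  have Z: "cbe_Z n \<beta> > 0"
    unfolding cbe_Z_def using b by (intro divide_pos_pos zero_less_power Gamma_real_pos) (auto intro: add_pos_nonneg)
  have "(LINT x|circular_beta_ensemble n \<beta>. h x) =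
    (LINT x|torus n. (fact n / cbe_Z n \<beta> * (of_bool (sorted_tuple n x) * reg_weight n \<beta> 0 x)) *\<^sub>R h x)"
    unfolding circular_beta_ensemble_eq
  proof (rule integral_density)
    show "h \<in> borel_measurable (torus n)" using h(1) by (simp add: bounded_measurable_def)
    show "(\<lambda>x. fact n / cbe_Z n \<beta> * (of_bool (sorted_tuple n x) * reg_weight n \<beta> 0 x)) \<in> borel_measurable (torus n)"
      by (intro borel_measurable_times borel_measurable_const measurable_reg_weight measurable_of_bool_sorted)
  qed (use Z in \<open>simp add: reg_weight_nonneg\<close>)
  also have "\<dots> = (LINT x|torus n. (1 / of_real (cbe_Z n \<beta>)) * (fact n * (of_bool (sorted_tuple n x) * complex_of_real (reg_weight n \<beta> 0 x) * h x)))"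
    by (intro Bochner_Integration.integral_cong refl) (simp add: scaleR_conv_of_real)
  also have "\<dots> = (1 / of_real (cbe_Z n \<beta>)) * (fact n * (LINT x|torus n. of_bool (sorted_tuple n x) * complex_of_real (reg_weight n \<beta> 0 x) * h x))"
    by (simp only: integral_mult_right_zero)
  finally show ?thesis unfolding weighted_integral_eq_sorted[OF b h] by simp
qed

text \<open>Testing with the constant 1: the law of a random variable has mass 1, which forces
  \<open>total_weight\<close> to be the normalizing constant \<open>cbe_Z\<close> and hence
  positive.\<close>

lemma cbe_random_variable_expectation:
  fixes h :: "(nat \<Rightarrow> real) \<Rightarrow> complex"
  assumes b: "\<beta> > 0" and M: "prob_space M" and x: "x \<in> M \<rightarrow>\<^sub>M Pi\<^sub>M {1..n} (\<lambda>_. lborel)"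
    and distr: "distr M (Pi\<^sub>M {1..n} (\<lambda>_. lborel)) x = circular_beta_ensemble n \<beta>"
  shows "total_weight n \<beta> > 0"
    and "bounded_measurable n h \<Longrightarrow> symmetric_torus n h \<Longrightarrow>
      (LINT w|M. h (x w)) = weighted_integral n \<beta> h / of_real (total_weight n \<beta>)"
proof -
  have s: "sets (torus n) = sets (Pi\<^sub>M {1..n} (\<lambda>_. lborel :: real measure))" unfolding torus_eq_density by simp
  have E: "(LINT w|M. h (x w)) = weighted_integral n \<beta> h / of_real (cbe_Z n \<beta>)"
    if h: "bounded_measurable n h" "symmetric_torus n h" for h :: "(nat \<Rightarrow> real) \<Rightarrow> complex"
  proof -
    have "(LINT w|M. h (x w)) = (LINT x|distr M (Pi\<^sub>M {1..n} (\<lambda>_. lborel)) x. h x)"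
      using h(1) x by (intro integral_distr[symmetric]) (auto simp: bounded_measurable_def measurable_cong_sets[OF s refl])
    then show ?thesis unfolding distr circular_beta_ensemble_expectation[OF b h] .
  qed
  have "(LINT w|M. (1::complex)) = 1" using M by (simp add: prob_space.prob_space)
  then have "of_real (total_weight n \<beta>) / complex_of_real (cbe_Z n \<beta>) = 1"
    using E[OF bounded_measurable_const[of n 1]] by (simp add: symmetric_torus_def weighted_integral_1)
  then have eq: "total_weight n \<beta> = cbe_Z n \<beta>" "cbe_Z n \<beta> \<noteq> 0"
    by (auto simp: divide_eq_1_iff)
  then show "total_weight n \<beta> > 0" using total_weight_nonneg[of n \<beta>] by simp
  show "(LINT w|M. h (x w)) = weighted_integral n \<beta> h / of_real (total_weight n \<beta>)"
    if "bounded_measurable n h" "symmetric_torus n h" using E[OF that] eq(1) by simp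
qed

section \<open>The fields as sequences and the Gaussian limit\<close>

text \<open>The power sum of index 0 would be \<open>n\<close>. The entry is set to 0 because the
  boxes of \<open>power_box\<close> have radius 0 at this index.\<close>

definition power_sum_seq :: "nat \<Rightarrow> (nat \<Rightarrow> real) \<Rightarrow> nat \<Rightarrow> complex" where
  "power_sum_seq n x m = (if m = 0 then 0 else power_sum n m x)"

lemma sum_log_coeff:
  "(\<Sum>j\<in>{1..n}. log_coeff (x j) k) = (if k < 0 then - power_sum n (nat (- k)) x / of_int (- k) else 0)"
proof (cases "k < 0")
  case True
  have "exp (\<i> * of_int (- k) * complex_of_real t) = cis t ^ nat (- k)" for t
  proof -
    have "cis t ^ nat (- k) = cis (of_int (- k) * t)" using True by (simp add: Complex.DeMoivre)
    then show ?thesis unfolding cis_conv_exp by (simp add: mult_ac)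
  qed
  then show ?thesis using True
    by (simp only: log_coeff_def power_sum_def if_True sum_negf sum_divide_distrib[symmetric] minus_divide_left)
qed (simp add: log_coeff_def)

lemma log_char_poly_fourier:
  "has_bochner_integral lborel (\<lambda>\<theta>. indicator {0..2 * pi} \<theta> *\<^sub>R (log_char_poly n x \<theta> * exp (- \<i> * of_int k * complex_of_real \<theta>)))
    (2 * of_real pi * (\<Sum>j\<in>{1..n}. log_coeff (x j) k))"
proof -
  have "has_bochner_integral lborel (\<lambda>\<theta>. indicator {0..2 * pi} \<theta> *\<^sub>R (log_factor 1 (x j) \<theta> * exp (- \<i> * of_int k * complex_of_real \<theta>)))
      (2 * of_real pi * log_coeff (x j) k)" for j
    using log_factor_1_fourier[of "x j" k]
    unfolding set_integrable_def set_lebesgue_integral_def has_bochner_integral_iff by (rule conjI)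
  then have "has_bochner_integral lborel (\<lambda>\<theta>. \<Sum>j\<in>{1..n}. indicator {0..2 * pi} \<theta> *\<^sub>R (log_factor 1 (x j) \<theta> * exp (- \<i> * of_int k * complex_of_real \<theta>)))
      (\<Sum>j\<in>{1..n}. 2 * of_real pi * log_coeff (x j) k)"
    by (intro has_bochner_integral_sum)
  moreover have "(\<Sum>j\<in>{1..n}. indicator {0..2 * pi} \<theta> *\<^sub>R (log_factor 1 (x j) \<theta> * exp (- \<i> * of_int k * complex_of_real \<theta>))) =
      indicator {0..2 * pi} \<theta> *\<^sub>R (log_char_poly n x \<theta> * exp (- \<i> * of_int k * complex_of_real \<theta>))" for \<theta>
    unfolding log_char_poly_def log_factor_def of_real_1 mult_1_left sum_distrib_right scaleR_right.sum ..
  ultimately show ?thesis unfolding sum_distrib_left by (simp only:)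
qed

text \<open>The coefficient of the conjugate function at \<open>k\<close> is the conjugate of the
  coefficient at \<open>- k\<close>. Integrability of the complex function allows splitting the
  integral.\<close>

lemma fourier_coeff_Re_Im:
  assumes f: "\<And>k. has_bochner_integral lborel (\<lambda>\<theta>. indicator {0..2 * pi} \<theta> *\<^sub>R (f \<theta> * exp (- \<i> * of_int k * complex_of_real \<theta>)))
    (2 * of_real pi * a k)"
  shows "fourier_coeff (\<lambda>\<theta>. complex_of_real (Re (f \<theta>))) k = (a k + cnj (a (- k))) / 2"
    and "fourier_coeff (\<lambda>\<theta>. complex_of_real (Im (f \<theta>))) k = (a k - cnj (a (- k))) / (2 * \<i>)"
proof -
  let ?F = "\<lambda>k \<theta>. indicator {0..2 * pi} \<theta> *\<^sub>R (f \<theta> * exp (- \<i> * of_int k * complex_of_real \<theta>))"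
  have c: "has_bochner_integral lborel (\<lambda>\<theta>. cnj (?F (- k) \<theta>)) (cnj (2 * of_real pi * a (- k)))"
    using has_bochner_integral_bounded_linear[OF bounded_linear_cnj f] .
  have e: "cnj (?F (- k) \<theta>) = indicator {0..2 * pi} \<theta> *\<^sub>R (cnj (f \<theta>) * exp (- \<i> * of_int k * complex_of_real \<theta>))" for \<theta>
    by (simp add: scaleR_conv_of_real exp_cnj)
  have "has_bochner_integral lborel (\<lambda>\<theta>. (?F k \<theta> + cnj (?F (- k) \<theta>)) / 2) ((2 * of_real pi * a k + cnj (2 * of_real pi * a (- k))) / 2)"
    by (intro has_bochner_integral_divide_zero has_bochner_integral_add f c)
  moreover have "(?F k \<theta> + cnj (?F (- k) \<theta>)) / 2 =
      indicator {0..2 * pi} \<theta> *\<^sub>R (complex_of_real (Re (f \<theta>)) * exp (- \<i> * of_int k * complex_of_real \<theta>))" for \<theta>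
    unfolding e using complex_add_cnj[of "f \<theta>"]
    by (simp add: scaleR_conv_of_real flip: distrib_left distrib_right)
  ultimately have "(CLBINT \<theta>:{0..2 * pi}. complex_of_real (Re (f \<theta>)) * exp (- \<i> * of_int k * complex_of_real \<theta>)) =
      (2 * of_real pi * a k + cnj (2 * of_real pi * a (- k))) / 2"
    unfolding set_lebesgue_integral_def by (simp only: has_bochner_integral_integral_eq)
  then show "fourier_coeff (\<lambda>\<theta>. complex_of_real (Re (f \<theta>))) k = (a k + cnj (a (- k))) / 2"
    unfolding fourier_coeff_def by (simp only:) (simp add: field_simps)
  have "has_bochner_integral lborel (\<lambda>\<theta>. (?F k \<theta> - cnj (?F (- k) \<theta>)) / (2 * \<i>)) ((2 * of_real pi * a k - cnj (2 * of_real pi * a (- k))) / (2 * \<i>))"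
    by (intro has_bochner_integral_divide_zero has_bochner_integral_diff f c)
  moreover have "(?F k \<theta> - cnj (?F (- k) \<theta>)) / (2 * \<i>) =
      indicator {0..2 * pi} \<theta> *\<^sub>R (complex_of_real (Im (f \<theta>)) * exp (- \<i> * of_int k * complex_of_real \<theta>))" for \<theta>
    unfolding e using complex_diff_cnj[of "f \<theta>"]
    by (simp add: scaleR_conv_of_real mult_ac flip: right_diff_distrib left_diff_distrib)
  ultimately have "(CLBINT \<theta>:{0..2 * pi}. complex_of_real (Im (f \<theta>)) * exp (- \<i> * of_int k * complex_of_real \<theta>)) =
      (2 * of_real pi * a k - cnj (2 * of_real pi * a (- k))) / (2 * \<i>)"
    unfolding set_lebesgue_integral_def by (simp only: has_bochner_integral_integral_eq)
  then show "fourier_coeff (\<lambda>\<theta>. complex_of_real (Im (f \<theta>))) k = (a k - cnj (a (- k))) / (2 * \<i>)"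
    unfolding fourier_coeff_def by (simp only:) (simp add: field_simps)
qed

lemma X_n_eq: "X_n n x = X_map (power_sum_seq n x)"
proof
  fix k
  show "X_n n x k = X_map (power_sum_seq n x) k"
    unfolding X_n_def fourier_coeff_Re_Im(1)[OF log_char_poly_fourier] sum_log_coeff
    by (simp add: X_map_def power_sum_seq_def)
qed

lemma Y_n_eq: "Y_n n x = Y_map (power_sum_seq n x)"
proof
  fix k
  show "Y_n n x k = Y_map (power_sum_seq n x) k"
    unfolding Y_n_def fourier_coeff_Re_Im(2)[OF log_char_poly_fourier] sum_log_coeff
    by (simp add: Y_map_def power_sum_seq_def field_simps)
qed

text \<open>The limit in law of the power sums, normalized such that \<open>X_map\<close> and
  \<open>Y_map\<close> send it exactly to the scaled fields; the sign comes from the one in the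
  expansion of the logarithm.\<close>

definition gauss_seq :: "real \<Rightarrow> (nat \<Rightarrow> complex) \<Rightarrow> nat \<Rightarrow> complex" where
  "gauss_seq \<beta> z m = - complex_of_real (sqrt (2 / \<beta> * real m)) * z m"

lemma infsum_single_index:
  fixes f :: "nat \<Rightarrow> complex"
  assumes "\<And>j. j \<in> A \<Longrightarrow> j \<noteq> i \<Longrightarrow> f j = 0" "i \<in> A"
  shows "infsum f A = f i"
proof -
  have "infsum f A = infsum f {i}"
    by (rule infsum_cong_neutral) (use assms in auto)
  then show ?thesis by simp
qed

lemma gauss_scale:
  assumes "m \<ge> 1"
  shows "complex_of_real (sqrt (2 / \<beta>)) * (1 / 2 * (1 / complex_of_real (sqrt (real m)) * u)) = complex_of_real (sqrt (2 / \<beta> * real m)) * u / (2 * of_nat m)"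
proof -
  define t where "t = complex_of_real (sqrt (real m))"
  have t: "t \<noteq> 0" "of_nat m = t * t" using assms by (simp_all add: t_def flip: of_real_mult)
  show ?thesis unfolding real_sqrt_mult of_real_mult t_def[symmetric] t(2) using t(1) by simp
qed

lemma scale_X_field: "scale_seq (sqrt (2 / \<beta>)) (X_field z) = X_map (gauss_seq \<beta> z)"
proof
  fix k :: int
  consider "k = 0" | m where "m \<ge> 1" "k = - int m" | m where "m \<ge> 1" "k = int m"
    by (cases k rule: int_cases3) auto
  then show "scale_seq (sqrt (2 / \<beta>)) (X_field z) k = X_map (gauss_seq \<beta> z) k"
  proof cases
    case 1
    have "X_field z k = 0"
      unfolding X_field_def by (subst infsum_0) (auto simp: 1 fourier_mode_def)
    then show ?thesis by (simp add: scale_seq_def X_map_def 1)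
  next
    case (2 m)
    have "X_field z k = 1 / 2 * (1 / complex_of_real (sqrt (real m)) * (z m))"
      unfolding X_field_def using 2 by (subst infsum_single_index[where i = m]) (auto simp: fourier_mode_def)
    then show ?thesis
      using 2 unfolding scale_seq_def by (simp only: gauss_scale) (simp add: X_map_def gauss_seq_def)
  next
    case (3 m)
    have "X_field z k = 1 / 2 * (1 / complex_of_real (sqrt (real m)) * (cnj (z m)))"
      unfolding X_field_def using 3 by (subst infsum_single_index[where i = m]) (auto simp: fourier_mode_def)
    then show ?thesis
      using 3 unfolding scale_seq_def by (simp only: gauss_scale) (simp add: X_map_def gauss_seq_def)
  qed
qed

lemma scale_Y_field: "scale_seq (sqrt (2 / \<beta>)) (Y_field z) = Y_map (gauss_seq \<beta> z)"
proof
  fix k :: int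
  consider "k = 0" | m where "m \<ge> 1" "k = - int m" | m where "m \<ge> 1" "k = int m"
    by (cases k rule: int_cases3) auto
  then show "scale_seq (sqrt (2 / \<beta>)) (Y_field z) k = Y_map (gauss_seq \<beta> z) k"
  proof cases
    case 1
    have "Y_field z k = 0"
      unfolding Y_field_def by (subst infsum_0) (auto simp: 1 fourier_mode_def)
    then show ?thesis by (simp add: scale_seq_def Y_map_def 1)
  next
    case (2 m)
    have "Y_field z k = 1 / 2 * (1 / complex_of_real (sqrt (real m)) * (- (\<i> * z m)))"
      unfolding Y_field_def using 2 by (subst infsum_single_index[where i = m]) (auto simp: fourier_mode_def)
    then show ?thesis
      using 2 unfolding scale_seq_def by (simp only: gauss_scale) (simp add: Y_map_def gauss_seq_def)
  next
    case (3 m)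
    have "Y_field z k = 1 / 2 * (1 / complex_of_real (sqrt (real m)) * (\<i> * cnj (z m)))"
      unfolding Y_field_def using 3 by (subst infsum_single_index[where i = m]) (auto simp: fourier_mode_def)
    then show ?thesis
      using 3 unfolding scale_seq_def by (simp only: gauss_scale) (simp add: Y_map_def gauss_seq_def)
  qed
qed

section \<open>Characteristic functional and second moments of the Gaussian sequence\<close>

context prob_space
begin

lemma char_normal:
  fixes a :: real
  assumes X: "distributed M lborel X (normal_density 0 \<sigma>)" and \<sigma>: "\<sigma> > 0"
  shows "char (distr M borel (\<lambda>w. a * X w)) 1 = complex_of_real (exp (- (a * \<sigma>)\<^sup>2 / 2))"
proof -
  have S: "distributed M lborel (\<lambda>w. X w / \<sigma>) std_normal_density"
    using X normal_standard_normal_convert[OF \<sigma>, of X 0] by simp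
  have meas: "X \<in> borel_measurable M" using distributed_measurable[OF X] by simp
  have "char (distr M borel (\<lambda>w. a * X w)) 1 = (LINT w|M. iexp (a * X w))"
    unfolding char_def using meas by (subst integral_distr) auto
  also have "\<dots> = (LINT w|M. iexp (a * \<sigma> * (X w / \<sigma>)))"
    using \<sigma> by simp
  also have "\<dots> = (LINT y|distr M lborel (\<lambda>w. X w / \<sigma>). iexp (a * \<sigma> * y))"
    using meas by (subst integral_distr) auto
  also have "\<dots> = char std_normal_distribution (a * \<sigma>)"
    unfolding distributed_distr_eq_density[OF S] char_def ..
  also have "\<dots> = complex_of_real (exp (- (a * \<sigma>)\<^sup>2 / 2))" by (simp add: char_std_normal_distribution)
  finally show ?thesis .
qed

text \<open>The real part of \<open>c * Z\<close> is a sum of two independent centered Gaussians of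
  total variance \<open>(cmod c)\<^sup>2 / 2\<close>.\<close>

lemma char_complex_gaussian:
  assumes Z: "standard_complex_gaussian Z"
  shows "char (distr M borel (\<lambda>w. Re (c * Z w))) 1 = complex_of_real (exp (- (cmod c)\<^sup>2 / 4))"
proof -
  have "indep_var borel ((\<lambda>t. Re c * t) \<circ> (\<lambda>w. Re (Z w))) borel ((\<lambda>t. - Im c * t) \<circ> (\<lambda>w. Im (Z w)))"
    using Z unfolding standard_complex_gaussian_def by (elim conjE) (erule indep_var_compose, simp_all)
  then have i: "indep_var borel (\<lambda>w. Re c * Re (Z w)) borel (\<lambda>w. - Im c * Im (Z w))"
    by (simp only: o_def)
  have "char (distr M borel (\<lambda>w. Re (c * Z w))) 1 = char (distr M borel (\<lambda>w. Re c * Re (Z w) + - Im c * Im (Z w))) 1"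
    by simp
  also have "\<dots> = complex_of_real (exp (- (Re c * sqrt (1 / 2))\<^sup>2 / 2)) * complex_of_real (exp (- (- Im c * sqrt (1 / 2))\<^sup>2 / 2))"
    using Z unfolding char_distr_add[OF i] standard_complex_gaussian_def
    by (intro arg_cong2[where f = "(*)"] char_normal) auto
  also have "\<dots> = complex_of_real (exp (- (cmod c)\<^sup>2 / 4))"
    unfolding of_real_mult[symmetric] exp_add[symmetric] cmod_power2
    by (simp add: power_mult_distrib real_sqrt_divide power_divide field_simps)
  finally show ?thesis .
qed

lemma complex_gaussian_measurable:
  assumes Z: "standard_complex_gaussian Z"
  shows "Z \<in> borel_measurable M"
proof -
  have "(\<lambda>w. Re (Z w)) \<in> borel_measurable M" "(\<lambda>w. Im (Z w)) \<in> borel_measurable M"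
    using Z distributed_measurable[of M lborel] unfolding standard_complex_gaussian_def by force+
  then show ?thesis by (simp add: borel_measurable_complex_iff)
qed

lemma complex_gaussian_second_moment:
  assumes Z: "standard_complex_gaussian Z"
  shows "integrable M (\<lambda>w. (cmod (Z w))\<^sup>2)" "(LINT w|M. (cmod (Z w))\<^sup>2) = 1"
proof -
  have 1: "integrable M (\<lambda>w. (X w)\<^sup>2) \<and> (LINT w|M. (X w)\<^sup>2) = 1 / 2"
    if X: "distributed M lborel X (normal_density 0 (sqrt (1 / 2)))" for X
  proof
    have s: "(0::real) < sqrt (1 / 2)" by simp
    show "integrable M (\<lambda>w. (X w)\<^sup>2)"
      using distributed_integrable[OF X, of "\<lambda>t. t\<^sup>2"] integrable_normal_moment[OF s, of 0 2] by simp
    have "(LINT w|M. (X w)\<^sup>2) = variance X"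
      unfolding normal_distributed_expectation[OF s X] by simp
    then show "(LINT w|M. (X w)\<^sup>2) = 1 / 2"
      unfolding normal_distributed_variance[OF s X] by simp
  qed
  have R: "integrable M (\<lambda>w. (Re (Z w))\<^sup>2) \<and> (LINT w|M. (Re (Z w))\<^sup>2) = 1 / 2"
    and I: "integrable M (\<lambda>w. (Im (Z w))\<^sup>2) \<and> (LINT w|M. (Im (Z w))\<^sup>2) = 1 / 2"
    using 1 Z unfolding standard_complex_gaussian_def by simp_all
  show "integrable M (\<lambda>w. (cmod (Z w))\<^sup>2)" unfolding cmod_power2 using R I by (intro Bochner_Integration.integrable_add) auto
  show "(LINT w|M. (cmod (Z w))\<^sup>2) = 1" unfolding cmod_power2 using R I by (subst Bochner_Integration.integral_add) auto
qed

text \<open>Independence factors the functional; the squared factor \<open>2 * r / \<beta>\<close>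
  of \<open>gauss_seq\<close> times a quarter gives the exponent found in
  \<open>char_statistic_limit\<close>.\<close>

lemma char_gauss_seq:
  assumes b: "\<beta> > 0" and ind: "indep_vars (\<lambda>_. borel) Z {1..}" and Z: "\<And>j. j \<ge> 1 \<Longrightarrow> standard_complex_gaussian (Z j)"
  shows "(LINT w|M. iexp (seq_functional c K (gauss_seq \<beta> (\<lambda>j. Z j w)))) =
    complex_of_real (exp (- (\<Sum>r\<in>{1..K}. real r * (cmod (c r))\<^sup>2) / (2 * \<beta>)))"
proof -
  define a where "a r = - complex_of_real (sqrt (2 / \<beta> * real r)) * c r" for r
  have f: "seq_functional c K (gauss_seq \<beta> (\<lambda>j. Z j w)) = (\<Sum>r\<in>{1..K}. Re (a r * Z r w))" for w
  proof -
    have "seq_functional c K (gauss_seq \<beta> (\<lambda>j. Z j w)) = (\<Sum>r\<in>{..K}. Re (a r * Z r w))"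
      unfolding seq_functional_def by (rule sum.cong) (simp_all add: a_def gauss_seq_def mult_ac)
    also have "\<dots> = (\<Sum>r\<in>{1..K}. Re (a r * Z r w))"
      by (rule sum.mono_neutral_right) (auto simp: a_def not_less_eq_eq)
    finally show ?thesis .
  qed
  have m: "(\<lambda>w. \<Sum>r\<in>{1..K}. Re (a r * Z r w)) \<in> borel_measurable M"
  proof (rule borel_measurable_sum)
    fix r assume "r \<in> {1..K}"
    then have [measurable]: "Z r \<in> borel_measurable M" by (intro complex_gaussian_measurable Z) simp
    show "(\<lambda>w. Re (a r * Z r w)) \<in> borel_measurable M" by measurable
  qed
  have iv: "indep_vars (\<lambda>_. borel) (\<lambda>r w. Re (a r * Z r w)) {1..K}"
    by (rule indep_vars_compose2[OF indep_vars_subset[OF ind]]) auto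
  have "(LINT w|M. iexp (seq_functional c K (gauss_seq \<beta> (\<lambda>j. Z j w)))) =
      char (distr M borel (\<lambda>w. \<Sum>r\<in>{1..K}. Re (a r * Z r w))) 1"
    unfolding f char_def using m by (subst integral_distr) auto
  also have "\<dots> = (\<Prod>r\<in>{1..K}. complex_of_real (exp (- (cmod (a r))\<^sup>2 / 4)))"
    unfolding char_distr_sum[OF iv] by (intro prod.cong refl char_complex_gaussian Z) simp
  also have "\<dots> = complex_of_real (exp (\<Sum>r\<in>{1..K}. - (cmod (a r))\<^sup>2 / 4))"
    by (simp only: of_real_prod exp_sum finite_atLeastAtMost)
  also have "(\<Sum>r\<in>{1..K}. - (cmod (a r))\<^sup>2 / 4) = (\<Sum>r\<in>{1..K}. - (1 / (2 * \<beta>)) * (real r * (cmod (c r))\<^sup>2))"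
  proof (intro sum.cong refl)
    fix r
    have "(cmod (a r))\<^sup>2 = 2 / \<beta> * real r * (cmod (c r))\<^sup>2"
      unfolding a_def norm_mult norm_minus_cancel norm_of_real power_mult_distrib power2_abs using b by simp
    then show "- (cmod (a r))\<^sup>2 / 4 = - (1 / (2 * \<beta>)) * (real r * (cmod (c r))\<^sup>2)" by simp
  qed
  also have "\<dots> = - (\<Sum>r\<in>{1..K}. real r * (cmod (c r))\<^sup>2) / (2 * \<beta>)"
    unfolding sum_distrib_left[symmetric] by simp
  finally show ?thesis .
qed

end

section \<open>Tightness and convergence in law\<close>

text \<open>
  The exponent lies between \<open>1\<close>, needed for the tail bound, and \<open>s + 1 / 2\<close>, needed for compactness
  in the Sobolev space of order \<open>- s\<close>.
\<close>

definition power_box :: "real \<Rightarrow> real \<Rightarrow> nat \<Rightarrow> real" where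
  "power_box s R m = R * real m powr (s / 2 + 3 / 4)"

lemma seq_box_borel: "seq_box \<rho> \<in> sets borel"
  using closed_seq_box by (rule borel_closed)

lemma power_box_summable:
  assumes s: "s > 1 / 2"
  shows "seq_sum_square (- s) (\<lambda>m. complex_of_real (power_box s R m)) summable_on UNIV"
proof -
  \<comment> \<open>Growth of the squared radius, squared denominator in \<open>X_map\<close>,
    Sobolev weight. The total is \<open>- s - 1 / 2\<close>, below -1 exactly because
    \<open>s > 1 / 2\<close>.\<close>
  define g where "g = 2 * (s / 2 + 3 / 4) - 2 - 2 * s"
  define h :: "int \<Rightarrow> real" where "h k = R\<^sup>2 / 4 * real (nat \<bar>k\<bar>) powr g" for k
  have "g < -1" using s by (simp add: g_def)
  then have "summable (\<lambda>n. real n powr g)" by (simp only: summable_real_powr_iff)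
  then have S: "(\<lambda>n. R\<^sup>2 / 4 * real n powr g) summable_on (UNIV :: nat set)"
    by (subst summable_on_UNIV_nonneg_real_iff) (auto intro: summable_mult summable_divide)
  have "h summable_on range int"
    using S by (subst summable_on_reindex) (simp_all add: inj_on_def o_def h_def)
  moreover have "h summable_on range (\<lambda>n. - int n)"
    using S by (subst summable_on_reindex) (simp_all add: inj_on_def o_def h_def)
  ultimately have "h summable_on (range int \<union> range (\<lambda>n. - int n))" by (rule summable_on_union)
  moreover have "range int \<union> range (\<lambda>n. - int n) = UNIV"
  proof (intro equalityI subsetI UNIV_I)
    fix k :: int show "k \<in> range int \<union> range (\<lambda>n. - int n)" by (cases k rule: int_cases2) auto
  qed
  ultimately have h: "h summable_on UNIV" by simp
  show ?thesis
  proof (rule summable_on_comparison_test[OF h])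
    fix k :: int
    show "0 \<le> seq_sum_square (- s) (\<lambda>m. complex_of_real (power_box s R m)) k" by (rule seq_sum_square_nonneg)
    show "seq_sum_square (- s) (\<lambda>m. complex_of_real (power_box s R m)) k \<le> h k"
    proof (cases "k = 0")
      case True
      then show ?thesis by (simp add: seq_sum_square_def X_map_def h_def)
    next
      case False
      define a where "a = real (nat \<bar>k\<bar>)"
      have a: "a > 0" "real_of_int \<bar>k\<bar> = a" "(real_of_int k)\<^sup>2 = a\<^sup>2" using False by (simp_all add: a_def)
      have "sobolev_weight (- s) k \<le> (a\<^sup>2) powr (- s)"
        unfolding sobolev_weight_def a(3) using s a(1) by (intro powr_mono2') auto
      also have "\<dots> = a powr (- 2 * s)" using a(1) by (simp flip: powr_numeral add: powr_powr)
      finally have w: "sobolev_weight (- s) k \<le> a powr (- 2 * s)" .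
      have "(cmod (X_map (\<lambda>m. complex_of_real (power_box s R m)) k))\<^sup>2 = (R * a powr (s / 2 + 3 / 4) / (2 * a))\<^sup>2"
        unfolding norm_X_map a(2) norm_of_real power_box_def a_def[symmetric] power_divide power2_abs ..
      also have "\<dots> = R\<^sup>2 / 4 * ((a powr (s / 2 + 3 / 4))\<^sup>2 / a\<^sup>2)"
        by (simp add: power_mult_distrib power_divide)
      also have "(a powr (s / 2 + 3 / 4))\<^sup>2 / a\<^sup>2 = a powr (2 * (s / 2 + 3 / 4) - 2)"
        unfolding powr_diff using a(1) by (simp add: powr_numeral power2_eq_square flip: powr_add)
      finally have n: "(cmod (X_map (\<lambda>m. complex_of_real (power_box s R m)) k))\<^sup>2 = R\<^sup>2 / 4 * a powr (2 * (s / 2 + 3 / 4) - 2)" .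
      have "seq_sum_square (- s) (\<lambda>m. complex_of_real (power_box s R m)) k \<le> R\<^sup>2 / 4 * a powr (2 * (s / 2 + 3 / 4) - 2) * a powr (- 2 * s)"
        unfolding seq_sum_square_def n by (intro mult_left_mono w) simp
      also have "\<dots> = h k" unfolding h_def g_def a_def[symmetric] by (simp add: mult.assoc flip: powr_add)
      finally show ?thesis .
    qed
  qed
qed

text \<open>The exponent of the box is at least 1, so a deterministic linear bound fits into
  it.\<close>

lemma le_power_box:
  assumes s: "s > 1 / 2" and R: "R \<ge> 0"
  shows "R * real m \<le> power_box s R m"
proof (cases "m = 0")
  case False
  then have "real m powr 1 \<le> real m powr (s / 2 + 3 / 4)" using s by (intro powr_mono) auto
  then show ?thesis unfolding power_box_def using R False by (intro mult_left_mono) auto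
qed (simp add: power_box_def)

text \<open>A union bound over the coordinates. A coordinate with the deterministic bound
  \<open>2 * m\<close> never leaves the box, as \<open>R \<ge> 2\<close>; for the others Markov's
  inequality gives \<open>C * m\<close> over the squared radius. The alternative is the distinction
  between indices above and below \<open>n / 2\<close>, and it makes the tail independent of
  \<open>n\<close>.\<close>

lemma (in prob_space) power_box_tail:
  assumes s: "s > 1 / 2" and R: "R \<ge> 2" and C: "C \<ge> 0" and Q: "Q \<in> borel_measurable M"
    and bd: "\<And>m. (\<forall>w\<in>space M. cmod (Q w m) \<le> 2 * real m) \<or>
      0 < m \<and> integrable M (\<lambda>w. (cmod (Q w m))\<^sup>2) \<and> (LINT w|M. (cmod (Q w m))\<^sup>2) \<le> C * real m"
  shows "measure M {w \<in> space M. Q w \<notin> seq_box (power_box s R)} \<le> C / R\<^sup>2 * (\<Sum>m. real m powr (- s - 1 / 2))"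
proof -
  let ?A = "\<lambda>m. {w \<in> space M. power_box s R m < cmod (Q w m)}"
  have [measurable]: "(\<lambda>w. Q w m) \<in> borel_measurable M" for m
    using Q by (rule measurable_product_then_coordinatewise)
  have sm: "summable (\<lambda>m. C / R\<^sup>2 * real m powr (- s - 1 / 2))"
    using s by (intro summable_mult) (simp only: summable_real_powr_iff)
  have A: "measure M (?A m) \<le> C / R\<^sup>2 * real m powr (- s - 1 / 2)" for m
  proof (cases "\<forall>w\<in>space M. cmod (Q w m) \<le> 2 * real m")
    case True
    have "2 * real m \<le> power_box s R m"
      using le_power_box[OF s, of R m] R mult_right_mono[of 2 R "real m"] by simp
    then have "?A m = {}" using True by force
    then have "measure M (?A m) = 0" by (simp only: measure_empty)
    then show ?thesis using C by (simp del: Collect_empty_eq)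
  next
    case False
    then have int: "integrable M (\<lambda>w. (cmod (Q w m))\<^sup>2)" "(LINT w|M. (cmod (Q w m))\<^sup>2) \<le> C * real m" and m: "0 < m" using bd[of m] by auto
    have pos: "power_box s R m \<ge> 0" using R m by (simp add: power_box_def)
    have p: "power_box s R m > 0" using R m by (simp add: power_box_def)
    have "measure M (?A m) \<le> measure M {w \<in> space M. (power_box s R m)\<^sup>2 \<le> (cmod (Q w m))\<^sup>2}"
    proof (rule finite_measure_mono)
      show "?A m \<subseteq> {w \<in> space M. (power_box s R m)\<^sup>2 \<le> (cmod (Q w m))\<^sup>2}"
        using pos power_mono[of "power_box s R m" _ 2] by fastforce
    qed measurable
    also have "\<dots> \<le> (LINT w|M. (cmod (Q w m))\<^sup>2) / (power_box s R m)\<^sup>2"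
      using p by (intro integral_Markov_inequality_measure[where A = "{}"] int) auto
    also have "\<dots> \<le> C * real m / (power_box s R m)\<^sup>2"
      using int(2) by (intro divide_right_mono) auto
    also have "\<dots> = C / R\<^sup>2 * (real m / (real m powr (s / 2 + 3 / 4))\<^sup>2)"
      by (simp add: power_box_def power_mult_distrib)
    also have "real m / (real m powr (s / 2 + 3 / 4))\<^sup>2 = real m powr 1 / real m powr (2 * (s / 2 + 3 / 4))"
      using m by (simp add: power2_eq_square flip: powr_add)
    also have "\<dots> = real m powr (1 - 2 * (s / 2 + 3 / 4))" by (rule powr_diff[symmetric])
    also have "1 - 2 * (s / 2 + 3 / 4) = - s - 1 / 2" by simp
    finally show ?thesis .
  qed
  have sA: "summable (\<lambda>m. measure M (?A m))"
    by (rule summable_comparison_test'[OF sm, of 0]) (use A in simp)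
  have "{w \<in> space M. Q w \<notin> seq_box (power_box s R)} = (\<Union>m. ?A m)"
    by (auto simp: seq_box_def not_le)
  then have "measure M {w \<in> space M. Q w \<notin> seq_box (power_box s R)} \<le> (\<Sum>m. measure M (?A m))"
    using sA by (simp only:) (intro finite_measure_subadditive_countably, auto)
  also have "\<dots> \<le> (\<Sum>m. C / R\<^sup>2 * real m powr (- s - 1 / 2))" by (intro suminf_le A sA sm)
  also have "\<dots> = C / R\<^sup>2 * (\<Sum>m. real m powr (- s - 1 / 2))"
    using s by (intro suminf_mult) (simp only: summable_real_powr_iff)
  finally show ?thesis .
qed

text \<open>The boxes lie in the space and carry all but an arbitrarily small part of the mass, so
  the complement of the space is a null set.\<close>

lemma seq_space_AE:
  assumes s: "s > 1 / 2" and M: "prob_space M" and Q: "Q \<in> borel_measurable M"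
    and tight: "\<And>e. e > 0 \<Longrightarrow> \<exists>R. measure M {w \<in> space M. Q w \<notin> seq_box (power_box s R)} \<le> e"
  shows "AE w in M. Q w \<in> seq_space (- s)"
proof -
  interpret prob_space M by (rule M)
  have [measurable]: "Q \<in> borel_measurable M" "seq_space (- s) \<in> sets borel" "seq_box \<rho> \<in> sets borel" for \<rho>
    by (rule Q seq_space_borel seq_box_borel)+
  have sub: "seq_box (power_box s R) \<subseteq> seq_space (- s)" for R
    by (rule continuous_on_box_sobolev(1)[OF _ power_box_summable[OF s], of "\<lambda>_. 0"]) simp
  have "measure M {w \<in> space M. Q w \<notin> seq_space (- s)} \<le> e" if e: "e > 0" for e
  proof -
    obtain R where R: "measure M {w \<in> space M. Q w \<notin> seq_box (power_box s R)} \<le> e" using tight[OF e] by blast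
    have "measure M {w \<in> space M. Q w \<notin> seq_space (- s)} \<le> measure M {w \<in> space M. Q w \<notin> seq_box (power_box s R)}"
      using sub[of R] by (intro finite_measure_mono) auto
    then show ?thesis using R by linarith
  qed
  then have "measure M {w \<in> space M. Q w \<notin> seq_space (- s)} \<le> 0" by (rule field_le_epsilon) simp
  then have "measure M {w \<in> space M. Q w \<notin> seq_space (- s)} = 0" by (intro antisym) simp_all
  then have "emeasure M {w \<in> space M. Q w \<notin> seq_space (- s)} = 0" by (simp add: emeasure_eq_measure)
  then show ?thesis by (subst AE_iff_measurable[OF _ refl]) auto
qed

lemma random_element_maps:
  assumes M: "prob_space M" and Q: "Q \<in> borel_measurable M" and ae: "AE w in M. Q w \<in> seq_space s"
  shows "random_element M (sobolev_prod s) (\<lambda>w. (X_map (Q w), Y_map (Q w)))"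
  unfolding random_element_def
proof (intro conjI allI impI M)
  fix U assume U: "openin (sobolev_prod s) U"
  have "(\<lambda>w. (X_map (Q w), Y_map (Q w))) -` U \<inter> space M = Q -` {q. (X_map q, Y_map q) \<in> U} \<inter> space M" by auto
  also have "\<dots> \<in> sets M" by (rule measurable_sets[OF Q openin_sobolev_prod_borel[OF U]])
  finally show "(\<lambda>w. (X_map (Q w), Y_map (Q w))) -` U \<inter> space M \<in> sets M" .
next
  show "AE w in M. (X_map (Q w), Y_map (Q w)) \<in> topspace (sobolev_prod s)"
    using ae by (simp add: topspace_sobolev_topology map_mem_sobolev)
qed

text \<open>Test functions are arbitrary outside the Sobolev space; the value 0 there reproduces the
  restriction in \<open>expectation_of\<close> and gives a Borel function on all sequences.\<close>

definition pull_back :: "real \<Rightarrow> ((int \<Rightarrow> complex) \<times> (int \<Rightarrow> complex) \<Rightarrow> real) \<Rightarrow> (nat \<Rightarrow> complex) \<Rightarrow> real" where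
  "pull_back s f q = (if q \<in> seq_space s then f (X_map q, Y_map q) else 0)"

lemma expectation_of_maps:
  "expectation_of M (sobolev_prod s) (\<lambda>w. (X_map (Q w), Y_map (Q w))) f = (LINT w|M. pull_back s f (Q w))"
  unfolding expectation_of_def set_lebesgue_integral_def
  by (rule Bochner_Integration.integral_cong)
    (auto simp: pull_back_def topspace_sobolev_topology map_mem_sobolev indicator_def)

lemma pull_back_borel:
  assumes f: "continuous_map (sobolev_prod s) euclideanreal f"
  shows "pull_back s f \<in> borel_measurable borel"
proof (rule borel_measurableI)
  fix B :: "real set" assume B: "open B"
  define U where "U = {z \<in> topspace (sobolev_prod s). f z \<in> B}"
  have "openin (sobolev_prod s) U"
    unfolding U_def using B by (intro openin_continuous_map_preimage[OF f]) simp
  then have 1: "{q. (X_map q, Y_map q) \<in> U} \<in> sets borel" by (rule openin_sobolev_prod_borel)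
  have "pull_back s f -` B \<inter> space borel = {q. (X_map q, Y_map q) \<in> U} \<union> (if 0 \<in> B then - seq_space s else {})"
    by (auto simp: pull_back_def U_def topspace_sobolev_topology map_mem_sobolev split: if_splits)
  also have "\<dots> \<in> sets borel" using 1 seq_space_borel[of s] by (auto intro: sets.Un)
  finally show "pull_back s f -` B \<inter> space borel \<in> sets borel" .
qed

text \<open>Convergence of the characteristic functional together with linear bounds on the
  coordinates. As both fields are functions of one sequence, the joint law needs no separate
  argument.\<close>

lemma converges_in_law_maps:
  fixes M :: "nat \<Rightarrow> 'w measure" and N :: "'v measure"
  assumes s: "s > 1 / 2" and M: "\<And>n. prob_space (M n)" and N: "prob_space N"
    and Q: "\<And>n. Q n \<in> borel_measurable (M n)" and G: "G \<in> borel_measurable N"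
    and char: "\<And>c K. (\<lambda>n. LINT w|M n. iexp (seq_functional c K (Q n w))) \<longlonglongrightarrow> (LINT w|N. iexp (seq_functional c K (G w)))"
    and C: "C \<ge> 0"
    and bdQ: "\<And>n m. (\<forall>w\<in>space (M n). cmod (Q n w m) \<le> 2 * real m) \<or>
      0 < m \<and> integrable (M n) (\<lambda>w. (cmod (Q n w m))\<^sup>2) \<and> (LINT w|M n. (cmod (Q n w m))\<^sup>2) \<le> C * real m"
    and bdG: "\<And>m. (\<forall>w\<in>space N. cmod (G w m) \<le> 2 * real m) \<or>
      0 < m \<and> integrable N (\<lambda>w. (cmod (G w m))\<^sup>2) \<and> (LINT w|N. (cmod (G w m))\<^sup>2) \<le> C * real m"
  shows "converges_in_law (sobolev_prod (- s)) M (\<lambda>n w. (X_map (Q n w), Y_map (Q n w))) N (\<lambda>w. (X_map (G w), Y_map (G w)))"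
proof -
  have tail: "\<exists>R. (\<forall>n. measure (M n) {w \<in> space (M n). Q n w \<notin> seq_box (power_box s R)} \<le> e) \<and>
      measure N {w \<in> space N. G w \<notin> seq_box (power_box s R)} \<le> e" if e: "e > 0" for e
  proof -
    define S where "S = (\<Sum>m. real m powr (- s - 1 / 2))"
    have "summable (\<lambda>m. real m powr (- s - 1 / 2))" using s by (simp only: summable_real_powr_iff)
    then have S: "S \<ge> 0" unfolding S_def by (rule suminf_nonneg) simp
    \<comment> \<open>The summand 2 serves \<open>power_box_tail\<close>; with it \<open>R\<close>
      is at most \<open>R\<^sup>2\<close>, so the second summand suffices for
      \<open>C * S / R\<^sup>2 \<le> e\<close>.\<close>
    define R where "R = 2 + C * S / e"
    have R: "R \<ge> 2" "C * S / e \<le> R" using S C e by (simp_all add: R_def)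
    have "C * S \<le> e * R" using R(2) e by (simp add: field_simps)
    also have "\<dots> \<le> e * R\<^sup>2" using e R(1) by (intro mult_left_mono) (simp_all add: power2_eq_square)
    finally have le: "C / R\<^sup>2 * S \<le> e" using R(1) by (simp add: divide_le_eq)
    have "measure (M n) {w \<in> space (M n). Q n w \<notin> seq_box (power_box s R)} \<le> e" for n
      using prob_space.power_box_tail[OF M s R(1) C Q bdQ, of n] le unfolding S_def by linarith
    moreover have "measure N {w \<in> space N. G w \<notin> seq_box (power_box s R)} \<le> e"
      using prob_space.power_box_tail[OF N s R(1) C G bdG] le unfolding S_def by linarith
    ultimately show ?thesis by blast
  qed
  have cs: "(LINT w|A. cos (seq_functional c K (q w))) = Re (LINT w|A. iexp (seq_functional c K (q w)))"
      "(LINT w|A. sin (seq_functional c K (q w))) = Im (LINT w|A. iexp (seq_functional c K (q w)))"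
    if A: "prob_space A" and q: "q \<in> borel_measurable A" for c K q and A :: "'x measure"
  proof -
    interpret prob_space A by (rule A)
    have [measurable]: "(\<lambda>w. q w m) \<in> borel_measurable A" for m
      using q by (rule measurable_product_then_coordinatewise)
    have i: "integrable A (\<lambda>w. iexp (seq_functional c K (q w)))"
      by (rule integrable_const_bound[where B = 1]) (simp_all add: seq_functional_def)
    show "(LINT w|A. cos (seq_functional c K (q w))) = Re (LINT w|A. iexp (seq_functional c K (q w)))"
      using integral_Re[OF i] by (simp add: Re_exp)
    show "(LINT w|A. sin (seq_functional c K (q w))) = Im (LINT w|A. iexp (seq_functional c K (q w)))"
      using integral_Im[OF i] by (simp add: Im_exp)
  qed
  show ?thesis
    unfolding converges_in_law_def
  proof (intro conjI allI impI)
    fix n show "random_element (M n) (sobolev_prod (- s)) (\<lambda>w. (X_map (Q n w), Y_map (Q n w)))"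
      using tail by (intro random_element_maps M Q seq_space_AE[OF s]) blast
  next
    show "random_element N (sobolev_prod (- s)) (\<lambda>w. (X_map (G w), Y_map (G w)))"
      using tail by (intro random_element_maps N G seq_space_AE[OF s]) blast
  next
    fix f :: "(int \<Rightarrow> complex) \<times> (int \<Rightarrow> complex) \<Rightarrow> real"
    assume f: "continuous_map (sobolev_prod (- s)) euclideanreal f \<and> bounded (f ` topspace (sobolev_prod (- s)))"
    then obtain B where B: "\<And>z. z \<in> topspace (sobolev_prod (- s)) \<Longrightarrow> \<bar>f z\<bar> \<le> B"
      unfolding bounded_iff by auto
    have B': "\<bar>pull_back (- s) f q\<bar> \<le> \<bar>B\<bar>" for q
      using B[of "(X_map q, Y_map q)"] by (auto simp: pull_back_def topspace_sobolev_topology map_mem_sobolev)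
    have "(\<lambda>n. LINT w|M n. pull_back (- s) f (Q n w)) \<longlonglongrightarrow> (LINT w|N. pull_back (- s) f (G w))"
    proof (rule expectation_tendsto_if_tight[OF M N Q G _ _ _ _ B', where P = "range (power_box s)"])
      fix c K
      show "(\<lambda>n. LINT w|M n. cos (seq_functional c K (Q n w))) \<longlonglongrightarrow> (LINT w|N. cos (seq_functional c K (G w)))"
        unfolding cs[OF M Q] cs[OF N G] by (rule tendsto_Re[OF char])
      show "(\<lambda>n. LINT w|M n. sin (seq_functional c K (Q n w))) \<longlonglongrightarrow> (LINT w|N. sin (seq_functional c K (G w)))"
        unfolding cs[OF M Q] cs[OF N G] by (rule tendsto_Im[OF char])
    next
      fix e :: real assume "e > 0"
      then show "\<exists>\<rho>\<in>range (power_box s). (\<forall>n. measure (M n) {w \<in> space (M n). Q n w \<notin> seq_box \<rho>} \<le> e) \<and>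
          measure N {w \<in> space N. G w \<notin> seq_box \<rho>} \<le> e"
        using tail[of e] by auto
    next
      show "pull_back (- s) f \<in> borel_measurable borel" using f by (intro pull_back_borel) simp
    next
      fix \<rho> assume "\<rho> \<in> range (power_box s)"
      then obtain R where \<rho>: "\<rho> = power_box s R" by blast
      have c: "seq_box \<rho> \<subseteq> seq_space (- s)" "continuous_on (seq_box \<rho>) (\<lambda>q. f (X_map q, Y_map q))"
        unfolding \<rho> by (rule continuous_on_box_sobolev[OF conjunct1[OF f] power_box_summable[OF s]])+
      show "continuous_on (seq_box \<rho>) (pull_back (- s) f)"
        by (rule continuous_on_eq[OF c(2)]) (use c(1) in \<open>auto simp: pull_back_def\<close>)
    qed
    then show "(\<lambda>n. expectation_of (M n) (sobolev_prod (- s)) (\<lambda>w. (X_map (Q n w), Y_map (Q n w))) f)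
        \<longlonglongrightarrow> expectation_of N (sobolev_prod (- s)) (\<lambda>w. (X_map (G w), Y_map (G w))) f"
      unfolding expectation_of_maps .
  qed
qed

lemma seq_functional_power_sum_seq: "seq_functional c K (power_sum_seq n x) = linear_statistic c K n x"
proof -
  have "seq_functional c K (power_sum_seq n x) = (\<Sum>r\<in>{1..K}. Re (c r * power_sum_seq n x r))"
    unfolding seq_functional_def by (rule sum.mono_neutral_right) (auto simp: power_sum_seq_def not_less_eq_eq)
  also have "\<dots> = linear_statistic c K n x"
    unfolding linear_statistic_def by (rule sum.cong) (auto simp: power_sum_seq_def)
  finally show ?thesis .
qed

theorem theorem20:
  fixes s \<beta> :: real
    and M :: "nat \<Rightarrow> 'w measure" and x :: "nat \<Rightarrow> 'w \<Rightarrow> nat \<Rightarrow> real"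
    and N :: "'v measure" and Z :: "nat \<Rightarrow> 'v \<Rightarrow> complex"
  assumes "s > 1 / 2" and "\<beta> > 0"
    and "\<And>n. prob_space (M n)"
    and "\<And>n. x n \<in> M n \<rightarrow>\<^sub>M Pi\<^sub>M {1..n} (\<lambda>_. lborel)"
    and "\<And>n. distr (M n) (Pi\<^sub>M {1..n} (\<lambda>_. lborel)) (x n) = circular_beta_ensemble n \<beta>"
    and "prob_space N"
    and "prob_space.indep_vars N (\<lambda>_. borel) Z {1..}"
    and "\<And>j. j \<ge> 1 \<Longrightarrow> prob_space.standard_complex_gaussian N (Z j)"
  shows "converges_in_law
           (prod_topology (sobolev_topology (- s)) (sobolev_topology (- s)))
           M (\<lambda>n \<omega>. (X_n n (x n \<omega>), Y_n n (x n \<omega>)))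
           N (\<lambda>\<omega>. (scale_seq (sqrt (2 / \<beta>)) (X_field (\<lambda>j. Z j \<omega>)),
                    scale_seq (sqrt (2 / \<beta>)) (Y_field (\<lambda>j. Z j \<omega>))))"
  unfolding X_n_eq Y_n_eq scale_X_field scale_Y_field
proof (rule converges_in_law_maps[where C = "4 / \<beta>"])
  note s = assms(1) and b = assms(2) and M = assms(3) and x = assms(4) and D = assms(5) and N = assms(6)
    and ind = assms(7) and Z = assms(8)
  interpret N: prob_space N by (rule N)
  note E = cbe_random_variable_expectation[OF b M x D]
  have p_meas: "(\<lambda>w. power_sum n m (x n w)) \<in> borel_measurable (M n)" for n m
  proof -
    have "power_sum n m \<in> borel_measurable (torus n)"
      using bounded_measurable_power_sum unfolding bounded_measurable_def by blast
    then have "power_sum n m \<in> borel_measurable (Pi\<^sub>M {1..n} (\<lambda>_. lborel))"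
      unfolding torus_eq_density by simp
    then show ?thesis using x[of n] by (rule measurable_compose[rotated])
  qed
  show "s > 1 / 2" "prob_space (M n)" "prob_space N" "4 / \<beta> \<ge> 0" for n using s M N b by simp_all
  show "(\<lambda>w. power_sum_seq n (x n w)) \<in> borel_measurable (M n)" for n
    using p_meas by (intro measurable_coordinatewise_then_product) (simp add: power_sum_seq_def)
  have Z_meas: "Z m \<in> borel_measurable N" if "m \<ge> 1" for m
    by (rule N.complex_gaussian_measurable[OF Z[OF that]])
  show "(\<lambda>w. gauss_seq \<beta> (\<lambda>j. Z j w)) \<in> borel_measurable N"
  proof (rule measurable_coordinatewise_then_product)
    fix m show "(\<lambda>w. gauss_seq \<beta> (\<lambda>j. Z j w) m) \<in> borel_measurable N"
      using Z_meas[of m] by (cases "m = 0") (simp_all add: gauss_seq_def)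
  qed
  show "(\<lambda>n. LINT w|M n. iexp (seq_functional c K (power_sum_seq n (x n w)))) \<longlonglongrightarrow>
      (LINT w|N. iexp (seq_functional c K (gauss_seq \<beta> (\<lambda>j. Z j w))))" for c K
  proof -
    have "(LINT w|M n. iexp (seq_functional c K (power_sum_seq n (x n w)))) =
        weighted_integral n \<beta> (char_statistic c K n 1) / of_real (total_weight n \<beta>)" for n
      using E(2)[OF bounded_measurable_char_statistic symmetric_torus_char_statistic, of n c K 1]
      by (simp add: char_statistic_def seq_functional_power_sum_seq)
    moreover have "(LINT w|N. iexp (seq_functional c K (gauss_seq \<beta> (\<lambda>j. Z j w)))) =
        complex_of_real (exp (- (\<Sum>r\<in>{1..K}. real r * (cmod (c r))\<^sup>2) / (2 * \<beta>)))"
      by (rule N.char_gauss_seq[OF b ind Z])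
    ultimately show ?thesis using char_statistic_limit[OF b E(1), of c K] by (simp only:)
  qed
  show "(\<forall>w\<in>space (M n). cmod (power_sum_seq n (x n w) m) \<le> 2 * real m) \<or>
      0 < m \<and> integrable (M n) (\<lambda>w. (cmod (power_sum_seq n (x n w) m))\<^sup>2) \<and>
      (LINT w|M n. (cmod (power_sum_seq n (x n w) m))\<^sup>2) \<le> 4 / \<beta> * real m" for n m
  \<comment> \<open>For \<open>m > n / 2\<close> the power sum has at most \<open>n < 2 * m\<close>
    summands of modulus 1, and for \<open>m = 0\<close> the entry is 0; the spectral bound is used
    in the remaining range.\<close>
  proof (cases "0 < m \<and> 2 * m \<le> n")
    case False
    then have "cmod (power_sum_seq n (x n w) m) \<le> 2 * real m" for w
      using norm_power_sum_le[of n m "x n w"] by (auto simp: power_sum_seq_def)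
    then show ?thesis by blast
  next
    case True
    interpret prob_space "M n" by (rule M)
    note [measurable] = p_meas
    have int: "integrable (M n) (\<lambda>w. (cmod (power_sum n m (x n w)))\<^sup>2)"
      by (rule integrable_const_bound[where B = "(real n)\<^sup>2"])
        (auto intro!: power_mono norm_power_sum_le)
    have "complex_of_real (LINT w|M n. (cmod (power_sum n m (x n w)))\<^sup>2) =
        (LINT w|M n. complex_of_real ((cmod (power_sum n m (x n w)))\<^sup>2))" by (rule integral_complex_of_real[symmetric])
    also have "\<dots> = weighted_integral n \<beta> (\<lambda>y. complex_of_real ((cmod (power_sum n m y))\<^sup>2)) / of_real (total_weight n \<beta>)"
      by (rule E(2)) (simp_all add: bounded_measurable_norm_square bounded_measurable_power_sum symmetric_torus_def power_sum_permute
          del: of_real_power)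
    finally have "(LINT w|M n. (cmod (power_sum n m (x n w)))\<^sup>2) =
        Re (weighted_integral n \<beta> (\<lambda>y. complex_of_real ((cmod (power_sum n m y))\<^sup>2))) / total_weight n \<beta>"
      by (metis Re_complex_of_real Re_divide_of_real)
    also have "\<dots> \<le> 4 / \<beta> * real m"
      using power_sum_second_moment_le[OF b, of m n] True E(1)[of n] by (simp add: divide_le_eq)
    finally have "(LINT w|M n. (cmod (power_sum n m (x n w)))\<^sup>2) \<le> 4 / \<beta> * real m" .
    then show ?thesis using int True by (simp add: power_sum_seq_def)
  qed
  show "(\<forall>w\<in>space N. cmod (gauss_seq \<beta> (\<lambda>j. Z j w) m) \<le> 2 * real m) \<or>
      0 < m \<and> integrable N (\<lambda>w. (cmod (gauss_seq \<beta> (\<lambda>j. Z j w) m))\<^sup>2) \<and>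
      (LINT w|N. (cmod (gauss_seq \<beta> (\<lambda>j. Z j w) m))\<^sup>2) \<le> 4 / \<beta> * real m" for m
  proof (cases "m = 0")
    case False
    have e: "(cmod (gauss_seq \<beta> (\<lambda>j. Z j w) m))\<^sup>2 = 2 / \<beta> * real m * (cmod (Z m w))\<^sup>2" for w
      unfolding gauss_seq_def norm_mult norm_minus_cancel norm_of_real power_mult_distrib power2_abs using b by simp
    have m: "m \<ge> 1" using False by simp
    show ?thesis
      unfolding e using N.complex_gaussian_second_moment[OF Z[OF m]] b m by (simp add: divide_right_mono)
  qed (simp add: gauss_seq_def)
qed

end
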